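(* Let $\mathcal{E}$ be an exact category. If $\mathcal{E}$ has enough projectives, then the inclusion $i_*\colon\operatorname{eff}(\mathcal{E})\to\operatorname{mod}_{\mathsf{adm}}(\mathcal{E})$, the functor $j^*=L\colon\operatorname{mod}_{\mathsf{adm}}(\mathcal{E})\to\mathcal{E}$ and the Yoneda functor $j_*=\Upsilon\colon\mathcal{E}\to\operatorname{mod}_{\mathsf{adm}}(\mathcal{E})$ fit, together with functors $i^*,i^!\colon\operatorname{mod}_{\mathsf{adm}}(\mathcal{E})\to\operatorname{eff}(\mathcal{E})$ and $j_!\colon\mathcal{E}\to\operatorname{mod}_{\mathsf{adm}}(\mathcal{E})$, into a recollement of exact categories $(\operatorname{eff}(\mathcal{E}),\operatorname{mod}_{\mathsf{adm}}(\mathcal{E}),\mathcal{E})$.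
   Context: All categories are essentially small and additive; subcategories are full and closed under isomorphisms. Exact categories are in the sense of Quillen, with conflations, inflations and deflations; no idempotent completeness is assumed. A morphism is admissible if it is a composite $m\circ p$ with $p$ a deflation and $m$ an inflation. A sequence is exact if all its morphisms are admissible and kernels coincide with images. $\operatorname{Mod}(\mathcal{E})$ is the category of additive contravariant functors $\mathcal{E}\to\mathsf{Ab}$, $\Upsilon(X)=\operatorname{Hom}_{\mathcal{E}}(-,X)$. $\operatorname{mod}_{\mathsf{adm}}(\mathcal{E})$ (resp. $\operatorname{eff}(\mathcal{E})$) is the full subcategory of $\operatorname{Mod}(\mathcal{E})$ of functors $F$ with an exact sequence $\Upsilon(X)\xrightarrow{\Upsilon(f)}\Upsilon(Y)\to F\to 0$ with $f$ an admissible morphism (resp. a deflation) in $\mathcal{E}$. Both are extension-closed in $\operatorname{Mod}(\mathcal{E})$ and carry the inherited exact structure. The functor $L\colon\operatorname{mod}_{\mathsf{adm}}(\mathcal{E})\to\mathcal{E}$ is the exact left adjoint of $\Upsilon$ with $L\circ\Upsilon=1_{\mathcal{E}}$; explicitly $L(F)\cong\operatorname{coker}(f)$ for an exact sequence $\Upsilon(X)\xrightarrow{\Upsilon(f)}\Upsilon(Y)\to F\to 0$ in $\operatorname{Mod}(\mathcal{E})$ with $f\colon X\to Y$ an admissible morphism in $\mathcal{E}$. A recollement of exact categories $(\mathcal{A},\mathcal{B},\mathcal{C})$ consists of additive functors $i_*\colon\mathcal{A}\to\mathcal{B}$, $i^*,i^!\colon\mathcal{B}\to\mathcal{A}$, $j^*\colon\mathcal{B}\to\mathcal{C}$,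 $j_!,j_*\colon\mathcal{C}\to\mathcal{B}$ such that: (1) $i^*\dashv i_*\dashv i^!$ and $j_!\dashv j^*\dashv j_*$. (2) $\operatorname{im}(i_* )=\ker(j^* )$ (essential image on objects, resp. objects sent to $0$). (3) $i_*,j_!,j_*$ are fully faithful. (4) For each $X\in\mathcal{B}$ there is an exact sequence $i_*i^!(X)\rightarrowtail X\to j_*j^*(X)\twoheadrightarrow i_*A$ with $A\in\mathcal{A}$, where the first map is the counit of $i_*\dashv i^!$ and the second, admissible, map is the unit of $j^*\dashv j_*$. (5) For each $X\in\mathcal{B}$ there is an exact sequence $i_*A'\rightarrowtail j_!j^*(X)\to X\twoheadrightarrow i_*i^*(X)$ with $A'\in\mathcal{A}$, where the second, admissible, map is the counit of $j_!\dashv j^*$ and the last map is the unit of $i^*\dashv i_*$. *)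

theory Defs
  imports "HOL-Algebra.Weak_Morphisms"
begin

section \<open>Additive categories\<close>

text \<open>
  Categories are small: the objects form a set \<^term>\<open>Ob C\<close> and the morphisms a set \<^term>\<open>Ar C\<close>, every
  morphism having one domain and one codomain.  Fields are only meaningful on these sets (and
  \<^term>\<open>cmp C g f\<close> only for composable morphisms).
\<close>

record ('o, 'm) addcat =
  Ob :: "'o set"
  Ar :: "'m set"
  dom :: "'m \<Rightarrow> 'o"
  cod :: "'m \<Rightarrow> 'o"
  ident :: "'o \<Rightarrow> 'm"
  cmp :: "'m \<Rightarrow> 'm \<Rightarrow> 'm"  (infixr "\<cdot>\<index>" 75)
  add_mor :: "'m \<Rightarrow> 'm \<Rightarrow> 'm"
  zero_mor :: "'o \<Rightarrow> 'o \<Rightarrow> 'm"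

definition Hom :: "('o, 'm, 'x) addcat_scheme \<Rightarrow> 'o \<Rightarrow> 'o \<Rightarrow> 'm set" where
  "Hom C X Y = {f \<in> Ar C. dom C f = X \<and> cod C f = Y}"

definition Hom_group :: "('o, 'm, 'x) addcat_scheme \<Rightarrow> 'o \<Rightarrow> 'o \<Rightarrow> 'm monoid" where
  "Hom_group C X Y = \<lparr>carrier = Hom C X Y, mult = add_mor C, one = zero_mor C X Y\<rparr>"

definition category :: "('o, 'm, 'x) addcat_scheme \<Rightarrow> bool" where
  "category C \<longleftrightarrow>
     (\<forall>f\<in>Ar C. dom C f \<in> Ob C \<and> cod C f \<in> Ob C) \<and>
     (\<forall>X\<in>Ob C. ident C X \<in> Hom C X X) \<and>
     (\<forall>X Y Z f g. f \<in> Hom C X Y \<longrightarrow> g \<in> Hom C Y Z \<longrightarrow> g \<cdot>\<^bsub>C\<^esub> f \<in> Hom C X Z) \<and>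
     (\<forall>W X Y Z f g h. f \<in> Hom C W X \<longrightarrow> g \<in> Hom C X Y \<longrightarrow> h \<in> Hom C Y Z \<longrightarrow>
        h \<cdot>\<^bsub>C\<^esub> (g \<cdot>\<^bsub>C\<^esub> f) = (h \<cdot>\<^bsub>C\<^esub> g) \<cdot>\<^bsub>C\<^esub> f) \<and>
     (\<forall>f\<in>Ar C. f \<cdot>\<^bsub>C\<^esub> ident C (dom C f) = f \<and> ident C (cod C f) \<cdot>\<^bsub>C\<^esub> f = f)"

definition preadditive_category :: "('o, 'm, 'x) addcat_scheme \<Rightarrow> bool" where
  "preadditive_category C \<longleftrightarrow> category C \<and>
     (\<forall>X\<in>Ob C. \<forall>Y\<in>Ob C. comm_group (Hom_group C X Y)) \<and>
     (\<forall>X Y Z f f' g. f \<in> Hom C X Y \<longrightarrow> f' \<in> Hom C X Y \<longrightarrow> g \<in> Hom C Y Z \<longrightarrow>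
        g \<cdot>\<^bsub>C\<^esub> (add_mor C f f') = add_mor C (g \<cdot>\<^bsub>C\<^esub> f) (g \<cdot>\<^bsub>C\<^esub> f')) \<and>
     (\<forall>X Y Z f g g'. f \<in> Hom C X Y \<longrightarrow> g \<in> Hom C Y Z \<longrightarrow> g' \<in> Hom C Y Z \<longrightarrow>
        (add_mor C g g') \<cdot>\<^bsub>C\<^esub> f = add_mor C (g \<cdot>\<^bsub>C\<^esub> f) (g' \<cdot>\<^bsub>C\<^esub> f))"

definition zero_object :: "('o, 'm, 'x) addcat_scheme \<Rightarrow> 'o \<Rightarrow> bool" where
  "zero_object C Z \<longleftrightarrow> Z \<in> Ob C \<and>
     (\<forall>X\<in>Ob C. (\<exists>!f. f \<in> Hom C X Z) \<and> (\<exists>!f. f \<in> Hom C Z X))"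

definition biproduct ::
  "('o, 'm, 'x) addcat_scheme \<Rightarrow> 'o \<Rightarrow> 'o \<Rightarrow> 'o \<Rightarrow> 'm \<Rightarrow> 'm \<Rightarrow> 'm \<Rightarrow> 'm \<Rightarrow> bool" where
  "biproduct C X Y B i1 i2 p1 p2 \<longleftrightarrow>
     i1 \<in> Hom C X B \<and> i2 \<in> Hom C Y B \<and> p1 \<in> Hom C B X \<and> p2 \<in> Hom C B Y \<and>
     p1 \<cdot>\<^bsub>C\<^esub> i1 = ident C X \<and> p2 \<cdot>\<^bsub>C\<^esub> i2 = ident C Y \<and>
     p2 \<cdot>\<^bsub>C\<^esub> i1 = zero_mor C X Y \<and> p1 \<cdot>\<^bsub>C\<^esub> i2 = zero_mor C Y X \<and>
     add_mor C (i1 \<cdot>\<^bsub>C\<^esub> p1) (i2 \<cdot>\<^bsub>C\<^esub> p2) = ident C B"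

definition additive_category :: "('o, 'm, 'x) addcat_scheme \<Rightarrow> bool" where
  "additive_category C \<longleftrightarrow> preadditive_category C \<and> (\<exists>Z. zero_object C Z) \<and>
     (\<forall>X\<in>Ob C. \<forall>Y\<in>Ob C. \<exists>B\<in>Ob C. \<exists>i1 i2 p1 p2. biproduct C X Y B i1 i2 p1 p2)"

definition iso_mor :: "('o, 'm, 'x) addcat_scheme \<Rightarrow> 'm \<Rightarrow> bool" where
  "iso_mor C f \<longleftrightarrow> f \<in> Ar C \<and> (\<exists>g\<in>Hom C (cod C f) (dom C f).
     g \<cdot>\<^bsub>C\<^esub> f = ident C (dom C f) \<and> f \<cdot>\<^bsub>C\<^esub> g = ident C (cod C f))"

definition isomorphic :: "('o, 'm, 'x) addcat_scheme \<Rightarrow> 'o \<Rightarrow> 'o \<Rightarrow> bool" where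
  "isomorphic C X Y \<longleftrightarrow> (\<exists>f\<in>Hom C X Y. iso_mor C f)"

definition is_kernel :: "('o, 'm, 'x) addcat_scheme \<Rightarrow> 'm \<Rightarrow> 'm \<Rightarrow> bool" where
  "is_kernel C k f \<longleftrightarrow> k \<in> Ar C \<and> f \<in> Ar C \<and> cod C k = dom C f \<and>
     f \<cdot>\<^bsub>C\<^esub> k = zero_mor C (dom C k) (cod C f) \<and>
     (\<forall>g\<in>Ar C. cod C g = dom C f \<and> f \<cdot>\<^bsub>C\<^esub> g = zero_mor C (dom C g) (cod C f) \<longrightarrow>
        (\<exists>!h. h \<in> Hom C (dom C g) (dom C k) \<and> k \<cdot>\<^bsub>C\<^esub> h = g))"

definition is_cokernel :: "('o, 'm, 'x) addcat_scheme \<Rightarrow> 'm \<Rightarrow> 'm \<Rightarrow> bool" where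
  "is_cokernel C c f \<longleftrightarrow> c \<in> Ar C \<and> f \<in> Ar C \<and> dom C c = cod C f \<and>
     c \<cdot>\<^bsub>C\<^esub> f = zero_mor C (dom C f) (cod C c) \<and>
     (\<forall>g\<in>Ar C. dom C g = cod C f \<and> g \<cdot>\<^bsub>C\<^esub> f = zero_mor C (dom C f) (cod C g) \<longrightarrow>
        (\<exists>!h. h \<in> Hom C (cod C c) (cod C g) \<and> h \<cdot>\<^bsub>C\<^esub> c = g))"

text \<open>The square \<open>g' \<cdot> f = f' \<cdot> g\<close> is a pushout of \<open>f, g\<close>, resp. a pullback of \<open>f', g'\<close>.\<close>

definition is_pushout :: "('o, 'm, 'x) addcat_scheme \<Rightarrow> 'm \<Rightarrow> 'm \<Rightarrow> 'm \<Rightarrow> 'm \<Rightarrow> bool" where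
  "is_pushout C f g f' g' \<longleftrightarrow>
     f \<in> Ar C \<and> g \<in> Hom C (dom C f) (dom C f') \<and>
     f' \<in> Ar C \<and> g' \<in> Hom C (cod C f) (cod C f') \<and> g' \<cdot>\<^bsub>C\<^esub> f = f' \<cdot>\<^bsub>C\<^esub> g \<and>
     (\<forall>T u v. u \<in> Hom C (cod C f) T \<longrightarrow> v \<in> Hom C (cod C g) T \<longrightarrow> u \<cdot>\<^bsub>C\<^esub> f = v \<cdot>\<^bsub>C\<^esub> g \<longrightarrow>
        (\<exists>!h. h \<in> Hom C (cod C f') T \<and> h \<cdot>\<^bsub>C\<^esub> g' = u \<and> h \<cdot>\<^bsub>C\<^esub> f' = v))"

definition is_pullback :: "('o, 'm, 'x) addcat_scheme \<Rightarrow> 'm \<Rightarrow> 'm \<Rightarrow> 'm \<Rightarrow> 'm \<Rightarrow> bool" where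
  "is_pullback C f g f' g' \<longleftrightarrow>
     f \<in> Ar C \<and> g \<in> Hom C (dom C f) (dom C f') \<and>
     f' \<in> Ar C \<and> g' \<in> Hom C (cod C f) (cod C f') \<and> g' \<cdot>\<^bsub>C\<^esub> f = f' \<cdot>\<^bsub>C\<^esub> g \<and>
     (\<forall>T u v. u \<in> Hom C T (dom C g') \<longrightarrow> v \<in> Hom C T (dom C f') \<longrightarrow> g' \<cdot>\<^bsub>C\<^esub> u = f' \<cdot>\<^bsub>C\<^esub> v \<longrightarrow>
        (\<exists>!h. h \<in> Hom C T (dom C f) \<and> f \<cdot>\<^bsub>C\<^esub> h = u \<and> g \<cdot>\<^bsub>C\<^esub> h = v))"

section \<open>Exact categories\<close>

record ('o, 'm) excat = "('o, 'm) addcat" +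
  conflations :: "('m \<times> 'm) set"

definition inflation :: "('o, 'm, 'x) excat_scheme \<Rightarrow> 'm \<Rightarrow> bool" where
  "inflation E i \<longleftrightarrow> (\<exists>p. (i, p) \<in> conflations E)"

definition deflation :: "('o, 'm, 'x) excat_scheme \<Rightarrow> 'm \<Rightarrow> bool" where
  "deflation E p \<longleftrightarrow> (\<exists>i. (i, p) \<in> conflations E)"

text \<open>Quillen's axioms, without the redundant obscure axiom.\<close>

definition exact_category :: "('o, 'm, 'x) excat_scheme \<Rightarrow> bool" where
  "exact_category E \<longleftrightarrow> additive_category E \<and>
     (\<forall>(i, p)\<in>conflations E. is_kernel E i p \<and> is_cokernel E p i) \<and>
     (\<forall>i p i' p' a b c. (i, p) \<in> conflations E \<longrightarrow> i' \<in> Ar E \<longrightarrow> p' \<in> Ar E \<longrightarrow> cod E i' = dom E p' \<longrightarrow>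
        a \<in> Hom E (dom E i) (dom E i') \<longrightarrow> b \<in> Hom E (cod E i) (cod E i') \<longrightarrow>
        c \<in> Hom E (cod E p) (cod E p') \<longrightarrow> iso_mor E a \<longrightarrow> iso_mor E b \<longrightarrow> iso_mor E c \<longrightarrow>
        b \<cdot>\<^bsub>E\<^esub> i = i' \<cdot>\<^bsub>E\<^esub> a \<longrightarrow> c \<cdot>\<^bsub>E\<^esub> p = p' \<cdot>\<^bsub>E\<^esub> b \<longrightarrow> (i', p') \<in> conflations E) \<and>
     (\<forall>X\<in>Ob E. inflation E (ident E X) \<and> deflation E (ident E X)) \<and>
     (\<forall>i j. inflation E i \<longrightarrow> inflation E j \<longrightarrow> cod E i = dom E j \<longrightarrow> inflation E (j \<cdot>\<^bsub>E\<^esub> i)) \<and>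
     (\<forall>p q. deflation E p \<longrightarrow> deflation E q \<longrightarrow> cod E p = dom E q \<longrightarrow> deflation E (q \<cdot>\<^bsub>E\<^esub> p)) \<and>
     (\<forall>i f. inflation E i \<longrightarrow> f \<in> Ar E \<longrightarrow> dom E f = dom E i \<longrightarrow>
        (\<exists>i' f'. is_pushout E i f i' f' \<and> inflation E i')) \<and>
     (\<forall>p f. deflation E p \<longrightarrow> f \<in> Ar E \<longrightarrow> cod E f = cod E p \<longrightarrow>
        (\<exists>p' f'. is_pullback E p' f' p f \<and> deflation E p'))"

definition admissible :: "('o, 'm, 'x) excat_scheme \<Rightarrow> 'm \<Rightarrow> bool" where
  "admissible E f \<longleftrightarrow>
     (\<exists>m p. inflation E m \<and> deflation E p \<and> cod E p = dom E m \<and> f = m \<cdot>\<^bsub>E\<^esub> p)"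

text \<open>
  \<open>X \<rightarrow> Y \<rightarrow> Z\<close> given by \<open>f, g\<close> is exact at \<open>Y\<close>: both morphisms are admissible and the image \<open>m\<close> of
  \<open>f\<close> is the kernel of \<open>g\<close>.
\<close>

definition exact_at :: "('o, 'm, 'x) excat_scheme \<Rightarrow> 'm \<Rightarrow> 'm \<Rightarrow> bool" where
  "exact_at E f g \<longleftrightarrow> admissible E f \<and> admissible E g \<and>
     (\<exists>m p. inflation E m \<and> deflation E p \<and> cod E p = dom E m \<and> f = m \<cdot>\<^bsub>E\<^esub> p \<and> is_kernel E m g)"

definition projective :: "('o, 'm, 'x) excat_scheme \<Rightarrow> 'o \<Rightarrow> bool" where
  "projective E P \<longleftrightarrow> P \<in> Ob E \<and>
     (\<forall>p f. deflation E p \<longrightarrow> f \<in> Hom E P (cod E p) \<longrightarrow> (\<exists>g\<in>Hom E P (dom E p). p \<cdot>\<^bsub>E\<^esub> g = f))"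

definition enough_projectives :: "('o, 'm, 'x) excat_scheme \<Rightarrow> bool" where
  "enough_projectives E \<longleftrightarrow>
     (\<forall>X\<in>Ob E. \<exists>p. deflation E p \<and> projective E (dom E p) \<and> cod E p = X)"

text \<open>
  The inherited structure: conflations of \<open>E\<close> all of whose terms lie in \<open>S\<close>.  It is a Quillen exact
  structure if \<open>S\<close> is closed under extensions.
\<close>

definition full_subcategory :: "('o, 'm) excat \<Rightarrow> 'o set \<Rightarrow> ('o, 'm) excat" where
  "full_subcategory E S = E\<lparr>
     Ob := Ob E \<inter> S,
     Ar := {f \<in> Ar E. dom E f \<in> S \<and> cod E f \<in> S},
     conflations := {(i, p) \<in> conflations E. dom E i \<in> S \<and> cod E i \<in> S \<and> cod E p \<in> S}\<rparr>"

section \<open>Functors and adjunctions\<close>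

record ('o1, 'm1, 'o2, 'm2) catfun =
  on_ob :: "'o1 \<Rightarrow> 'o2"
  on_ar :: "'m1 \<Rightarrow> 'm2"

definition is_functor ::
  "('o1, 'm1, 'x) addcat_scheme \<Rightarrow> ('o2, 'm2, 'y) addcat_scheme \<Rightarrow>
   ('o1, 'm1, 'o2, 'm2) catfun \<Rightarrow> bool" where
  "is_functor C D T \<longleftrightarrow>
     (\<forall>X\<in>Ob C. on_ob T X \<in> Ob D \<and> on_ar T (ident C X) = ident D (on_ob T X)) \<and>
     (\<forall>X Y f. f \<in> Hom C X Y \<longrightarrow> on_ar T f \<in> Hom D (on_ob T X) (on_ob T Y)) \<and>
     (\<forall>X Y Z f g. f \<in> Hom C X Y \<longrightarrow> g \<in> Hom C Y Z \<longrightarrow>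
        on_ar T (g \<cdot>\<^bsub>C\<^esub> f) = on_ar T g \<cdot>\<^bsub>D\<^esub> on_ar T f)"

definition additive_functor ::
  "('o1, 'm1, 'x) addcat_scheme \<Rightarrow> ('o2, 'm2, 'y) addcat_scheme \<Rightarrow>
   ('o1, 'm1, 'o2, 'm2) catfun \<Rightarrow> bool" where
  "additive_functor C D T \<longleftrightarrow> is_functor C D T \<and>
     (\<forall>X\<in>Ob C. \<forall>Y\<in>Ob C. on_ar T \<in> hom (Hom_group C X Y) (Hom_group D (on_ob T X) (on_ob T Y)))"

definition fully_faithful ::
  "('o1, 'm1, 'x) addcat_scheme \<Rightarrow> ('o2, 'm2, 'y) addcat_scheme \<Rightarrow>
   ('o1, 'm1, 'o2, 'm2) catfun \<Rightarrow> bool" where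
  "fully_faithful C D T \<longleftrightarrow>
     (\<forall>X\<in>Ob C. \<forall>Y\<in>Ob C. bij_betw (on_ar T) (Hom C X Y) (Hom D (on_ob T X) (on_ob T Y)))"

definition essential_image ::
  "('o1, 'm1, 'x) addcat_scheme \<Rightarrow> ('o2, 'm2, 'y) addcat_scheme \<Rightarrow>
   ('o1, 'm1, 'o2, 'm2) catfun \<Rightarrow> 'o2 set" where
  "essential_image C D T = {Y \<in> Ob D. \<exists>X\<in>Ob C. isomorphic D (on_ob T X) Y}"

definition functor_kernel ::
  "('o1, 'm1, 'x) addcat_scheme \<Rightarrow> ('o2, 'm2, 'y) addcat_scheme \<Rightarrow>
   ('o1, 'm1, 'o2, 'm2) catfun \<Rightarrow> 'o1 set" where
  "functor_kernel C D T = {X \<in> Ob C. zero_object D (on_ob T X)}"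

text \<open>\<open>T \<stileturn> U\<close> with unit \<open>\<eta>\<close> and counit \<open>\<epsilon>\<close>.\<close>

definition adjunction ::
  "('o1, 'm1, 'x) addcat_scheme \<Rightarrow> ('o2, 'm2, 'y) addcat_scheme \<Rightarrow>
   ('o1, 'm1, 'o2, 'm2) catfun \<Rightarrow> ('o2, 'm2, 'o1, 'm1) catfun \<Rightarrow>
   ('o1 \<Rightarrow> 'm1) \<Rightarrow> ('o2 \<Rightarrow> 'm2) \<Rightarrow> bool" where
  "adjunction C D T U \<eta> \<epsilon> \<longleftrightarrow> is_functor C D T \<and> is_functor D C U \<and>
     (\<forall>X\<in>Ob C. \<eta> X \<in> Hom C X (on_ob U (on_ob T X))) \<and>
     (\<forall>X Y f. f \<in> Hom C X Y \<longrightarrow> on_ar U (on_ar T f) \<cdot>\<^bsub>C\<^esub> \<eta> X = \<eta> Y \<cdot>\<^bsub>C\<^esub> f) \<and>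
     (\<forall>Y\<in>Ob D. \<epsilon> Y \<in> Hom D (on_ob T (on_ob U Y)) Y) \<and>
     (\<forall>X Y f. f \<in> Hom D X Y \<longrightarrow> \<epsilon> Y \<cdot>\<^bsub>D\<^esub> on_ar T (on_ar U f) = f \<cdot>\<^bsub>D\<^esub> \<epsilon> X) \<and>
     (\<forall>X\<in>Ob C. \<epsilon> (on_ob T X) \<cdot>\<^bsub>D\<^esub> on_ar T (\<eta> X) = ident D (on_ob T X)) \<and>
     (\<forall>Y\<in>Ob D. on_ar U (\<epsilon> Y) \<cdot>\<^bsub>C\<^esub> \<eta> (on_ob U Y) = ident C (on_ob U Y))"

section \<open>Recollements\<close>

text \<open>
  The functor arguments are \<open>i\<^sup>*, i\<^sub>*, i\<^sup>!, j\<^sub>!, j\<^sup>*, j\<^sub>*\<close>, in this order.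
\<close>

definition recollement ::
  "('oa, 'ma) excat \<Rightarrow> ('ob, 'mb) excat \<Rightarrow> ('oc, 'mc) excat \<Rightarrow>
   ('ob, 'mb, 'oa, 'ma) catfun \<Rightarrow> ('oa, 'ma, 'ob, 'mb) catfun \<Rightarrow> ('ob, 'mb, 'oa, 'ma) catfun \<Rightarrow>
   ('oc, 'mc, 'ob, 'mb) catfun \<Rightarrow> ('ob, 'mb, 'oc, 'mc) catfun \<Rightarrow> ('oc, 'mc, 'ob, 'mb) catfun \<Rightarrow>
   bool" where
  "recollement A B C i_up i_low i_sh j_sh j_up j_low \<longleftrightarrow>
     exact_category A \<and> exact_category B \<and> exact_category C \<and>
     additive_functor B A i_up \<and> additive_functor A B i_low \<and> additive_functor B A i_sh \<and>
     additive_functor C B j_sh \<and> additive_functor B C j_up \<and> additive_functor C B j_low \<and>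
     (\<exists>\<eta>1 \<epsilon>1 \<eta>2 \<epsilon>2 \<eta>3 \<epsilon>3 \<eta>4 \<epsilon>4.
        adjunction B A i_up i_low \<eta>1 \<epsilon>1 \<and> adjunction A B i_low i_sh \<eta>2 \<epsilon>2 \<and>
        adjunction C B j_sh j_up \<eta>3 \<epsilon>3 \<and> adjunction B C j_up j_low \<eta>4 \<epsilon>4 \<and>
        essential_image A B i_low = functor_kernel B C j_up \<and>
        fully_faithful A B i_low \<and> fully_faithful C B j_sh \<and> fully_faithful C B j_low \<and>
        (\<forall>X\<in>Ob B. \<exists>Z\<in>Ob A. \<exists>q\<in>Hom B (on_ob j_low (on_ob j_up X)) (on_ob i_low Z).
           inflation B (\<epsilon>2 X) \<and> exact_at B (\<epsilon>2 X) (\<eta>4 X) \<and> exact_at B (\<eta>4 X) q \<and> deflation B q) \<and>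
        (\<forall>X\<in>Ob B. \<exists>Z\<in>Ob A. \<exists>k\<in>Hom B (on_ob i_low Z) (on_ob j_sh (on_ob j_up X)).
           inflation B k \<and> exact_at B k (\<epsilon>3 X) \<and> exact_at B (\<epsilon>3 X) (\<eta>1 X) \<and> deflation B (\<eta>1 X)))"

section \<open>The category of additive presheaves\<close>

record ('o, 'm, 'u) presheaf =
  grp :: "'o \<Rightarrow> 'u monoid"
  res :: "'m \<Rightarrow> 'u \<Rightarrow> 'u"

text \<open>
  Additive contravariant functors to abelian groups, the type \<open>'u\<close> playing the role of the universe
  in which the underlying sets of the groups live.
\<close>

definition is_presheaf :: "('o, 'm, 'x) addcat_scheme \<Rightarrow> ('o, 'm, 'u) presheaf \<Rightarrow> bool" where
  "is_presheaf E F \<longleftrightarrow>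
     (\<forall>X\<in>Ob E. comm_group (grp F X)) \<and>
     (\<forall>X Y f. f \<in> Hom E X Y \<longrightarrow> res F f \<in> hom (grp F Y) (grp F X)) \<and>
     (\<forall>X\<in>Ob E. \<forall>x\<in>carrier (grp F X). res F (ident E X) x = x) \<and>
     (\<forall>X Y Z f g. f \<in> Hom E X Y \<longrightarrow> g \<in> Hom E Y Z \<longrightarrow>
        (\<forall>x\<in>carrier (grp F Z). res F (g \<cdot>\<^bsub>E\<^esub> f) x = res F f (res F g x))) \<and>
     (\<forall>X Y f g. f \<in> Hom E X Y \<longrightarrow> g \<in> Hom E X Y \<longrightarrow>
        (\<forall>x\<in>carrier (grp F Y). res F (add_mor E f g) x = res F f x \<otimes>\<^bsub>grp F X\<^esub> res F g x))"

text \<open>Components are extensional, so that equal natural transformations are equal as functions.\<close>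

definition nat_transf ::
  "('o, 'm, 'x) addcat_scheme \<Rightarrow> ('o, 'm, 'u) presheaf \<Rightarrow> ('o, 'm, 'u) presheaf \<Rightarrow>
   ('o \<Rightarrow> 'u \<Rightarrow> 'u) set" where
  "nat_transf E F G =
     {\<alpha> \<in> (\<Pi>\<^sub>E X\<in>Ob E. hom (grp F X) (grp G X) \<inter> extensional (carrier (grp F X))).
        \<forall>X Y f. f \<in> Hom E X Y \<longrightarrow> (\<forall>x\<in>carrier (grp F Y). \<alpha> X (res F f x) = res G f (\<alpha> Y x))}"

type_synonym ('o, 'm, 'u) presheaf_mor =
  "('o, 'm, 'u) presheaf \<times> ('o \<Rightarrow> 'u \<Rightarrow> 'u) \<times> ('o, 'm, 'u) presheaf"

text \<open>Exactness in the abelian category of presheaves is exactness at each object.\<close>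

fun presheaf_exact_at ::
  "('o, 'm, 'x) addcat_scheme \<Rightarrow> ('o, 'm, 'u) presheaf_mor \<Rightarrow> ('o, 'm, 'u) presheaf_mor \<Rightarrow> bool" where
  "presheaf_exact_at E (F, \<alpha>, G) (G', \<beta>, H) \<longleftrightarrow> G = G' \<and>
     (\<forall>X\<in>Ob E. \<alpha> X ` carrier (grp F X) = kernel (grp G X) (grp H X) (\<beta> X))"

fun presheaf_mono :: "('o, 'm, 'x) addcat_scheme \<Rightarrow> ('o, 'm, 'u) presheaf_mor \<Rightarrow> bool" where
  "presheaf_mono E (F, \<alpha>, G) \<longleftrightarrow> (\<forall>X\<in>Ob E. inj_on (\<alpha> X) (carrier (grp F X)))"

fun presheaf_epi :: "('o, 'm, 'x) addcat_scheme \<Rightarrow> ('o, 'm, 'u) presheaf_mor \<Rightarrow> bool" where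
  "presheaf_epi E (F, \<alpha>, G) \<longleftrightarrow> (\<forall>X\<in>Ob E. \<alpha> X ` carrier (grp F X) = carrier (grp G X))"

definition presheaf_mors :: "('o, 'm, 'x) addcat_scheme \<Rightarrow> ('o, 'm, 'u) presheaf_mor set" where
  "presheaf_mors E = {(F, \<alpha>, G). is_presheaf E F \<and> is_presheaf E G \<and> \<alpha> \<in> nat_transf E F G}"

definition ModC ::
  "('o, 'm, 'x) addcat_scheme \<Rightarrow> (('o, 'm, 'u) presheaf, ('o, 'm, 'u) presheaf_mor) excat" where
  "ModC E = \<lparr>
     Ob = {F. is_presheaf E F},
     Ar = presheaf_mors E,
     dom = (\<lambda>(F, \<alpha>, G). F),
     cod = (\<lambda>(F, \<alpha>, G). G),
     ident = (\<lambda>F. (F, (\<lambda>X\<in>Ob E. \<lambda>x\<in>carrier (grp F X). x), F)),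
     cmp = (\<lambda>(_, \<beta>, H) (F, \<alpha>, _). (F, (\<lambda>X\<in>Ob E. \<lambda>x\<in>carrier (grp F X). \<beta> X (\<alpha> X x)), H)),
     add_mor = (\<lambda>(F, \<alpha>, G) (_, \<beta>, _).
       (F, (\<lambda>X\<in>Ob E. \<lambda>x\<in>carrier (grp F X). \<alpha> X x \<otimes>\<^bsub>grp G X\<^esub> \<beta> X x), G)),
     zero_mor = (\<lambda>F G. (F, (\<lambda>X\<in>Ob E. \<lambda>x\<in>carrier (grp F X). \<one>\<^bsub>grp G X\<^esub>), G)),
     conflations = {(i, p). i \<in> presheaf_mors E \<and> p \<in> presheaf_mors E \<and>
       presheaf_mono E i \<and> presheaf_exact_at E i p \<and> presheaf_epi E p}\<rparr>"

section \<open>Yoneda embedding, admissibly presented and effaceable functors\<close>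

text \<open>
  The map \<open>\<iota>\<close>, injective on morphisms, places the Hom groups into the universe \<open>'u\<close>: the value of
  \<open>\<Upsilon>(X)\<close> at \<open>Z\<close> is the copy of \<open>Hom(Z, X)\<close> along \<open>\<iota>\<close>.
\<close>

definition yoneda_ob ::
  "('o, 'm, 'x) addcat_scheme \<Rightarrow> ('m \<Rightarrow> 'u) \<Rightarrow> 'o \<Rightarrow> ('o, 'm, 'u) presheaf" where
  "yoneda_ob E \<iota> X = \<lparr>
     grp = (\<lambda>Z. image_group \<iota> (Hom_group E Z X)),
     res = (\<lambda>f u. \<iota> (inv_into (Ar E) \<iota> u \<cdot>\<^bsub>E\<^esub> f))\<rparr>"

definition yoneda ::
  "('o, 'm, 'x) addcat_scheme \<Rightarrow> ('m \<Rightarrow> 'u) \<Rightarrow>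
   ('o, 'm, ('o, 'm, 'u) presheaf, ('o, 'm, 'u) presheaf_mor) catfun" where
  "yoneda E \<iota> = \<lparr>
     on_ob = yoneda_ob E \<iota>,
     on_ar = (\<lambda>f. (yoneda_ob E \<iota> (dom E f),
       (\<lambda>Z\<in>Ob E. \<lambda>u\<in>\<iota> ` Hom E Z (dom E f). \<iota> (f \<cdot>\<^bsub>E\<^esub> inv_into (Ar E) \<iota> u)),
       yoneda_ob E \<iota> (cod E f)))\<rparr>"

text \<open>\<open>\<Upsilon>(X) \<rightarrow> \<Upsilon>(Y) \<rightarrow> F \<rightarrow> 0\<close> with maps \<open>\<Upsilon>(f)\<close> and \<open>q\<close> is exact.\<close>

definition presents ::
  "('o, 'm, 'x) addcat_scheme \<Rightarrow> ('m \<Rightarrow> 'u) \<Rightarrow> 'm \<Rightarrow> ('o, 'm, 'u) presheaf_mor \<Rightarrow>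
   ('o, 'm, 'u) presheaf \<Rightarrow> bool" where
  "presents E \<iota> f q F \<longleftrightarrow> f \<in> Ar E \<and> q \<in> Hom (ModC E) (yoneda_ob E \<iota> (cod E f)) F \<and>
     presheaf_exact_at E (on_ar (yoneda E \<iota>) f) q \<and> presheaf_epi E q"

definition mod_adm ::
  "('o, 'm, 'x) excat_scheme \<Rightarrow> ('m \<Rightarrow> 'u) \<Rightarrow>
   (('o, 'm, 'u) presheaf, ('o, 'm, 'u) presheaf_mor) excat" where
  "mod_adm E \<iota> = full_subcategory (ModC E) {F. \<exists>f q. admissible E f \<and> presents E \<iota> f q F}"

definition eff ::
  "('o, 'm, 'x) excat_scheme \<Rightarrow> ('m \<Rightarrow> 'u) \<Rightarrow>
   (('o, 'm, 'u) presheaf, ('o, 'm, 'u) presheaf_mor) excat" where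
  "eff E \<iota> = full_subcategory (ModC E) {F. \<exists>f q. deflation E f \<and> presents E \<iota> f q F}"

definition inclusion :: "('o, 'm, 'o, 'm) catfun" where
  "inclusion = \<lparr>on_ob = (\<lambda>X. X), on_ar = (\<lambda>f. f)\<rparr>"

section \<open>The left adjoint of the Yoneda embedding\<close>

text \<open>
  For each \<open>F\<close> choose an admissible presentation \<open>f, q\<close> together with a cokernel \<open>c\<close> of \<open>f\<close>; then
  \<open>L(F) = coker(f)\<close> is the codomain of \<open>c\<close>.  For \<open>F = \<Upsilon>(X)\<close> the choice is \<open>0 \<rightarrow> X\<close> with identities, which makes
  \<open>L \<circ> \<Upsilon>\<close> equal to the identity and not merely isomorphic to it.
\<close>

definition L_choice ::
  "('o, 'm, 'x) excat_scheme \<Rightarrow> ('m \<Rightarrow> 'u) \<Rightarrow> ('o, 'm, 'u) presheaf \<Rightarrow>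
   'm \<times> ('o, 'm, 'u) presheaf_mor \<times> 'm" where
  "L_choice E \<iota> F = (SOME (f, q, c). admissible E f \<and> presents E \<iota> f q F \<and> is_cokernel E c f \<and>
     (\<forall>X\<in>Ob E. F = yoneda_ob E \<iota> X \<longrightarrow> q = ident (ModC E) F \<and> c = ident E X))"

text \<open>
  \<open>L(\<alpha>)\<close> is the map induced on cokernels by any lift \<open>h\<close> of \<open>\<alpha>\<close> to the chosen presentations.
\<close>

definition L_functor ::
  "('o, 'm, 'x) excat_scheme \<Rightarrow> ('m \<Rightarrow> 'u) \<Rightarrow>
   (('o, 'm, 'u) presheaf, ('o, 'm, 'u) presheaf_mor, 'o, 'm) catfun" where
  "L_functor E \<iota> = \<lparr>
     on_ob = (\<lambda>F. case L_choice E \<iota> F of (f, q, c) \<Rightarrow> cod E c),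
     on_ar = (\<lambda>\<alpha>.
       case L_choice E \<iota> (dom (ModC E) \<alpha>) of (f, q, c) \<Rightarrow>
       case L_choice E \<iota> (cod (ModC E) \<alpha>) of (f', q', c') \<Rightarrow>
         (THE g. g \<in> Hom E (cod E c) (cod E c') \<and>
            (\<exists>h\<in>Hom E (cod E f) (cod E f').
               \<alpha> \<cdot>\<^bsub>ModC E\<^esub> q = q' \<cdot>\<^bsub>ModC E\<^esub> on_ar (yoneda E \<iota>) h \<and> g \<cdot>\<^bsub>E\<^esub> c = c' \<cdot>\<^bsub>E\<^esub> h)))\<rparr>"

end

theory Submission
  imports Defs
begin

text \<open>
  An extension of admissibly presented functors is presented by a matrix with diagonal entries the two
  presentations, and such a matrix is again admissible if the off-diagonal entry is compatible with the
  kernels.  So \<open>mod\<^sub>a\<^sub>d\<^sub>m\<close> is closed under extensions in \<open>Mod\<close>, and \<open>eff\<close> consists of those of its objects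
  all of whose elements are killed by restriction along some deflation.  The latter elements form the kernel
  of the unit \<open>F \<rightarrow> \<Upsilon>(L F)\<close>, which is \<open>i\<^sup>! F\<close>.

  If \<open>P\<close> is projective, this kernel vanishes at \<open>P\<close> and the unit is an isomorphism \<open>F(P) \<cong> Hom(P, L F)\<close>.
  Hence, for a presentation \<open>P\<^sub>1 \<rightarrow> P\<^sub>0 \<rightarrow> D\<close> by projectives, the cokernel of \<open>\<Upsilon>(P\<^sub>1) \<rightarrow> \<Upsilon>(P\<^sub>0)\<close> has the
  universal property of \<open>j\<^sub>! D\<close>, and the image of \<open>j\<^sub>! L F \<rightarrow> F\<close> is the subfunctor generated by the values
  of \<open>F\<close> at projectives.  Morphisms from \<open>F\<close> to effaceable functors vanish on it, so that \<open>i\<^sup>* F\<close> is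
  the quotient.
\<close>


section \<open>Preadditive categories\<close>

text \<open>Two obstacles shape the development. The universe \<open>'u\<close> only has to receive
  the morphisms of the category through \<open>\<iota>\<close>, so presheaves with values in it need
  not have biproducts. Quotients are therefore carried by representatives, and products are formed
  only inside the subcategories, as cokernels of diagonal matrices. Objects of \<open>Adm\<close>
  are handled by a generator \<open>x\<close> and relations \<open>f\<close>, and a closure
  statement amounts to exhibiting new generators and relations. Moreover idempotents need not split,
  so if \<open>f \<cdot> s\<close> is a deflation, \<open>f\<close> need not be one. Membership in
  \<open>Adm\<close> or \<open>Eff\<close> thus always rests on an explicit factorization. The
  recurrent tool is \<open>copair_deflation\<close>: a morphism into the middle term of a conflation
  is a deflation if one component covers the kernel and the other covers the quotient. It yields the
  matrices for extensions, the relations of \<open>F\<close> modulo \<open>N F\<close>, and those of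
  the kernel of the counit of \<open>j_!\<close>. Projectives serve to turn conditions in
  \<open>F\<close> into conditions on morphisms to \<open>LL F\<close>, which is what makes
  \<open>j_!\<close> and \<open>i^*\<close> computable.\<close>

locale preadditive =
  fixes C :: "('o, 'm, 'x) addcat_scheme" (structure)
  assumes preadditive: "preadditive_category C"
begin

definition minus_mor :: "'m \<Rightarrow> 'm \<Rightarrow> 'm" (infixl "\<^bold>-" 65) where
  "f \<^bold>- g = add_mor C f (inv\<^bsub>Hom_group C (dom C g) (cod C g)\<^esub> g)"

lemma category: "category C"
  using preadditive by (simp add: preadditive_category_def)

lemma Hom_iff [simp]: "f \<in> Hom C X Y \<longleftrightarrow> f \<in> Ar C \<and> dom C f = X \<and> cod C f = Y"
  by (auto simp: Hom_def)

lemma dom_Ob [simp]: "f \<in> Ar C \<Longrightarrow> dom C f \<in> Ob C"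
  and cod_Ob [simp]: "f \<in> Ar C \<Longrightarrow> cod C f \<in> Ob C"
  using category by (auto simp: category_def)

lemma ident_Ar [simp]: "X \<in> Ob C \<Longrightarrow> ident C X \<in> Ar C"
  and dom_ident [simp]: "X \<in> Ob C \<Longrightarrow> dom C (ident C X) = X"
  and cod_ident [simp]: "X \<in> Ob C \<Longrightarrow> cod C (ident C X) = X"
  using category by (auto simp: category_def)

lemma cmp_Hom: "f \<in> Hom C X Y \<Longrightarrow> g \<in> Hom C Y Z \<Longrightarrow> g \<cdot> f \<in> Hom C X Z"
  using category unfolding category_def by blast

lemma cmp_Ar [simp]: "f \<in> Ar C \<Longrightarrow> g \<in> Ar C \<Longrightarrow> cod C f = dom C g \<Longrightarrow> g \<cdot> f \<in> Ar C"
  and dom_cmp [simp]: "f \<in> Ar C \<Longrightarrow> g \<in> Ar C \<Longrightarrow> cod C f = dom C g \<Longrightarrow> dom C (g \<cdot> f) = dom C f"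
  and cod_cmp [simp]: "f \<in> Ar C \<Longrightarrow> g \<in> Ar C \<Longrightarrow> cod C f = dom C g \<Longrightarrow> cod C (g \<cdot> f) = cod C g"
  using cmp_Hom[of f "dom C f" "cod C f" g "cod C g"] by auto

lemma cmp_assoc [simp]:
  assumes "f \<in> Ar C" "g \<in> Ar C" "h \<in> Ar C" "cod C f = dom C g" "cod C g = dom C h"
  shows "(h \<cdot> g) \<cdot> f = h \<cdot> (g \<cdot> f)"
proof -
  have "f \<in> Hom C (dom C f) (cod C f)" "g \<in> Hom C (cod C f) (cod C g)"
    "h \<in> Hom C (cod C g) (cod C h)"
    using assms by auto
  then show ?thesis
    using category unfolding category_def by metis
qed

text \<open>\<open>cmp_assoc\<close> nests composites to the right, so an equation for
  \<open>g \<cdot> f\<close> does not match inside \<open>g \<cdot> (f \<cdot> s)\<close>. Known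
  equations between composites are applied in this form.\<close>

lemma cmp_reduce:
  assumes "g \<cdot> f = h" "f \<in> Ar C" "g \<in> Ar C" "cod C f = dom C g" "s \<in> Ar C" "cod C s = dom C f"
  shows "g \<cdot> (f \<cdot> s) = h \<cdot> s"
  using assms by (metis cmp_assoc)

lemma ident_right [simp]: "f \<in> Ar C \<Longrightarrow> dom C f = X \<Longrightarrow> f \<cdot> ident C X = f"
  and ident_left [simp]: "f \<in> Ar C \<Longrightarrow> cod C f = X \<Longrightarrow> ident C X \<cdot> f = f"
  using category by (auto simp: category_def)

section \<open>Addition and subtraction of morphisms\<close>

lemma Hom_comm_group: "X \<in> Ob C \<Longrightarrow> Y \<in> Ob C \<Longrightarrow> comm_group (Hom_group C X Y)"
  using preadditive by (simp add: preadditive_category_def)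

lemma carrier_Hom_group [simp]: "carrier (Hom_group C X Y) = Hom C X Y"
  and mult_Hom_group [simp]: "mult (Hom_group C X Y) = add_mor C"
  and one_Hom_group [simp]: "one (Hom_group C X Y) = zero_mor C X Y"
  by (simp_all add: Hom_group_def)

lemma add_Hom: "f \<in> Hom C X Y \<Longrightarrow> g \<in> Hom C X Y \<Longrightarrow> add_mor C f g \<in> Hom C X Y"
  using monoid.m_closed[OF group.is_monoid[OF comm_group.axioms(2)[OF Hom_comm_group[of X Y]]], of f g]
  by auto

lemma add_Ar [simp]: "f \<in> Ar C \<Longrightarrow> g \<in> Ar C \<Longrightarrow> dom C f = dom C g \<Longrightarrow> cod C f = cod C g \<Longrightarrow> add_mor C f g \<in> Ar C"
  and dom_add [simp]: "f \<in> Ar C \<Longrightarrow> g \<in> Ar C \<Longrightarrow> dom C f = dom C g \<Longrightarrow> cod C f = cod C g \<Longrightarrow> dom C (add_mor C f g) = dom C g"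
  and cod_add [simp]: "f \<in> Ar C \<Longrightarrow> g \<in> Ar C \<Longrightarrow> dom C f = dom C g \<Longrightarrow> cod C f = cod C g \<Longrightarrow> cod C (add_mor C f g) = cod C g"
  using add_Hom[of f "dom C g" "cod C g" g] by auto

lemma zero_Ar [simp]: "X \<in> Ob C \<Longrightarrow> Y \<in> Ob C \<Longrightarrow> zero_mor C X Y \<in> Ar C"
  and dom_zero [simp]: "X \<in> Ob C \<Longrightarrow> Y \<in> Ob C \<Longrightarrow> dom C (zero_mor C X Y) = X"
  and cod_zero [simp]: "X \<in> Ob C \<Longrightarrow> Y \<in> Ob C \<Longrightarrow> cod C (zero_mor C X Y) = Y"
  using monoid.one_closed[OF group.is_monoid[OF comm_group.axioms(2)[OF Hom_comm_group[of X Y]]]]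
  by auto

lemma inv_Hom: "f \<in> Hom C X Y \<Longrightarrow> inv\<^bsub>Hom_group C X Y\<^esub> f \<in> Hom C X Y"
  using group.inv_closed[OF comm_group.axioms(2)[OF Hom_comm_group[of X Y]], of f] by auto

lemma minus_Ar [simp]: "f \<in> Ar C \<Longrightarrow> g \<in> Ar C \<Longrightarrow> dom C f = dom C g \<Longrightarrow> cod C f = cod C g \<Longrightarrow> f \<^bold>- g \<in> Ar C"
  and dom_minus [simp]: "f \<in> Ar C \<Longrightarrow> g \<in> Ar C \<Longrightarrow> dom C f = dom C g \<Longrightarrow> cod C f = cod C g \<Longrightarrow> dom C (f \<^bold>- g) = dom C g"
  and cod_minus [simp]: "f \<in> Ar C \<Longrightarrow> g \<in> Ar C \<Longrightarrow> dom C f = dom C g \<Longrightarrow> cod C f = cod C g \<Longrightarrow> cod C (f \<^bold>- g) = cod C g"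
  using inv_Hom[of g "dom C g" "cod C g"] by (auto simp: minus_mor_def)

lemma add_assoc:
  assumes "f \<in> Hom C X Y" "g \<in> Hom C X Y" "h \<in> Hom C X Y"
  shows "add_mor C (add_mor C f g) h = add_mor C f (add_mor C g h)"
  using monoid.m_assoc[OF group.is_monoid[OF comm_group.axioms(2)[OF Hom_comm_group[of X Y]]], of f g h] assms
  by auto

lemma add_commute:
  assumes "f \<in> Hom C X Y" "g \<in> Hom C X Y"
  shows "add_mor C f g = add_mor C g f"
  using comm_monoid.m_comm[OF comm_group.axioms(1)[OF Hom_comm_group[of X Y]], of f g] assms
  by auto

lemma add_zero_right [simp]: "f \<in> Ar C \<Longrightarrow> dom C f = X \<Longrightarrow> cod C f = Y \<Longrightarrow> add_mor C f (zero_mor C X Y) = f"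
  using monoid.r_one[OF group.is_monoid[OF comm_group.axioms(2)[OF Hom_comm_group[of X Y]]], of f] by auto

lemma add_zero_left [simp]: "f \<in> Ar C \<Longrightarrow> dom C f = X \<Longrightarrow> cod C f = Y \<Longrightarrow> add_mor C (zero_mor C X Y) f = f"
  using monoid.l_one[OF group.is_monoid[OF comm_group.axioms(2)[OF Hom_comm_group[of X Y]]], of f] by auto

lemma minus_self: "f \<in> Ar C \<Longrightarrow> f \<^bold>- f = zero_mor C (dom C f) (cod C f)"
  using group.r_inv[OF comm_group.axioms(2)[OF Hom_comm_group[of "dom C f" "cod C f"]], of f]
  by (auto simp: minus_mor_def)

lemma minus_add_cancel:
  assumes "f \<in> Hom C X Y" "g \<in> Hom C X Y"
  shows "add_mor C (f \<^bold>- g) g = f"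
proof -
  have "add_mor C (inv\<^bsub>Hom_group C X Y\<^esub> g) g = zero_mor C X Y"
    using group.l_inv[OF comm_group.axioms(2)[OF Hom_comm_group[of X Y]], of g] assms by auto
  then show ?thesis
    using assms add_assoc[OF assms(1) inv_Hom[OF assms(2)] assms(2)] by (simp add: minus_mor_def)
qed

lemma add_right_cancel:
  assumes "f \<in> Hom C X Y" "f' \<in> Hom C X Y" "g \<in> Hom C X Y" "add_mor C f g = add_mor C f' g"
  shows "f = f'"
proof -
  have "X \<in> Ob C" "Y \<in> Ob C" using assms(1) by auto
  then show ?thesis
    using group.right_cancel[OF comm_group.axioms(2)[OF Hom_comm_group[of X Y]], of g f f'] assms
    by (simp del: Hom_iff)
qed

lemma eq_minusI:
  assumes "f \<in> Hom C X Y" "g \<in> Hom C X Y" "h \<in> Hom C X Y" "add_mor C h g = f"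
  shows "h = f \<^bold>- g"
  using assms minus_add_cancel[OF assms(1,2)] by (intro add_right_cancel[of h X Y "f \<^bold>- g" g]) auto

lemma cmp_add:
  assumes "f \<in> Hom C X Y" "f' \<in> Hom C X Y" "g \<in> Hom C Y Z"
  shows "g \<cdot> add_mor C f f' = add_mor C (g \<cdot> f) (g \<cdot> f')"
  using preadditive assms unfolding preadditive_category_def by blast

lemma add_cmp:
  assumes "f \<in> Hom C X Y" "g \<in> Hom C Y Z" "g' \<in> Hom C Y Z"
  shows "add_mor C g g' \<cdot> f = add_mor C (g \<cdot> f) (g' \<cdot> f)"
  using preadditive assms unfolding preadditive_category_def by blast

lemma cmp_minus:
  assumes "f \<in> Hom C X Y" "f' \<in> Hom C X Y" "g \<in> Hom C Y Z"
  shows "g \<cdot> (f \<^bold>- f') = (g \<cdot> f) \<^bold>- (g \<cdot> f')"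
  by (rule eq_minusI[where X=X and Y=Z])
     (use assms cmp_add[of "f \<^bold>- f'" X Y f' g Z] minus_add_cancel[OF assms(1,2)] in auto)

lemma minus_cmp:
  assumes "f \<in> Hom C X Y" "g \<in> Hom C Y Z" "g' \<in> Hom C Y Z"
  shows "(g \<^bold>- g') \<cdot> f = (g \<cdot> f) \<^bold>- (g' \<cdot> f)"
  by (rule eq_minusI[where X=X and Y=Z])
     (use assms add_cmp[of f X Y "g \<^bold>- g'" Z g'] minus_add_cancel[OF assms(2,3)] in auto)

text \<open>Zero is its own difference with itself, and composition distributes over
  differences.\<close>

lemma cmp_zero [simp]:
  assumes "g \<in> Ar C" "X \<in> Ob C" "dom C g = Y"
  shows "g \<cdot> zero_mor C X Y = zero_mor C X (cod C g)"
proof -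
  have "g \<cdot> (zero_mor C X Y \<^bold>- zero_mor C X Y) = zero_mor C X (cod C g)"
    using assms by (subst cmp_minus[where X=X and Y=Y and Z="cod C g"]) (auto simp: minus_self)
  then show ?thesis using assms by (auto simp: minus_self)
qed

lemma zero_cmp [simp]:
  assumes "f \<in> Ar C" "Z \<in> Ob C" "cod C f = Y"
  shows "zero_mor C Y Z \<cdot> f = zero_mor C (dom C f) Z"
proof -
  have "(zero_mor C Y Z \<^bold>- zero_mor C Y Z) \<cdot> f = zero_mor C (dom C f) Z"
    using assms by (subst minus_cmp[where X="dom C f" and Y=Y and Z=Z]) (auto simp: minus_self)
  then show ?thesis using assms by (auto simp: minus_self)
qed

lemma minus_zero [simp]: "f \<in> Ar C \<Longrightarrow> dom C f = X \<Longrightarrow> cod C f = Y \<Longrightarrow> f \<^bold>- zero_mor C X Y = f"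
  using minus_add_cancel[of f X Y "zero_mor C X Y"] by auto

section \<open>Kernels, cokernels, isomorphisms and zero objects\<close>

lemma is_kernelD:
  assumes "is_kernel C k f"
  shows "k \<in> Ar C" "f \<in> Ar C" "cod C k = dom C f" "f \<cdot> k = zero_mor C (dom C k) (cod C f)"
  using assms by (auto simp: is_kernel_def)

lemma is_cokernelD:
  assumes "is_cokernel C c f"
  shows "c \<in> Ar C" "f \<in> Ar C" "dom C c = cod C f" "c \<cdot> f = zero_mor C (dom C f) (cod C c)"
  using assms by (auto simp: is_cokernel_def)

lemma kernel_unique_factor:
  assumes "is_kernel C k f" "g \<in> Hom C X (dom C f)" "f \<cdot> g = zero_mor C X (cod C f)"
  shows "\<exists>!h. h \<in> Hom C X (dom C k) \<and> k \<cdot> h = g"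
proof -
  have "g \<in> Ar C" "dom C g = X" "cod C g = dom C f" using assms(2) by auto
  then show ?thesis using assms(1,3) unfolding is_kernel_def by blast
qed

lemma cokernel_unique_factor:
  assumes "is_cokernel C c f" "g \<in> Hom C (cod C f) X" "g \<cdot> f = zero_mor C (dom C f) X"
  shows "\<exists>!h. h \<in> Hom C (cod C c) X \<and> h \<cdot> c = g"
proof -
  have "g \<in> Ar C" "cod C g = X" "dom C g = cod C f" using assms(2) by auto
  then show ?thesis using assms(1,3) unfolding is_cokernel_def by blast
qed

lemma kernel_factor:
  assumes "is_kernel C k f" "g \<in> Hom C X (dom C f)" "f \<cdot> g = zero_mor C X (cod C f)"
  obtains h where "h \<in> Hom C X (dom C k)" "k \<cdot> h = g"
  using kernel_unique_factor[OF assms] by blast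

lemma cokernel_factor:
  assumes "is_cokernel C c f" "g \<in> Hom C (cod C f) X" "g \<cdot> f = zero_mor C (dom C f) X"
  obtains h where "h \<in> Hom C (cod C c) X" "h \<cdot> c = g"
  using cokernel_unique_factor[OF assms] by blast

text \<open>\<open>g\<close> and \<open>h\<close> are both factorizations through \<open>k\<close>
  of the one morphism \<open>k \<cdot> h\<close>, which \<open>f\<close> annihilates.\<close>

lemma kernel_mono:
  assumes "is_kernel C k f" "g \<in> Hom C X (dom C k)" "h \<in> Hom C X (dom C k)" "k \<cdot> g = k \<cdot> h"
  shows "g = h"
proof -
  note k = is_kernelD[OF assms(1)]
  have h: "h \<in> Ar C" "dom C h = X" "cod C h = dom C k" using assms(3) by auto
  have "f \<cdot> (k \<cdot> h) = zero_mor C X (cod C f)"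
    using cmp_reduce[OF k(4) k(1,2,3) h(1,3)] k(1,2) h by simp
  then have "\<exists>!u. u \<in> Hom C X (dom C k) \<and> k \<cdot> u = k \<cdot> h"
    using k h by (intro kernel_unique_factor[OF assms(1)]) simp_all
  then show ?thesis using assms by blast
qed

lemma cokernel_epi:
  assumes "is_cokernel C c f" "g \<in> Hom C (cod C c) X" "h \<in> Hom C (cod C c) X" "g \<cdot> c = h \<cdot> c"
  shows "g = h"
proof -
  note c = is_cokernelD[OF assms(1)]
  have h: "h \<in> Ar C" "cod C h = X" "dom C h = cod C c" using assms(3) by auto
  have "(h \<cdot> c) \<cdot> f = zero_mor C (dom C f) X"
    using c h by simp
  then have "\<exists>!u. u \<in> Hom C (cod C c) X \<and> u \<cdot> c = h \<cdot> c"
    using c h by (intro cokernel_unique_factor[OF assms(1)]) simp_all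
  then show ?thesis using assms by blast
qed

lemma iso_morE:
  assumes "iso_mor C f"
  obtains g where "iso_mor C g" "g \<in> Hom C (cod C f) (dom C f)"
    "g \<cdot> f = ident C (dom C f)" "f \<cdot> g = ident C (cod C f)"
proof -
  obtain g where "g \<in> Hom C (cod C f) (dom C f)"
    "g \<cdot> f = ident C (dom C f)" "f \<cdot> g = ident C (cod C f)" "f \<in> Ar C"
    using assms unfolding iso_mor_def by blast
  moreover from this have "iso_mor C g" unfolding iso_mor_def by (metis Hom_iff)
  ultimately show ?thesis using that by blast
qed

lemma iso_mor_Ar: "iso_mor C f \<Longrightarrow> f \<in> Ar C"
  by (simp add: iso_mor_def)

lemma iso_mor_ident: "X \<in> Ob C \<Longrightarrow> iso_mor C (ident C X)"
  by (auto simp: iso_mor_def)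

lemma iso_morI:
  assumes "f \<in> Hom C X Y" "g \<in> Hom C Y X" "g \<cdot> f = ident C X" "f \<cdot> g = ident C Y"
  shows "iso_mor C f"
  using assms by (auto simp: iso_mor_def)

text \<open>Each kernel factors through the other, and the two factorizations are inverse because
  kernels are monic. In the opposite category this becomes the comparison of two cokernels from
  which \<open>\<theta>\<close> is obtained.\<close>

lemma kernel_iso:
  assumes "is_kernel C k f" "is_kernel C k' f"
  obtains a where "iso_mor C a" "a \<in> Hom C (dom C k) (dom C k')" "k' \<cdot> a = k"
proof -
  note k = is_kernelD[OF assms(1)] and k' = is_kernelD[OF assms(2)]
  obtain a where a: "a \<in> Ar C" "dom C a = dom C k" "cod C a = dom C k'" "k' \<cdot> a = k"
    using kernel_factor[OF assms(2), of k "dom C k"] k by auto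
  obtain b where b: "b \<in> Ar C" "dom C b = dom C k'" "cod C b = dom C k" "k \<cdot> b = k'"
    using kernel_factor[OF assms(1), of k' "dom C k'"] k' by auto
  have ba: "b \<cdot> a = ident C (dom C k)"
  proof (rule kernel_mono[OF assms(1)])
    show "k \<cdot> (b \<cdot> a) = k \<cdot> ident C (dom C k)"
      using cmp_reduce[OF b(4) b(1) k(1) b(3) a(1)] a b k(1) by simp
    show "b \<cdot> a \<in> Hom C (dom C k) (dom C k)" using a b by simp
  qed (use k in simp)
  have ab: "a \<cdot> b = ident C (dom C k')"
  proof (rule kernel_mono[OF assms(2)])
    show "k' \<cdot> (a \<cdot> b) = k' \<cdot> ident C (dom C k')"
      using cmp_reduce[OF a(4) a(1) k'(1) a(3) b(1)] a b k'(1) by simp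
    show "a \<cdot> b \<in> Hom C (dom C k') (dom C k')" using a b by simp
  qed (use k' in simp)
  have "a \<in> Hom C (dom C k) (dom C k')" "b \<in> Hom C (dom C k') (dom C k)" using a b by auto
  then show ?thesis using iso_morI[OF _ _ ba ab] that a(4) by blast
qed

text \<open>Any morphism into or out of \<open>Z\<close> equals its composite with the identity of
  \<open>Z\<close>, which is zero.\<close>

lemma zero_objectI:
  assumes "Z \<in> Ob C" "ident C Z = zero_mor C Z Z"
  shows "zero_object C Z"
  unfolding zero_object_def
proof (intro conjI ballI assms(1))
  fix X assume X: "X \<in> Ob C"
  show "\<exists>!f. f \<in> Hom C X Z"
  proof (intro ex1I[of _ "zero_mor C X Z"])
    fix f assume "f \<in> Hom C X Z"
    then have "ident C Z \<cdot> f = zero_mor C X Z" using assms by (auto simp: assms(2) simp del: ident_left)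
    with \<open>f \<in> Hom C X Z\<close> show "f = zero_mor C X Z" by auto
  qed (use X assms in auto)
  show "\<exists>!f. f \<in> Hom C Z X"
  proof (intro ex1I[of _ "zero_mor C Z X"])
    fix f assume "f \<in> Hom C Z X"
    then have "f \<cdot> ident C Z = zero_mor C Z X" using assms by (auto simp: assms(2) simp del: ident_right)
    with \<open>f \<in> Hom C Z X\<close> show "f = zero_mor C Z X" by auto
  qed (use X assms in auto)
qed

lemma zero_object_eq:
  assumes "zero_object C Z" "X \<in> Ob C"
  shows "f \<in> Hom C X Z \<Longrightarrow> f = zero_mor C X Z" "g \<in> Hom C Z X \<Longrightarrow> g = zero_mor C Z X"
  using assms unfolding zero_object_def by (metis Hom_iff cod_zero dom_zero zero_Ar)+

end

section \<open>Biproducts\<close>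

locale biprod = preadditive +
  fixes X Y B i1 i2 p1 p2
  assumes biproduct: "biproduct C X Y B i1 i2 p1 p2"
begin

lemma biprod_Hom [simp]:
  "i1 \<in> Ar C" "dom C i1 = X" "cod C i1 = B" "i2 \<in> Ar C" "dom C i2 = Y" "cod C i2 = B"
  "p1 \<in> Ar C" "dom C p1 = B" "cod C p1 = X" "p2 \<in> Ar C" "dom C p2 = B" "cod C p2 = Y"
  using biproduct by (auto simp: biproduct_def)

lemma biprod_Ob [simp]: "X \<in> Ob C" "Y \<in> Ob C" "B \<in> Ob C"
  using dom_Ob[of i1] dom_Ob[of i2] cod_Ob[of i1] by simp_all

lemma biprod_cmp [simp]: "p1 \<cdot> i1 = ident C X" "p2 \<cdot> i2 = ident C Y"
  "p2 \<cdot> i1 = zero_mor C X Y" "p1 \<cdot> i2 = zero_mor C Y X"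
  and biprod_sum: "add_mor C (i1 \<cdot> p1) (i2 \<cdot> p2) = ident C B"
  using biproduct by (auto simp: biproduct_def)

lemma biprod_cmp2 [simp]:
  "f \<in> Ar C \<Longrightarrow> cod C f = X \<Longrightarrow> p1 \<cdot> (i1 \<cdot> f) = f" "f \<in> Ar C \<Longrightarrow> cod C f = Y \<Longrightarrow> p2 \<cdot> (i2 \<cdot> f) = f"
  "f \<in> Ar C \<Longrightarrow> cod C f = X \<Longrightarrow> p2 \<cdot> (i1 \<cdot> f) = zero_mor C (dom C f) Y"
  "f \<in> Ar C \<Longrightarrow> cod C f = Y \<Longrightarrow> p1 \<cdot> (i2 \<cdot> f) = zero_mor C (dom C f) X"
  by (simp_all flip: cmp_assoc)

definition pair :: "'b \<Rightarrow> 'b \<Rightarrow> 'b" where "pair u v = add_mor C (i1 \<cdot> u) (i2 \<cdot> v)"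
definition copair :: "'b \<Rightarrow> 'b \<Rightarrow> 'b" where "copair u v = add_mor C (u \<cdot> p1) (v \<cdot> p2)"

lemma pair_Hom [simp]:
  assumes "u \<in> Ar C" "v \<in> Ar C" "cod C u = X" "cod C v = Y" "dom C u = dom C v"
  shows "pair u v \<in> Ar C" "dom C (pair u v) = dom C v" "cod C (pair u v) = B"
    "p1 \<cdot> pair u v = u" "p2 \<cdot> pair u v = v"
  using assms cmp_add[of "i1 \<cdot> u" "dom C v" B "i2 \<cdot> v"] by (auto simp: pair_def)

lemma copair_Hom [simp]:
  assumes "u \<in> Ar C" "v \<in> Ar C" "dom C u = X" "dom C v = Y" "cod C u = cod C v"
  shows "copair u v \<in> Ar C" "cod C (copair u v) = cod C v" "dom C (copair u v) = B"
    "copair u v \<cdot> i1 = u" "copair u v \<cdot> i2 = v"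
  using assms add_cmp[of _ _ B "u \<cdot> p1" "cod C v" "v \<cdot> p2"] by (auto simp: copair_def)

lemma copair_cmp:
  assumes "u \<in> Ar C" "v \<in> Ar C" "dom C u = X" "dom C v = Y" "cod C u = cod C v" "s \<in> Ar C" "cod C s = B"
  shows "copair u v \<cdot> s = add_mor C (u \<cdot> (p1 \<cdot> s)) (v \<cdot> (p2 \<cdot> s))"
  using assms add_cmp[of s _ B "u \<cdot> p1" "cod C v" "v \<cdot> p2"] by (auto simp: copair_def)

text \<open>The decomposition of the identity of \<open>B\<close> recovers a morphism into
  \<open>B\<close> from its two components.\<close>

lemma to_biprod_eqI:
  assumes "f \<in> Hom C T B" "g \<in> Hom C T B" "p1 \<cdot> f = p1 \<cdot> g" "p2 \<cdot> f = p2 \<cdot> g"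
  shows "f = g"
proof -
  have "h = pair (p1 \<cdot> h) (p2 \<cdot> h)" if "h \<in> Hom C T B" for h
    using that add_cmp[of h T B "i1 \<cdot> p1" B "i2 \<cdot> p2"] by (simp add: biprod_sum pair_def)
  then show ?thesis using assms by metis
qed

lemma pair_cmp:
  assumes "u \<in> Ar C" "v \<in> Ar C" "cod C u = X" "cod C v = Y" "dom C u = dom C v" "s \<in> Ar C" "cod C s = dom C v"
  shows "pair u v \<cdot> s = pair (u \<cdot> s) (v \<cdot> s)"
proof (rule to_biprod_eqI)
  show "p1 \<cdot> (pair u v \<cdot> s) = p1 \<cdot> pair (u \<cdot> s) (v \<cdot> s)"
    using assms cmp_reduce[OF pair_Hom(4)[OF assms(1-5)], of s] by simp
  show "p2 \<cdot> (pair u v \<cdot> s) = p2 \<cdot> pair (u \<cdot> s) (v \<cdot> s)"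
    using assms cmp_reduce[OF pair_Hom(5)[OF assms(1-5)], of s] by simp
qed (use assms in simp_all)

lemma from_biprod_eqI:
  assumes "f \<in> Hom C B T" "g \<in> Hom C B T" "f \<cdot> i1 = g \<cdot> i1" "f \<cdot> i2 = g \<cdot> i2"
  shows "f = g"
proof -
  have "h = copair (h \<cdot> i1) (h \<cdot> i2)" if "h \<in> Hom C B T" for h
    using that cmp_add[of "i1 \<cdot> p1" B B "i2 \<cdot> p2" h T] by (simp add: biprod_sum copair_def)
  then show ?thesis using assms by metis
qed

end

section \<open>The opposite category\<close>

text \<open>Hom groups are kept with source and target exchanged, hence the exchanged arguments of
  \<open>zero_mor\<close>. Through \<open>op_cat\<close> the results on deflations, kernels and left
  adjoints yield those on inflations, cokernels and right adjoints.\<close>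

definition op_cat :: "('o, 'm) excat \<Rightarrow> ('o, 'm) excat" where
  "op_cat E = E\<lparr>dom := cod E, cod := dom E, cmp := \<lambda>g f. f \<cdot>\<^bsub>E\<^esub> g,
     zero_mor := \<lambda>X Y. zero_mor E Y X, conflations := (conflations E)\<inverse>\<rparr>"

lemma op_cat_simps [simp]:
  "Ob (op_cat E) = Ob E" "Ar (op_cat E) = Ar E" "dom (op_cat E) = cod E" "cod (op_cat E) = dom E"
  "ident (op_cat E) = ident E" "g \<cdot>\<^bsub>op_cat E\<^esub> f = f \<cdot>\<^bsub>E\<^esub> g" "add_mor (op_cat E) = add_mor E"
  "zero_mor (op_cat E) X Y = zero_mor E Y X" "conflations (op_cat E) = (conflations E)\<inverse>"
  "op_cat (op_cat E) = E"
  by (simp_all add: op_cat_def)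

lemma Hom_op [simp]: "Hom (op_cat E) X Y = Hom E Y X"
  and Hom_group_op [simp]: "Hom_group (op_cat E) X Y = Hom_group E Y X"
  by (auto simp: Hom_def Hom_group_def)

lemma iso_mor_op [simp]: "iso_mor (op_cat E) f \<longleftrightarrow> iso_mor E f"
  by (auto simp: iso_mor_def)

lemma is_kernel_op [simp]: "is_kernel (op_cat E) k f \<longleftrightarrow> is_cokernel E k f"
  and is_cokernel_op [simp]: "is_cokernel (op_cat E) k f \<longleftrightarrow> is_kernel E k f"
  by (simp_all add: is_kernel_def is_cokernel_def)

text \<open>The two definitions list the legs of the square in mirrored positions. Duality therefore
  permutes the four arguments and exchanges the two equations under the unique existence.\<close>

lemma is_pullback_op [simp]: "is_pullback (op_cat E) f g f' g' \<longleftrightarrow> is_pushout E f' g' f g"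
proof
  assume *: "is_pushout E f' g' f g"
  show "is_pullback (op_cat E) f g f' g'"
    unfolding is_pullback_def op_cat_simps Hom_op
  proof (intro conjI allI impI)
    fix T u v assume "u \<in> Hom E (cod E g') T" "v \<in> Hom E (cod E f') T" "u \<cdot>\<^bsub>E\<^esub> g' = v \<cdot>\<^bsub>E\<^esub> f'"
    then have "\<exists>!h. h \<in> Hom E (cod E f) T \<and> h \<cdot>\<^bsub>E\<^esub> g = v \<and> h \<cdot>\<^bsub>E\<^esub> f = u"
      using *[unfolded is_pushout_def] by (metis (no_types, lifting))
    then show "\<exists>!h. h \<in> Hom E (cod E f) T \<and> h \<cdot>\<^bsub>E\<^esub> f = u \<and> h \<cdot>\<^bsub>E\<^esub> g = v"
      by blast
  qed (use * in \<open>auto simp: is_pushout_def Hom_def\<close>)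
next
  assume *: "is_pullback (op_cat E) f g f' g'"
  show "is_pushout E f' g' f g"
    unfolding is_pushout_def
  proof (intro conjI allI impI)
    fix T u v assume "u \<in> Hom E (cod E f') T" "v \<in> Hom E (cod E g') T" "u \<cdot>\<^bsub>E\<^esub> f' = v \<cdot>\<^bsub>E\<^esub> g'"
    then have "\<exists>!h. h \<in> Hom E (cod E f) T \<and> h \<cdot>\<^bsub>E\<^esub> f = v \<and> h \<cdot>\<^bsub>E\<^esub> g = u"
      using *[unfolded is_pullback_def op_cat_simps Hom_op] by (metis (no_types, lifting))
    then show "\<exists>!h. h \<in> Hom E (cod E f) T \<and> h \<cdot>\<^bsub>E\<^esub> g = u \<and> h \<cdot>\<^bsub>E\<^esub> f = v"
      by blast
  qed (use * in \<open>auto simp: is_pullback_def Hom_def\<close>)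
qed

lemma is_pushout_op [simp]: "is_pushout (op_cat E) f g f' g' \<longleftrightarrow> is_pullback E f' g' f g"
  using is_pullback_op[of "op_cat E" f' g' f g] by simp

lemma inflation_op [simp]: "inflation (op_cat E) f \<longleftrightarrow> deflation E f"
  and deflation_op [simp]: "deflation (op_cat E) f \<longleftrightarrow> inflation E f"
  by (simp_all add: inflation_def deflation_def)

lemma biproduct_op [simp]:
  "biproduct (op_cat E) X Y B i1 i2 p1 p2 \<longleftrightarrow> biproduct E X Y B p1 p2 i1 i2"
  by (auto simp: biproduct_def)

lemma zero_object_op [simp]: "zero_object (op_cat E) Z \<longleftrightarrow> zero_object E Z"
  by (auto simp: zero_object_def)

section \<open>Exact categories\<close>

locale exact = preadditive C for C :: "('o, 'm) excat" (structure) +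
  assumes exact: "exact_category C"
begin

lemma conflation_kernel: "(i, p) \<in> conflations C \<Longrightarrow> is_kernel C i p"
  and conflation_cokernel: "(i, p) \<in> conflations C \<Longrightarrow> is_cokernel C p i"
  using exact by (auto simp: exact_category_def)

lemma conflation_iso:
  assumes "(i, p) \<in> conflations C" "i' \<in> Ar C" "p' \<in> Ar C" "cod C i' = dom C p'"
    "a \<in> Hom C (dom C i) (dom C i')" "b \<in> Hom C (cod C i) (cod C i')" "c \<in> Hom C (cod C p) (cod C p')"
    "iso_mor C a" "iso_mor C b" "iso_mor C c" "b \<cdot> i = i' \<cdot> a" "c \<cdot> p = p' \<cdot> b"
  shows "(i', p') \<in> conflations C"
proof -
  note * = exact[unfolded exact_category_def, THEN conjunct2, THEN conjunct2, THEN conjunct1, rule_format]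
  show ?thesis by (rule *[OF assms])
qed

lemma ident_inflation: "X \<in> Ob C \<Longrightarrow> inflation C (ident C X)"
  and ident_deflation: "X \<in> Ob C \<Longrightarrow> deflation C (ident C X)"
  using exact unfolding exact_category_def by blast+

lemma cmp_inflation: "inflation C i \<Longrightarrow> inflation C j \<Longrightarrow> cod C i = dom C j \<Longrightarrow> inflation C (j \<cdot> i)"
  and cmp_deflation: "deflation C p \<Longrightarrow> deflation C q \<Longrightarrow> cod C p = dom C q \<Longrightarrow> deflation C (q \<cdot> p)"
  using exact unfolding exact_category_def by blast+

lemma obtain_pushout:
  assumes "inflation C i" "f \<in> Ar C" "dom C f = dom C i"
  obtains i' f' where "is_pushout C i f i' f'" "inflation C i'"
  using exact assms unfolding exact_category_def by blast

lemma obtain_pullback: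
  assumes "deflation C p" "f \<in> Ar C" "cod C f = cod C p"
  obtains p' f' where "is_pullback C p' f' p f" "deflation C p'"
  using exact assms unfolding exact_category_def by blast

lemma obtain_biproduct:
  assumes "X \<in> Ob C" "Y \<in> Ob C"
  obtains B i1 i2 p1 p2 where "biproduct C X Y B i1 i2 p1 p2"
proof -
  have "\<exists>B\<in>Ob C. \<exists>i1 i2 p1 p2. biproduct C X Y B i1 i2 p1 p2"
    using exact assms by (simp add: exact_category_def additive_category_def)
  then show thesis using that by blast
qed

lemma obtain_zero_object:
  obtains Z where "zero_object C Z"
proof -
  have "\<exists>Z. zero_object C Z"
    using exact by (simp add: exact_category_def additive_category_def)
  then show thesis using that by blast
qed

lemma conflation_Ar:
  assumes "(i, p) \<in> conflations C"
  shows "i \<in> Ar C" "p \<in> Ar C" "cod C i = dom C p" "p \<cdot> i = zero_mor C (dom C i) (cod C p)"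
  using is_kernelD[OF conflation_kernel[OF assms]] by auto

lemma inflation_Ar [simp]: "inflation C f \<Longrightarrow> f \<in> Ar C"
  and deflation_Ar [simp]: "deflation C f \<Longrightarrow> f \<in> Ar C"
  using conflation_Ar by (auto simp: inflation_def deflation_def)

lemma op_preadditive: "preadditive_category (op_cat C)"
  unfolding preadditive_category_def category_def
  by (auto simp: Hom_comm_group simp del: Hom_iff) (auto simp: Hom_comm_group cmp_add add_cmp)

end

lemma exact_category_preadditive: "exact_category E \<Longrightarrow> preadditive_category E"
  by (simp add: exact_category_def additive_category_def)

lemma exactI: "exact_category E \<Longrightarrow> exact E"
  by (simp add: exact_def preadditive_def exact_axioms_def exact_category_preadditive)

context exact
begin

lemma op_exact: "exact_category (op_cat C)"
  unfolding exact_category_def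
proof (intro conjI)
  show "additive_category (op_cat C)"
    unfolding additive_category_def
  proof (intro conjI ballI)
    show "\<exists>Z. zero_object (op_cat C) Z" using obtain_zero_object by auto
    fix X Y assume XY: "X \<in> Ob (op_cat C)" "Y \<in> Ob (op_cat C)"
    then have "X \<in> Ob C" "Y \<in> Ob C" by simp_all
    then obtain B i1 i2 p1 p2 where B: "biproduct C X Y B i1 i2 p1 p2"
      by (rule obtain_biproduct)
    then have "i1 \<in> Hom C X B" by (simp add: biproduct_def)
    with B show "\<exists>B\<in>Ob (op_cat C). \<exists>i1 i2 p1 p2. biproduct (op_cat C) X Y B i1 i2 p1 p2"
      by (intro bexI[of _ B]) auto
  qed (rule op_preadditive)
  show "\<forall>(i, p)\<in>conflations (op_cat C). is_kernel (op_cat C) i p \<and> is_cokernel (op_cat C) p i"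
    using conflation_kernel conflation_cokernel by auto
  show "\<forall>i p i' p' a b c. (i, p) \<in> conflations (op_cat C) \<longrightarrow> i' \<in> Ar (op_cat C) \<longrightarrow> p' \<in> Ar (op_cat C) \<longrightarrow>
     cod (op_cat C) i' = dom (op_cat C) p' \<longrightarrow> a \<in> Hom (op_cat C) (dom (op_cat C) i) (dom (op_cat C) i') \<longrightarrow>
     b \<in> Hom (op_cat C) (cod (op_cat C) i) (cod (op_cat C) i') \<longrightarrow>
     c \<in> Hom (op_cat C) (cod (op_cat C) p) (cod (op_cat C) p') \<longrightarrow>
     iso_mor (op_cat C) a \<longrightarrow> iso_mor (op_cat C) b \<longrightarrow> iso_mor (op_cat C) c \<longrightarrow>
     b \<cdot>\<^bsub>op_cat C\<^esub> i = i' \<cdot>\<^bsub>op_cat C\<^esub> a \<longrightarrow> c \<cdot>\<^bsub>op_cat C\<^esub> p = p' \<cdot>\<^bsub>op_cat C\<^esub> b \<longrightarrow>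
     (i', p') \<in> conflations (op_cat C)"
  proof (intro allI impI)
    fix i p i' p' a b c
    assume *: "(i, p) \<in> conflations (op_cat C)" "i' \<in> Ar (op_cat C)" "p' \<in> Ar (op_cat C)"
     "cod (op_cat C) i' = dom (op_cat C) p'" "a \<in> Hom (op_cat C) (dom (op_cat C) i) (dom (op_cat C) i')"
     "b \<in> Hom (op_cat C) (cod (op_cat C) i) (cod (op_cat C) i')"
     "c \<in> Hom (op_cat C) (cod (op_cat C) p) (cod (op_cat C) p')"
     "iso_mor (op_cat C) a" "iso_mor (op_cat C) b" "iso_mor (op_cat C) c"
     "b \<cdot>\<^bsub>op_cat C\<^esub> i = i' \<cdot>\<^bsub>op_cat C\<^esub> a" "c \<cdot>\<^bsub>op_cat C\<^esub> p = p' \<cdot>\<^bsub>op_cat C\<^esub> b"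
    \<comment> \<open>Read in \<open>C\<close>, the isomorphisms \<open>a\<close>, \<open>b\<close>,
      \<open>c\<close> go from the new sequence to the given conflation, opposite to what
      \<open>conflation_iso\<close> expects. Hence their inverses are used.\<close>
    have isos: "iso_mor C a" "iso_mor C b" "iso_mor C c" using * by simp_all
    obtain a1 where a1: "iso_mor C a1" "a1 \<in> Ar C" "dom C a1 = cod C a" "cod C a1 = dom C a"
      "a1 \<cdot> a = ident C (dom C a)" "a \<cdot> a1 = ident C (cod C a)"
      using iso_morE[of a thesis] isos by simp
    obtain b1 where b1: "iso_mor C b1" "b1 \<in> Ar C" "dom C b1 = cod C b" "cod C b1 = dom C b"
      "b1 \<cdot> b = ident C (dom C b)" "b \<cdot> b1 = ident C (cod C b)"
      using iso_morE[of b thesis] isos by simp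
    obtain c1 where c1: "iso_mor C c1" "c1 \<in> Ar C" "dom C c1 = cod C c" "cod C c1 = dom C c"
      "c1 \<cdot> c = ident C (dom C c)" "c \<cdot> c1 = ident C (cod C c)"
      using iso_morE[of c thesis] isos by simp
    have pi: "(p, i) \<in> conflations C" and ip: "i \<in> Ar C" "p \<in> Ar C" "cod C p = dom C i"
      using * conflation_Ar by auto
    have t: "i' \<in> Ar C" "p' \<in> Ar C" "cod C p' = dom C i'" "a \<in> Ar C" "dom C a = cod C i'" "cod C a = cod C i"
      "b \<in> Ar C" "dom C b = dom C i'" "cod C b = dom C i" "c \<in> Ar C" "dom C c = dom C p'" "cod C c = dom C p"
      "i \<cdot> b = a \<cdot> i'" "p \<cdot> c = b \<cdot> p'"
      using * by auto
    have "b1 \<cdot> p = b1 \<cdot> (p \<cdot> (c \<cdot> c1))"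
      using c1 t ip by simp
    also have "\<dots> = b1 \<cdot> (b \<cdot> (p' \<cdot> c1))"
      using cmp_reduce[OF t(14) _ _ _ c1(2)] t c1 b1 ip by simp
    also have "\<dots> = p' \<cdot> c1"
      using cmp_reduce[OF b1(5), of "p' \<cdot> c1"] t c1 b1 ip by simp
    finally have bp: "b1 \<cdot> p = p' \<cdot> c1" .
    have "a1 \<cdot> i = a1 \<cdot> (i \<cdot> (b \<cdot> b1))"
      using b1 t ip by simp
    also have "\<dots> = a1 \<cdot> (a \<cdot> (i' \<cdot> b1))"
      using cmp_reduce[OF t(13) _ _ _ b1(2)] t a1 b1 ip by simp
    also have "\<dots> = i' \<cdot> b1"
      using cmp_reduce[OF a1(5), of "i' \<cdot> b1"] t a1 b1 ip by simp
    finally have ai: "a1 \<cdot> i = i' \<cdot> b1" .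
    have "(p', i') \<in> conflations C"
      by (rule conflation_iso[OF pi, of p' i' c1 b1 a1]) (use t a1 b1 c1 ip bp ai in simp_all)
    then show "(i', p') \<in> conflations (op_cat C)" by simp
  qed
qed (auto intro: ident_inflation ident_deflation cmp_inflation cmp_deflation,
     (metis obtain_pullback obtain_pushout)+)

lemma op_exact_locale: "exact (op_cat C)"
  by (rule exactI[OF op_exact])

text \<open>Any kernel of \<open>p\<close> is isomorphic to the one in a conflation ending with
  \<open>p\<close>, and conflations are closed under isomorphism.\<close>

lemma deflation_kernel:
  assumes "deflation C p" "is_kernel C k p"
  shows "(k, p) \<in> conflations C"
proof -
  obtain i where i: "(i, p) \<in> conflations C" using assms by (auto simp: deflation_def)
  obtain a where a: "iso_mor C a" "a \<in> Hom C (dom C i) (dom C k)" "k \<cdot> a = i"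
    using kernel_iso[OF conflation_kernel[OF i] assms(2)] by blast
  show ?thesis
    by (rule conflation_iso[OF i, of k p a "ident C (dom C p)" "ident C (cod C p)"])
       (use a conflation_Ar(1-3)[OF i] is_kernelD(1-3)[OF assms(2)] in \<open>simp_all add: iso_mor_ident\<close>)
qed

lemma inflation_cokernel: "inflation C i \<Longrightarrow> is_cokernel C c i \<Longrightarrow> (i, c) \<in> conflations C"
  using exact.deflation_kernel[OF op_exact_locale, of i c] by simp

text \<open>Transporting the end of a conflation whose deflation is an identity along
  \<open>f\<close> replaces that identity by \<open>f\<close>.\<close>

lemma iso_deflation:
  assumes "iso_mor C f"
  shows "deflation C f"
proof -
  have f: "f \<in> Ar C" using assms by (rule iso_mor_Ar)
  obtain i where i: "(i, ident C (dom C f)) \<in> conflations C"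
    using ident_deflation[of "dom C f"] f by (auto simp: deflation_def)
  have "(i, f) \<in> conflations C"
    by (rule conflation_iso[OF i, of i f "ident C (dom C i)" "ident C (dom C f)" f])
       (use f assms conflation_Ar(1,3)[OF i] in \<open>simp_all add: iso_mor_ident\<close>)
  then show ?thesis by (auto simp: deflation_def)
qed

section \<open>Pullbacks and a criterion for deflations\<close>

lemma is_pullbackD:
  assumes "is_pullback C f g f' g'"
  shows "f \<in> Ar C" "g \<in> Ar C" "f' \<in> Ar C" "g' \<in> Ar C" "dom C g = dom C f" "cod C g = dom C f'"
    "dom C g' = cod C f" "cod C g' = cod C f'" "g' \<cdot> f = f' \<cdot> g"
  using assms by (auto simp: is_pullback_def)

lemma pullback_unique_factor:
  assumes "is_pullback C f g f' g'" "u \<in> Hom C T (dom C g')" "v \<in> Hom C T (dom C f')" "g' \<cdot> u = f' \<cdot> v"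
  shows "\<exists>!h. h \<in> Hom C T (dom C f) \<and> f \<cdot> h = u \<and> g \<cdot> h = v"
  using assms unfolding is_pullback_def by blast

lemma pullback_factor:
  assumes "is_pullback C f g f' g'" "u \<in> Hom C T (dom C g')" "v \<in> Hom C T (dom C f')" "g' \<cdot> u = f' \<cdot> v"
  obtains h where "h \<in> Ar C" "dom C h = T" "cod C h = dom C f" "f \<cdot> h = u" "g \<cdot> h = v"
proof -
  obtain h where "h \<in> Hom C T (dom C f)" "f \<cdot> h = u" "g \<cdot> h = v"
    using pullback_unique_factor[OF assms] by blast
  then show ?thesis using that[of h] by simp
qed

lemma pullback_eqI:
  assumes pb: "is_pullback C f g f' g'" and h: "h \<in> Hom C T (dom C f)" "h' \<in> Hom C T (dom C f)"
    and eq: "f \<cdot> h = f \<cdot> h'" "g \<cdot> h = g \<cdot> h'"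
  shows "h = h'"
proof -
  note t = is_pullbackD[OF pb]
  have "g' \<cdot> (f \<cdot> h) = f' \<cdot> (g \<cdot> h)"
    using cmp_reduce[OF t(9), of h] t h by simp
  then have "\<exists>!u. u \<in> Hom C T (dom C f) \<and> f \<cdot> u = f \<cdot> h \<and> g \<cdot> u = g \<cdot> h"
    using t h by (intro pullback_unique_factor[OF pb]) simp_all
  then show ?thesis using h eq by metis
qed

text \<open>The axiom provides one pullback that is a deflation. Two pullbacks of the same pair
  differ by an isomorphism, which is itself a deflation.\<close>

lemma pullback_deflation:
  assumes pb: "is_pullback C p' f' p f" and p: "deflation C p"
  shows "deflation C p'"
proof -
  note t = is_pullbackD[OF pb]
  obtain q g where pb2: "is_pullback C q g p f" and q: "deflation C q"
    using obtain_pullback[OF p, of f] t by auto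
  note t2 = is_pullbackD[OF pb2]
  obtain u where u: "u \<in> Ar C" "dom C u = dom C p'" "cod C u = dom C q" "q \<cdot> u = p'" "g \<cdot> u = f'"
    using pullback_factor[OF pb2, of p' "dom C p'" f'] t by auto
  obtain v where v: "v \<in> Ar C" "dom C v = dom C q" "cod C v = dom C p'" "p' \<cdot> v = q" "f' \<cdot> v = g"
    using pullback_factor[OF pb, of q "dom C q" g] t2 by auto
  have "u \<cdot> v = ident C (dom C q)"
  proof (rule pullback_eqI[OF pb2])
    show "q \<cdot> (u \<cdot> v) = q \<cdot> ident C (dom C q)"
      using cmp_reduce[OF u(4), of v] u v t2 by simp
    show "g \<cdot> (u \<cdot> v) = g \<cdot> ident C (dom C q)"
      using cmp_reduce[OF u(5), of v] u v t2 by simp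
  qed (use u v t2 in simp_all)
  moreover have "v \<cdot> u = ident C (dom C p')"
  proof (rule pullback_eqI[OF pb])
    show "p' \<cdot> (v \<cdot> u) = p' \<cdot> ident C (dom C p')"
      using cmp_reduce[OF v(4), of u] u v t by simp
    show "f' \<cdot> (v \<cdot> u) = f' \<cdot> ident C (dom C p')"
      using cmp_reduce[OF v(5), of u] u v t by simp
  qed (use u v t in simp_all)
  ultimately have "iso_mor C u"
    using u v by (intro iso_morI[of u "dom C p'" "dom C q" v]) simp_all
  then have "deflation C (q \<cdot> u)"
    using u q iso_deflation[of u] by (intro cmp_deflation) simp_all
  then show ?thesis using u by simp
qed

text \<open>A horseshoe-type criterion for the middle term of the conflation \<open>(k, r)\<close>:
  the component through \<open>p\<close> covers the kernel, and \<open>d\<close> covers the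
  quotient. It supplies the deflations in \<open>admissible_matrix\<close>,
  \<open>quot_N_Eff\<close> and \<open>ker_from_J_Eff\<close>.\<close>

lemma copair_deflation:
  assumes r: "deflation C r" and k: "is_kernel C k r" and p: "deflation C p" "cod C p = dom C k"
    and d: "d \<in> Hom C P (dom C r)" "deflation C (r \<cdot> d)"
    and B: "biproduct C (dom C p) P B i1 i2 p1 p2"
    and h: "h \<in> Hom C B (dom C r)" "h \<cdot> i1 = k \<cdot> p" "h \<cdot> i2 = d"
  shows "deflation C h"
proof -
  note kt = is_kernelD[OF k] and pt = deflation_Ar[OF p(1)]
  have dt: "d \<in> Ar C" "dom C d = P" "cod C d = dom C r" "P \<in> Ob C" using d(1) by auto
  have ht: "h \<in> Ar C" "dom C h = B" "cod C h = dom C r" using h by auto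
  interpret b: biprod C "dom C p" P B i1 i2 p1 p2
    by unfold_locales (rule B)
  obtain B' j1 j2 q1 q2 where B': "biproduct C (dom C k) P B' j1 j2 q1 q2"
    using obtain_biproduct[OF dom_Ob[OF kt(1)] dt(4)] by blast
  interpret b': biprod C "dom C k" P B' j1 j2 q1 q2
    by unfold_locales (rule B')
  txt \<open>If \<open>p\<close> is an identity, \<open>h\<close> is the pullback of \<open>r \<cdot> d\<close> along \<open>r\<close>.  The general case differs
    from it by \<open>p \<oplus> 1\<close>, a pullback of \<open>p\<close>.\<close>
  have pb1: "is_pullback C (b'.copair k d) q2 (r \<cdot> d) r"
    unfolding is_pullback_def
  proof (intro conjI allI impI)
    show "r \<cdot> b'.copair k d = (r \<cdot> d) \<cdot> q2"
      by (rule b'.from_biprod_eqI[of _ "cod C r"]) (use kt dt in simp_all)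
    fix T u v assume u: "u \<in> Hom C T (dom C r)" and v: "v \<in> Hom C T (dom C (r \<cdot> d))"
      and eq: "r \<cdot> u = (r \<cdot> d) \<cdot> v"
    have ut: "u \<in> Ar C" "dom C u = T" "cod C u = dom C r"
      and vt: "v \<in> Ar C" "dom C v = T" "cod C v = P" and T: "T \<in> Ob C"
      using u v kt dt by auto
    have dv: "d \<cdot> v \<in> Hom C T (dom C r)" using dt vt by simp
    have "r \<cdot> (u \<^bold>- d \<cdot> v) = zero_mor C T (cod C r)"
      using cmp_minus[OF u dv, of r "cod C r"] kt dt vt eq minus_self[of "r \<cdot> (d \<cdot> v)"] by simp
    \<comment> \<open>The defect between \<open>u\<close> and \<open>d \<cdot> v\<close> is killed
      by \<open>r\<close>; its lift \<open>s\<close> along \<open>k\<close> is the first component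
      of the mediating morphism.\<close>
    then obtain s where s: "s \<in> Ar C" "dom C s = T" "cod C s = dom C k" "k \<cdot> s = u \<^bold>- d \<cdot> v"
      using kernel_factor[OF k, of "u \<^bold>- d \<cdot> v" T] ut vt dt by auto
    show "\<exists>!h. h \<in> Hom C T (dom C (b'.copair k d)) \<and> b'.copair k d \<cdot> h = u \<and> q2 \<cdot> h = v"
    proof (rule ex1I[of _ "b'.pair s v"])
      have "b'.copair k d \<cdot> b'.pair s v = u"
        using minus_add_cancel[OF u dv] kt dt s vt by (subst b'.copair_cmp) simp_all
      then show "b'.pair s v \<in> Hom C T (dom C (b'.copair k d)) \<and> b'.copair k d \<cdot> b'.pair s v = u
          \<and> q2 \<cdot> b'.pair s v = v"
        using kt dt s vt by simp
    next
      fix h assume "h \<in> Hom C T (dom C (b'.copair k d)) \<and> b'.copair k d \<cdot> h = u \<and> q2 \<cdot> h = v"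
      then have h: "h \<in> Ar C" "dom C h = T" "cod C h = B'" "b'.copair k d \<cdot> h = u" "q2 \<cdot> h = v"
        using kt dt by auto
      have "add_mor C (k \<cdot> (q1 \<cdot> h)) (d \<cdot> v) = u"
        using h kt dt by (subst (asm) b'.copair_cmp) simp_all
      then have e: "k \<cdot> (q1 \<cdot> h) = k \<cdot> s"
        unfolding s(4) by (intro eq_minusI[OF u dv]) (use h kt in simp_all)
      have "q1 \<cdot> h = s"
        by (rule kernel_mono[OF k _ _ e]) (use h s in simp_all)
      with h s vt show "h = b'.pair s v"
        by (metis b'.to_biprod_eqI b'.pair_Hom Hom_iff)
    qed
  qed (use kt dt in simp_all)
  have pb2: "is_pullback C (b'.pair (p \<cdot> p1) p2) p1 p q1"
    unfolding is_pullback_def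
  proof (intro conjI allI impI)
    fix T u v assume u: "u \<in> Hom C T (dom C q1)" and v: "v \<in> Hom C T (dom C p)"
      and eq: "q1 \<cdot> u = p \<cdot> v"
    have ut: "u \<in> Ar C" "dom C u = T" "cod C u = B'"
      and vt: "v \<in> Ar C" "dom C v = T" "cod C v = dom C p" using u v by auto
    show "\<exists>!h. h \<in> Hom C T (dom C (b'.pair (p \<cdot> p1) p2)) \<and> b'.pair (p \<cdot> p1) p2 \<cdot> h = u \<and> p1 \<cdot> h = v"
    proof (rule ex1I[of _ "b.pair v (q2 \<cdot> u)"])
      have "b'.pair (p \<cdot> p1) p2 \<cdot> b.pair v (q2 \<cdot> u) = u"
      proof (rule b'.to_biprod_eqI[of _ T])
        show "q1 \<cdot> (b'.pair (p \<cdot> p1) p2 \<cdot> b.pair v (q2 \<cdot> u)) = q1 \<cdot> u"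
          using ut vt pt p eq by (subst cmp_assoc[symmetric]) simp_all
        show "q2 \<cdot> (b'.pair (p \<cdot> p1) p2 \<cdot> b.pair v (q2 \<cdot> u)) = q2 \<cdot> u"
          using ut vt pt p eq by (subst cmp_assoc[symmetric]) simp_all
      qed (use ut vt pt p in simp_all)
      then show "b.pair v (q2 \<cdot> u) \<in> Hom C T (dom C (b'.pair (p \<cdot> p1) p2)) \<and>
          b'.pair (p \<cdot> p1) p2 \<cdot> b.pair v (q2 \<cdot> u) = u \<and> p1 \<cdot> b.pair v (q2 \<cdot> u) = v"
        using ut vt pt p by simp
    next
      fix h assume "h \<in> Hom C T (dom C (b'.pair (p \<cdot> p1) p2)) \<and> b'.pair (p \<cdot> p1) p2 \<cdot> h = u \<and> p1 \<cdot> h = v"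
      then have h: "h \<in> Ar C" "dom C h = T" "cod C h = B" "b'.pair (p \<cdot> p1) p2 \<cdot> h = u" "p1 \<cdot> h = v"
        using pt p by auto
      have q: "q2 \<cdot> u = p2 \<cdot> h"
        unfolding h(4)[symmetric] using h pt p by (subst cmp_assoc[symmetric]) simp_all
      have e: "p2 \<cdot> h = p2 \<cdot> b.pair v (q2 \<cdot> u)" using vt ut q[symmetric] by simp
      show "h = b.pair v (q2 \<cdot> u)"
        by (rule b.to_biprod_eqI[OF _ _ _ e]) (use h vt ut in simp_all)
    qed
  qed (use pt p in simp_all)
  have "h = b'.copair k d \<cdot> b'.pair (p \<cdot> p1) p2"
  proof (rule b.from_biprod_eqI[of _ "dom C r"])
    show "h \<cdot> i1 = (b'.copair k d \<cdot> b'.pair (p \<cdot> p1) p2) \<cdot> i1"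
      using kt dt pt p h by (subst cmp_assoc) (simp_all add: b'.copair_cmp b'.pair_cmp)
    show "h \<cdot> i2 = (b'.copair k d \<cdot> b'.pair (p \<cdot> p1) p2) \<cdot> i2"
      using kt dt pt p h by (subst cmp_assoc) (simp_all add: b'.copair_cmp b'.pair_cmp)
  qed (use kt dt pt p h in simp_all)
  moreover have "deflation C (b'.copair k d \<cdot> b'.pair (p \<cdot> p1) p2)"
    using pullback_deflation[OF pb1 d(2)] pullback_deflation[OF pb2 p(1)] kt dt pt p
    by (intro cmp_deflation) simp_all
  ultimately show ?thesis by simp
qed

text \<open>The preceding criterion in the opposite category, where a biproduct exchanges its
  injections with its projections.\<close>

lemma pair_inflation:
  assumes "inflation C i" "is_cokernel C c i" "inflation C m" "dom C m = cod C c"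
    "e \<in> Hom C (cod C i) P" "inflation C (e \<cdot> i)"
    "biproduct C (cod C m) P B i1 i2 p1 p2" "h \<in> Hom C (cod C i) B" "p1 \<cdot> h = m \<cdot> c" "p2 \<cdot> h = e"
  shows "inflation C h"
  using exact.copair_deflation[OF op_exact_locale, of i c m e P B p1 p2 i1 i2 h] assms by simp

lemma biproduct_swap:
  assumes "biproduct C X Y B i1 i2 p1 p2"
  shows "biproduct C Y X B i2 i1 p2 p1"
  using assms add_commute[of "i1 \<cdot> p1" B B "i2 \<cdot> p2"] by (auto simp: biproduct_def)

lemma deflation_epi:
  assumes "deflation C p" "g \<in> Hom C (cod C p) X" "h \<in> Hom C (cod C p) X" "g \<cdot> p = h \<cdot> p"
  shows "g = h"
  using assms cokernel_epi conflation_cokernel by (metis deflation_def)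

section \<open>Admissible morphisms, their cokernels, and triangular matrices\<close>

lemma deflation_admissible:
  assumes "deflation C f"
  shows "admissible C f"
  unfolding admissible_def
  using assms ident_inflation[of "cod C f"]
  by (intro exI[of _ "ident C (cod C f)"] exI[of _ f]) auto

lemma inflation_admissible:
  assumes "inflation C f"
  shows "admissible C f"
  unfolding admissible_def
  using assms ident_deflation[of "dom C f"]
  by (intro exI[of _ f] exI[of _ "ident C (dom C f)"]) auto

lemma admissibleE:
  assumes "admissible C f"
  obtains m p where "inflation C m" "deflation C p" "m \<in> Ar C" "p \<in> Ar C" "cod C p = dom C m" "f = m \<cdot> p"
    "f \<in> Ar C" "dom C p = dom C f" "cod C m = cod C f"
proof -
  obtain m p where "inflation C m" "deflation C p" "cod C p = dom C m" "f = m \<cdot> p"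
    using assms unfolding admissible_def by blast
  then show ?thesis using that[of m p] by simp
qed

lemma admissible_Ar: "admissible C f \<Longrightarrow> f \<in> Ar C"
  by (elim admissibleE)

text \<open>A deflation is epi, so the morphisms annihilating \<open>m \<cdot> p\<close> are exactly
  those annihilating \<open>m\<close>.\<close>

lemma cokernel_cmp_deflation:
  assumes "deflation C p" "m \<in> Ar C" "cod C p = dom C m"
  shows "is_cokernel C c (m \<cdot> p) \<longleftrightarrow> is_cokernel C c m"
proof -
  have p: "p \<in> Ar C" using assms by simp
  have *: "g \<cdot> (m \<cdot> p) = zero_mor C (dom C p) (cod C g) \<longleftrightarrow> g \<cdot> m = zero_mor C (dom C m) (cod C g)"
    if g: "g \<in> Ar C" "dom C g = cod C m" for g
  proof
    assume "g \<cdot> (m \<cdot> p) = zero_mor C (dom C p) (cod C g)"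
    then have e: "(g \<cdot> m) \<cdot> p = zero_mor C (dom C m) (cod C g) \<cdot> p"
      using p assms g by simp
    show "g \<cdot> m = zero_mor C (dom C m) (cod C g)"
      by (rule deflation_epi[OF assms(1) _ _ e]) (use p assms g in simp_all)
  next
    assume "g \<cdot> m = zero_mor C (dom C m) (cod C g)"
    from cmp_reduce[OF this, of p] show "g \<cdot> (m \<cdot> p) = zero_mor C (dom C p) (cod C g)"
      using p assms g by simp
  qed
  show ?thesis
    unfolding is_cokernel_def using p assms * by (simp del: Hom_iff cong: conj_cong)
qed

lemma kernel_cmp_inflation:
  assumes "inflation C m" "p \<in> Ar C" "cod C p = dom C m"
  shows "is_kernel C k (m \<cdot> p) \<longleftrightarrow> is_kernel C k p"
  using exact.cokernel_cmp_deflation[OF op_exact_locale, of m p k] assms by simp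

lemma admissible_cokernel:
  assumes "admissible C f"
  obtains c where "is_cokernel C c f" "deflation C c"
proof -
  obtain m p where f: "inflation C m" "deflation C p" "m \<in> Ar C" "p \<in> Ar C" "cod C p = dom C m" "f = m \<cdot> p"
    using admissibleE[OF assms] by blast
  obtain c where c: "(m, c) \<in> conflations C" using f by (auto simp: inflation_def)
  then have "is_cokernel C c f" "deflation C c"
    using f cokernel_cmp_deflation[of p m c] conflation_cokernel by (auto simp: deflation_def)
  then show ?thesis by (rule that)
qed

text \<open>A cokernel of \<open>f\<close> is also one of the inflation in any factorization of
  \<open>f\<close>, so the prescribed \<open>c\<close> completes that inflation to a
  conflation.\<close>

lemma admissible_cokernelE:
  assumes "admissible C f" "is_cokernel C c f"
  obtains m p where "(m, c) \<in> conflations C" "deflation C p" "m \<in> Ar C" "p \<in> Ar C" "cod C p = dom C m" "f = m \<cdot> p"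
    "f \<in> Ar C" "dom C p = dom C f" "cod C m = cod C f"
proof -
  obtain m p where f: "inflation C m" "deflation C p" "m \<in> Ar C" "p \<in> Ar C" "cod C p = dom C m" "f = m \<cdot> p"
    "f \<in> Ar C" "dom C p = dom C f" "cod C m = cod C f"
    using admissibleE[OF assms(1)] by blast
  have "is_cokernel C c m" using f assms cokernel_cmp_deflation[of p m c] by simp
  then show ?thesis using that[of m p] f inflation_cokernel by blast
qed

text \<open>The image inflation \<open>m\<close> is a kernel of a zero morphism, so the identity
  factors through it and \<open>m\<close> is invertible.\<close>

lemma zero_cokernel_deflation:
  assumes "admissible C f" "is_cokernel C (zero_mor C (cod C f) Q) f" "Q \<in> Ob C"
  shows "deflation C f"
proof -
  obtain m p where f: "(m, zero_mor C (cod C f) Q) \<in> conflations C" "deflation C p" "m \<in> Ar C"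
    "p \<in> Ar C" "cod C p = dom C m" "f \<in> Ar C" "cod C m = cod C f" and fe: "f = m \<cdot> p"
    using admissible_cokernelE[OF assms(1,2)] by metis
  note k = conflation_kernel[OF f(1)]
  obtain u where u: "u \<in> Ar C" "dom C u = cod C f" "cod C u = dom C m" "m \<cdot> u = ident C (cod C f)"
    using kernel_factor[OF k, of "ident C (cod C f)" "cod C f"] f assms by auto
  have "u \<cdot> m = ident C (dom C m)"
  proof (rule kernel_mono[OF k])
    show "m \<cdot> (u \<cdot> m) = m \<cdot> ident C (dom C m)"
      using cmp_reduce[OF u(4), of m] u f by simp
  qed (use u f in simp_all)
  then have "iso_mor C m"
    using u f by (intro iso_morI[of m "dom C m" "cod C m" u]) simp_all
  then show ?thesis
    unfolding fe using f iso_deflation[of m] by (intro cmp_deflation)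
qed

text \<open>A cokernel of \<open>f\<close> annihilates the deflation \<open>f \<cdot> s\<close>,
  hence is zero. Admissibility of \<open>f\<close> is what lets this vanishing imply that
  \<open>f\<close> is a deflation, as idempotents need not split.\<close>

lemma admissible_deflationI:
  assumes f: "admissible C f" and s: "s \<in> Ar C" "cod C s = dom C f" "deflation C (f \<cdot> s)"
  shows "deflation C f"
proof -
  note ft = admissible_Ar[OF f]
  obtain c where c: "is_cokernel C c f" using admissible_cokernel[OF f] .
  note ct = is_cokernelD[OF c]
  have "c \<cdot> (f \<cdot> s) = zero_mor C (dom C s) (cod C c)"
    using cmp_reduce[OF ct(4), of s] ct s ft by simp
  then have e: "c \<cdot> (f \<cdot> s) = zero_mor C (cod C f) (cod C c) \<cdot> (f \<cdot> s)" using ct s ft by simp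
  have "c = zero_mor C (cod C f) (cod C c)"
    by (rule deflation_epi[OF s(3) _ _ e]) (use ct s ft in simp_all)
  then show ?thesis using zero_cokernel_deflation[OF f, of "cod C c"] c ct by simp
qed

text \<open>This conflation underlies the presentation of a representable functor by a zero
  morphism, with an identity as cokernel.\<close>

lemma zero_conflation:
  assumes "zero_object C Z" "X \<in> Ob C"
  shows "(zero_mor C Z X, ident C X) \<in> conflations C"
proof -
  have Z: "Z \<in> Ob C" using assms by (simp add: zero_object_def)
  have "is_kernel C (zero_mor C Z X) (ident C X)"
    unfolding is_kernel_def
  proof (intro conjI ballI impI)
    fix g assume g: "g \<in> Ar C" and g2: "cod C g = dom C (ident C X) \<and> ident C X \<cdot> g = zero_mor C (dom C g) (cod C (ident C X))"
    then have "g = zero_mor C (dom C g) X" using assms by auto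
    then show "\<exists>!h. h \<in> Hom C (dom C g) (dom C (zero_mor C Z X)) \<and> zero_mor C Z X \<cdot> h = g"
      using g assms Z zero_object_eq(1)[OF assms(1), of "dom C g"]
      by (intro ex1I[of _ "zero_mor C (dom C g) Z"]) (auto simp del: Hom_iff, auto)
  qed (use assms Z in simp_all)
  then show "(zero_mor C Z X, ident C X) \<in> conflations C"
    using ident_deflation assms by (intro deflation_kernel)
qed

text \<open>The matrix has rows \<open>(f, g)\<close> and \<open>(0, f')\<close>. The hypothesis
  \<open>lift\<close> is the compatibility of \<open>g\<close> with the kernel of \<open>f'\<close>;
  in \<open>Adm_ext\<close> it comes from the injectivity of the first map of an extension.\<close>

lemma admissible_matrix:
  assumes f: "admissible C f" "f \<in> Hom C X Y" and f': "admissible C f'" "f' \<in> Hom C X' Y'"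
    and g: "g \<in> Hom C X' Y"
    and lift: "\<And>T s. s \<in> Hom C T X' \<Longrightarrow> f' \<cdot> s = zero_mor C T Y' \<Longrightarrow> \<exists>t\<in>Hom C T X. f \<cdot> t = g \<cdot> s"
    and B: "biproduct C X X' B i1 i2 p1 p2"
    and B': "biproduct C Y Y' B' j1 j2 q1 q2"
  obtains M where "M \<in> Hom C B B'" "admissible C M"
    "q1 \<cdot> (M \<cdot> i1) = f" "q1 \<cdot> (M \<cdot> i2) = g" "q2 \<cdot> (M \<cdot> i1) = zero_mor C X Y'" "q2 \<cdot> (M \<cdot> i2) = f'"
proof -
  obtain c where c: "is_cokernel C c f" using admissible_cokernel[OF f(1)] .
  define Q where "Q = cod C c"
  obtain m p where mc: "(m, c) \<in> conflations C" and pd: "deflation C p" and fe: "f = m \<cdot> p"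
    and t: "m \<in> Ar C" "p \<in> Ar C" "cod C p = dom C m" "dom C p = dom C f" "cod C m = cod C f"
    using admissible_cokernelE[OF f(1) c] by metis
  define I where "I = dom C m"
  have ft: "f \<in> Ar C" "dom C f = X" "cod C f = Y" using f(2) by auto
  have mt: "m \<in> Ar C" "dom C m = I" "cod C m = Y" and pt: "p \<in> Ar C" "dom C p = X" "cod C p = I"
    using t ft by (simp_all add: I_def)
  have ct: "c \<in> Ar C" "dom C c = Y" "cod C c = Q" "c \<cdot> m = zero_mor C I Q"
    using conflation_Ar[OF mc] mt by (simp_all add: Q_def)
  obtain m' p' where m'i: "inflation C m'" and p'd: "deflation C p'" and fe': "f' = m' \<cdot> p'"
    and t': "m' \<in> Ar C" "p' \<in> Ar C" "cod C p' = dom C m'" "dom C p' = dom C f'" "cod C m' = cod C f'"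
    using admissibleE[OF f'(1)] by metis
  define I' where "I' = dom C m'"
  have ft': "f' \<in> Ar C" "dom C f' = X'" "cod C f' = Y'" using f'(2) by auto
  have mt': "m' \<in> Ar C" "dom C m' = I'" "cod C m' = Y'" and pt': "p' \<in> Ar C" "dom C p' = X'" "cod C p' = I'"
    using t' ft' by (simp_all add: I'_def)
  obtain k' where k': "(k', p') \<in> conflations C" using p'd by (auto simp: deflation_def)
  define K' where "K' = dom C k'"
  have kt': "k' \<in> Ar C" "dom C k' = K'" "cod C k' = X'" "p' \<cdot> k' = zero_mor C K' I'"
    using conflation_Ar[OF k'] pt' by (simp_all add: K'_def)
  have gt: "g \<in> Ar C" "dom C g = X'" "cod C g = Y" using g by auto
  have Ob: "X \<in> Ob C" "Y \<in> Ob C" "X' \<in> Ob C" "Y' \<in> Ob C" "I \<in> Ob C" "I' \<in> Ob C" "K' \<in> Ob C" "Q \<in> Ob C"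
    using dom_Ob[OF ft(1)] cod_Ob[OF ft(1)] dom_Ob[OF ft'(1)] cod_Ob[OF ft'(1)] dom_Ob[OF mt(1)]
      dom_Ob[OF mt'(1)] dom_Ob[OF kt'(1)] cod_Ob[OF ct(1)] ft ft' mt mt' kt' ct by simp_all
  interpret b: biprod C X X' B i1 i2 p1 p2
    by unfold_locales (rule B)
  interpret b': biprod C Y Y' B' j1 j2 q1 q2
    by unfold_locales (rule B')
  txt \<open>Since \<open>c \<cdot> g\<close> vanishes on the kernel of \<open>f'\<close>, it equals \<open>h \<cdot> p'\<close> for some \<open>h\<close>.  With \<open>W\<close> the
    pullback of \<open>c\<close> along \<open>h\<close>, an extension of the two images, the matrix factors as
    \<open>X \<oplus> X' \<rightarrow> W \<rightarrow> Y \<oplus> Y'\<close>.\<close>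
  have "f' \<cdot> k' = zero_mor C K' Y'"
    unfolding fe' using pt' kt' mt' Ob by simp
  then obtain t where t: "t \<in> Ar C" "dom C t = K'" "cod C t = X" "f \<cdot> t = g \<cdot> k'"
    using lift[of k' K'] kt' by auto
  have "c \<cdot> (f \<cdot> t) = zero_mor C K' Q"
    unfolding fe using cmp_reduce[OF ct(4), of "p \<cdot> t"] ct mt pt t Ob by simp
  then have "(c \<cdot> g) \<cdot> k' = zero_mor C K' Q"
    using t gt ct kt' by simp
  then obtain h where h: "h \<in> Ar C" "dom C h = I'" "cod C h = Q" "h \<cdot> p' = c \<cdot> g"
    using cokernel_factor[OF conflation_cokernel[OF k'], of "c \<cdot> g" Q] gt ct kt' pt' by auto
  have dc: "deflation C c" using mc by (auto simp: deflation_def)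
  obtain w' w where pb: "is_pullback C w' w c h" and w': "deflation C w'"
    using obtain_pullback[OF dc, of h] h ct by auto
  define W where "W = dom C w'"
  have wt: "w' \<in> Ar C" "w \<in> Ar C" "dom C w' = W" "dom C w = W" "cod C w' = I'" "cod C w = Y"
    "h \<cdot> w' = c \<cdot> w" and W: "W \<in> Ob C"
    using is_pullbackD[OF pb] dom_Ob[of w'] h ct by (simp_all add: W_def)
  have inj: "s = s'" if "s \<in> Hom C T W" "s' \<in> Hom C T W" "w' \<cdot> s = w' \<cdot> s'" "w \<cdot> s = w \<cdot> s'" for s s' T
    using pullback_eqI[OF pb, of s T s'] that by (simp add: W_def)
  have fac: "\<exists>u. u \<in> Ar C \<and> dom C u = T \<and> cod C u = W \<and> w' \<cdot> u = a \<and> w \<cdot> u = b"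
    if "a \<in> Ar C" "b \<in> Ar C" "dom C a = T" "dom C b = T" "cod C a = I'" "cod C b = Y" "h \<cdot> a = c \<cdot> b" for a b T
    using pullback_factor[OF pb, of a T b] that h ct by (simp add: W_def) metis
  \<comment> \<open>The kernel of \<open>w'\<close> has to be a copy of the image \<open>I\<close>
    of \<open>f\<close>: it has coordinates \<open>(0, m)\<close> in the pullback, and makes
    \<open>W\<close> an extension of \<open>I'\<close> by \<open>I\<close>.\<close>
  obtain i where i: "i \<in> Ar C" "dom C i = I" "cod C i = W" "w' \<cdot> i = zero_mor C I I'" "w \<cdot> i = m"
    using fac[of "zero_mor C I I'" m I] h ct mt Ob by auto
  have ki: "is_kernel C i w'"
    unfolding is_kernel_def
  proof (intro conjI ballI impI)
    fix s assume s: "s \<in> Ar C" and s2: "cod C s = dom C w' \<and> w' \<cdot> s = zero_mor C (dom C s) (cod C w')"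
    define T where "T = dom C s"
    have st: "s \<in> Ar C" "dom C s = T" "cod C s = W" "w' \<cdot> s = zero_mor C T I'" "T \<in> Ob C"
      using s s2 wt by (simp_all add: T_def)
    have "c \<cdot> (w \<cdot> s) = zero_mor C T Q"
      using cmp_reduce[OF wt(7)[symmetric], of s] st wt(1-6) h ct by simp
    then obtain s' where s': "s' \<in> Ar C" "dom C s' = T" "cod C s' = I" "m \<cdot> s' = w \<cdot> s"
      using kernel_factor[OF conflation_kernel[OF mc], of "w \<cdot> s" T] st wt ct mt by auto
    have "i \<cdot> s' = s"
    proof (rule inj)
      show "w' \<cdot> (i \<cdot> s') = w' \<cdot> s" using cmp_reduce[OF i(4), of s'] i s' st wt Ob by simp
      show "w \<cdot> (i \<cdot> s') = w \<cdot> s" using cmp_reduce[OF i(5), of s'] i s' st wt by simp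
      show "i \<cdot> s' \<in> Hom C T W" "s \<in> Hom C T W" using st s' i by simp_all
    qed
    moreover have "h = s'" if h: "h \<in> Hom C T I" "i \<cdot> h = s" for h
    proof -
      have e: "m \<cdot> h = m \<cdot> s'" using cmp_reduce[OF i(5), of h] h s' i wt by simp
      show "h = s'"
        by (rule kernel_mono[OF conflation_kernel[OF mc] _ _ e]) (use h s' mt in simp_all)
    qed
    moreover have "s' \<in> Hom C T I" using s' by simp
    ultimately show "\<exists>!h. h \<in> Hom C (dom C s) (dom C i) \<and> i \<cdot> h = s"
      unfolding st(2) i(2) by blast
  qed (use i wt in simp_all)
  have iw: "(i, w') \<in> conflations C" by (rule deflation_kernel[OF w' ki])
  \<comment> \<open>\<open>p'\<close> and \<open>g\<close> agree over \<open>Q\<close> by the choice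
    of \<open>h\<close>. Together they give the component of the deflation part on
    \<open>X'\<close>.\<close>
  obtain b where b: "b \<in> Ar C" "dom C b = X'" "cod C b = W" "w' \<cdot> b = p'" "w \<cdot> b = g"
    using fac[of p' g X'] h gt pt' by auto
  define a where "a = b.copair (i \<cdot> p) b"
  have at: "a \<in> Ar C" "dom C a = B" "cod C a = W" "a \<cdot> i1 = i \<cdot> p" "a \<cdot> i2 = b"
    using i pt b by (simp_all add: a_def)
  have B2: "biproduct C (dom C p) X' B i1 i2 p1 p2" using B pt by simp
  have ad: "deflation C a"
    by (rule copair_deflation[OF w' ki pd _ _ _ B2, of b])
       (use at b pt i wt p'd in simp_all)
  \<comment> \<open>The inflation part has components \<open>w\<close> and
    \<open>m' \<cdot> w'\<close>. The dual criterion applies to the conflation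
    \<open>(i, w')\<close>, with \<open>w \<cdot> i = m\<close> as the composite that must be an
    inflation.\<close>
  define n where "n = b'.pair w (m' \<cdot> w')"
  have nt: "n \<in> Ar C" "dom C n = W" "cod C n = B'" "q1 \<cdot> n = w" "q2 \<cdot> n = m' \<cdot> w'"
    using wt mt' by (simp_all add: n_def)
  have B2': "biproduct C (cod C m') Y B' j2 j1 q2 q1" using biproduct_swap[OF B'] mt' by simp
  have "inflation C i" "inflation C m" using iw mc by (auto simp: inflation_def)
  then have ninf: "inflation C n"
    by (intro pair_inflation[OF _ conflation_cokernel[OF iw] m'i _ _ _ B2', of w n])
       (use nt wt mt' i in simp_all)
  show ?thesis
  proof (rule that[of "n \<cdot> a"])
    show "admissible C (n \<cdot> a)" unfolding admissible_def using ninf ad nt at by metis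
    show "q1 \<cdot> ((n \<cdot> a) \<cdot> i1) = f" unfolding fe
      using cmp_reduce[OF nt(4), of "a \<cdot> i1"] cmp_reduce[OF i(5), of p] nt at i pt wt by simp
    show "q2 \<cdot> ((n \<cdot> a) \<cdot> i1) = zero_mor C X Y'"
      using cmp_reduce[OF nt(5), of "a \<cdot> i1"] cmp_reduce[OF i(4), of p] nt at i pt wt mt' Ob by simp
    show "q1 \<cdot> ((n \<cdot> a) \<cdot> i2) = g"
      using cmp_reduce[OF nt(4), of "a \<cdot> i2"] nt at b wt by simp
    show "q2 \<cdot> ((n \<cdot> a) \<cdot> i2) = f'" unfolding fe'
      using cmp_reduce[OF nt(5), of "a \<cdot> i2"] nt at b wt mt' by simp
    show "n \<cdot> a \<in> Hom C B B'" using nt at by simp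
  qed
qed

end

section \<open>Elements of presheaves and of their morphisms\<close>

abbreviation el :: "('o, 'm, 'u) presheaf \<Rightarrow> 'o \<Rightarrow> 'u set" where
  "el F Z \<equiv> carrier (grp F Z)"

definition app :: "('o, 'm, 'u) presheaf_mor \<Rightarrow> 'o \<Rightarrow> 'u \<Rightarrow> 'u" where
  "app \<alpha> = fst (snd \<alpha>)"

lemma ModC_simps [simp]:
  "Ob (ModC E) = {F. is_presheaf E F}" "Ar (ModC E) = presheaf_mors E"
  "dom (ModC E) = fst" "cod (ModC E) = (\<lambda>\<alpha>. snd (snd \<alpha>))"
  by (auto simp: ModC_def)

context preadditive
begin

abbreviation pcmp :: "('o, 'm, 'u) presheaf_mor \<Rightarrow> ('o, 'm, 'u) presheaf_mor \<Rightarrow> ('o, 'm, 'u) presheaf_mor"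
    (infixr "\<bullet>" 75) where
  "\<beta> \<bullet> \<alpha> \<equiv> \<beta> \<cdot>\<^bsub>ModC C\<^esub> \<alpha>"

text \<open>The family \<open>\<phi>\<close> may be arbitrary outside the carriers; restricting it
  makes the components extensional, as \<open>nat_transf\<close> demands.\<close>

definition mor :: "('o, 'm, 'u) presheaf \<Rightarrow> ('o, 'm, 'u) presheaf \<Rightarrow> ('o \<Rightarrow> 'u \<Rightarrow> 'u) \<Rightarrow> ('o, 'm, 'u) presheaf_mor"
  where "mor F G \<phi> = (F, (\<lambda>X\<in>Ob C. \<lambda>x\<in>el F X. \<phi> X x), G)"

lemma presheaf_comm_group: "is_presheaf C F \<Longrightarrow> Z \<in> Ob C \<Longrightarrow> comm_group (grp F Z)"
  by (simp add: is_presheaf_def)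

lemma presheaf_group: "is_presheaf C F \<Longrightarrow> Z \<in> Ob C \<Longrightarrow> group (grp F Z)"
  using presheaf_comm_group comm_group.axioms(2) by blast

lemma el_group [simp]:
  assumes "is_presheaf C F" "Z \<in> Ob C"
  shows el_one: "\<one>\<^bsub>grp F Z\<^esub> \<in> el F Z"
    and el_mult: "x \<in> el F Z \<Longrightarrow> y \<in> el F Z \<Longrightarrow> x \<otimes>\<^bsub>grp F Z\<^esub> y \<in> el F Z"
    and el_inv: "x \<in> el F Z \<Longrightarrow> inv\<^bsub>grp F Z\<^esub> x \<in> el F Z"
    and el_l_one: "x \<in> el F Z \<Longrightarrow> \<one>\<^bsub>grp F Z\<^esub> \<otimes>\<^bsub>grp F Z\<^esub> x = x"
    and el_r_one: "x \<in> el F Z \<Longrightarrow> x \<otimes>\<^bsub>grp F Z\<^esub> \<one>\<^bsub>grp F Z\<^esub> = x"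
    and el_l_inv: "x \<in> el F Z \<Longrightarrow> inv\<^bsub>grp F Z\<^esub> x \<otimes>\<^bsub>grp F Z\<^esub> x = \<one>\<^bsub>grp F Z\<^esub>"
    and el_r_inv: "x \<in> el F Z \<Longrightarrow> x \<otimes>\<^bsub>grp F Z\<^esub> inv\<^bsub>grp F Z\<^esub> x = \<one>\<^bsub>grp F Z\<^esub>"
    and el_inv_one: "inv\<^bsub>grp F Z\<^esub> \<one>\<^bsub>grp F Z\<^esub> = \<one>\<^bsub>grp F Z\<^esub>"
proof -
  interpret group "grp F Z" by (rule presheaf_group[OF assms])
  show "\<one>\<^bsub>grp F Z\<^esub> \<in> el F Z"
    "x \<in> el F Z \<Longrightarrow> y \<in> el F Z \<Longrightarrow> x \<otimes>\<^bsub>grp F Z\<^esub> y \<in> el F Z"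
    "x \<in> el F Z \<Longrightarrow> inv\<^bsub>grp F Z\<^esub> x \<in> el F Z"
    "x \<in> el F Z \<Longrightarrow> \<one>\<^bsub>grp F Z\<^esub> \<otimes>\<^bsub>grp F Z\<^esub> x = x"
    "x \<in> el F Z \<Longrightarrow> x \<otimes>\<^bsub>grp F Z\<^esub> \<one>\<^bsub>grp F Z\<^esub> = x"
    "x \<in> el F Z \<Longrightarrow> inv\<^bsub>grp F Z\<^esub> x \<otimes>\<^bsub>grp F Z\<^esub> x = \<one>\<^bsub>grp F Z\<^esub>"
    "x \<in> el F Z \<Longrightarrow> x \<otimes>\<^bsub>grp F Z\<^esub> inv\<^bsub>grp F Z\<^esub> x = \<one>\<^bsub>grp F Z\<^esub>"
    "inv\<^bsub>grp F Z\<^esub> \<one>\<^bsub>grp F Z\<^esub> = \<one>\<^bsub>grp F Z\<^esub>"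
    by simp_all
qed

lemma el_assoc:
  assumes "is_presheaf C F" "Z \<in> Ob C" "x \<in> el F Z" "y \<in> el F Z" "z \<in> el F Z"
  shows "(x \<otimes>\<^bsub>grp F Z\<^esub> y) \<otimes>\<^bsub>grp F Z\<^esub> z = x \<otimes>\<^bsub>grp F Z\<^esub> (y \<otimes>\<^bsub>grp F Z\<^esub> z)"
  using assms presheaf_group[OF assms(1,2)] by (intro monoid.m_assoc[OF group.is_monoid])

lemma el_commute:
  assumes "is_presheaf C F" "Z \<in> Ob C" "x \<in> el F Z" "y \<in> el F Z"
  shows "x \<otimes>\<^bsub>grp F Z\<^esub> y = y \<otimes>\<^bsub>grp F Z\<^esub> x"
  using assms presheaf_comm_group[OF assms(1,2)] by (intro comm_monoid.m_comm[OF comm_group.axioms(1)])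

lemma el_inv_mult:
  assumes "is_presheaf C F" "Z \<in> Ob C" "x \<in> el F Z" "y \<in> el F Z"
  shows "inv\<^bsub>grp F Z\<^esub> (x \<otimes>\<^bsub>grp F Z\<^esub> y) = inv\<^bsub>grp F Z\<^esub> x \<otimes>\<^bsub>grp F Z\<^esub> inv\<^bsub>grp F Z\<^esub> y"
  using assms presheaf_comm_group[OF assms(1,2)] by (intro comm_group.inv_mult)

lemma el_diff_one:
  assumes "is_presheaf C F" "Z \<in> Ob C" "x \<in> el F Z" "y \<in> el F Z"
  shows "x \<otimes>\<^bsub>grp F Z\<^esub> inv\<^bsub>grp F Z\<^esub> y = \<one>\<^bsub>grp F Z\<^esub> \<longleftrightarrow> x = y"
proof -
  interpret group "grp F Z" by (rule presheaf_group[OF assms(1,2)])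
  show ?thesis using assms(3,4) by (metis inv_closed inv_equality inv_inv r_inv)
qed

lemma el_diff_mult:
  assumes "is_presheaf C F" "Z \<in> Ob C" "x \<in> el F Z" "y \<in> el F Z"
  shows "(x \<otimes>\<^bsub>grp F Z\<^esub> inv\<^bsub>grp F Z\<^esub> y) \<otimes>\<^bsub>grp F Z\<^esub> y = x"
  using assms by (simp add: el_assoc)

lemma res_hom: "is_presheaf C F \<Longrightarrow> f \<in> Ar C \<Longrightarrow> res F f \<in> hom (grp F (cod C f)) (grp F (dom C f))"
  by (simp add: is_presheaf_def)

lemma res_el [simp]: "is_presheaf C F \<Longrightarrow> f \<in> Ar C \<Longrightarrow> dom C f = X \<Longrightarrow> x \<in> el F (cod C f) \<Longrightarrow> res F f x \<in> el F X"
  using res_hom[of F f] by (auto simp: hom_def)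

lemma res_ident [simp]: "is_presheaf C F \<Longrightarrow> X \<in> Ob C \<Longrightarrow> x \<in> el F X \<Longrightarrow> res F (ident C X) x = x"
  by (simp add: is_presheaf_def)

lemma res_cmp [simp]:
  "is_presheaf C F \<Longrightarrow> f \<in> Ar C \<Longrightarrow> g \<in> Ar C \<Longrightarrow> cod C f = dom C g \<Longrightarrow> x \<in> el F (cod C g) \<Longrightarrow>
    res F (g \<cdot> f) x = res F f (res F g x)"
  unfolding is_presheaf_def by simp

lemma res_mult [simp]:
  "is_presheaf C F \<Longrightarrow> f \<in> Ar C \<Longrightarrow> cod C f = Y \<Longrightarrow> x \<in> el F Y \<Longrightarrow> y \<in> el F Y \<Longrightarrow>
    res F f (x \<otimes>\<^bsub>grp F Y\<^esub> y) = res F f x \<otimes>\<^bsub>grp F (dom C f)\<^esub> res F f y"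
  using res_hom[of F f] by (auto simp: hom_def)

lemma res_group_hom:
  "is_presheaf C F \<Longrightarrow> f \<in> Ar C \<Longrightarrow> group_hom (grp F (cod C f)) (grp F (dom C f)) (res F f)"
  by (intro group_hom.intro group_hom_axioms.intro presheaf_group res_hom) simp_all

lemma res_one [simp]:
  "is_presheaf C F \<Longrightarrow> f \<in> Ar C \<Longrightarrow> cod C f = Y \<Longrightarrow> res F f \<one>\<^bsub>grp F Y\<^esub> = \<one>\<^bsub>grp F (dom C f)\<^esub>"
  using group_hom.hom_one[OF res_group_hom] by blast

lemma res_inv [simp]:
  "is_presheaf C F \<Longrightarrow> f \<in> Ar C \<Longrightarrow> cod C f = Y \<Longrightarrow> x \<in> el F Y \<Longrightarrow>
    res F f (inv\<^bsub>grp F Y\<^esub> x) = inv\<^bsub>grp F (dom C f)\<^esub> res F f x"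
  using group_hom.hom_inv[OF res_group_hom[of F f], of x] by simp

lemma res_add:
  "is_presheaf C F \<Longrightarrow> f \<in> Hom C X Y \<Longrightarrow> g \<in> Hom C X Y \<Longrightarrow> x \<in> el F Y \<Longrightarrow>
    res F (add_mor C f g) x = res F f x \<otimes>\<^bsub>grp F X\<^esub> res F g x"
  unfolding is_presheaf_def by metis

lemma res_minus:
  assumes F: "is_presheaf C F" and fg: "f \<in> Hom C X Y" "g \<in> Hom C X Y" and x: "x \<in> el F Y"
  shows "res F (f \<^bold>- g) x = res F f x \<otimes>\<^bsub>grp F X\<^esub> inv\<^bsub>grp F X\<^esub> res F g x"
proof -
  have X: "X \<in> Ob C" using fg by auto
  interpret group "grp F X" by (rule presheaf_group[OF F X])
  have d: "f \<^bold>- g \<in> Hom C X Y" using fg by simp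
  have "res F (f \<^bold>- g) x \<otimes>\<^bsub>grp F X\<^esub> res F g x = res F f x"
    using res_add[OF F d fg(2) x] minus_add_cancel[OF fg] by simp
  then have "res F f x \<otimes>\<^bsub>grp F X\<^esub> inv\<^bsub>grp F X\<^esub> res F g x =
      (res F (f \<^bold>- g) x \<otimes>\<^bsub>grp F X\<^esub> res F g x) \<otimes>\<^bsub>grp F X\<^esub> inv\<^bsub>grp F X\<^esub> res F g x" by simp
  also have "\<dots> = res F (f \<^bold>- g) x"
    by (subst m_assoc) (use F d fg x in simp_all)
  finally show ?thesis by simp
qed

lemma res_zero [simp]:
  assumes "is_presheaf C F" "X \<in> Ob C" "Y \<in> Ob C" "x \<in> el F Y"
  shows "res F (zero_mor C X Y) x = \<one>\<^bsub>grp F X\<^esub>"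
proof -
  have z: "zero_mor C X Y \<in> Hom C X Y" using assms by simp
  show ?thesis using res_minus[OF assms(1) z z assms(4)] assms by (simp add: minus_self)
qed

section \<open>Morphisms of presheaves and the preadditive structure of \<open>ModC\<close>\<close>

lemma ModC_Hom_iff:
  "\<alpha> \<in> Hom (ModC C) F G \<longleftrightarrow> is_presheaf C F \<and> is_presheaf C G \<and> fst \<alpha> = F \<and> snd (snd \<alpha>) = G \<and> app \<alpha> \<in> nat_transf C F G"
  by (auto simp: Hom_def presheaf_mors_def app_def)

lemma app_mor [simp]: "Z \<in> Ob C \<Longrightarrow> x \<in> el F Z \<Longrightarrow> app (mor F G \<phi>) Z x = \<phi> Z x"
  by (simp add: app_def mor_def)

lemma mor_Hom:
  assumes F: "is_presheaf C F" "is_presheaf C G"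
    and el: "\<And>Z x. Z \<in> Ob C \<Longrightarrow> x \<in> el F Z \<Longrightarrow> \<phi> Z x \<in> el G Z"
    and mult: "\<And>Z x y. Z \<in> Ob C \<Longrightarrow> x \<in> el F Z \<Longrightarrow> y \<in> el F Z \<Longrightarrow>
      \<phi> Z (x \<otimes>\<^bsub>grp F Z\<^esub> y) = \<phi> Z x \<otimes>\<^bsub>grp G Z\<^esub> \<phi> Z y"
    and nat: "\<And>f x. f \<in> Ar C \<Longrightarrow> x \<in> el F (cod C f) \<Longrightarrow> \<phi> (dom C f) (res F f x) = res G f (\<phi> (cod C f) x)"
  shows "mor F G \<phi> \<in> Hom (ModC C) F G"
  unfolding ModC_Hom_iff nat_transf_def
proof (intro conjI CollectI PiE_I allI impI ballI)
  show "app (mor F G \<phi>) X \<in> hom (grp F X) (grp G X) \<inter> extensional (el F X)" if "X \<in> Ob C" for X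
    using that F el mult by (auto simp: app_def mor_def hom_def)
  show "app (mor F G \<phi>) X (res F f x) = res G f (app (mor F G \<phi>) Y x)"
    if "f \<in> Hom C X Y" "x \<in> el F Y" for f X Y x
    using that F nat[of f x] by auto
qed (use F in \<open>auto simp: app_def mor_def\<close>)

lemma app_hom: "\<alpha> \<in> Hom (ModC C) F G \<Longrightarrow> Z \<in> Ob C \<Longrightarrow> app \<alpha> Z \<in> hom (grp F Z) (grp G Z)"
  unfolding ModC_Hom_iff nat_transf_def by (blast dest: PiE_mem)

lemma app_el [simp]:
  "\<alpha> \<in> Hom (ModC C) F G \<Longrightarrow> Z \<in> Ob C \<Longrightarrow> x \<in> el F Z \<Longrightarrow> app \<alpha> Z x \<in> el G Z"
  and app_mult [simp]:
  "\<alpha> \<in> Hom (ModC C) F G \<Longrightarrow> Z \<in> Ob C \<Longrightarrow> x \<in> el F Z \<Longrightarrow> y \<in> el F Z \<Longrightarrow>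
    app \<alpha> Z (x \<otimes>\<^bsub>grp F Z\<^esub> y) = app \<alpha> Z x \<otimes>\<^bsub>grp G Z\<^esub> app \<alpha> Z y"
  using app_hom[of \<alpha> F G Z] by (auto simp: hom_def)

lemma app_res [simp]:
  assumes "\<alpha> \<in> Hom (ModC C) F G" "f \<in> Ar C" "dom C f = X" "x \<in> el F (cod C f)"
  shows "app \<alpha> X (res F f x) = res G f (app \<alpha> (cod C f) x)"
proof -
  have "\<forall>X Y f. f \<in> Hom C X Y \<longrightarrow> (\<forall>x\<in>el F Y. app \<alpha> X (res F f x) = res G f (app \<alpha> Y x))"
    using assms(1) by (simp add: ModC_Hom_iff nat_transf_def)
  moreover have "f \<in> Hom C X (cod C f)" using assms by simp
  ultimately show ?thesis using assms by blast
qed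

lemma Hom_presheaf:
  assumes "\<alpha> \<in> Hom (ModC C) F G"
  shows "is_presheaf C F" "is_presheaf C G"
  using assms by (auto simp: ModC_Hom_iff)

lemma app_group_hom:
  "\<alpha> \<in> Hom (ModC C) F G \<Longrightarrow> Z \<in> Ob C \<Longrightarrow> group_hom (grp F Z) (grp G Z) (app \<alpha> Z)"
  by (intro group_hom.intro group_hom_axioms.intro presheaf_group app_hom) (auto dest: Hom_presheaf)

lemma app_one [simp]: "\<alpha> \<in> Hom (ModC C) F G \<Longrightarrow> Z \<in> Ob C \<Longrightarrow> app \<alpha> Z \<one>\<^bsub>grp F Z\<^esub> = \<one>\<^bsub>grp G Z\<^esub>"
  using group_hom.hom_one[OF app_group_hom] by blast

lemma app_inv [simp]:
  "\<alpha> \<in> Hom (ModC C) F G \<Longrightarrow> Z \<in> Ob C \<Longrightarrow> x \<in> el F Z \<Longrightarrow> app \<alpha> Z (inv\<^bsub>grp F Z\<^esub> x) = inv\<^bsub>grp G Z\<^esub> app \<alpha> Z x"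
  by (rule group_hom.hom_inv[OF app_group_hom])

text \<open>Extensionality fixes the components off the carriers and off \<open>Ob C\<close>, so
  agreement on elements suffices.\<close>

lemma mor_eqI:
  assumes a: "\<alpha> \<in> Hom (ModC C) F G" "\<beta> \<in> Hom (ModC C) F G"
    and eq: "\<And>Z x. Z \<in> Ob C \<Longrightarrow> x \<in> el F Z \<Longrightarrow> app \<alpha> Z x = app \<beta> Z x"
  shows "\<alpha> = \<beta>"
proof -
  have n: "app \<alpha> \<in> nat_transf C F G" "app \<beta> \<in> nat_transf C F G" using a by (auto simp: ModC_Hom_iff)
  have "app \<alpha> = app \<beta>"
  proof
    fix Z show "app \<alpha> Z = app \<beta> Z"
    proof (cases "Z \<in> Ob C")
      case True
      then have "app \<alpha> Z \<in> extensional (el F Z)" "app \<beta> Z \<in> extensional (el F Z)"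
        using n by (auto simp: nat_transf_def)
      then show ?thesis by (rule extensionalityI) (use True eq in auto)
    next
      case False
      then show ?thesis using n unfolding nat_transf_def by (auto simp: PiE_def extensional_def)
    qed
  qed
  then show ?thesis using a by (auto simp: ModC_Hom_iff app_def prod_eq_iff)
qed

lemma cmp_ModC: "\<beta> \<bullet> \<alpha> = mor (fst \<alpha>) (snd (snd \<beta>)) (\<lambda>Z x. app \<beta> Z (app \<alpha> Z x))"
  and ident_ModC: "ident (ModC C) F = mor F F (\<lambda>Z x. x)"
  and add_ModC: "add_mor (ModC C) \<alpha> \<beta> =
    mor (fst \<alpha>) (snd (snd \<alpha>)) (\<lambda>Z x. app \<alpha> Z x \<otimes>\<^bsub>grp (snd (snd \<alpha>)) Z\<^esub> app \<beta> Z x)"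
  and zero_ModC: "zero_mor (ModC C) F G = mor F G (\<lambda>Z x. \<one>\<^bsub>grp G Z\<^esub>)"
  by (simp_all add: ModC_def mor_def app_def split: prod.splits)

lemma Hom_fst: "\<alpha> \<in> Hom (ModC C) F G \<Longrightarrow> fst \<alpha> = F" "\<alpha> \<in> Hom (ModC C) F G \<Longrightarrow> snd (snd \<alpha>) = G"
  by (auto simp: ModC_Hom_iff)

lemma ModC_cmp_Hom:
  assumes "\<alpha> \<in> Hom (ModC C) F G" "\<beta> \<in> Hom (ModC C) G H"
  shows "\<beta> \<bullet> \<alpha> \<in> Hom (ModC C) F H"
  unfolding cmp_ModC Hom_fst[OF assms(1)] Hom_fst[OF assms(2)]
  by (rule mor_Hom) (use assms Hom_presheaf[OF assms(1)] Hom_presheaf[OF assms(2)] in simp_all)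

lemma app_cmp [simp]:
  "\<alpha> \<in> Hom (ModC C) F G \<Longrightarrow> Z \<in> Ob C \<Longrightarrow> x \<in> el F Z \<Longrightarrow> app (\<beta> \<bullet> \<alpha>) Z x = app \<beta> Z (app \<alpha> Z x)"
  by (simp add: cmp_ModC Hom_fst)

lemma app_ident [simp]: "Z \<in> Ob C \<Longrightarrow> x \<in> el F Z \<Longrightarrow> app (ident (ModC C) F) Z x = x"
  by (simp add: ident_ModC)

lemma app_zero [simp]: "Z \<in> Ob C \<Longrightarrow> x \<in> el F Z \<Longrightarrow> app (zero_mor (ModC C) F G) Z x = \<one>\<^bsub>grp G Z\<^esub>"
  by (simp add: zero_ModC)

lemma app_add:
  "\<alpha> \<in> Hom (ModC C) F G \<Longrightarrow> Z \<in> Ob C \<Longrightarrow> x \<in> el F Z \<Longrightarrow>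
    app (add_mor (ModC C) \<alpha> \<beta>) Z x = app \<alpha> Z x \<otimes>\<^bsub>grp G Z\<^esub> app \<beta> Z x"
  by (simp add: add_ModC Hom_fst)

lemma ModC_ident_Hom: "is_presheaf C F \<Longrightarrow> ident (ModC C) F \<in> Hom (ModC C) F F"
  unfolding ident_ModC by (rule mor_Hom) simp_all

lemma ModC_zero_Hom: "is_presheaf C F \<Longrightarrow> is_presheaf C G \<Longrightarrow> zero_mor (ModC C) F G \<in> Hom (ModC C) F G"
  unfolding zero_ModC by (rule mor_Hom) simp_all

lemma el_interchange:
  assumes "is_presheaf C F" "Z \<in> Ob C" "a \<in> el F Z" "b \<in> el F Z" "c \<in> el F Z" "d \<in> el F Z"
  shows "(a \<otimes>\<^bsub>grp F Z\<^esub> b) \<otimes>\<^bsub>grp F Z\<^esub> (c \<otimes>\<^bsub>grp F Z\<^esub> d) = (a \<otimes>\<^bsub>grp F Z\<^esub> c) \<otimes>\<^bsub>grp F Z\<^esub> (b \<otimes>\<^bsub>grp F Z\<^esub> d)"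
proof -
  interpret comm_group "grp F Z" by (rule presheaf_comm_group[OF assms(1,2)])
  show ?thesis using assms(3-) by (simp add: m_ac)
qed

lemma ModC_add_Hom:
  assumes "\<alpha> \<in> Hom (ModC C) F G" "\<beta> \<in> Hom (ModC C) F G"
  shows "add_mor (ModC C) \<alpha> \<beta> \<in> Hom (ModC C) F G"
  unfolding add_ModC Hom_fst[OF assms(1)]
  by (rule mor_Hom) (use assms Hom_presheaf[OF assms(1)] in \<open>simp_all add: el_interchange\<close>)

lemma ModC_category: "category (ModC C)"
  unfolding category_def
proof (intro conjI ballI allI impI)
  fix \<alpha> assume "\<alpha> \<in> Ar (ModC C)"
  then have a: "\<alpha> \<in> Hom (ModC C) (dom (ModC C) \<alpha>) (cod (ModC C) \<alpha>)" by (simp add: Hom_def)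
  note p = Hom_presheaf[OF a]
  show "dom (ModC C) \<alpha> \<in> Ob (ModC C)" "cod (ModC C) \<alpha> \<in> Ob (ModC C)" using p by simp_all
  show "\<alpha> \<bullet> ident (ModC C) (dom (ModC C) \<alpha>) = \<alpha>"
    by (rule mor_eqI[OF ModC_cmp_Hom[OF ModC_ident_Hom[OF p(1)] a] a])
       (use a p ModC_ident_Hom[OF p(1)] in simp)
  show "ident (ModC C) (cod (ModC C) \<alpha>) \<bullet> \<alpha> = \<alpha>"
    by (rule mor_eqI[OF ModC_cmp_Hom[OF a ModC_ident_Hom[OF p(2)]] a])
       (use a p in \<open>simp del: ModC_simps\<close>)
next
  fix W X Y Z f g h assume f: "f \<in> Hom (ModC C) W X" and g: "g \<in> Hom (ModC C) X Y" and h: "h \<in> Hom (ModC C) Y Z"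
  show "h \<bullet> (g \<bullet> f) = (h \<bullet> g) \<bullet> f"
    by (rule mor_eqI[OF ModC_cmp_Hom[OF ModC_cmp_Hom[OF f g] h] ModC_cmp_Hom[OF f ModC_cmp_Hom[OF g h]]])
       (use f g h ModC_cmp_Hom[OF f g] ModC_cmp_Hom[OF g h] in simp)
qed (use ModC_ident_Hom ModC_cmp_Hom in auto)

lemma ModC_comm_group:
  assumes F: "is_presheaf C F" and G: "is_presheaf C G"
  shows "comm_group (Hom_group (ModC C) F G)"
proof (rule comm_groupI; simp only: Hom_group_def monoid.simps partial_object.simps)
  show "zero_mor (ModC C) F G \<in> Hom (ModC C) F G" by (rule ModC_zero_Hom[OF F G])
  fix \<alpha> assume a: "\<alpha> \<in> Hom (ModC C) F G"
  show "add_mor (ModC C) (zero_mor (ModC C) F G) \<alpha> = \<alpha>"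
    by (rule mor_eqI[OF ModC_add_Hom[OF ModC_zero_Hom[OF F G] a] a])
       (use a G in \<open>simp add: app_add[OF ModC_zero_Hom[OF F G]]\<close>)
  define \<beta> where "\<beta> = mor F G (\<lambda>Z x. inv\<^bsub>grp G Z\<^esub> (app \<alpha> Z x))"
  have b: "\<beta> \<in> Hom (ModC C) F G"
    unfolding \<beta>_def by (rule mor_Hom) (use F G a in \<open>simp_all add: el_inv_mult\<close>)
  have "app \<beta> Z x = inv\<^bsub>grp G Z\<^esub> (app \<alpha> Z x)" if "Z \<in> Ob C" "x \<in> el F Z" for Z x
    using that by (simp add: \<beta>_def)
  then have "add_mor (ModC C) \<beta> \<alpha> = zero_mor (ModC C) F G"
    by (intro mor_eqI[OF ModC_add_Hom[OF b a] ModC_zero_Hom[OF F G]])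
       (use a G in \<open>simp add: app_add[OF b]\<close>)
  with b show "\<exists>\<beta>\<in>Hom (ModC C) F G. add_mor (ModC C) \<beta> \<alpha> = zero_mor (ModC C) F G" by blast
  fix \<beta> assume b: "\<beta> \<in> Hom (ModC C) F G"
  show "add_mor (ModC C) \<alpha> \<beta> \<in> Hom (ModC C) F G" by (rule ModC_add_Hom[OF a b])
  show "add_mor (ModC C) \<alpha> \<beta> = add_mor (ModC C) \<beta> \<alpha>"
    by (rule mor_eqI[OF ModC_add_Hom[OF a b] ModC_add_Hom[OF b a]])
       (use a b G in \<open>simp add: app_add[OF a] app_add[OF b] el_commute\<close>)
  fix \<gamma> assume c: "\<gamma> \<in> Hom (ModC C) F G"
  show "add_mor (ModC C) (add_mor (ModC C) \<alpha> \<beta>) \<gamma> = add_mor (ModC C) \<alpha> (add_mor (ModC C) \<beta> \<gamma>)"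
    by (rule mor_eqI[OF ModC_add_Hom[OF ModC_add_Hom[OF a b] c] ModC_add_Hom[OF a ModC_add_Hom[OF b c]]])
       (use a b c G ModC_add_Hom[OF a b] in \<open>simp add: app_add[of _ F G] el_assoc\<close>)
qed

lemma ModC_preadditive:
  "preadditive_category (ModC C :: (('o, 'm, 'd) presheaf, ('o, 'm, 'd) presheaf_mor) excat)"
  unfolding preadditive_category_def
proof (intro conjI ballI allI impI)
  fix F G :: "('o, 'm, 'd) presheaf" assume "F \<in> Ob (ModC C)" "G \<in> Ob (ModC C)"
  then show "comm_group (Hom_group (ModC C) F G)" by (simp add: ModC_comm_group)
next
  fix X Y Z f f' and g :: "('o, 'm, 'd) presheaf_mor" assume f: "f \<in> Hom (ModC C) X Y" and f': "f' \<in> Hom (ModC C) X Y" and g: "g \<in> Hom (ModC C) Y Z"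
  show "g \<bullet> add_mor (ModC C) f f' = add_mor (ModC C) (g \<bullet> f) (g \<bullet> f')"
    by (rule mor_eqI[OF ModC_cmp_Hom[OF ModC_add_Hom[OF f f'] g] ModC_add_Hom[OF ModC_cmp_Hom[OF f g] ModC_cmp_Hom[OF f' g]]])
       (use f f' g in \<open>simp add: app_add[OF f] app_add[OF ModC_cmp_Hom[OF f g]] app_cmp[OF ModC_add_Hom[OF f f']]\<close>)
next
  fix X Y Z f g and g' :: "('o, 'm, 'd) presheaf_mor" assume f: "f \<in> Hom (ModC C) X Y" and g: "g \<in> Hom (ModC C) Y Z" and g': "g' \<in> Hom (ModC C) Y Z"
  show "add_mor (ModC C) g g' \<bullet> f = add_mor (ModC C) (g \<bullet> f) (g' \<bullet> f)"
    by (rule mor_eqI[OF ModC_cmp_Hom[OF f ModC_add_Hom[OF g g']] ModC_add_Hom[OF ModC_cmp_Hom[OF f g] ModC_cmp_Hom[OF f g']]])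
       (use f g g' in \<open>simp add: app_add[OF g] app_add[OF ModC_cmp_Hom[OF f g]]\<close>)
qed (rule ModC_category)

subsection \<open>Subpresheaves and quotients\<close>

text \<open>The presheaf laws are equational, hence pass to any structure receiving a compatible
  surjection. The two value types may differ: besides quotients, this yields the copy of the Hom
  groups along \<open>\<iota>\<close>.\<close>

lemma presheaf_image:
  fixes F :: "('o, 'm, 'a) presheaf" and Q :: "('o, 'm, 'b) presheaf"
  assumes F: "is_presheaf C F"
    and surj: "\<And>Z. Z \<in> Ob C \<Longrightarrow> el Q Z = q Z ` el F Z"
    and one: "\<And>Z. Z \<in> Ob C \<Longrightarrow> \<one>\<^bsub>grp Q Z\<^esub> = q Z \<one>\<^bsub>grp F Z\<^esub>"
    and mult: "\<And>Z x y. Z \<in> Ob C \<Longrightarrow> x \<in> el F Z \<Longrightarrow> y \<in> el F Z \<Longrightarrow>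
      q Z x \<otimes>\<^bsub>grp Q Z\<^esub> q Z y = q Z (x \<otimes>\<^bsub>grp F Z\<^esub> y)"
    and res: "\<And>f x. f \<in> Ar C \<Longrightarrow> x \<in> el F (cod C f) \<Longrightarrow> res Q f (q (cod C f) x) = q (dom C f) (res F f x)"
  shows "is_presheaf C Q"
  unfolding is_presheaf_def
proof (intro conjI ballI allI impI)
  fix X assume X: "X \<in> Ob C"
  show "comm_group (grp Q X)"
  proof (rule comm_groupI)
    fix x assume "x \<in> el Q X"
    then obtain a where a: "a \<in> el F X" "x = q X a" using X surj by auto
    show "\<one>\<^bsub>grp Q X\<^esub> \<otimes>\<^bsub>grp Q X\<^esub> x = x" using X F a by (simp add: one mult)
    show "\<exists>y\<in>el Q X. y \<otimes>\<^bsub>grp Q X\<^esub> x = \<one>\<^bsub>grp Q X\<^esub>"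
      using X F a by (intro bexI[of _ "q X (inv\<^bsub>grp F X\<^esub> a)"]) (simp_all add: one mult surj)
    fix y assume "y \<in> el Q X"
    then obtain b where b: "b \<in> el F X" "y = q X b" using X surj by auto
    show "x \<otimes>\<^bsub>grp Q X\<^esub> y \<in> el Q X" "x \<otimes>\<^bsub>grp Q X\<^esub> y = y \<otimes>\<^bsub>grp Q X\<^esub> x"
      using X F a b by (simp_all add: surj mult el_commute)
    fix z assume "z \<in> el Q X"
    then obtain c where c: "c \<in> el F X" "z = q X c" using X surj by auto
    show "x \<otimes>\<^bsub>grp Q X\<^esub> y \<otimes>\<^bsub>grp Q X\<^esub> z = x \<otimes>\<^bsub>grp Q X\<^esub> (y \<otimes>\<^bsub>grp Q X\<^esub> z)"
      using X F a b c by (simp add: mult el_assoc)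
  qed (use X F in \<open>simp add: one surj\<close>)
next
  fix X x assume "X \<in> Ob C" "x \<in> el Q X"
  then show "res Q (ident C X) x = x"
    using res[of "ident C X"] F by (auto simp: surj)
next
  fix X Y f assume f: "f \<in> Hom C X Y"
  then have [simp]: "X \<in> Ob C" "Y \<in> Ob C" by auto
  show "res Q f \<in> hom (grp Q Y) (grp Q X)"
    using f F res[of f] by (auto simp: hom_def surj mult)
  show "res Q (g \<cdot> f) x = res Q f (res Q g x)" if "g \<in> Hom C Y Z" "x \<in> el Q Z" for g Z x
  proof -
    have [simp]: "Z \<in> Ob C" using that by auto
    show ?thesis using that f F res[of f] res[of g] res[of "g \<cdot> f"] by (auto simp: surj)
  qed
  show "res Q (add_mor C f g) x = res Q f x \<otimes>\<^bsub>grp Q X\<^esub> res Q g x"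
    if "g \<in> Hom C X Y" "x \<in> el Q Y" for g x
    using that f F res[of f] res[of g] res[of "add_mor C f g"] res_add[OF F f that(1)]
    by (auto simp: surj mult)
qed

definition subpresheaf :: "('o, 'm, 'u) presheaf \<Rightarrow> ('o \<Rightarrow> 'u set) \<Rightarrow> bool" where
  "subpresheaf F N \<longleftrightarrow> (\<forall>Z\<in>Ob C. subgroup (N Z) (grp F Z)) \<and> (\<forall>f\<in>Ar C. res F f ` N (cod C f) \<subseteq> N (dom C f))"

definition sub :: "('o, 'm, 'u) presheaf \<Rightarrow> ('o \<Rightarrow> 'u set) \<Rightarrow> ('o, 'm, 'u) presheaf" where
  "sub F N = F\<lparr>grp := \<lambda>Z. (grp F Z)\<lparr>carrier := N Z\<rparr>\<rparr>"

lemma sub_simps [simp]: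
  "el (sub F N) Z = N Z" "mult (grp (sub F N) Z) = mult (grp F Z)" "one (grp (sub F N) Z) = one (grp F Z)"
  "res (sub F N) = res F"
  by (simp_all add: sub_def)

lemma subpresheafI:
  assumes F: "is_presheaf C F"
    and el: "\<And>Z. Z \<in> Ob C \<Longrightarrow> N Z \<subseteq> el F Z"
    and one: "\<And>Z. Z \<in> Ob C \<Longrightarrow> \<one>\<^bsub>grp F Z\<^esub> \<in> N Z"
    and diff: "\<And>Z x y. Z \<in> Ob C \<Longrightarrow> x \<in> N Z \<Longrightarrow> y \<in> N Z \<Longrightarrow> x \<otimes>\<^bsub>grp F Z\<^esub> inv\<^bsub>grp F Z\<^esub> y \<in> N Z"
    and res: "\<And>f x. f \<in> Ar C \<Longrightarrow> x \<in> N (cod C f) \<Longrightarrow> res F f x \<in> N (dom C f)"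
  shows "subpresheaf F N"
  unfolding subpresheaf_def
proof (intro conjI ballI)
  fix Z assume Z: "Z \<in> Ob C"
  interpret group "grp F Z" by (rule presheaf_group[OF F Z])
  have inv: "inv\<^bsub>grp F Z\<^esub> x \<in> N Z" if "x \<in> N Z" for x
    using diff[OF Z one[OF Z] that] that el[OF Z] by auto
  have "x \<otimes>\<^bsub>grp F Z\<^esub> y \<in> N Z" if "x \<in> N Z" "y \<in> N Z" for x y
    using diff[OF Z that(1) inv[OF that(2)]] that el[OF Z] by auto
  with inv show "subgroup (N Z) (grp F Z)"
    using el[OF Z] one[OF Z] by (intro subgroupI) auto
qed (use res in auto)

lemma subpresheafD:
  assumes "subpresheaf F N"
  shows "Z \<in> Ob C \<Longrightarrow> x \<in> N Z \<Longrightarrow> x \<in> el F Z"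
    and "Z \<in> Ob C \<Longrightarrow> \<one>\<^bsub>grp F Z\<^esub> \<in> N Z"
    and "Z \<in> Ob C \<Longrightarrow> x \<in> N Z \<Longrightarrow> y \<in> N Z \<Longrightarrow> x \<otimes>\<^bsub>grp F Z\<^esub> y \<in> N Z"
    and "Z \<in> Ob C \<Longrightarrow> x \<in> N Z \<Longrightarrow> inv\<^bsub>grp F Z\<^esub> x \<in> N Z"
    and "f \<in> Ar C \<Longrightarrow> dom C f = X \<Longrightarrow> x \<in> N (cod C f) \<Longrightarrow> res F f x \<in> N X"
proof -
  have "subgroup (N Z) (grp F Z)" if "Z \<in> Ob C" for Z
    using assms that by (simp add: subpresheaf_def)
  then show "Z \<in> Ob C \<Longrightarrow> x \<in> N Z \<Longrightarrow> x \<in> el F Z" "Z \<in> Ob C \<Longrightarrow> \<one>\<^bsub>grp F Z\<^esub> \<in> N Z"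
    "Z \<in> Ob C \<Longrightarrow> x \<in> N Z \<Longrightarrow> y \<in> N Z \<Longrightarrow> x \<otimes>\<^bsub>grp F Z\<^esub> y \<in> N Z"
    "Z \<in> Ob C \<Longrightarrow> x \<in> N Z \<Longrightarrow> inv\<^bsub>grp F Z\<^esub> x \<in> N Z"
    by (auto intro: subgroup.mem_carrier subgroup.one_closed subgroup.m_closed subgroup.m_inv_closed)
  show "f \<in> Ar C \<Longrightarrow> dom C f = X \<Longrightarrow> x \<in> N (cod C f) \<Longrightarrow> res F f x \<in> N X"
    using assms unfolding subpresheaf_def by blast
qed

lemma sub_presheaf:
  assumes F: "is_presheaf C F" and N: "subpresheaf F N"
  shows "is_presheaf C (sub F N)"
  unfolding is_presheaf_def
proof (intro conjI ballI allI impI)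
  fix X assume X: "X \<in> Ob C"
  note D = subpresheafD[OF N]
  show "comm_group (grp (sub F N) X)"
  proof (rule comm_groupI; unfold sub_simps)
    fix x assume x: "x \<in> N X"
    have "inv\<^bsub>grp F X\<^esub> x \<otimes>\<^bsub>grp F X\<^esub> x = \<one>\<^bsub>grp F X\<^esub>" using D(1)[OF X x] F X by simp
    then show "\<exists>y\<in>N X. y \<otimes>\<^bsub>grp F X\<^esub> x = \<one>\<^bsub>grp F X\<^esub>" using D(4)[OF X x] by blast
    show "\<one>\<^bsub>grp F X\<^esub> \<otimes>\<^bsub>grp F X\<^esub> x = x" using F X x D(1) by simp
    fix y assume y: "y \<in> N X"
    show "x \<otimes>\<^bsub>grp F X\<^esub> y = y \<otimes>\<^bsub>grp F X\<^esub> x" by (rule el_commute[OF F X D(1)[OF X x] D(1)[OF X y]])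
    show "x \<otimes>\<^bsub>grp F X\<^esub> y \<in> N X" using X x y D(3) by blast
    fix z assume z: "z \<in> N X"
    show "x \<otimes>\<^bsub>grp F X\<^esub> y \<otimes>\<^bsub>grp F X\<^esub> z = x \<otimes>\<^bsub>grp F X\<^esub> (y \<otimes>\<^bsub>grp F X\<^esub> z)"
      by (rule el_assoc[OF F X D(1)[OF X x] D(1)[OF X y] D(1)[OF X z]])
  qed (use X D in blast)
next
  fix X Y f assume f: "f \<in> Hom C X Y"
  then have [simp]: "X \<in> Ob C" "Y \<in> Ob C" by auto
  note [simp] = subpresheafD[OF N]
  show "res (sub F N) f \<in> hom (grp (sub F N) Y) (grp (sub F N) X)"
    using f F by (auto simp: hom_def)
  show "res (sub F N) (g \<cdot> f) x = res (sub F N) f (res (sub F N) g x)" if "g \<in> Hom C Y Z" "x \<in> el (sub F N) Z" for g Z x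
    using that f F cod_Ob[of g] by auto
  show "res (sub F N) (add_mor C f g) x = res (sub F N) f x \<otimes>\<^bsub>grp (sub F N) X\<^esub> res (sub F N) g x"
    if "g \<in> Hom C X Y" "x \<in> el (sub F N) Y" for g x
    using that f F res_add[OF F f that(1), of x] by simp
qed (use F subpresheafD[OF N] in simp)

definition incl :: "('o, 'm, 'u) presheaf \<Rightarrow> ('o \<Rightarrow> 'u set) \<Rightarrow> ('o, 'm, 'u) presheaf_mor" where
  "incl F N = mor (sub F N) F (\<lambda>Z x. x)"

lemma incl_Hom: "is_presheaf C F \<Longrightarrow> subpresheaf F N \<Longrightarrow> incl F N \<in> Hom (ModC C) (sub F N) F"
  unfolding incl_def using subpresheafD[of F N] sub_presheaf by (intro mor_Hom) simp_all

lemma app_incl [simp]: "Z \<in> Ob C \<Longrightarrow> x \<in> N Z \<Longrightarrow> app (incl F N) Z x = x"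
  by (simp add: incl_def)

lemma corestrict:
  assumes \<alpha>: "\<alpha> \<in> Hom (ModC C) F G" and N: "subpresheaf G N"
    and im: "\<And>Z x. Z \<in> Ob C \<Longrightarrow> x \<in> el F Z \<Longrightarrow> app \<alpha> Z x \<in> N Z"
  obtains \<beta> where "\<beta> \<in> Hom (ModC C) F (sub G N)" "\<And>Z x. Z \<in> Ob C \<Longrightarrow> x \<in> el F Z \<Longrightarrow> app \<beta> Z x = app \<alpha> Z x"
proof (rule that[of "mor F (sub G N) (app \<alpha>)"])
  show "mor F (sub G N) (app \<alpha>) \<in> Hom (ModC C) F (sub G N)"
    using \<alpha> N Hom_presheaf[OF \<alpha>] im by (intro mor_Hom sub_presheaf) simp_all
qed simp

text \<open>The choice is made from the coset as a set, which makes \<open>rep\<close> constant on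
  cosets.\<close>

definition rep :: "('o, 'm, 'u) presheaf \<Rightarrow> ('o \<Rightarrow> 'u set) \<Rightarrow> 'o \<Rightarrow> 'u \<Rightarrow> 'u" where
  "rep F N Z x = (SOME y. y \<in> N Z #>\<^bsub>grp F Z\<^esub> x)"

text \<open>Elements of the quotient are representatives of cosets, so that it stays in the same universe.\<close>

definition quot :: "('o, 'm, 'u) presheaf \<Rightarrow> ('o \<Rightarrow> 'u set) \<Rightarrow> ('o, 'm, 'u) presheaf" where
  "quot F N = \<lparr>
     grp = (\<lambda>Z. \<lparr>carrier = rep F N Z ` el F Z, mult = (\<lambda>x y. rep F N Z (x \<otimes>\<^bsub>grp F Z\<^esub> y)),
       one = rep F N Z \<one>\<^bsub>grp F Z\<^esub>\<rparr>),
     res = (\<lambda>f x. rep F N (dom C f) (res F f x))\<rparr>"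

definition proj :: "('o, 'm, 'u) presheaf \<Rightarrow> ('o \<Rightarrow> 'u set) \<Rightarrow> ('o, 'm, 'u) presheaf_mor" where
  "proj F N = mor F (quot F N) (rep F N)"

context
  fixes F :: "('o, 'm, 'u) presheaf" and N
  assumes F: "is_presheaf C F" and N: "subpresheaf F N"
begin

lemma rep_props:
  assumes Z: "Z \<in> Ob C" and x: "x \<in> el F Z"
  shows "rep F N Z x \<in> el F Z" "rep F N Z x \<in> N Z #>\<^bsub>grp F Z\<^esub> x"
    "y \<in> el F Z \<Longrightarrow> rep F N Z x = rep F N Z y \<longleftrightarrow> x \<otimes>\<^bsub>grp F Z\<^esub> inv\<^bsub>grp F Z\<^esub> y \<in> N Z"
proof -
  interpret group "grp F Z" by (rule presheaf_group[OF F Z])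
  have s: "subgroup (N Z) (grp F Z)" using N Z by (simp add: subpresheaf_def)
  have *: "rep F N Z x \<in> N Z #>\<^bsub>grp F Z\<^esub> x" if "x \<in> el F Z" for x
    unfolding rep_def by (rule someI[where P="\<lambda>y. y \<in> N Z #>\<^bsub>grp F Z\<^esub> x"]) (rule rcos_self[OF that s])
  show "rep F N Z x \<in> N Z #>\<^bsub>grp F Z\<^esub> x" by (rule *[OF x])
  then show "rep F N Z x \<in> el F Z" using r_coset_subset_G[OF subgroup.subset[OF s] x] by blast
  assume y: "y \<in> el F Z"
  show "rep F N Z x = rep F N Z y \<longleftrightarrow> x \<otimes>\<^bsub>grp F Z\<^esub> inv\<^bsub>grp F Z\<^esub> y \<in> N Z"
  proof
    assume "rep F N Z x = rep F N Z y"
    then have "rep F N Z x \<in> N Z #>\<^bsub>grp F Z\<^esub> x" "rep F N Z x \<in> N Z #>\<^bsub>grp F Z\<^esub> y" using * x y by metis+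
    then have "N Z #>\<^bsub>grp F Z\<^esub> x = N Z #>\<^bsub>grp F Z\<^esub> y"
      using repr_independence[OF _ x s] repr_independence[OF _ y s] by metis
    then have "x \<in> N Z #>\<^bsub>grp F Z\<^esub> y" using rcos_self[OF x s] by simp
    then show "x \<otimes>\<^bsub>grp F Z\<^esub> inv\<^bsub>grp F Z\<^esub> y \<in> N Z"
      using subgroup.rcos_module_imp[OF s is_group y] by simp
  next
    assume "x \<otimes>\<^bsub>grp F Z\<^esub> inv\<^bsub>grp F Z\<^esub> y \<in> N Z"
    then have "x \<in> N Z #>\<^bsub>grp F Z\<^esub> y"
      using subgroup.rcos_module_rev[OF s is_group y x] by simp
    then have "N Z #>\<^bsub>grp F Z\<^esub> y = N Z #>\<^bsub>grp F Z\<^esub> x" by (rule repr_independence[OF _ y s])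
    then show "rep F N Z x = rep F N Z y" by (simp add: rep_def)
  qed
qed

lemma rep_diff:
  assumes Z: "Z \<in> Ob C" and x: "x \<in> el F Z"
  shows "rep F N Z x \<otimes>\<^bsub>grp F Z\<^esub> inv\<^bsub>grp F Z\<^esub> x \<in> N Z"
proof -
  interpret group "grp F Z" by (rule presheaf_group[OF F Z])
  have s: "subgroup (N Z) (grp F Z)" using N Z by (simp add: subpresheaf_def)
  show ?thesis using subgroup.rcos_module_imp[OF s is_group x rep_props(2)[OF Z x]] .
qed

lemma rep_mult:
  assumes Z: "Z \<in> Ob C" and x: "x \<in> el F Z" and y: "y \<in> el F Z"
  shows "rep F N Z (rep F N Z x \<otimes>\<^bsub>grp F Z\<^esub> rep F N Z y) = rep F N Z (x \<otimes>\<^bsub>grp F Z\<^esub> y)"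
proof -
  let ?r = "rep F N Z"
  have r: "?r x \<in> el F Z" "?r y \<in> el F Z" using rep_props Z x y by auto
  \<comment> \<open>Each factor differs from its representative by an element of \<open>N Z\<close>;
    by commutativity the products differ by one as well.\<close>
  have "(?r x \<otimes>\<^bsub>grp F Z\<^esub> inv\<^bsub>grp F Z\<^esub> x) \<otimes>\<^bsub>grp F Z\<^esub> (?r y \<otimes>\<^bsub>grp F Z\<^esub> inv\<^bsub>grp F Z\<^esub> y) \<in> N Z"
    using subpresheafD(3)[OF N] rep_diff Z x y by blast
  also have "(?r x \<otimes>\<^bsub>grp F Z\<^esub> inv\<^bsub>grp F Z\<^esub> x) \<otimes>\<^bsub>grp F Z\<^esub> (?r y \<otimes>\<^bsub>grp F Z\<^esub> inv\<^bsub>grp F Z\<^esub> y) =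
    (?r x \<otimes>\<^bsub>grp F Z\<^esub> ?r y) \<otimes>\<^bsub>grp F Z\<^esub> inv\<^bsub>grp F Z\<^esub> (x \<otimes>\<^bsub>grp F Z\<^esub> y)"
    using F Z x y r by (simp add: el_inv_mult el_interchange)
  finally show ?thesis
    using rep_props(3)[OF Z, of "?r x \<otimes>\<^bsub>grp F Z\<^esub> ?r y" "x \<otimes>\<^bsub>grp F Z\<^esub> y"] F Z x y r by simp
qed

lemma rep_res:
  assumes f: "f \<in> Ar C" and x: "x \<in> el F (cod C f)"
  shows "rep F N (dom C f) (res F f (rep F N (cod C f) x)) = rep F N (dom C f) (res F f x)"
proof -
  have Z: "cod C f \<in> Ob C" using f by simp
  have "res F f (rep F N (cod C f) x \<otimes>\<^bsub>grp F (cod C f)\<^esub> inv\<^bsub>grp F (cod C f)\<^esub> x) \<in> N (dom C f)"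
    by (rule subpresheafD(5)[OF N f refl rep_diff[OF Z x]])
  moreover have "rep F N (cod C f) x \<in> el F (cod C f)" using rep_props[OF Z x] by simp
  ultimately show ?thesis
    using rep_props(3)[of "dom C f" "res F f (rep F N (cod C f) x)" "res F f x"] f x F by simp
qed

lemma quot_presheaf: "is_presheaf C (quot F N)"
  by (rule presheaf_image[OF F, where q="rep F N"])
     (auto simp: quot_def rep_mult rep_res)

lemma proj_Hom: "proj F N \<in> Hom (ModC C) F (quot F N)"
  unfolding proj_def
  by (rule mor_Hom[OF F quot_presheaf]) (auto simp: quot_def rep_mult rep_res)

lemma proj_surj: "Z \<in> Ob C \<Longrightarrow> app (proj F N) Z ` el F Z = el (quot F N) Z"
  by (auto simp: proj_def quot_def)

lemma proj_eq_one:
  assumes Z: "Z \<in> Ob C" and x: "x \<in> el F Z"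
  shows "app (proj F N) Z x = \<one>\<^bsub>grp (quot F N) Z\<^esub> \<longleftrightarrow> x \<in> N Z"
  using rep_props(3)[OF Z x, of "\<one>\<^bsub>grp F Z\<^esub>"] F Z x by (simp add: proj_def quot_def)

end

text \<open>The homomorphism theorem at each object. The formula on elements is returned as well,
  since later arguments compute with values at preimages.\<close>

lemma factor_surj:
  assumes q: "q \<in> Hom (ModC C) F Q" and surj: "\<And>Z. Z \<in> Ob C \<Longrightarrow> app q Z ` el F Z = el Q Z"
    and \<beta>: "\<beta> \<in> Hom (ModC C) F H"
    and ker: "\<And>Z x. Z \<in> Ob C \<Longrightarrow> x \<in> el F Z \<Longrightarrow> app q Z x = \<one>\<^bsub>grp Q Z\<^esub> \<Longrightarrow> app \<beta> Z x = \<one>\<^bsub>grp H Z\<^esub>"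
  shows "\<exists>\<gamma>\<in>Hom (ModC C) Q H. \<gamma> \<bullet> q = \<beta> \<and> (\<forall>Z\<in>Ob C. \<forall>x\<in>el F Z. app \<gamma> Z (app q Z x) = app \<beta> Z x)"
proof -
  define \<phi> where "\<phi> = (\<lambda>Z y. app \<beta> Z (SOME x. x \<in> el F Z \<and> app q Z x = y))"
  note p = Hom_presheaf[OF q] Hom_presheaf[OF \<beta>]
  \<comment> \<open>The value is independent of the preimage, because two preimages differ by an
    element of the kernel.\<close>
  have eq: "app \<beta> Z x = app \<beta> Z y" if "Z \<in> Ob C" "x \<in> el F Z" "y \<in> el F Z" "app q Z x = app q Z y" for Z x y
    using ker[of Z "x \<otimes>\<^bsub>grp F Z\<^esub> inv\<^bsub>grp F Z\<^esub> y"] that q \<beta> p by (simp add: el_diff_one)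
  have \<phi>: "\<phi> Z (app q Z x) = app \<beta> Z x" if "Z \<in> Ob C" "x \<in> el F Z" for Z x
    unfolding \<phi>_def
    using someI[of "\<lambda>y. y \<in> el F Z \<and> app q Z y = app q Z x" x] that by (intro eq) auto
  have \<gamma>: "mor Q H \<phi> \<in> Hom (ModC C) Q H"
  proof (rule mor_Hom)
    fix Z y assume Z: "Z \<in> Ob C" and "y \<in> el Q Z"
    then obtain x where x: "x \<in> el F Z" "y = app q Z x" using surj[OF Z] by auto
    show "\<phi> Z y \<in> el H Z" using \<phi> Z x \<beta> by simp
    fix y' assume "y' \<in> el Q Z"
    then obtain x' where x': "x' \<in> el F Z" "y' = app q Z x'" using surj[OF Z] by auto
    have "\<phi> Z (app q Z (x \<otimes>\<^bsub>grp F Z\<^esub> x')) = \<phi> Z y \<otimes>\<^bsub>grp H Z\<^esub> \<phi> Z y'"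
      using \<phi> Z x x' \<beta> p by (simp del: app_mult, simp)
    then show "\<phi> Z (y \<otimes>\<^bsub>grp Q Z\<^esub> y') = \<phi> Z y \<otimes>\<^bsub>grp H Z\<^esub> \<phi> Z y'" using q Z x x' by simp
  next
    fix f y assume f: "f \<in> Ar C" and "y \<in> el Q (cod C f)"
    then obtain x where x: "x \<in> el F (cod C f)" "y = app q (cod C f) x" using surj[of "cod C f"] by auto
    have "\<phi> (dom C f) (app q (dom C f) (res F f x)) = res H f (\<phi> (cod C f) y)"
      using \<phi> f x \<beta> p by (simp del: app_res, simp)
    then show "\<phi> (dom C f) (res Q f y) = res H f (\<phi> (cod C f) y)" using q f x by simp
  qed (use p in simp_all)
  have e: "app (mor Q H \<phi>) Z (app q Z x) = app \<beta> Z x" if "Z \<in> Ob C" "x \<in> el F Z" for Z x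
    using that \<phi> q by simp
  have "mor Q H \<phi> \<bullet> q = \<beta>"
    by (rule mor_eqI[OF ModC_cmp_Hom[OF q \<gamma>] \<beta>]) (use q e in simp)
  then show ?thesis using \<gamma> e by blast
qed

text \<open>The value is the preimage under an injective component; that it is homomorphic and
  natural is tested after applying \<open>i\<close>.\<close>

lemma factor_inj:
  assumes i: "i \<in> Hom (ModC C) K G" and inj: "\<And>Z. Z \<in> Ob C \<Longrightarrow> inj_on (app i Z) (el K Z)"
    and \<beta>: "\<beta> \<in> Hom (ModC C) F G"
    and im: "\<And>Z x. Z \<in> Ob C \<Longrightarrow> x \<in> el F Z \<Longrightarrow> app \<beta> Z x \<in> app i Z ` el K Z"
  shows "\<exists>\<gamma>\<in>Hom (ModC C) F K. i \<bullet> \<gamma> = \<beta> \<and> (\<forall>Z\<in>Ob C. \<forall>x\<in>el F Z. app i Z (app \<gamma> Z x) = app \<beta> Z x)"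
proof -
  define \<phi> where "\<phi> = (\<lambda>Z x. inv_into (el K Z) (app i Z) (app \<beta> Z x))"
  note p = Hom_presheaf[OF i] Hom_presheaf[OF \<beta>]
  have \<phi>: "\<phi> Z x \<in> el K Z" "app i Z (\<phi> Z x) = app \<beta> Z x" if "Z \<in> Ob C" "x \<in> el F Z" for Z x
    unfolding \<phi>_def using im[OF that] by (auto intro: inv_into_into f_inv_into_f)
  have \<gamma>: "mor F K \<phi> \<in> Hom (ModC C) F K"
  proof (rule mor_Hom)
    fix Z x y assume Z: "Z \<in> Ob C" "x \<in> el F Z" "y \<in> el F Z"
    show "\<phi> Z (x \<otimes>\<^bsub>grp F Z\<^esub> y) = \<phi> Z x \<otimes>\<^bsub>grp K Z\<^esub> \<phi> Z y"
      by (rule inj_onD[OF inj[OF Z(1)]]) (use Z \<phi> \<beta> i p in simp_all)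
  next
    fix f x assume f: "f \<in> Ar C" "x \<in> el F (cod C f)"
    show "\<phi> (dom C f) (res F f x) = res K f (\<phi> (cod C f) x)"
      by (rule inj_onD[OF inj[of "dom C f"]]) (use f \<phi> \<beta> i p in simp_all)
  qed (use p \<phi> in simp_all)
  have e: "app i Z (app (mor F K \<phi>) Z x) = app \<beta> Z x" if "Z \<in> Ob C" "x \<in> el F Z" for Z x
    using that \<phi> by simp
  have "i \<bullet> mor F K \<phi> = \<beta>"
    by (rule mor_eqI[OF ModC_cmp_Hom[OF \<gamma> i] \<beta>]) (use \<gamma> e in simp)
  then show ?thesis using \<gamma> e by blast
qed

end

section \<open>Extension-closed subcategories of presheaves are exact\<close>

lemma full_subcategory_simps [simp]:
  "Ob (full_subcategory E S) = Ob E \<inter> S" "dom (full_subcategory E S) = dom E"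
  "cod (full_subcategory E S) = cod E" "ident (full_subcategory E S) = ident E"
  "cmp (full_subcategory E S) = cmp E" "add_mor (full_subcategory E S) = add_mor E"
  "zero_mor (full_subcategory E S) = zero_mor E"
  by (simp_all add: full_subcategory_def)

lemma Hom_full_subcategory:
  "Hom (full_subcategory E S) X Y = (if X \<in> S \<and> Y \<in> S then Hom E X Y else {})"
  by (auto simp: full_subcategory_def Hom_def)

lemma Ar_full_subcategory: "f \<in> Ar (full_subcategory E S) \<longleftrightarrow> f \<in> Hom E (dom E f) (cod E f) \<and> dom E f \<in> S \<and> cod E f \<in> S"
  by (auto simp: full_subcategory_def Hom_def)

context preadditive
begin

text \<open>A conflation of \<open>ModC\<close> with its three terms named and exactness stated on
  elements. Closure under extensions is always used in this form.\<close>

definition short_exact ::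
  "('o, 'm, 'u) presheaf_mor \<Rightarrow> ('o, 'm, 'u) presheaf_mor \<Rightarrow> ('o, 'm, 'u) presheaf \<Rightarrow>
   ('o, 'm, 'u) presheaf \<Rightarrow> ('o, 'm, 'u) presheaf \<Rightarrow> bool" where
  "short_exact i p K G Q \<longleftrightarrow> i \<in> Hom (ModC C) K G \<and> p \<in> Hom (ModC C) G Q \<and>
     (\<forall>Z\<in>Ob C. inj_on (app i Z) (el K Z)) \<and>
     (\<forall>Z\<in>Ob C. \<forall>x\<in>el G Z. app p Z x = \<one>\<^bsub>grp Q Z\<^esub> \<longleftrightarrow> x \<in> app i Z ` el K Z) \<and>
     (\<forall>Z\<in>Ob C. app p Z ` el G Z = el Q Z)"

lemma short_exactD:
  assumes "short_exact i p K G Q"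
  shows "i \<in> Hom (ModC C) K G" "p \<in> Hom (ModC C) G Q"
    and "Z \<in> Ob C \<Longrightarrow> inj_on (app i Z) (el K Z)"
    and "Z \<in> Ob C \<Longrightarrow> x \<in> el G Z \<Longrightarrow> app p Z x = \<one>\<^bsub>grp Q Z\<^esub> \<longleftrightarrow> x \<in> app i Z ` el K Z"
    and "Z \<in> Ob C \<Longrightarrow> app p Z ` el G Z = el Q Z"
  using assms by (auto simp: short_exact_def)

lemma short_exact_zero:
  assumes "short_exact i p K G Q" "Z \<in> Ob C" "x \<in> el K Z"
  shows "app p Z (app i Z x) = \<one>\<^bsub>grp Q Z\<^esub>"
  using short_exactD(4)[OF assms(1,2), of "app i Z x"] short_exactD(1)[OF assms(1)] assms by auto

lemma short_exact_kernelE: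
  assumes "short_exact i p K G Q" "Z \<in> Ob C" "x \<in> el G Z" "app p Z x = \<one>\<^bsub>grp Q Z\<^esub>"
  obtains y where "y \<in> el K Z" "x = app i Z y"
  using short_exactD(4)[OF assms(1,2,3)] assms(4) by blast

lemma short_exact_surjE:
  assumes "short_exact i p K G Q" "Z \<in> Ob C" "y \<in> el Q Z"
  obtains x where "x \<in> el G Z" "y = app p Z x"
  using short_exactD(5)[OF assms(1,2)] assms(3) by blast

lemma conflation_ModC_iff:
  assumes "i \<in> Hom (ModC C) K G" "p \<in> Hom (ModC C) G' Q"
  shows "(i, p) \<in> conflations (ModC C) \<longleftrightarrow> G' = G \<and> short_exact i p K G Q"
proof -
  obtain a b where ab: "i = (K, a, G)" "p = (G', b, Q)"
    using assms by (cases i, cases p) (auto simp: Hom_def)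
  have ms: "i \<in> presheaf_mors C" "p \<in> presheaf_mors C"
    using assms by (simp_all add: Hom_def)
  have im: "a Z ` el K Z \<subseteq> el G Z" if "Z \<in> Ob C" for Z
    using app_el[OF assms(1) that] by (auto simp: app_def ab)
  have "a Z ` el K Z = kernel (grp G Z) (grp Q Z) (b Z) \<longleftrightarrow>
      (\<forall>x\<in>el G Z. b Z x = \<one>\<^bsub>grp Q Z\<^esub> \<longleftrightarrow> x \<in> a Z ` el K Z)" if "Z \<in> Ob C" for Z
    using im[OF that] unfolding kernel_def by blast
  then have "(\<forall>Z\<in>Ob C. a Z ` el K Z = kernel (grp G Z) (grp Q Z) (b Z)) \<longleftrightarrow>
      (\<forall>Z\<in>Ob C. \<forall>x\<in>el G Z. b Z x = \<one>\<^bsub>grp Q Z\<^esub> \<longleftrightarrow> x \<in> a Z ` el K Z)"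
    by (intro ball_cong) simp_all
  then have "(i, p) \<in> conflations (ModC C) \<longleftrightarrow> (\<forall>Z\<in>Ob C. inj_on (a Z) (el K Z)) \<and>
      (G = G' \<and> (\<forall>Z\<in>Ob C. \<forall>x\<in>el G Z. b Z x = \<one>\<^bsub>grp Q Z\<^esub> \<longleftrightarrow> x \<in> a Z ` el K Z)) \<and>
      (\<forall>Z\<in>Ob C. b Z ` el G' Z = el Q Z)"
    using ms unfolding ab by (simp add: ModC_def)
  also have "\<dots> \<longleftrightarrow> G' = G \<and> short_exact i p K G Q"
    using assms unfolding short_exact_def by (auto simp: ab app_def)
  finally show ?thesis .
qed

lemma inj_onI_one:
  assumes "\<alpha> \<in> Hom (ModC C) F G" "Z \<in> Ob C"
    and "\<And>x. x \<in> el F Z \<Longrightarrow> app \<alpha> Z x = \<one>\<^bsub>grp G Z\<^esub> \<Longrightarrow> x = \<one>\<^bsub>grp F Z\<^esub>"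
  shows "inj_on (app \<alpha> Z) (el F Z)"
proof (rule inj_onI)
  fix x y assume xy: "x \<in> el F Z" "y \<in> el F Z" "app \<alpha> Z x = app \<alpha> Z y"
  note p = Hom_presheaf[OF assms(1)]
  have "app \<alpha> Z (x \<otimes>\<^bsub>grp F Z\<^esub> inv\<^bsub>grp F Z\<^esub> y) = \<one>\<^bsub>grp G Z\<^esub>"
    using assms(1,2) xy p by simp
  then have "x \<otimes>\<^bsub>grp F Z\<^esub> inv\<^bsub>grp F Z\<^esub> y = \<one>\<^bsub>grp F Z\<^esub>"
    using assms(2,3) xy p by simp
  then show "x = y" using assms(2) xy p by (simp add: el_diff_one)
qed

lemma inj_one:
  assumes "\<alpha> \<in> Hom (ModC C) F G" "Z \<in> Ob C" "inj_on (app \<alpha> Z) (el F Z)"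
    "x \<in> el F Z" "app \<alpha> Z x = \<one>\<^bsub>grp G Z\<^esub>"
  shows "x = \<one>\<^bsub>grp F Z\<^esub>"
  by (rule inj_onD[OF assms(3)]) (use assms Hom_presheaf[OF assms(1)] in simp_all)

lemma mor_eq_iff:
  assumes "\<alpha> \<in> Hom (ModC C) F G" "\<beta> \<in> Hom (ModC C) F G"
  shows "\<alpha> = \<beta> \<longleftrightarrow> (\<forall>Z\<in>Ob C. \<forall>x\<in>el F Z. app \<alpha> Z x = app \<beta> Z x)"
  using mor_eqI[OF assms] by auto

lemma cmp_eq_zero_iff:
  assumes "\<alpha> \<in> Hom (ModC C) F G" "\<beta> \<in> Hom (ModC C) G H"
  shows "\<beta> \<bullet> \<alpha> = zero_mor (ModC C) F H \<longleftrightarrow> (\<forall>Z\<in>Ob C. \<forall>x\<in>el F Z. app \<beta> Z (app \<alpha> Z x) = \<one>\<^bsub>grp H Z\<^esub>)"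
  using mor_eq_iff[OF ModC_cmp_Hom[OF assms] ModC_zero_Hom, of] Hom_presheaf[OF assms(1)] Hom_presheaf[OF assms(2)] assms
  by simp

section \<open>Images and kernels as families of subsets, ready for \<open>sub\<close> and
  \<open>quot\<close>\<close>

definition im :: "('o, 'm, 'u) presheaf_mor \<Rightarrow> 'o \<Rightarrow> 'u set" where
  "im \<alpha> Z = app \<alpha> Z ` el (fst \<alpha>) Z"

definition ker :: "('o, 'm, 'u) presheaf_mor \<Rightarrow> 'o \<Rightarrow> 'u set" where
  "ker \<alpha> Z = {x \<in> el (fst \<alpha>) Z. app \<alpha> Z x = \<one>\<^bsub>grp (snd (snd \<alpha>)) Z\<^esub>}"

lemma im_iff: "\<alpha> \<in> Hom (ModC C) F G \<Longrightarrow> im \<alpha> Z = app \<alpha> Z ` el F Z"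
  and ker_iff: "\<alpha> \<in> Hom (ModC C) F G \<Longrightarrow> x \<in> ker \<alpha> Z \<longleftrightarrow> x \<in> el F Z \<and> app \<alpha> Z x = \<one>\<^bsub>grp G Z\<^esub>"
  by (auto simp: im_def ker_def Hom_fst)

lemma im_subpresheaf:
  assumes \<alpha>: "\<alpha> \<in> Hom (ModC C) F G"
  shows "subpresheaf G (im \<alpha>)"
proof (rule subpresheafI)
  note p = Hom_presheaf[OF \<alpha>]
  show "is_presheaf C G" by (rule p)
  fix Z assume Z: "Z \<in> Ob C"
  show "im \<alpha> Z \<subseteq> el G Z" using \<alpha> Z by (auto simp: im_iff[OF \<alpha>])
  show "\<one>\<^bsub>grp G Z\<^esub> \<in> im \<alpha> Z"
    unfolding im_iff[OF \<alpha>] by (rule image_eqI[of _ _ "\<one>\<^bsub>grp F Z\<^esub>"]) (use \<alpha> Z p in simp_all)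
  fix x y assume "x \<in> im \<alpha> Z" "y \<in> im \<alpha> Z"
  then obtain a b where ab: "a \<in> el F Z" "b \<in> el F Z" "x = app \<alpha> Z a" "y = app \<alpha> Z b"
    by (auto simp: im_iff[OF \<alpha>])
  show "x \<otimes>\<^bsub>grp G Z\<^esub> inv\<^bsub>grp G Z\<^esub> y \<in> im \<alpha> Z"
    unfolding im_iff[OF \<alpha>] by (rule image_eqI[of _ _ "a \<otimes>\<^bsub>grp F Z\<^esub> inv\<^bsub>grp F Z\<^esub> b"]) (use \<alpha> Z p ab in simp_all)
next
  note p = Hom_presheaf[OF \<alpha>]
  fix f x assume f: "f \<in> Ar C" "x \<in> im \<alpha> (cod C f)"
  then obtain a where a: "a \<in> el F (cod C f)" "x = app \<alpha> (cod C f) a" by (auto simp: im_iff[OF \<alpha>])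
  show "res G f x \<in> im \<alpha> (dom C f)"
    unfolding im_iff[OF \<alpha>] by (rule image_eqI[of _ _ "res F f a"]) (use \<alpha> f p a in simp_all)
qed

lemma ker_subpresheaf:
  assumes \<alpha>: "\<alpha> \<in> Hom (ModC C) F G"
  shows "subpresheaf F (ker \<alpha>)"
  by (rule subpresheafI) (use \<alpha> Hom_presheaf[OF \<alpha>] in \<open>auto simp: ker_iff[OF \<alpha>]\<close>)

lemma short_exact_quot:
  assumes i: "i \<in> Hom (ModC C) K G" and inj: "\<And>Z. Z \<in> Ob C \<Longrightarrow> inj_on (app i Z) (el K Z)"
  shows "short_exact i (proj G (im i)) K G (quot G (im i))"
  using i inj Hom_presheaf[OF i] im_subpresheaf[OF i]
  by (simp add: short_exact_def proj_Hom proj_surj proj_eq_one im_iff[OF i])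

lemma short_exact_sub:
  assumes p: "p \<in> Hom (ModC C) G Q" and surj: "\<And>Z. Z \<in> Ob C \<Longrightarrow> app p Z ` el G Z = el Q Z"
  shows "short_exact (incl G (ker p)) p (sub G (ker p)) G Q"
  using p surj Hom_presheaf[OF p] ker_subpresheaf[OF p]
  by (auto simp: short_exact_def incl_Hom ker_iff[OF p] inj_on_def image_iff)

end

text \<open>Products are required because the universe need not contain all of them.\<close>

locale ext_closed = preadditive C for C :: "('o, 'm, 'x) addcat_scheme" (structure) +
  fixes S :: "('o, 'm, 'u) presheaf set"
  assumes S_presheaf: "F \<in> S \<Longrightarrow> is_presheaf C F"
    and S_zero: "\<exists>F\<in>S. \<forall>Z\<in>Ob C. el F Z = {\<one>\<^bsub>grp F Z\<^esub>}"
    and S_prod: "F \<in> S \<Longrightarrow> G \<in> S \<Longrightarrow> \<exists>B\<in>S. \<exists>p1\<in>Hom (ModC C) B F. \<exists>p2\<in>Hom (ModC C) B G.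
      \<forall>Z\<in>Ob C. bij_betw (\<lambda>x. (app p1 Z x, app p2 Z x)) (el B Z) (el F Z \<times> el G Z)"
    and S_ext: "short_exact i p K G Q \<Longrightarrow> K \<in> S \<Longrightarrow> Q \<in> S \<Longrightarrow> G \<in> S"
begin

abbreviation D :: "(('o, 'm, 'u) presheaf, ('o, 'm, 'u) presheaf_mor) excat" where
  "D \<equiv> full_subcategory (ModC C) S"

lemma Hom_D: "\<alpha> \<in> Hom D F G \<longleftrightarrow> \<alpha> \<in> Hom (ModC C) F G \<and> F \<in> S \<and> G \<in> S"
  by (simp add: Hom_full_subcategory)

lemma Ar_D: "\<alpha> \<in> Hom (ModC C) F G \<Longrightarrow> F \<in> S \<Longrightarrow> G \<in> S \<Longrightarrow> \<alpha> \<in> Ar D"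
  by (auto simp: Ar_full_subcategory Hom_fst)

lemma Ar_DE:
  assumes "\<alpha> \<in> Ar D"
  obtains F G where "\<alpha> \<in> Hom (ModC C) F G" "fst \<alpha> = F" "snd (snd \<alpha>) = G" "F \<in> S" "G \<in> S"
  using assms that[of "fst \<alpha>" "snd (snd \<alpha>)"] by (simp add: Ar_full_subcategory)

lemma D_preadditive: "preadditive_category D"
proof -
  interpret M: preadditive "ModC C :: (('o, 'm, 'u) presheaf, ('o, 'm, 'u) presheaf_mor) excat"
    by unfold_locales (rule ModC_preadditive)
  have "category D"
    unfolding category_def
  proof (intro conjI ballI allI impI)
    fix f assume "f \<in> Ar D"
    then obtain F G where f: "f \<in> Hom (ModC C) F G" "fst f = F" "snd (snd f) = G" "F \<in> S" "G \<in> S"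
      by (rule Ar_DE)
    then show "dom D f \<in> Ob D" "cod D f \<in> Ob D" using S_presheaf by simp_all
    have "f \<in> Ar (ModC C)" using f(1) by (simp add: Hom_def)
    then show "f \<cdot>\<^bsub>D\<^esub> ident D (dom D f) = f" "ident D (cod D f) \<cdot>\<^bsub>D\<^esub> f = f"
      using ModC_category unfolding category_def full_subcategory_simps by blast+
  next
    fix F assume "F \<in> Ob D"
    then show "ident D F \<in> Hom D F F" using ModC_ident_Hom[of F] by (simp add: Hom_D del: M.Hom_iff)
  next
    fix X Y Z f g assume "f \<in> Hom D X Y" "g \<in> Hom D Y Z"
    then show "g \<cdot>\<^bsub>D\<^esub> f \<in> Hom D X Z" unfolding Hom_D full_subcategory_simps using ModC_cmp_Hom by blast
  next
    fix W X Y Z f g h assume "f \<in> Hom D W X" "g \<in> Hom D X Y" "h \<in> Hom D Y Z"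
    then show "h \<cdot>\<^bsub>D\<^esub> (g \<cdot>\<^bsub>D\<^esub> f) = (h \<cdot>\<^bsub>D\<^esub> g) \<cdot>\<^bsub>D\<^esub> f"
      using ModC_category unfolding Hom_D full_subcategory_simps category_def by blast
  qed
  moreover have "Hom_group D F G = Hom_group (ModC C) F G" if "F \<in> S" "G \<in> S" for F G
    using that by (simp add: Hom_group_def Hom_full_subcategory)
  moreover have "comm_group (Hom_group (ModC C) F G)" if "F \<in> S" "G \<in> S" for F G
    using that ModC_comm_group S_presheaf by blast
  ultimately show ?thesis
    unfolding preadditive_category_def
  proof (intro conjI allI impI ballI)
    fix X Y Z f f' g assume "f \<in> Hom D X Y" "f' \<in> Hom D X Y" "g \<in> Hom D Y Z"
    then show "g \<cdot>\<^bsub>D\<^esub> add_mor D f f' = add_mor D (g \<cdot>\<^bsub>D\<^esub> f) (g \<cdot>\<^bsub>D\<^esub> f')"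
      unfolding Hom_D full_subcategory_simps using M.cmp_add by blast
  next
    fix X Y Z f g g' assume "f \<in> Hom D X Y" "g \<in> Hom D Y Z" "g' \<in> Hom D Y Z"
    then show "add_mor D g g' \<cdot>\<^bsub>D\<^esub> f = add_mor D (g \<cdot>\<^bsub>D\<^esub> f) (g' \<cdot>\<^bsub>D\<^esub> f)"
      unfolding Hom_D full_subcategory_simps using M.add_cmp by blast
  qed simp_all
qed

section \<open>Conflations between objects of \<open>S\<close>\<close>

lemma D_conflationI:
  assumes "short_exact i p K G Q" "K \<in> S" "Q \<in> S"
  shows "(i, p) \<in> conflations D"
  using assms S_ext[OF assms] short_exactD(1,2)[OF assms(1)] conflation_ModC_iff[of i K G p G Q]
  by (auto simp: full_subcategory_def Hom_fst)

lemma D_conflationE: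
  assumes "(i, p) \<in> conflations D"
  obtains K G Q where "short_exact i p K G Q" "K \<in> S" "G \<in> S" "Q \<in> S"
    "fst i = K" "snd (snd i) = G" "fst p = G" "snd (snd p) = Q"
proof -
  have c: "(i, p) \<in> conflations (ModC C)" and S: "fst i \<in> S" "snd (snd i) \<in> S" "snd (snd p) \<in> S"
    using assms by (auto simp: full_subcategory_def)
  from c have "i \<in> presheaf_mors C" "p \<in> presheaf_mors C" by (simp_all add: ModC_def)
  then have "i \<in> Hom (ModC C) (fst i) (snd (snd i))" "p \<in> Hom (ModC C) (fst p) (snd (snd p))"
    by (simp_all add: Hom_def)
  with c have "fst p = snd (snd i)" "short_exact i p (fst i) (snd (snd i)) (snd (snd p))"
    using conflation_ModC_iff by blast+
  then show ?thesis using that S by metis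
qed

lemma D_inflationI: "short_exact i p K G Q \<Longrightarrow> K \<in> S \<Longrightarrow> Q \<in> S \<Longrightarrow> inflation D i"
  and D_deflationI: "short_exact i p K G Q \<Longrightarrow> K \<in> S \<Longrightarrow> Q \<in> S \<Longrightarrow> deflation D p"
  using D_conflationI unfolding inflation_def deflation_def by blast+

lemma D_kernel:
  assumes se: "short_exact i p K G Q" and S: "K \<in> S" "G \<in> S" "Q \<in> S"
  shows "is_kernel D i p"
  unfolding is_kernel_def full_subcategory_simps ModC_simps
proof (intro conjI ballI impI)
  note i = short_exactD(1)[OF se] and p = short_exactD(2)[OF se]
  show "i \<in> Ar D" "p \<in> Ar D" using Ar_D i p S by blast+
  show "snd (snd i) = fst p" using i p by (simp add: Hom_fst)
  show "p \<bullet> i = zero_mor (ModC C) (fst i) (snd (snd p))"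
    unfolding Hom_fst[OF i] Hom_fst[OF p] cmp_eq_zero_iff[OF i p]
    using short_exact_zero[OF se] by simp
  fix g assume "g \<in> Ar D" and g2: "snd (snd g) = fst p \<and> p \<bullet> g = zero_mor (ModC C) (fst g) (snd (snd p))"
  obtain T where g: "g \<in> Hom (ModC C) T G" "fst g = T" "T \<in> S"
    using Ar_DE[OF \<open>g \<in> Ar D\<close>] g2 Hom_fst(1)[OF p] by metis
  have z: "app p Z (app g Z x) = \<one>\<^bsub>grp Q Z\<^esub>" if "Z \<in> Ob C" "x \<in> el T Z" for Z x
    using g2 cmp_eq_zero_iff[OF g(1) p] that by (simp add: Hom_fst[OF p] g(2))
  have "app g Z x \<in> app i Z ` el K Z" if "Z \<in> Ob C" "x \<in> el T Z" for Z x
    using short_exactD(4)[OF se that(1) app_el[OF g(1) that]] z[OF that] by simp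
  from factor_inj[OF i short_exactD(3)[OF se] g(1) this]
  obtain \<gamma> where \<gamma>: "\<gamma> \<in> Hom (ModC C) T K" "i \<bullet> \<gamma> = g" by blast
  show "\<exists>!h. h \<in> Hom D (fst g) (fst i) \<and> i \<bullet> h = g"
    unfolding g(2) Hom_fst[OF i]
  proof (rule ex1I[of _ \<gamma>])
    show "\<gamma> \<in> Hom D T K \<and> i \<bullet> \<gamma> = g" using \<gamma> g S by (simp add: Hom_D)
    fix h assume "h \<in> Hom D T K \<and> i \<bullet> h = g"
    then have h: "h \<in> Hom (ModC C) T K" "i \<bullet> h = g" by (auto simp: Hom_D)
    show "h = \<gamma>"
    proof (rule mor_eqI[OF h(1) \<gamma>(1)])
      fix Z x assume Z: "Z \<in> Ob C" "x \<in> el T Z"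
      have "app (i \<bullet> h) Z x = app (i \<bullet> \<gamma>) Z x" using h \<gamma> by simp
      then have e: "app i Z (app h Z x) = app i Z (app \<gamma> Z x)" using Z h(1) \<gamma>(1) by simp
      show "app h Z x = app \<gamma> Z x"
        by (rule inj_onD[OF short_exactD(3)[OF se Z(1)] e]) (use Z h(1) \<gamma>(1) in simp_all)
    qed
  qed
qed

lemma D_cokernel:
  assumes se: "short_exact i p K G Q" and S: "K \<in> S" "G \<in> S" "Q \<in> S"
  shows "is_cokernel D p i"
  unfolding is_cokernel_def full_subcategory_simps ModC_simps
proof (intro conjI ballI impI)
  note i = short_exactD(1)[OF se] and p = short_exactD(2)[OF se]
  show "i \<in> Ar D" "p \<in> Ar D" using Ar_D i p S by blast+
  show "fst p = snd (snd i)" using i p by (simp add: Hom_fst)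
  show "p \<bullet> i = zero_mor (ModC C) (fst i) (snd (snd p))"
    unfolding Hom_fst[OF i] Hom_fst[OF p] cmp_eq_zero_iff[OF i p]
    using short_exact_zero[OF se] by simp
  fix g assume "g \<in> Ar D" and g2: "fst g = snd (snd i) \<and> g \<bullet> i = zero_mor (ModC C) (fst i) (snd (snd g))"
  obtain T where g: "g \<in> Hom (ModC C) G T" "snd (snd g) = T" "T \<in> S"
    using Ar_DE[OF \<open>g \<in> Ar D\<close>] g2 Hom_fst(2)[OF i] by metis
  have z: "app g Z (app i Z x) = \<one>\<^bsub>grp T Z\<^esub>" if "Z \<in> Ob C" "x \<in> el K Z" for Z x
    using g2 cmp_eq_zero_iff[OF i g(1)] that by (simp add: Hom_fst[OF i] g(2))
  have z': "app g Z x = \<one>\<^bsub>grp T Z\<^esub>" if "Z \<in> Ob C" "x \<in> el G Z" "app p Z x = \<one>\<^bsub>grp Q Z\<^esub>" for Z x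
    using short_exactD(4)[OF se that(1,2)] that z by auto
  from factor_surj[OF p short_exactD(5)[OF se] g(1) z']
  obtain \<gamma> where \<gamma>: "\<gamma> \<in> Hom (ModC C) Q T" "\<gamma> \<bullet> p = g" by blast
  show "\<exists>!h. h \<in> Hom D (snd (snd p)) (snd (snd g)) \<and> h \<bullet> p = g"
    unfolding g(2) Hom_fst[OF p]
  proof (rule ex1I[of _ \<gamma>])
    show "\<gamma> \<in> Hom D Q T \<and> \<gamma> \<bullet> p = g" using \<gamma> g S by (simp add: Hom_D)
    fix h assume "h \<in> Hom D Q T \<and> h \<bullet> p = g"
    then have h: "h \<in> Hom (ModC C) Q T" "h \<bullet> p = g" by (auto simp: Hom_D)
    show "h = \<gamma>"
    proof (rule mor_eqI[OF h(1) \<gamma>(1)])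
      fix Z y assume Z: "Z \<in> Ob C" "y \<in> el Q Z"
      then obtain x where x: "x \<in> el G Z" "y = app p Z x" using short_exactD(5)[OF se] by blast
      have "app (h \<bullet> p) Z x = app (\<gamma> \<bullet> p) Z x" using h \<gamma> by simp
      then show "app h Z y = app \<gamma> Z y" using x Z p by simp
    qed
  qed
qed

lemma iso_bij:
  assumes a: "iso_mor D a" "a \<in> Hom (ModC C) F G" and Z: "Z \<in> Ob C"
  shows "bij_betw (app a Z) (el F Z) (el G Z)"
proof -
  obtain b where b: "b \<in> Hom (ModC C) G F" "b \<bullet> a = ident (ModC C) F" "a \<bullet> b = ident (ModC C) G"
    using a unfolding iso_mor_def by (auto simp: Hom_D Hom_fst)
  have "app b Z (app a Z x) = x" if "x \<in> el F Z" for x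
    using arg_cong[OF b(2), of "\<lambda>\<gamma>. app \<gamma> Z x"] a(2) that Z by simp
  moreover have "app a Z (app b Z x) = x" if "x \<in> el G Z" for x
    using arg_cong[OF b(3), of "\<lambda>\<gamma>. app \<gamma> Z x"] b(1) that Z by simp
  ultimately show ?thesis
    using a b(1) Z by (intro bij_betw_byWitness[where f'="app b Z"]) auto
qed

text \<open>Isomorphisms are bijective on elements at each object, so injectivity, the kernel
  condition and surjectivity carry over along the ladder.\<close>

lemma D_conflation_iso:
  assumes se: "short_exact i p K G Q" and i': "i' \<in> Hom (ModC C) K' G'" and p': "p' \<in> Hom (ModC C) G' Q'"
    and abc: "a \<in> Hom (ModC C) K K'" "b \<in> Hom (ModC C) G G'" "c \<in> Hom (ModC C) Q Q'"
      "iso_mor D a" "iso_mor D b" "iso_mor D c"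
    and eq: "b \<bullet> i = i' \<bullet> a" "c \<bullet> p = p' \<bullet> b"
  shows "short_exact i' p' K' G' Q'"
  unfolding short_exact_def
proof (intro conjI ballI)
  note i = short_exactD(1)[OF se] and p = short_exactD(2)[OF se]
  fix Z assume Z: "Z \<in> Ob C"
  note ba = iso_bij[OF abc(4,1) Z] and bb = iso_bij[OF abc(5,2) Z] and bc = iso_bij[OF abc(6,3) Z]
  have e1: "app b Z (app i Z x) = app i' Z (app a Z x)" if "x \<in> el K Z" for x
    using arg_cong[OF eq(1), of "\<lambda>\<gamma>. app \<gamma> Z x"] i abc that Z by simp
  have e2: "app c Z (app p Z x) = app p' Z (app b Z x)" if "x \<in> el G Z" for x
    using arg_cong[OF eq(2), of "\<lambda>\<gamma>. app \<gamma> Z x"] p abc that Z by simp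
  have subK: "app i Z ` el K Z \<subseteq> el G Z" using i Z by (simp add: image_subset_iff)
  show "inj_on (app i' Z) (el K' Z)"
  proof (rule inj_onI)
    fix x y assume xy: "x \<in> el K' Z" "y \<in> el K' Z" "app i' Z x = app i' Z y"
    obtain x0 where 1: "x0 \<in> el K Z" "x = app a Z x0"
      using bij_betw_imp_surj_on[OF ba] xy(1) by blast
    obtain y0 where 2: "y0 \<in> el K Z" "y = app a Z y0"
      using bij_betw_imp_surj_on[OF ba] xy(2) by blast
    note 0 = 1(1) 2(1) 1(2) 2(2)
    have e: "app b Z (app i Z x0) = app b Z (app i Z y0)" using xy(3) e1 0 by metis
    have "app i Z x0 = app i Z y0"
      by (rule inj_onD[OF bij_betw_imp_inj_on[OF bb] e]) (use i Z 0(1,2) in simp_all)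
    then show "x = y" using inj_onD[OF short_exactD(3)[OF se Z]] 0 by blast
  qed
  show "app p' Z ` el G' Z = el Q' Z"
  proof -
    have "app p' Z ` el G' Z = app p' Z ` app b Z ` el G Z" using bb by (simp add: bij_betw_def)
    also have "\<dots> = app c Z ` app p Z ` el G Z" using e2 by (auto simp: image_image)
    also have "\<dots> = el Q' Z" using short_exactD(5)[OF se Z] bc by (simp add: bij_betw_def)
    finally show ?thesis .
  qed
  fix y assume y: "y \<in> el G' Z"
  then obtain x where x: "x \<in> el G Z" "y = app b Z x" using bb by (metis bij_betw_def imageE)
  have "app p' Z y = \<one>\<^bsub>grp Q' Z\<^esub> \<longleftrightarrow> app c Z (app p Z x) = app c Z \<one>\<^bsub>grp Q Z\<^esub>"
    using x e2 abc Z by simp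
  also have "\<dots> \<longleftrightarrow> app p Z x = \<one>\<^bsub>grp Q Z\<^esub>"
    using inj_on_eq_iff[OF bij_betw_imp_inj_on[OF bc]] p x Z Hom_presheaf[OF p] by simp
  also have "\<dots> \<longleftrightarrow> x \<in> app i Z ` el K Z" by (rule short_exactD(4)[OF se Z x(1)])
  also have "\<dots> \<longleftrightarrow> y \<in> app b Z ` app i Z ` el K Z"
    using inj_on_image_mem_iff[OF bij_betw_imp_inj_on[OF bb] x(1) subK] x by simp
  also have "app b Z ` app i Z ` el K Z = app i' Z ` app a Z ` el K Z" using e1 by (auto simp: image_image)
  also have "\<dots> = app i' Z ` el K' Z" using ba by (simp add: bij_betw_def)
  finally show "app p' Z y = \<one>\<^bsub>grp Q' Z\<^esub> \<longleftrightarrow> y \<in> app i' Z ` el K' Z" .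
qed (use i' p' in simp_all)

section \<open>Zero object and biproducts\<close>

lemma S_zeroE:
  obtains O' where "O' \<in> S" "\<And>Z. Z \<in> Ob C \<Longrightarrow> el O' Z = {\<one>\<^bsub>grp O' Z\<^esub>}"
  using S_zero by metis

lemma D_zero_object:
  assumes O: "O' \<in> S" "\<And>Z. Z \<in> Ob C \<Longrightarrow> el O' Z = {\<one>\<^bsub>grp O' Z\<^esub>}"
  shows "zero_object D O'"
proof -
  interpret D: preadditive D by unfold_locales (rule D_preadditive)
  have pO: "is_presheaf C O'" using O S_presheaf by blast
  have "ident (ModC C) O' = zero_mor (ModC C) O' O'"
    by (rule mor_eqI[OF ModC_ident_Hom ModC_zero_Hom]) (use pO O in auto)
  then show ?thesis using O pO by (intro D.zero_objectI) simp_all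
qed

text \<open>Biproduct data on elements. The last clause says that the projections are jointly
  injective; identities in \<open>B\<close> are checked coordinatewise through it.\<close>

definition prod_of ::
  "('o, 'm, 'u) presheaf \<Rightarrow> ('o, 'm, 'u) presheaf \<Rightarrow> ('o, 'm, 'u) presheaf \<Rightarrow> ('o, 'm, 'u) presheaf_mor \<Rightarrow>
   ('o, 'm, 'u) presheaf_mor \<Rightarrow> ('o, 'm, 'u) presheaf_mor \<Rightarrow> ('o, 'm, 'u) presheaf_mor \<Rightarrow> bool" where
  "prod_of F G B p1 p2 j1 j2 \<longleftrightarrow> B \<in> S \<and> p1 \<in> Hom (ModC C) B F \<and> p2 \<in> Hom (ModC C) B G \<and>
     j1 \<in> Hom (ModC C) F B \<and> j2 \<in> Hom (ModC C) G B \<and>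
     (\<forall>Z\<in>Ob C. \<forall>x\<in>el F Z. app p1 Z (app j1 Z x) = x \<and> app p2 Z (app j1 Z x) = \<one>\<^bsub>grp G Z\<^esub>) \<and>
     (\<forall>Z\<in>Ob C. \<forall>x\<in>el G Z. app p1 Z (app j2 Z x) = \<one>\<^bsub>grp F Z\<^esub> \<and> app p2 Z (app j2 Z x) = x) \<and>
     (\<forall>Z\<in>Ob C. \<forall>x\<in>el B Z. \<forall>y\<in>el B Z. app p1 Z x = app p1 Z y \<longrightarrow> app p2 Z x = app p2 Z y \<longrightarrow> x = y)"

lemma prod_ofD:
  assumes "prod_of F G B p1 p2 j1 j2"
  shows "B \<in> S" "p1 \<in> Hom (ModC C) B F" "p2 \<in> Hom (ModC C) B G"
    "j1 \<in> Hom (ModC C) F B" "j2 \<in> Hom (ModC C) G B"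
    "Z \<in> Ob C \<Longrightarrow> x \<in> el F Z \<Longrightarrow> app p1 Z (app j1 Z x) = x"
    "Z \<in> Ob C \<Longrightarrow> x \<in> el F Z \<Longrightarrow> app p2 Z (app j1 Z x) = \<one>\<^bsub>grp G Z\<^esub>"
    "Z \<in> Ob C \<Longrightarrow> y \<in> el G Z \<Longrightarrow> app p1 Z (app j2 Z y) = \<one>\<^bsub>grp F Z\<^esub>"
    "Z \<in> Ob C \<Longrightarrow> y \<in> el G Z \<Longrightarrow> app p2 Z (app j2 Z y) = y"
    "Z \<in> Ob C \<Longrightarrow> b \<in> el B Z \<Longrightarrow> b' \<in> el B Z \<Longrightarrow> app p1 Z b = app p1 Z b' \<Longrightarrow> app p2 Z b = app p2 Z b' \<Longrightarrow> b = b'"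
  using assms by (simp_all add: prod_of_def)

text \<open>\<open>S_prod\<close> gives projections only. The element \<open>u Z x y\<close> with
  coordinates \<open>x\<close> and \<open>y\<close> is unique, and this uniqueness makes the
  injections homomorphic and natural.\<close>

lemma obtain_prod:
  assumes F: "F \<in> S" and G: "G \<in> S"
  obtains B p1 p2 j1 j2 where "prod_of F G B p1 p2 j1 j2"
proof -
  obtain B p1 p2 where B: "B \<in> S" and p1: "p1 \<in> Hom (ModC C) B F" and p2: "p2 \<in> Hom (ModC C) B G"
    and bij: "\<And>Z. Z \<in> Ob C \<Longrightarrow> bij_betw (\<lambda>x. (app p1 Z x, app p2 Z x)) (el B Z) (el F Z \<times> el G Z)"
    using S_prod[OF F G] by blast
  note p = Hom_presheaf[OF p1] Hom_presheaf[OF p2]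
  have eq: "x = y" if "Z \<in> Ob C" "x \<in> el B Z" "y \<in> el B Z" "app p1 Z x = app p1 Z y" "app p2 Z x = app p2 Z y" for Z x y
    using bij_betw_imp_inj_on[OF bij[OF that(1)]] that by (auto dest: inj_onD)
  define u where "u Z x y = (SOME b. b \<in> el B Z \<and> app p1 Z b = x \<and> app p2 Z b = y)" for Z x y
  have u: "u Z x y \<in> el B Z \<and> app p1 Z (u Z x y) = x \<and> app p2 Z (u Z x y) = y"
    if "Z \<in> Ob C" "x \<in> el F Z" "y \<in> el G Z" for Z x y
  proof -
    have "(x, y) \<in> (\<lambda>x. (app p1 Z x, app p2 Z x)) ` el B Z"
      using bij[OF that(1)] that by (simp add: bij_betw_def)
    then have "\<exists>b. b \<in> el B Z \<and> app p1 Z b = x \<and> app p2 Z b = y" by auto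
    then show ?thesis unfolding u_def by (rule someI_ex)
  qed
  have j1: "mor F B (\<lambda>Z x. u Z x \<one>\<^bsub>grp G Z\<^esub>) \<in> Hom (ModC C) F B"
  proof (rule mor_Hom)
    fix Z x y assume Z: "Z \<in> Ob C" "x \<in> el F Z" "y \<in> el F Z"
    show "u Z (x \<otimes>\<^bsub>grp F Z\<^esub> y) \<one>\<^bsub>grp G Z\<^esub> = u Z x \<one>\<^bsub>grp G Z\<^esub> \<otimes>\<^bsub>grp B Z\<^esub> u Z y \<one>\<^bsub>grp G Z\<^esub>"
      by (rule eq[OF Z(1)]) (use Z u p p1 p2 in simp_all)
  next
    fix f x assume f: "f \<in> Ar C" "x \<in> el F (cod C f)"
    show "u (dom C f) (res F f x) \<one>\<^bsub>grp G (dom C f)\<^esub> = res B f (u (cod C f) x \<one>\<^bsub>grp G (cod C f)\<^esub>)"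
      by (rule eq[of "dom C f"]) (use f u p p1 p2 in simp_all)
  qed (use p u in simp_all)
  have j2: "mor G B (\<lambda>Z x. u Z \<one>\<^bsub>grp F Z\<^esub> x) \<in> Hom (ModC C) G B"
  proof (rule mor_Hom)
    fix Z x y assume Z: "Z \<in> Ob C" "x \<in> el G Z" "y \<in> el G Z"
    show "u Z \<one>\<^bsub>grp F Z\<^esub> (x \<otimes>\<^bsub>grp G Z\<^esub> y) = u Z \<one>\<^bsub>grp F Z\<^esub> x \<otimes>\<^bsub>grp B Z\<^esub> u Z \<one>\<^bsub>grp F Z\<^esub> y"
      by (rule eq[OF Z(1)]) (use Z u p p1 p2 in simp_all)
  next
    fix f x assume f: "f \<in> Ar C" "x \<in> el G (cod C f)"
    show "u (dom C f) \<one>\<^bsub>grp F (dom C f)\<^esub> (res G f x) = res B f (u (cod C f) \<one>\<^bsub>grp F (cod C f)\<^esub> x)"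
      by (rule eq[of "dom C f"]) (use f u p p1 p2 in simp_all)
  qed (use p u in simp_all)
  have "\<forall>Z\<in>Ob C. \<forall>x\<in>el B Z. \<forall>y\<in>el B Z. app p1 Z x = app p1 Z y \<longrightarrow> app p2 Z x = app p2 Z y \<longrightarrow> x = y"
    using eq by blast
  with B p1 p2 j1 j2 u p show ?thesis
    by (intro that[of B p1 p2 "mor F B (\<lambda>Z x. u Z x \<one>\<^bsub>grp G Z\<^esub>)" "mor G B (\<lambda>Z x. u Z \<one>\<^bsub>grp F Z\<^esub> x)"])
       (simp add: prod_of_def)
qed

lemma D_biproduct:
  assumes "F \<in> S" "G \<in> S"
  shows "\<exists>B\<in>Ob D. \<exists>i1 i2 p1 p2. biproduct D F G B i1 i2 p1 p2"
proof -
  obtain B p1 p2 j1 j2 where pr: "prod_of F G B p1 p2 j1 j2"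
    using obtain_prod[OF assms] by blast
  note B = prod_ofD(1-5)[OF pr] and e = prod_ofD(6-10)[OF pr]
  note p = S_presheaf[OF assms(1)] S_presheaf[OF assms(2)] S_presheaf[OF B(1)]
  note H1 = ModC_cmp_Hom[OF B(2) B(4)] and H2 = ModC_cmp_Hom[OF B(3) B(5)]
  have "biproduct D F G B j1 j2 p1 p2"
    unfolding biproduct_def full_subcategory_simps
  proof (intro conjI)
    show "p1 \<bullet> j1 = ident (ModC C) F"
      by (rule mor_eqI[OF ModC_cmp_Hom[OF B(4,2)] ModC_ident_Hom]) (use p B e in simp_all)
    show "p2 \<bullet> j2 = ident (ModC C) G"
      by (rule mor_eqI[OF ModC_cmp_Hom[OF B(5,3)] ModC_ident_Hom]) (use p B e in simp_all)
    show "p2 \<bullet> j1 = zero_mor (ModC C) F G"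
      by (rule mor_eqI[OF ModC_cmp_Hom[OF B(4,3)] ModC_zero_Hom]) (use p B e in simp_all)
    show "p1 \<bullet> j2 = zero_mor (ModC C) G F"
      by (rule mor_eqI[OF ModC_cmp_Hom[OF B(5,2)] ModC_zero_Hom]) (use p B e in simp_all)
    show "add_mor (ModC C) (j1 \<bullet> p1) (j2 \<bullet> p2) = ident (ModC C) B"
    proof (rule mor_eqI[OF ModC_add_Hom[OF H1 H2] ModC_ident_Hom[OF p(3)]])
      fix Z x assume Z: "Z \<in> Ob C" "x \<in> el B Z"
      show "app (add_mor (ModC C) (j1 \<bullet> p1) (j2 \<bullet> p2)) Z x = app (ident (ModC C) B) Z x"
        using Z B p e by (simp add: app_add[OF H1])
    qed
  qed (use B assms in \<open>simp_all add: Hom_D\<close>)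
  then show ?thesis using B(1) p(3) by (intro bexI[of _ B] exI) simp_all
qed

text \<open>Noether's isomorphism: the cokernel of the composite is an extension of \<open>R\<close>
  by \<open>Q\<close>, and so it lies in \<open>S\<close>.\<close>

lemma D_cmp_inflation:
  assumes ip: "short_exact i p F G Q" and jq: "short_exact j q G H R" and S: "Q \<in> S" "R \<in> S"
  shows "\<exists>r Q'. short_exact (j \<bullet> i) r F H Q' \<and> Q' \<in> S"
proof -
  note i = short_exactD(1)[OF ip] and p = short_exactD(2)[OF ip]
    and j = short_exactD(1)[OF jq] and q = short_exactD(2)[OF jq]
  note ps = Hom_presheaf[OF i] Hom_presheaf[OF p] Hom_presheaf[OF j] Hom_presheaf[OF q]
  note ji = ModC_cmp_Hom[OF i j]
  define Q' where "Q' = quot H (im (j \<bullet> i))"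
  define \<pi> where "\<pi> = proj H (im (j \<bullet> i))"
  have inj: "inj_on (app (j \<bullet> i) Z) (el F Z)" if Z: "Z \<in> Ob C" for Z
    using short_exactD(3)[OF ip Z] short_exactD(3)[OF jq Z] i Z by (simp add: inj_on_def)
  have se: "short_exact (j \<bullet> i) \<pi> F H Q'"
    unfolding \<pi>_def Q'_def by (rule short_exact_quot[OF ji inj])
  note \<pi> = short_exactD(2)[OF se]
  have ker: "app \<pi> Z (app j Z y) = \<one>\<^bsub>grp Q' Z\<^esub> \<longleftrightarrow> app p Z y = \<one>\<^bsub>grp Q Z\<^esub>" if Z: "Z \<in> Ob C" "y \<in> el G Z" for Z y
  proof -
    have "app \<pi> Z (app j Z y) = \<one>\<^bsub>grp Q' Z\<^esub> \<longleftrightarrow> app j Z y \<in> app j Z ` app i Z ` el F Z"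
      using short_exactD(4)[OF se Z(1), of "app j Z y"] i j Z by (auto simp: image_image)
    also have "\<dots> \<longleftrightarrow> y \<in> app i Z ` el F Z"
      using i Z by (intro inj_on_image_mem_iff[OF short_exactD(3)[OF jq Z(1)] Z(2)]) (simp add: image_subset_iff)
    also have "\<dots> \<longleftrightarrow> app p Z y = \<one>\<^bsub>grp Q Z\<^esub>" using short_exactD(4)[OF ip Z] by simp
    finally show ?thesis .
  qed
  have "app (\<pi> \<bullet> j) Z y = \<one>\<^bsub>grp Q' Z\<^esub>" if "Z \<in> Ob C" "y \<in> el G Z" "app p Z y = \<one>\<^bsub>grp Q Z\<^esub>" for Z y
    using that ker j by simp
  from factor_surj[OF p short_exactD(5)[OF ip] ModC_cmp_Hom[OF j \<pi>] this]
  obtain \<alpha> where \<alpha>: "\<alpha> \<in> Hom (ModC C) Q Q'"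
    "\<And>Z x. Z \<in> Ob C \<Longrightarrow> x \<in> el G Z \<Longrightarrow> app \<alpha> Z (app p Z x) = app (\<pi> \<bullet> j) Z x" by blast
  then have \<alpha>': "app \<alpha> Z (app p Z x) = app \<pi> Z (app j Z x)" if "Z \<in> Ob C" "x \<in> el G Z" for Z x
    using that j by simp
  have qz: "app q Z y = \<one>\<^bsub>grp R Z\<^esub>" if Z: "Z \<in> Ob C" "y \<in> el H Z" "app \<pi> Z y = \<one>\<^bsub>grp Q' Z\<^esub>" for Z y
  proof -
    obtain x where "x \<in> el F Z" "y = app j Z (app i Z x)"
      using short_exact_kernelE[OF se Z] i Z by (metis app_cmp)
    then show ?thesis using short_exact_zero[OF jq Z(1)] i Z by simp
  qed
  from factor_surj[OF \<pi> short_exactD(5)[OF se] q qz]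
  obtain \<beta> where \<beta>: "\<beta> \<in> Hom (ModC C) Q' R"
    "\<And>Z x. Z \<in> Ob C \<Longrightarrow> x \<in> el H Z \<Longrightarrow> app \<beta> Z (app \<pi> Z x) = app q Z x" by blast
  have "short_exact \<alpha> \<beta> Q Q' R"
    unfolding short_exact_def
  proof (intro conjI ballI)
    fix Z assume Z: "Z \<in> Ob C"
    show "inj_on (app \<alpha> Z) (el Q Z)"
    proof (rule inj_onI_one[OF \<alpha>(1) Z])
      fix x assume x: "x \<in> el Q Z" "app \<alpha> Z x = \<one>\<^bsub>grp Q' Z\<^esub>"
      obtain y where "y \<in> el G Z" "x = app p Z y" using short_exact_surjE[OF ip Z x(1)] .
      then show "x = \<one>\<^bsub>grp Q Z\<^esub>" using x(2) \<alpha>'[OF Z] ker[OF Z] by metis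
    qed
    have "app \<beta> Z ` el Q' Z = app \<beta> Z ` app \<pi> Z ` el H Z" using short_exactD(5)[OF se Z] by simp
    also have "\<dots> = app q Z ` el H Z" using \<beta>(2)[OF Z] by (simp add: image_image)
    also have "\<dots> = el R Z" using short_exactD(5)[OF jq Z] .
    finally show "app \<beta> Z ` el Q' Z = el R Z" .
    fix z assume "z \<in> el Q' Z"
    then obtain y where y: "y \<in> el H Z" "z = app \<pi> Z y" using short_exactD(5)[OF se Z] by blast
    show "app \<beta> Z z = \<one>\<^bsub>grp R Z\<^esub> \<longleftrightarrow> z \<in> app \<alpha> Z ` el Q Z"
    proof
      assume "app \<beta> Z z = \<one>\<^bsub>grp R Z\<^esub>"
      then obtain x where "x \<in> el G Z" "y = app j Z x"
        using short_exactD(4)[OF jq Z y(1)] \<beta>(2)[OF Z y(1)] y by auto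
      then show "z \<in> app \<alpha> Z ` el Q Z" using \<alpha>'[OF Z] y p Z by (metis app_el image_eqI)
    next
      assume "z \<in> app \<alpha> Z ` el Q Z"
      then obtain u where u: "u \<in> el Q Z" "z = app \<alpha> Z u" by blast
      obtain x where "x \<in> el G Z" "u = app p Z x" using short_exact_surjE[OF ip Z u(1)] .
      then have "x \<in> el G Z" "z = app \<pi> Z (app j Z x)" using u \<alpha>'[OF Z] by simp_all
      then show "app \<beta> Z z = \<one>\<^bsub>grp R Z\<^esub>" using \<beta>(2)[OF Z] short_exact_zero[OF jq Z] j Z by simp
    qed
  qed (use \<alpha> \<beta> in simp_all)
  then have "Q' \<in> S" using S_ext S by blast
  then show ?thesis using se by blast
qed

text \<open>The kernel of the composite is an extension of \<open>L\<close> by \<open>K\<close>, and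
  so it lies in \<open>S\<close>.\<close>

lemma D_cmp_deflation:
  assumes kp: "short_exact k p K F G" and lq: "short_exact l q L G H" and S: "K \<in> S" "L \<in> S"
  shows "\<exists>n N. short_exact n (q \<bullet> p) N F H \<and> N \<in> S"
proof -
  note k = short_exactD(1)[OF kp] and p = short_exactD(2)[OF kp]
    and l = short_exactD(1)[OF lq] and q = short_exactD(2)[OF lq]
  note ps = Hom_presheaf[OF k] Hom_presheaf[OF p] Hom_presheaf[OF l] Hom_presheaf[OF q]
  note qp = ModC_cmp_Hom[OF p q]
  have surj: "app (q \<bullet> p) Z ` el F Z = el H Z" if Z: "Z \<in> Ob C" for Z
  proof -
    have "app (q \<bullet> p) Z ` el F Z = app q Z ` app p Z ` el F Z"
      using p Z by (auto simp: image_image)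
    then show ?thesis using short_exactD(5)[OF kp Z] short_exactD(5)[OF lq Z] by simp
  qed
  define N where "N = sub F (ker (q \<bullet> p))"
  define n where "n = incl F (ker (q \<bullet> p))"
  have se: "short_exact n (q \<bullet> p) N F H"
    unfolding n_def N_def by (rule short_exact_sub[OF qp surj])
  note n = short_exactD(1)[OF se]
  have elN: "x \<in> el N Z \<longleftrightarrow> x \<in> el F Z \<and> app q Z (app p Z x) = \<one>\<^bsub>grp H Z\<^esub>" if "Z \<in> Ob C" for Z x
    using that p by (auto simp: N_def ker_iff[OF qp])
  have an: "app n Z x = x" if "Z \<in> Ob C" "x \<in> el N Z" for Z x
    using that by (simp add: n_def N_def)
  have "app k Z x \<in> ker (q \<bullet> p) Z" if "Z \<in> Ob C" "x \<in> el K Z" for Z x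
    using that k q p short_exact_zero[OF kp that] by (simp add: ker_iff[OF qp])
  then obtain \<alpha> where \<alpha>: "\<alpha> \<in> Hom (ModC C) K N" "\<And>Z x. Z \<in> Ob C \<Longrightarrow> x \<in> el K Z \<Longrightarrow> app \<alpha> Z x = app k Z x"
    using corestrict[OF k ker_subpresheaf[OF qp]] unfolding N_def by metis
  note pn = ModC_cmp_Hom[OF n p]
  have "app (p \<bullet> n) Z x \<in> app l Z ` el L Z" if Z: "Z \<in> Ob C" "x \<in> el N Z" for Z x
    using short_exactD(4)[OF lq Z(1), of "app p Z x"] Z elN[OF Z(1)] an[OF Z] n p by simp
  from factor_inj[OF l short_exactD(3)[OF lq] pn this]
  obtain \<beta> where \<beta>0: "\<beta> \<in> Hom (ModC C) N L"
    "\<And>Z x. Z \<in> Ob C \<Longrightarrow> x \<in> el N Z \<Longrightarrow> app l Z (app \<beta> Z x) = app (p \<bullet> n) Z x" by blast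
  then have \<beta>: "\<beta> \<in> Hom (ModC C) N L"
    "\<And>Z x. Z \<in> Ob C \<Longrightarrow> x \<in> el N Z \<Longrightarrow> app l Z (app \<beta> Z x) = app p Z x"
    using an n by simp_all
  have "short_exact \<alpha> \<beta> K N L"
    unfolding short_exact_def
  proof (intro conjI ballI)
    fix Z assume Z: "Z \<in> Ob C"
    show "inj_on (app \<alpha> Z) (el K Z)"
      using short_exactD(3)[OF kp Z] \<alpha>(2)[OF Z] by (simp add: inj_on_def)
    show "app \<beta> Z ` el N Z = el L Z"
    proof (intro equalityI subsetI)
      fix y assume y: "y \<in> el L Z"
      then have "app l Z y \<in> el G Z" using l Z by simp
      then obtain x where x: "x \<in> el F Z" "app p Z x = app l Z y" using short_exactD(5)[OF kp Z] by (metis imageE)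
      then have xN: "x \<in> el N Z" using elN[OF Z] short_exact_zero[OF lq Z y] by simp
      have "app \<beta> Z x = y"
        by (rule inj_onD[OF short_exactD(3)[OF lq Z]]) (use \<beta> Z xN x y in simp_all)
      then show "y \<in> app \<beta> Z ` el N Z" using xN by blast
    qed (use \<beta>(1) Z in auto)
    fix x assume x: "x \<in> el N Z"
    have "app \<beta> Z x = \<one>\<^bsub>grp L Z\<^esub> \<longleftrightarrow> app l Z (app \<beta> Z x) = app l Z \<one>\<^bsub>grp L Z\<^esub>"
      using inj_on_eq_iff[OF short_exactD(3)[OF lq Z]] \<beta>(1) x Z ps by simp
    also have "\<dots> \<longleftrightarrow> app p Z x = \<one>\<^bsub>grp G Z\<^esub>" using \<beta>(2) Z x l by simp
    also have "\<dots> \<longleftrightarrow> x \<in> app k Z ` el K Z" using short_exactD(4)[OF kp Z] elN[OF Z] x by simp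
    finally show "app \<beta> Z x = \<one>\<^bsub>grp L Z\<^esub> \<longleftrightarrow> x \<in> app \<alpha> Z ` el K Z" using \<alpha>(2)[OF Z] by auto
  qed (use \<alpha> \<beta> in simp_all)
  then have "N \<in> S" using S_ext S by blast
  then show ?thesis using se by blast
qed

text \<open>The pushout is the quotient of the product of \<open>G\<close> and \<open>F'\<close> by
  the antidiagonal copy \<open>\<delta>\<close> of \<open>F\<close>. It is an extension of
  \<open>Q\<close> by \<open>F'\<close>, which puts it into \<open>S\<close> and makes the map from
  \<open>F'\<close> an inflation.\<close>

lemma D_pushout:
  assumes ip: "short_exact i p F G Q" and S: "F \<in> S" "Q \<in> S" and f: "f \<in> Hom (ModC C) F F'" "F' \<in> S"
  shows "\<exists>i' f'. is_pushout D i f i' f' \<and> inflation D i'"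
proof -
  note i = short_exactD(1)[OF ip] and p = short_exactD(2)[OF ip]
  have GS: "G \<in> S" by (rule S_ext[OF ip S])
  obtain B p1 p2 j1 j2 where pr: "prod_of G F' B p1 p2 j1 j2"
    using obtain_prod[OF GS f(2)] by blast
  note B = prod_ofD(1)[OF pr] and p1 = prod_ofD(2)[OF pr] and p2 = prod_ofD(3)[OF pr]
    and j1 = prod_ofD(4)[OF pr] and j2 = prod_ofD(5)[OF pr] and e = prod_ofD(6-9)[OF pr] and eq = prod_ofD(10)[OF pr]
  note ps = S_presheaf[OF S(1)] S_presheaf[OF GS] S_presheaf[OF S(2)] S_presheaf[OF f(2)] S_presheaf[OF B]
  have dec: "b = app j1 Z (app p1 Z b) \<otimes>\<^bsub>grp B Z\<^esub> app j2 Z (app p2 Z b)" if "Z \<in> Ob C" "b \<in> el B Z" for Z b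
    by (rule eq[OF that(1)]) (use that p1 p2 j1 j2 e ps in simp_all)
  define \<delta> where "\<delta> = mor F B (\<lambda>Z x. app j1 Z (app i Z x) \<otimes>\<^bsub>grp B Z\<^esub> inv\<^bsub>grp B Z\<^esub> app j2 Z (app f Z x))"
  have \<delta>: "\<delta> \<in> Hom (ModC C) F B"
    unfolding \<delta>_def by (rule mor_Hom) (use i j1 j2 f ps in \<open>simp_all add: el_inv_mult el_interchange\<close>)
  have a\<delta>: "app \<delta> Z x = app j1 Z (app i Z x) \<otimes>\<^bsub>grp B Z\<^esub> inv\<^bsub>grp B Z\<^esub> app j2 Z (app f Z x)"
    if "Z \<in> Ob C" "x \<in> el F Z" for Z x using that by (simp add: \<delta>_def)
  have dinj: "inj_on (app \<delta> Z) (el F Z)" if Z: "Z \<in> Ob C" for Z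
  proof (rule inj_onI_one[OF \<delta> Z])
    fix x assume x: "x \<in> el F Z" "app \<delta> Z x = \<one>\<^bsub>grp B Z\<^esub>"
    have "app p1 Z (app \<delta> Z x) = app i Z x" using x(1) Z p1 j1 j2 i f e ps by (simp add: a\<delta>)
    then have "app i Z x = \<one>\<^bsub>grp G Z\<^esub>" using x(2) p1 Z by simp
    then show "x = \<one>\<^bsub>grp F Z\<^esub>" using inj_one[OF i Z short_exactD(3)[OF ip Z] x(1)] by simp
  qed
  define P where "P = quot B (im \<delta>)"
  define \<pi> where "\<pi> = proj B (im \<delta>)"
  have se: "short_exact \<delta> \<pi> F B P"
    unfolding \<pi>_def P_def by (rule short_exact_quot[OF \<delta> dinj])
  note \<pi> = short_exactD(2)[OF se]
  have pP: "is_presheaf C P" by (rule Hom_presheaf(2)[OF \<pi>])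
  note i' = ModC_cmp_Hom[OF j2 \<pi>] and f' = ModC_cmp_Hom[OF j1 \<pi>]
  have "app (p \<bullet> p1) Z b = \<one>\<^bsub>grp Q Z\<^esub>" if Z: "Z \<in> Ob C" "b \<in> el B Z" "app \<pi> Z b = \<one>\<^bsub>grp P Z\<^esub>" for Z b
  proof -
    obtain x where x: "x \<in> el F Z" "b = app \<delta> Z x" using short_exact_kernelE[OF se Z] .
    then have "app p1 Z b = app i Z x" using Z p1 j1 j2 i f e ps by (simp add: a\<delta>)
    then show ?thesis using short_exact_zero[OF ip Z(1) x(1)] Z p1 by simp
  qed
  from factor_surj[OF \<pi> short_exactD(5)[OF se] ModC_cmp_Hom[OF p1 p] this]
  obtain \<gamma> where \<gamma>: "\<gamma> \<in> Hom (ModC C) P Q"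
    and "\<forall>Z\<in>Ob C. \<forall>x\<in>el B Z. app \<gamma> Z (app \<pi> Z x) = app (p \<bullet> p1) Z x" by blast
  then have \<gamma>\<pi>: "app \<gamma> Z (app \<pi> Z b) = app p Z (app p1 Z b)" if "Z \<in> Ob C" "b \<in> el B Z" for Z b
    using that p1 by simp
  have se2: "short_exact (\<pi> \<bullet> j2) \<gamma> F' P Q"
    unfolding short_exact_def
  proof (intro conjI ballI)
    fix Z assume Z: "Z \<in> Ob C"
    show "inj_on (app (\<pi> \<bullet> j2) Z) (el F' Z)"
    proof (rule inj_onI_one[OF i' Z])
      fix y assume y: "y \<in> el F' Z" "app (\<pi> \<bullet> j2) Z y = \<one>\<^bsub>grp P Z\<^esub>"
      then obtain x where x: "x \<in> el F Z" "app j2 Z y = app \<delta> Z x"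
        using short_exact_kernelE[OF se Z, of "app j2 Z y"] j2 Z by auto
      have "app p1 Z (app \<delta> Z x) = app i Z x" using x(1) Z p1 j1 j2 i f e ps by (simp add: a\<delta>)
      then have "app i Z x = \<one>\<^bsub>grp G Z\<^esub>" using x(2)[symmetric] e(3)[OF Z y(1)] by simp
      then have "x = \<one>\<^bsub>grp F Z\<^esub>" using inj_one[OF i Z short_exactD(3)[OF ip Z] x(1)] by simp
      then have "app p2 Z (app j2 Z y) = \<one>\<^bsub>grp F' Z\<^esub>" using x(2) \<delta> p2 Z by simp
      then show "y = \<one>\<^bsub>grp F' Z\<^esub>" using e(4)[OF Z y(1)] by simp
    qed
    show "app \<gamma> Z ` el P Z = el Q Z"
    proof (intro equalityI subsetI)
      fix y assume "y \<in> el Q Z"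
      then obtain x where x: "x \<in> el G Z" "y = app p Z x" by (rule short_exact_surjE[OF ip Z])
      have "y = app \<gamma> Z (app \<pi> Z (app j1 Z x))" using x Z \<gamma>\<pi> j1 e by simp
      then show "y \<in> app \<gamma> Z ` el P Z" using x Z j1 \<pi> by simp
    qed (use \<gamma> Z in auto)
    fix z assume "z \<in> el P Z"
    then obtain b where b: "b \<in> el B Z" "z = app \<pi> Z b" by (rule short_exact_surjE[OF se Z])
    show "app \<gamma> Z z = \<one>\<^bsub>grp Q Z\<^esub> \<longleftrightarrow> z \<in> app (\<pi> \<bullet> j2) Z ` el F' Z"
    proof
      assume "app \<gamma> Z z = \<one>\<^bsub>grp Q Z\<^esub>"
      then have "app p Z (app p1 Z b) = \<one>\<^bsub>grp Q Z\<^esub>" using b \<gamma>\<pi> Z by simp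
      then obtain x where x: "x \<in> el F Z" "app p1 Z b = app i Z x"
        using short_exact_kernelE[OF ip Z app_el[OF p1 Z b(1)]] by metis
      \<comment> \<open>The second coordinate of \<open>\<delta>\<close> at \<open>x\<close> is the
        inverse of \<open>f\<close> at \<open>x\<close>. Adding \<open>f\<close> at \<open>x\<close>
        compensates for it, so \<open>b\<close> and \<open>j2\<close> of \<open>y\<close> have the
        same class.\<close>
      define y where "y = app p2 Z b \<otimes>\<^bsub>grp F' Z\<^esub> app f Z x"
      have y: "y \<in> el F' Z" using b x p2 f ps Z by (simp add: y_def)
      have d1: "app p1 Z (app \<delta> Z x) = app i Z x" and d2: "app p2 Z (app \<delta> Z x) = inv\<^bsub>grp F' Z\<^esub> app f Z x"
        using x(1) Z p1 p2 j1 j2 i f e ps by (simp_all add: a\<delta>)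
      have fx: "app f Z x \<in> el F' Z" and pb: "app p2 Z b \<in> el F' Z" using x b p2 f Z by simp_all
      have "inv\<^bsub>grp F' Z\<^esub> app f Z x \<otimes>\<^bsub>grp F' Z\<^esub> y = app p2 Z b"
        unfolding y_def el_commute[OF ps(4) Z pb fx] using el_assoc[OF ps(4) Z _ fx pb, symmetric] ps Z fx pb by simp
      then have "b = app \<delta> Z x \<otimes>\<^bsub>grp B Z\<^esub> app j2 Z y"
        by (intro eq[OF Z b(1)]) (use x b(1) y Z p1 p2 j2 \<delta> i d1 d2 e ps in simp_all)
      then have "z = app \<pi> Z (app \<delta> Z x) \<otimes>\<^bsub>grp P Z\<^esub> app \<pi> Z (app j2 Z y)" using b x y Z \<pi> \<delta> j2 by simp
      also have "\<dots> = app (\<pi> \<bullet> j2) Z y"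
        using short_exact_zero[OF se Z x(1)] y Z \<pi> j2 pP by simp
      finally show "z \<in> app (\<pi> \<bullet> j2) Z ` el F' Z" using y by blast
    next
      assume "z \<in> app (\<pi> \<bullet> j2) Z ` el F' Z"
      then obtain y where "y \<in> el F' Z" "z = app \<pi> Z (app j2 Z y)" using j2 Z by auto
      then show "app \<gamma> Z z = \<one>\<^bsub>grp Q Z\<^esub>" using \<gamma>\<pi> Z j2 e p by simp
    qed
  qed (use i' \<gamma> in simp_all)
  have PS: "P \<in> S" by (rule S_ext[OF se2 f(2) S(2)])
  \<comment> \<open>The relation divided out says precisely that the two ways from \<open>F\<close>
    into the quotient agree.\<close>
  have comm: "app \<pi> Z (app j1 Z (app i Z x)) = app \<pi> Z (app j2 Z (app f Z x))" if Z: "Z \<in> Ob C" "x \<in> el F Z" for Z x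
  proof -
    have "app \<pi> Z (app j1 Z (app i Z x)) \<otimes>\<^bsub>grp P Z\<^esub> inv\<^bsub>grp P Z\<^esub> app \<pi> Z (app j2 Z (app f Z x)) = \<one>\<^bsub>grp P Z\<^esub>"
      using short_exact_zero[OF se Z] Z i j1 j2 f \<pi> ps by (simp add: a\<delta>)
    then show ?thesis using Z i j1 j2 f \<pi> pP by (simp add: el_diff_one)
  qed
  have "is_pushout D i f (\<pi> \<bullet> j2) (\<pi> \<bullet> j1)"
    unfolding is_pushout_def full_subcategory_simps ModC_simps Hom_fst[OF i] Hom_fst[OF i'] Hom_fst[OF f(1)]
  proof (intro conjI allI impI)
    show "i \<in> Ar D" "\<pi> \<bullet> j2 \<in> Ar D" using Ar_D[OF i S(1) GS] Ar_D[OF i' f(2) PS] .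
    show "f \<in> Hom D F F'" "\<pi> \<bullet> j1 \<in> Hom D G P" using f f' S GS PS by (simp_all add: Hom_D)
    show "(\<pi> \<bullet> j1) \<bullet> i = (\<pi> \<bullet> j2) \<bullet> f"
      by (rule mor_eqI[OF ModC_cmp_Hom[OF i f'] ModC_cmp_Hom[OF f(1) i']])
         (use i f j1 j2 comm in simp)
    fix T u v assume "u \<in> Hom D G T" "v \<in> Hom D F' T" and uv: "u \<bullet> i = v \<bullet> f"
    then have u: "u \<in> Hom (ModC C) G T" and v: "v \<in> Hom (ModC C) F' T" and TS: "T \<in> S" by (simp_all add: Hom_D)
    have pT: "is_presheaf C T" using TS S_presheaf by blast
    have uvx: "app u Z (app i Z x) = app v Z (app f Z x)" if "Z \<in> Ob C" "x \<in> el F Z" for Z x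
      using arg_cong[OF uv, of "\<lambda>\<gamma>. app \<gamma> Z x"] i f(1) that by simp
    \<comment> \<open>The morphism on the product with components \<open>u\<close> and
      \<open>v\<close>; it vanishes on \<open>\<delta>\<close> because
      \<open>u \<bullet> i = v \<bullet> f\<close>.\<close>
    define \<beta> where "\<beta> = mor B T (\<lambda>Z b. app u Z (app p1 Z b) \<otimes>\<^bsub>grp T Z\<^esub> app v Z (app p2 Z b))"
    have \<beta>: "\<beta> \<in> Hom (ModC C) B T"
      unfolding \<beta>_def by (rule mor_Hom) (use u v p1 p2 ps pT in \<open>simp_all add: el_interchange\<close>)
    have a\<beta>: "app \<beta> Z b = app u Z (app p1 Z b) \<otimes>\<^bsub>grp T Z\<^esub> app v Z (app p2 Z b)"
      if "Z \<in> Ob C" "b \<in> el B Z" for Z b using that by (simp add: \<beta>_def)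
    have "app \<beta> Z b = \<one>\<^bsub>grp T Z\<^esub>" if Z: "Z \<in> Ob C" "b \<in> el B Z" "app \<pi> Z b = \<one>\<^bsub>grp P Z\<^esub>" for Z b
    proof -
      obtain x where x: "x \<in> el F Z" "b = app \<delta> Z x" using short_exact_kernelE[OF se Z] .
      have "app p1 Z b = app i Z x" "app p2 Z b = inv\<^bsub>grp F' Z\<^esub> app f Z x"
        using x Z p1 p2 j1 j2 i f e ps by (simp_all add: a\<delta>)
      then show ?thesis using x Z u v f pT uvx by (simp add: a\<beta>)
    qed
    from factor_surj[OF \<pi> short_exactD(5)[OF se] \<beta> this]
    obtain h where h: "h \<in> Hom (ModC C) P T" and h\<pi>: "\<And>Z b. Z \<in> Ob C \<Longrightarrow> b \<in> el B Z \<Longrightarrow> app h Z (app \<pi> Z b) = app \<beta> Z b"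
      by blast
    show "\<exists>!h. h \<in> Hom D P T \<and> h \<bullet> (\<pi> \<bullet> j1) = u \<and> h \<bullet> (\<pi> \<bullet> j2) = v"
    proof (intro ex1I[of _ h] conjI)
      show "h \<in> Hom D P T" using h PS TS by (simp add: Hom_D)
      show "h \<bullet> (\<pi> \<bullet> j1) = u"
        by (rule mor_eqI[OF ModC_cmp_Hom[OF f' h] u]) (use h\<pi> f' j1 e u v pT in \<open>simp add: a\<beta>\<close>)
      show "h \<bullet> (\<pi> \<bullet> j2) = v"
        by (rule mor_eqI[OF ModC_cmp_Hom[OF i' h] v]) (use h\<pi> i' j2 e u v pT in \<open>simp add: a\<beta>\<close>)
      fix h' assume *: "h' \<in> Hom D P T \<and> h' \<bullet> (\<pi> \<bullet> j1) = u \<and> h' \<bullet> (\<pi> \<bullet> j2) = v"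
      then have h': "h' \<in> Hom (ModC C) P T" by (simp add: Hom_D)
      show "h' = h"
      proof (rule mor_eqI[OF h' h])
        fix Z z assume Z: "Z \<in> Ob C" and "z \<in> el P Z"
        then obtain b where b: "b \<in> el B Z" "z = app \<pi> Z b" using short_exact_surjE[OF se] by blast
        have "app h' Z (app \<pi> Z (app j1 Z (app p1 Z b))) = app u Z (app p1 Z b)"
          using arg_cong[OF conjunct1[OF conjunct2[OF *]], of "\<lambda>\<gamma>. app \<gamma> Z (app p1 Z b)"] f' j1 p1 b(1) Z by simp
        moreover have "app h' Z (app \<pi> Z (app j2 Z (app p2 Z b))) = app v Z (app p2 Z b)"
          using arg_cong[OF conjunct2[OF conjunct2[OF *]], of "\<lambda>\<gamma>. app \<gamma> Z (app p2 Z b)"] i' j2 p2 b(1) Z by simp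
        moreover have "app h' Z z = app h' Z (app \<pi> Z (app j1 Z (app p1 Z b))) \<otimes>\<^bsub>grp T Z\<^esub> app h' Z (app \<pi> Z (app j2 Z (app p2 Z b)))"
          unfolding b(2) by (subst dec[OF Z b(1)]) (use Z b p1 p2 j1 j2 \<pi> h' in simp)
        ultimately show "app h' Z z = app h Z z" using h\<pi>[OF Z b(1)] a\<beta>[OF Z b(1)] b by simp
      qed
    qed
  qed
  moreover have "inflation D (\<pi> \<bullet> j2)" by (rule D_inflationI[OF se2 f(2) S(2)])
  ultimately show ?thesis by blast
qed

text \<open>The pullback is the subpresheaf of the product of \<open>G\<close> and \<open>H'\<close>
  of pairs with the same image in \<open>H\<close>. Its projection to \<open>H'\<close> is
  surjective with the kernel \<open>K\<close> of \<open>p\<close>, so it is an extension of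
  \<open>H'\<close> by \<open>K\<close>.\<close>

lemma D_pullback:
  assumes kp: "short_exact k p K G H" and S: "K \<in> S" "H \<in> S" and f: "f \<in> Hom (ModC C) H' H" "H' \<in> S"
  shows "\<exists>p' f'. is_pullback D p' f' p f \<and> deflation D p'"
proof -
  note k = short_exactD(1)[OF kp] and p = short_exactD(2)[OF kp]
  have GS: "G \<in> S" by (rule S_ext[OF kp S])
  obtain B p1 p2 j1 j2 where pr: "prod_of G H' B p1 p2 j1 j2"
    using obtain_prod[OF GS f(2)] by blast
  note B = prod_ofD(1)[OF pr] and p1 = prod_ofD(2)[OF pr] and p2 = prod_ofD(3)[OF pr]
    and j1 = prod_ofD(4)[OF pr] and j2 = prod_ofD(5)[OF pr] and e = prod_ofD(6-9)[OF pr] and eq = prod_ofD(10)[OF pr]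
  note ps = S_presheaf[OF S(1)] S_presheaf[OF GS] S_presheaf[OF S(2)] S_presheaf[OF f(2)] S_presheaf[OF B]
  define N where "N Z = {b \<in> el B Z. app p Z (app p1 Z b) = app f Z (app p2 Z b)}" for Z
  have N: "subpresheaf B N"
    by (rule subpresheafI) (use ps p1 p2 p f in \<open>auto simp: N_def\<close>)
  define P where "P = sub B N"
  define \<nu> where "\<nu> = incl B N"
  have \<nu>: "\<nu> \<in> Hom (ModC C) P B" unfolding \<nu>_def P_def by (rule incl_Hom[OF ps(5) N])
  have pP: "is_presheaf C P" by (rule Hom_presheaf(1)[OF \<nu>])
  have elP: "b \<in> el P Z \<longleftrightarrow> b \<in> el B Z \<and> app p Z (app p1 Z b) = app f Z (app p2 Z b)" for Z b
    by (simp add: P_def N_def)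
  have a\<nu>: "app \<nu> Z b = b" if "Z \<in> Ob C" "b \<in> el P Z" for Z b
    using that by (simp add: \<nu>_def P_def)
  note p' = ModC_cmp_Hom[OF \<nu> p2] and f' = ModC_cmp_Hom[OF \<nu> p1]
  have ap': "app (p2 \<bullet> \<nu>) Z b = app p2 Z b" and af': "app (p1 \<bullet> \<nu>) Z b = app p1 Z b"
    if "Z \<in> Ob C" "b \<in> el P Z" for Z b using that \<nu> a\<nu> by simp_all
  have "app (j1 \<bullet> k) Z x \<in> N Z" if "Z \<in> Ob C" "x \<in> el K Z" for Z x
    using that k j1 e f short_exact_zero[OF kp that] by (simp add: N_def)
  then obtain \<kappa> where \<kappa>: "\<kappa> \<in> Hom (ModC C) K P" and \<kappa>0: "\<And>Z x. Z \<in> Ob C \<Longrightarrow> x \<in> el K Z \<Longrightarrow> app \<kappa> Z x = app (j1 \<bullet> k) Z x"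
    using corestrict[OF ModC_cmp_Hom[OF k j1] N] unfolding P_def by metis
  have a\<kappa>: "app \<kappa> Z x = app j1 Z (app k Z x)" if "Z \<in> Ob C" "x \<in> el K Z" for Z x
    using \<kappa>0[OF that] that k by simp
  have se: "short_exact \<kappa> (p2 \<bullet> \<nu>) K P H'"
    unfolding short_exact_def
  proof (intro conjI ballI)
    fix Z assume Z: "Z \<in> Ob C"
    show "inj_on (app \<kappa> Z) (el K Z)"
    proof (rule inj_onI)
      fix x y assume xy: "x \<in> el K Z" "y \<in> el K Z" "app \<kappa> Z x = app \<kappa> Z y"
      then have "app k Z x = app k Z y" using a\<kappa> e(1)[OF Z] k Z by (metis app_el)
      then show "x = y" using inj_onD[OF short_exactD(3)[OF kp Z]] xy by blast
    qed
    show "app (p2 \<bullet> \<nu>) Z ` el P Z = el H' Z"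
    proof (intro equalityI subsetI)
      fix y assume y: "y \<in> el H' Z"
      obtain x where x: "x \<in> el G Z" "app f Z y = app p Z x"
        using short_exact_surjE[OF kp Z app_el[OF f(1) Z y]] .
      define b where "b = app j1 Z x \<otimes>\<^bsub>grp B Z\<^esub> app j2 Z y"
      have b: "b \<in> el B Z" "app p1 Z b = x" "app p2 Z b = y"
        using x y Z j1 j2 p1 p2 e ps by (simp_all add: b_def)
      then have bP: "b \<in> el P Z" using x by (simp add: elP)
      then show "y \<in> app (p2 \<bullet> \<nu>) Z ` el P Z" using ap'[OF Z bP] b by (metis image_eqI)
    qed (use p' Z in auto)
    fix b assume b: "b \<in> el P Z"
    show "app (p2 \<bullet> \<nu>) Z b = \<one>\<^bsub>grp H' Z\<^esub> \<longleftrightarrow> b \<in> app \<kappa> Z ` el K Z"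
    proof
      assume "app (p2 \<bullet> \<nu>) Z b = \<one>\<^bsub>grp H' Z\<^esub>"
      then have b2: "app p2 Z b = \<one>\<^bsub>grp H' Z\<^esub>" using ap'[OF Z b] by simp
      then have "app p Z (app p1 Z b) = \<one>\<^bsub>grp H Z\<^esub>" using b f Z by (simp add: elP)
      then obtain x where x: "x \<in> el K Z" "app p1 Z b = app k Z x"
        using short_exact_kernelE[OF kp Z] b p1 Z by (metis app_el elP)
      have "b = app j1 Z (app k Z x)"
        by (rule eq[OF Z]) (use x b b2 Z e j1 k in \<open>simp_all add: elP\<close>)
      then show "b \<in> app \<kappa> Z ` el K Z" using a\<kappa>[OF Z x(1)] x(1) by (intro image_eqI[of _ _ x]) simp_all
    next
      assume "b \<in> app \<kappa> Z ` el K Z"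
      then obtain x where "x \<in> el K Z" "b = app j1 Z (app k Z x)" using a\<kappa>[OF Z] by auto
      then show "app (p2 \<bullet> \<nu>) Z b = \<one>\<^bsub>grp H' Z\<^esub>" using ap'[OF Z b] e Z k by simp
    qed
  qed (use \<kappa> p' in simp_all)
  have PS: "P \<in> S" by (rule S_ext[OF se S(1) f(2)])
  have "is_pullback D (p2 \<bullet> \<nu>) (p1 \<bullet> \<nu>) p f"
    unfolding is_pullback_def full_subcategory_simps ModC_simps Hom_fst[OF p] Hom_fst[OF p'] Hom_fst[OF f(1)]
  proof (intro conjI allI impI)
    show "p \<in> Ar D" "p2 \<bullet> \<nu> \<in> Ar D" using Ar_D[OF p GS S(2)] Ar_D[OF p' PS f(2)] .
    show "f \<in> Hom D H' H" "p1 \<bullet> \<nu> \<in> Hom D P G" using f f' S GS PS by (simp_all add: Hom_D)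
    show "f \<bullet> (p2 \<bullet> \<nu>) = p \<bullet> (p1 \<bullet> \<nu>)"
    proof (rule mor_eqI[OF ModC_cmp_Hom[OF p' f(1)] ModC_cmp_Hom[OF f' p]])
      fix Z b assume "Z \<in> Ob C" "b \<in> el P Z"
      then show "app (f \<bullet> (p2 \<bullet> \<nu>)) Z b = app (p \<bullet> (p1 \<bullet> \<nu>)) Z b"
        using p' f' ap' af' by (simp add: app_cmp[OF p'] app_cmp[OF f'] elP del: app_cmp)
    qed
    fix T u v assume "u \<in> Hom D T H'" "v \<in> Hom D T G" and uv: "f \<bullet> u = p \<bullet> v"
    then have u: "u \<in> Hom (ModC C) T H'" and v: "v \<in> Hom (ModC C) T G" and TS: "T \<in> S" by (simp_all add: Hom_D)
    have pT: "is_presheaf C T" using TS S_presheaf by blast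
    have uvx: "app f Z (app u Z x) = app p Z (app v Z x)" if "Z \<in> Ob C" "x \<in> el T Z" for Z x
      using arg_cong[OF uv, of "\<lambda>\<gamma>. app \<gamma> Z x"] u v that by simp
    define \<beta> where "\<beta> = mor T B (\<lambda>Z x. app j1 Z (app v Z x) \<otimes>\<^bsub>grp B Z\<^esub> app j2 Z (app u Z x))"
    have \<beta>: "\<beta> \<in> Hom (ModC C) T B"
      unfolding \<beta>_def by (rule mor_Hom) (use u v j1 j2 ps pT in \<open>simp_all add: el_interchange\<close>)
    have a\<beta>: "app p1 Z (app \<beta> Z x) = app v Z x" "app p2 Z (app \<beta> Z x) = app u Z x"
      if "Z \<in> Ob C" "x \<in> el T Z" for Z x using that u v j1 j2 p1 p2 e ps by (simp_all add: \<beta>_def)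
    have "app \<beta> Z x \<in> N Z" if "Z \<in> Ob C" "x \<in> el T Z" for Z x
      using that \<beta> a\<beta> uvx by (simp add: N_def)
    then obtain h where h: "h \<in> Hom (ModC C) T P" and ah: "\<And>Z x. Z \<in> Ob C \<Longrightarrow> x \<in> el T Z \<Longrightarrow> app h Z x = app \<beta> Z x"
      using corestrict[OF \<beta> N] unfolding P_def by metis
    show "\<exists>!h. h \<in> Hom D T P \<and> (p2 \<bullet> \<nu>) \<bullet> h = u \<and> (p1 \<bullet> \<nu>) \<bullet> h = v"
    proof (intro ex1I[of _ h] conjI)
      show "h \<in> Hom D T P" using h PS TS by (simp add: Hom_D)
      show "(p2 \<bullet> \<nu>) \<bullet> h = u"
      proof (rule mor_eqI[OF ModC_cmp_Hom[OF h p'] u])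
        fix Z x assume Z: "Z \<in> Ob C" "x \<in> el T Z"
        show "app ((p2 \<bullet> \<nu>) \<bullet> h) Z x = app u Z x"
          unfolding app_cmp[OF h Z] ap'[OF Z(1) app_el[OF h Z]] using ah a\<beta> Z by simp
      qed
      show "(p1 \<bullet> \<nu>) \<bullet> h = v"
      proof (rule mor_eqI[OF ModC_cmp_Hom[OF h f'] v])
        fix Z x assume Z: "Z \<in> Ob C" "x \<in> el T Z"
        show "app ((p1 \<bullet> \<nu>) \<bullet> h) Z x = app v Z x"
          unfolding app_cmp[OF h Z] af'[OF Z(1) app_el[OF h Z]] using ah a\<beta> Z by simp
      qed
      fix h' assume *: "h' \<in> Hom D T P \<and> (p2 \<bullet> \<nu>) \<bullet> h' = u \<and> (p1 \<bullet> \<nu>) \<bullet> h' = v"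
      then have h': "h' \<in> Hom (ModC C) T P" by (simp add: Hom_D)
      show "h' = h"
      proof (rule mor_eqI[OF h' h])
        fix Z x assume Z: "Z \<in> Ob C" "x \<in> el T Z"
        have h'uv: "app p2 Z (app h' Z x) = app u Z x" "app p1 Z (app h' Z x) = app v Z x"
          using * app_cmp[OF h' Z, of "p2 \<bullet> \<nu>"] app_cmp[OF h' Z, of "p1 \<bullet> \<nu>"]
            ap'[OF Z(1) app_el[OF h' Z]] af'[OF Z(1) app_el[OF h' Z]] by simp_all
        have huv: "app p2 Z (app h Z x) = app u Z x" "app p1 Z (app h Z x) = app v Z x"
          using ah a\<beta> Z by simp_all
        show "app h' Z x = app h Z x"
          by (rule eq[OF Z(1)]) (use h'uv huv app_el[OF h' Z] app_el[OF h Z] in \<open>simp_all add: elP\<close>)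
      qed
    qed
  qed
  moreover have "deflation D (p2 \<bullet> \<nu>)" by (rule D_deflationI[OF se S(1) f(2)])
  ultimately show ?thesis by blast
qed

theorem D_exact: "exact_category D"
  unfolding exact_category_def
proof (intro conjI allI impI ballI)
  obtain O' where O: "O' \<in> S" "\<And>Z. Z \<in> Ob C \<Longrightarrow> el O' Z = {\<one>\<^bsub>grp O' Z\<^esub>}" using S_zeroE by metis
  show "additive_category D"
    unfolding additive_category_def
    using D_preadditive D_zero_object[OF O] D_biproduct by auto
  fix X assume "X \<in> Ob D"
  then have X: "X \<in> S" "is_presheaf C X" by simp_all
  have pO: "is_presheaf C O'" by (rule S_presheaf[OF O(1)])
  \<comment> \<open>An identity is an inflation and a deflation because the zero object serves as
    its cokernel and as its kernel.\<close>
  have "short_exact (ident (ModC C) X) (zero_mor (ModC C) X O') X X O'"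
    using X pO O ModC_ident_Hom ModC_zero_Hom
    by (auto simp: short_exact_def inj_on_def image_iff intro: el_one[OF X(2)])
  then show "inflation D (ident D X)" using D_inflationI X O by simp
  have "short_exact (zero_mor (ModC C) O' X) (ident (ModC C) X) O' X X"
    using X pO O ModC_ident_Hom ModC_zero_Hom by (auto simp: short_exact_def inj_on_def image_iff)
  then show "deflation D (ident D X)" using D_deflationI X O by simp
next
  fix c assume "c \<in> conflations D"
  then show "case c of (i, p) \<Rightarrow> is_kernel D i p \<and> is_cokernel D p i"
    using D_conflationE D_kernel D_cokernel by (metis (no_types, lifting) case_prodI2)
next
  fix i p i' p' a b c
  assume ip: "(i, p) \<in> conflations D" and i': "i' \<in> Ar D" and p': "p' \<in> Ar D" "cod D i' = dom D p'"
    and abc: "a \<in> Hom D (dom D i) (dom D i')" "b \<in> Hom D (cod D i) (cod D i')" "c \<in> Hom D (cod D p) (cod D p')"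
     "iso_mor D a" "iso_mor D b" "iso_mor D c"
    and eq: "b \<cdot>\<^bsub>D\<^esub> i = i' \<cdot>\<^bsub>D\<^esub> a" "c \<cdot>\<^bsub>D\<^esub> p = p' \<cdot>\<^bsub>D\<^esub> b"
  obtain K G Q where se: "short_exact i p K G Q" "K \<in> S" "G \<in> S" "Q \<in> S"
    "fst i = K" "snd (snd i) = G" "fst p = G" "snd (snd p) = Q" using ip by (rule D_conflationE)
  obtain K' G' where i'2: "i' \<in> Hom (ModC C) K' G'" "fst i' = K'" "snd (snd i') = G'" "K' \<in> S" "G' \<in> S"
    using i' by (rule Ar_DE)
  obtain Q' where p'2: "p' \<in> Hom (ModC C) G' Q'" "snd (snd p') = Q'" "Q' \<in> S"
    using Ar_DE[OF p'(1)] p'(2) i'2(3) by (metis ModC_simps(3,4) full_subcategory_simps(2,3))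
  have "short_exact i' p' K' G' Q'"
    by (rule D_conflation_iso[OF se(1) i'2(1) p'2(1) _ _ _ abc(4-6)])
       (use abc(1-3) eq se i'2 p'2 in \<open>simp_all add: Hom_D\<close>)
  then show "(i', p') \<in> conflations D" using D_conflationI i'2 p'2 by blast
next
  fix i j assume "inflation D i" "inflation D j" and ij: "cod D i = dom D j"
  then obtain p q where "(i, p) \<in> conflations D" "(j, q) \<in> conflations D" by (auto simp: inflation_def)
  moreover from this obtain F G Q where "short_exact i p F G Q" "F \<in> S" "Q \<in> S" "snd (snd i) = G"
    by (elim D_conflationE)
  moreover from calculation obtain H R where "short_exact j q G H R" "R \<in> S"
    using ij by (elim D_conflationE) simp
  ultimately show "inflation D (j \<cdot>\<^bsub>D\<^esub> i)"
    using D_cmp_inflation D_inflationI by (metis full_subcategory_simps(5))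
next
  fix p q assume "deflation D p" "deflation D q" and pq: "cod D p = dom D q"
  then obtain k l where "(k, p) \<in> conflations D" "(l, q) \<in> conflations D" by (auto simp: deflation_def)
  moreover from this obtain K F G where "short_exact k p K F G" "K \<in> S" "snd (snd p) = G"
    by (elim D_conflationE)
  moreover from calculation obtain L H where "short_exact l q L G H" "L \<in> S" "H \<in> S"
    using pq by (elim D_conflationE) simp
  ultimately show "deflation D (q \<cdot>\<^bsub>D\<^esub> p)"
    using D_cmp_deflation D_deflationI by (metis full_subcategory_simps(5))
next
  fix i f assume "inflation D i" and f: "f \<in> Ar D" "dom D f = dom D i"
  then obtain p where "(i, p) \<in> conflations D" by (auto simp: inflation_def)
  then obtain F G Q where "short_exact i p F G Q" "F \<in> S" "Q \<in> S" "fst i = F" by (rule D_conflationE)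
  moreover from calculation obtain F' where "f \<in> Hom (ModC C) F F'" "F' \<in> S"
    using Ar_DE[OF f(1)] f(2) by (metis ModC_simps(3) full_subcategory_simps(2))
  ultimately show "\<exists>i' f'. is_pushout D i f i' f' \<and> inflation D i'" by (intro D_pushout)
next
  fix p f assume "deflation D p" and f: "f \<in> Ar D" "cod D f = cod D p"
  then obtain k where "(k, p) \<in> conflations D" by (auto simp: deflation_def)
  then obtain K G H where "short_exact k p K G H" "K \<in> S" "H \<in> S" "snd (snd p) = H" by (rule D_conflationE)
  moreover from calculation obtain H' where "f \<in> Hom (ModC C) H' H" "H' \<in> S"
    using Ar_DE[OF f(1)] f(2) by (metis ModC_simps(4) full_subcategory_simps(3))
  ultimately show "\<exists>p' f'. is_pullback D p' f' p f \<and> deflation D p'" by (intro D_pullback)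
qed

end

section \<open>Adjunctions from universal arrows\<close>

locale functor_pair = C: preadditive C + D: preadditive D
  for C :: "('o1, 'm1, 'x) addcat_scheme" and D :: "('o2, 'm2, 'y) addcat_scheme" +
  fixes U :: "('o2, 'm2, 'o1, 'm1) catfun"
  assumes U: "is_functor D C U"
begin

lemma U_simps [simp]:
  "Y \<in> Ob D \<Longrightarrow> on_ob U Y \<in> Ob C" "Y \<in> Ob D \<Longrightarrow> on_ar U (ident D Y) = ident C (on_ob U Y)"
  "g \<in> Ar D \<Longrightarrow> on_ar U g \<in> Ar C" "g \<in> Ar D \<Longrightarrow> dom C (on_ar U g) = on_ob U (dom D g)"
  "g \<in> Ar D \<Longrightarrow> cod C (on_ar U g) = on_ob U (cod D g)"
  "g \<in> Ar D \<Longrightarrow> h \<in> Ar D \<Longrightarrow> cod D g = dom D h \<Longrightarrow> on_ar U (h \<cdot>\<^bsub>D\<^esub> g) = on_ar U h \<cdot>\<^bsub>C\<^esub> on_ar U g"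
proof -
  show "Y \<in> Ob D \<Longrightarrow> on_ob U Y \<in> Ob C" "Y \<in> Ob D \<Longrightarrow> on_ar U (ident D Y) = ident C (on_ob U Y)"
    using U unfolding is_functor_def by blast+
  have *: "on_ar U g \<in> Hom C (on_ob U (dom D g)) (on_ob U (cod D g))" if "g \<in> Ar D" for g
  proof -
    have "g \<in> Hom D (dom D g) (cod D g)" using that by simp
    then show ?thesis using U unfolding is_functor_def by blast
  qed
  then show "g \<in> Ar D \<Longrightarrow> on_ar U g \<in> Ar C" "g \<in> Ar D \<Longrightarrow> dom C (on_ar U g) = on_ob U (dom D g)"
    "g \<in> Ar D \<Longrightarrow> cod C (on_ar U g) = on_ob U (cod D g)" by auto
  assume "g \<in> Ar D" "h \<in> Ar D" "cod D g = dom D h"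
  then have "g \<in> Hom D (dom D g) (cod D g)" "h \<in> Hom D (cod D g) (cod D h)" by auto
  then show "on_ar U (h \<cdot>\<^bsub>D\<^esub> g) = on_ar U h \<cdot>\<^bsub>C\<^esub> on_ar U g" using U unfolding is_functor_def by blast
qed

text \<open>The action of \<open>T\<close> on morphisms is given in advance, as that of
  \<open>L_functor\<close> is. Beyond the typing, it is tied to \<open>\<eta>\<close> by naturality
  alone; functoriality, the counit identities and additivity then follow by comparing
  transposes.\<close>

lemma left_adjointI:
  assumes ob: "\<And>X. X \<in> Ob C \<Longrightarrow> on_ob T X \<in> Ob D"
    and ar: "\<And>X X' f. f \<in> Hom C X X' \<Longrightarrow> on_ar T f \<in> Hom D (on_ob T X) (on_ob T X')"
    and nat: "\<And>X X' f. f \<in> Hom C X X' \<Longrightarrow> on_ar U (on_ar T f) \<cdot>\<^bsub>C\<^esub> \<eta> X = \<eta> X' \<cdot>\<^bsub>C\<^esub> f"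
    and \<eta>: "\<And>X. X \<in> Ob C \<Longrightarrow> \<eta> X \<in> Hom C X (on_ob U (on_ob T X))"
    and univ: "\<And>X Y f. X \<in> Ob C \<Longrightarrow> Y \<in> Ob D \<Longrightarrow> f \<in> Hom C X (on_ob U Y) \<Longrightarrow>
      \<exists>!g. g \<in> Hom D (on_ob T X) Y \<and> on_ar U g \<cdot>\<^bsub>C\<^esub> \<eta> X = f"
  shows "\<exists>\<epsilon>. adjunction C D T U \<eta> \<epsilon>" and "additive_functor D C U \<Longrightarrow> additive_functor C D T"
proof -
  have \<eta>t [simp]: "\<eta> X \<in> Ar C" "dom C (\<eta> X) = X" "cod C (\<eta> X) = on_ob U (on_ob T X)" if "X \<in> Ob C" for X
    using \<eta>[OF that] by simp_all
  have tt [simp]: "on_ar T f \<in> Ar D" "dom D (on_ar T f) = on_ob T (dom C f)" "cod D (on_ar T f) = on_ob T (cod C f)"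
    if "f \<in> Ar C" for f using ar[of f "dom C f" "cod C f"] that by simp_all
  note [simp] = ob
  \<comment> \<open>Morphisms out of \<open>on_ob T X\<close> agree if their transposes do. All
    equations below are checked in this way.\<close>
  have uniq: "g = g'" if X: "X \<in> Ob C" and g: "g \<in> Hom D (on_ob T X) Y" and g': "g' \<in> Hom D (on_ob T X) Y"
    and eq: "on_ar U g \<cdot>\<^bsub>C\<^esub> \<eta> X = on_ar U g' \<cdot>\<^bsub>C\<^esub> \<eta> X" for X Y g g'
  proof -
    have "\<exists>!h. h \<in> Hom D (on_ob T X) Y \<and> on_ar U h \<cdot>\<^bsub>C\<^esub> \<eta> X = on_ar U g' \<cdot>\<^bsub>C\<^esub> \<eta> X"
      by (rule univ[OF X]) (use X g' in auto)
    then show ?thesis using g g' eq by blast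
  qed
  have Tf: "is_functor C D T"
    unfolding is_functor_def
  proof (intro conjI ballI allI impI)
    fix X assume X: "X \<in> Ob C"
    show "on_ar T (ident C X) = ident D (on_ob T X)"
    proof (rule uniq[OF X])
      show "on_ar U (on_ar T (ident C X)) \<cdot>\<^bsub>C\<^esub> \<eta> X = on_ar U (ident D (on_ob T X)) \<cdot>\<^bsub>C\<^esub> \<eta> X"
        using X nat[of "ident C X" X X] by simp
    qed (use X in simp_all)
  next
    fix X Y Z f g assume fg: "f \<in> Hom C X Y" "g \<in> Hom C Y Z"
    then have X: "X \<in> Ob C" "Y \<in> Ob C" "Z \<in> Ob C" by auto
    have fgt: "f \<in> Ar C" "dom C f = X" "cod C f = Y" "g \<in> Ar C" "dom C g = Y" "cod C g = Z" using fg by auto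
    show "on_ar T (g \<cdot>\<^bsub>C\<^esub> f) = on_ar T g \<cdot>\<^bsub>D\<^esub> on_ar T f"
    proof (rule uniq[OF X(1)])
      have "on_ar U (on_ar T g) \<cdot>\<^bsub>C\<^esub> (on_ar U (on_ar T f) \<cdot>\<^bsub>C\<^esub> \<eta> X) = on_ar U (on_ar T g) \<cdot>\<^bsub>C\<^esub> (\<eta> Y \<cdot>\<^bsub>C\<^esub> f)"
        using nat[OF fg(1)] by simp
      also have "\<dots> = (\<eta> Z \<cdot>\<^bsub>C\<^esub> g) \<cdot>\<^bsub>C\<^esub> f"
        using C.cmp_reduce[OF nat[OF fg(2)], of f] fgt X by simp
      finally show "on_ar U (on_ar T (g \<cdot>\<^bsub>C\<^esub> f)) \<cdot>\<^bsub>C\<^esub> \<eta> X = on_ar U (on_ar T g \<cdot>\<^bsub>D\<^esub> on_ar T f) \<cdot>\<^bsub>C\<^esub> \<eta> X"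
        using nat[of "g \<cdot>\<^bsub>C\<^esub> f" X Z] fgt X by simp
    qed (use fgt X in simp_all)
  qed (use ar ob in simp_all)
  \<comment> \<open>The counit is the morphism whose transpose is an identity.\<close>
  define \<epsilon> where "\<epsilon> Y = (THE g. g \<in> Hom D (on_ob T (on_ob U Y)) Y \<and> on_ar U g \<cdot>\<^bsub>C\<^esub> \<eta> (on_ob U Y) = ident C (on_ob U Y))" for Y
  have \<epsilon>: "\<epsilon> Y \<in> Hom D (on_ob T (on_ob U Y)) Y \<and> on_ar U (\<epsilon> Y) \<cdot>\<^bsub>C\<^esub> \<eta> (on_ob U Y) = ident C (on_ob U Y)"
    if "Y \<in> Ob D" for Y
    unfolding \<epsilon>_def by (rule theI') (rule univ, use that in simp_all)
  have \<epsilon>t [simp]: "\<epsilon> Y \<in> Ar D" "dom D (\<epsilon> Y) = on_ob T (on_ob U Y)" "cod D (\<epsilon> Y) = Y" if "Y \<in> Ob D" for Y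
    using \<epsilon>[OF that] by simp_all
  have "adjunction C D T U \<eta> \<epsilon>"
    unfolding adjunction_def
  proof (intro conjI ballI allI impI Tf U)
    fix X Y f assume f: "f \<in> Hom D X Y"
    then have X: "X \<in> Ob D" "Y \<in> Ob D" and ft: "f \<in> Ar D" "dom D f = X" "cod D f = Y" by auto
    show "\<epsilon> Y \<cdot>\<^bsub>D\<^esub> on_ar T (on_ar U f) = f \<cdot>\<^bsub>D\<^esub> \<epsilon> X"
    proof (rule uniq[of "on_ob U X"])
      have "on_ar U (\<epsilon> Y) \<cdot>\<^bsub>C\<^esub> (on_ar U (on_ar T (on_ar U f)) \<cdot>\<^bsub>C\<^esub> \<eta> (on_ob U X)) =
          on_ar U (\<epsilon> Y) \<cdot>\<^bsub>C\<^esub> (\<eta> (on_ob U Y) \<cdot>\<^bsub>C\<^esub> on_ar U f)"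
        using nat[of "on_ar U f" "on_ob U X" "on_ob U Y"] ft by simp
      also have "\<dots> = on_ar U f"
        using C.cmp_reduce[OF conjunct2[OF \<epsilon>[OF X(2)]], of "on_ar U f"] ft X by simp
      finally show "on_ar U (\<epsilon> Y \<cdot>\<^bsub>D\<^esub> on_ar T (on_ar U f)) \<cdot>\<^bsub>C\<^esub> \<eta> (on_ob U X) = on_ar U (f \<cdot>\<^bsub>D\<^esub> \<epsilon> X) \<cdot>\<^bsub>C\<^esub> \<eta> (on_ob U X)"
        using ft X conjunct2[OF \<epsilon>[OF X(1)]] by simp
    qed (use ft X in simp_all)
  next
    fix X assume X: "X \<in> Ob C"
    show "\<epsilon> (on_ob T X) \<cdot>\<^bsub>D\<^esub> on_ar T (\<eta> X) = ident D (on_ob T X)"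
    proof (rule uniq[OF X])
      have "on_ar U (\<epsilon> (on_ob T X)) \<cdot>\<^bsub>C\<^esub> (on_ar U (on_ar T (\<eta> X)) \<cdot>\<^bsub>C\<^esub> \<eta> X) =
          on_ar U (\<epsilon> (on_ob T X)) \<cdot>\<^bsub>C\<^esub> (\<eta> (on_ob U (on_ob T X)) \<cdot>\<^bsub>C\<^esub> \<eta> X)"
        using nat[OF \<eta>[OF X]] by simp
      also have "\<dots> = \<eta> X"
        using C.cmp_reduce[OF conjunct2[OF \<epsilon>[of "on_ob T X"]], of "\<eta> X"] X by simp
      finally show "on_ar U (\<epsilon> (on_ob T X) \<cdot>\<^bsub>D\<^esub> on_ar T (\<eta> X)) \<cdot>\<^bsub>C\<^esub> \<eta> X = on_ar U (ident D (on_ob T X)) \<cdot>\<^bsub>C\<^esub> \<eta> X"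
        using X by simp
    qed (use X in simp_all)
  qed (use nat \<epsilon> \<eta> in simp_all)
  then show "\<exists>\<epsilon>. adjunction C D T U \<eta> \<epsilon>" by blast
  assume add: "additive_functor D C U"
  have Uadd: "on_ar U (add_mor D g g') = add_mor C (on_ar U g) (on_ar U g')"
    if "g \<in> Hom D X Y" "g' \<in> Hom D X Y" for g g' X Y
  proof -
    have "X \<in> Ob D" "Y \<in> Ob D" using that by auto
    then have "on_ar U \<in> hom (Hom_group D X Y) (Hom_group C (on_ob U X) (on_ob U Y))"
      using add by (simp add: additive_functor_def)
    then show ?thesis using that unfolding hom_def by simp
  qed
  show "additive_functor C D T"
    unfolding additive_functor_def
  proof (intro conjI ballI Tf)
    fix X Y assume X: "X \<in> Ob C" "Y \<in> Ob C"
    show "on_ar T \<in> hom (Hom_group C X Y) (Hom_group D (on_ob T X) (on_ob T Y))"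
    proof (rule homI)
      fix f f' assume "f \<in> carrier (Hom_group C X Y)" "f' \<in> carrier (Hom_group C X Y)"
      then have f: "f \<in> Hom C X Y" and f': "f' \<in> Hom C X Y" by (simp_all del: C.Hom_iff)
      note Tf = ar[OF f] and Tf' = ar[OF f']
      have UT: "on_ar U (on_ar T f) \<in> Hom C (on_ob U (on_ob T X)) (on_ob U (on_ob T Y))"
        "on_ar U (on_ar T f') \<in> Hom C (on_ob U (on_ob T X)) (on_ob U (on_ob T Y))" using f f' by simp_all
      have "on_ar T (add_mor C f f') = add_mor D (on_ar T f) (on_ar T f')"
      proof (rule uniq[OF X(1)])
        have "on_ar U (add_mor D (on_ar T f) (on_ar T f')) \<cdot>\<^bsub>C\<^esub> \<eta> X = add_mor C (\<eta> Y \<cdot>\<^bsub>C\<^esub> f) (\<eta> Y \<cdot>\<^bsub>C\<^esub> f')"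
          unfolding Uadd[OF Tf Tf'] C.add_cmp[OF \<eta>[OF X(1)] UT] nat[OF f] nat[OF f'] ..
        also have "\<dots> = \<eta> Y \<cdot>\<^bsub>C\<^esub> add_mor C f f'" using C.cmp_add[OF f f' \<eta>[OF X(2)]] by simp
        finally show "on_ar U (on_ar T (add_mor C f f')) \<cdot>\<^bsub>C\<^esub> \<eta> X = on_ar U (add_mor D (on_ar T f) (on_ar T f')) \<cdot>\<^bsub>C\<^esub> \<eta> X"
          using nat[OF C.add_Hom[OF f f']] by simp
        show "on_ar T (add_mor C f f') \<in> Hom D (on_ob T X) (on_ob T Y)"
          using f f' by simp
        show "add_mor D (on_ar T f) (on_ar T f') \<in> Hom D (on_ob T X) (on_ob T Y)"
          using f f' by simp
      qed
      then show "on_ar T (f \<otimes>\<^bsub>Hom_group C X Y\<^esub> f') = on_ar T f \<otimes>\<^bsub>Hom_group D (on_ob T X) (on_ob T Y)\<^esub> on_ar T f'"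
        by simp
    qed (use ar in simp)
  qed
qed

text \<open>If only the objects and the universal arrows are known, \<open>T\<close> takes a
  morphism to the unique solution of the naturality square of \<open>\<eta>\<close>.\<close>

lemma left_adjoint_exists:
  assumes ob: "\<And>X. X \<in> Ob C \<Longrightarrow> T0 X \<in> Ob D" and \<eta>: "\<And>X. X \<in> Ob C \<Longrightarrow> \<eta> X \<in> Hom C X (on_ob U (T0 X))"
    and univ: "\<And>X Y f. X \<in> Ob C \<Longrightarrow> Y \<in> Ob D \<Longrightarrow> f \<in> Hom C X (on_ob U Y) \<Longrightarrow>
      \<exists>!g. g \<in> Hom D (T0 X) Y \<and> on_ar U g \<cdot>\<^bsub>C\<^esub> \<eta> X = f"
    and add: "additive_functor D C U"
  obtains T \<epsilon> where "on_ob T = T0" "adjunction C D T U \<eta> \<epsilon>" "additive_functor C D T"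
proof -
  define T where "T = \<lparr>on_ob = T0, on_ar = (\<lambda>f. THE g. g \<in> Hom D (T0 (dom C f)) (T0 (cod C f)) \<and>
    on_ar U g \<cdot>\<^bsub>C\<^esub> \<eta> (dom C f) = \<eta> (cod C f) \<cdot>\<^bsub>C\<^esub> f)\<rparr>"
  have T0 [simp]: "on_ob T = T0" by (simp add: T_def)
  have T: "on_ar T f \<in> Hom D (T0 X) (T0 Y) \<and> on_ar U (on_ar T f) \<cdot>\<^bsub>C\<^esub> \<eta> X = \<eta> Y \<cdot>\<^bsub>C\<^esub> f" if f: "f \<in> Hom C X Y" for f X Y
  proof -
    have X: "X \<in> Ob C" "Y \<in> Ob C" and d: "dom C f = X" "cod C f = Y" "f \<in> Ar C" using f by auto
    have "\<exists>!g. g \<in> Hom D (T0 X) (T0 Y) \<and> on_ar U g \<cdot>\<^bsub>C\<^esub> \<eta> X = \<eta> Y \<cdot>\<^bsub>C\<^esub> f"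
      by (rule univ[OF X(1) ob[OF X(2)]]) (use d \<eta>[OF X(2)] in simp)
    from theI'[OF this] show ?thesis by (simp add: T_def d del: D.Hom_iff)
  qed
  have "\<exists>\<epsilon>. adjunction C D T U \<eta> \<epsilon>"
    by (rule left_adjointI(1)) (use T ob \<eta> univ in \<open>simp_all del: C.Hom_iff D.Hom_iff\<close>)
  moreover have "additive_functor C D T"
    by (rule left_adjointI(2)[where \<eta>=\<eta>]) (use T ob \<eta> univ add in \<open>simp_all del: C.Hom_iff D.Hom_iff\<close>)
  ultimately have *: "\<exists>\<epsilon>. adjunction C D T U \<eta> \<epsilon>" "additive_functor C D T" .
  then show ?thesis using that T0 by blast
qed

end

text \<open>Naturality of the counit and a triangle identity recover a morphism from its transpose,
  so transposition is injective.\<close>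

lemma adjunction_unique:
  assumes adj: "adjunction C D T U \<eta> \<epsilon>" and C: "preadditive_category C" and D: "preadditive_category D"
    and X: "X \<in> Ob C" and g: "g \<in> Hom D (on_ob T X) Y"
  shows "\<epsilon> Y \<cdot>\<^bsub>D\<^esub> on_ar T (on_ar U g \<cdot>\<^bsub>C\<^esub> \<eta> X) = g"
proof -
  interpret UC: functor_pair C D U
    using adj C D by unfold_locales (auto simp: adjunction_def)
  interpret TC: functor_pair D C T
    using adj C D by unfold_locales (auto simp: adjunction_def)
  have a: "\<eta> X \<in> Hom C X (on_ob U (on_ob T X))" "\<epsilon> (on_ob T X) \<cdot>\<^bsub>D\<^esub> on_ar T (\<eta> X) = ident D (on_ob T X)"
    using adj X unfolding adjunction_def by blast+
  have Y: "Y \<in> Ob D" "on_ob T X \<in> Ob D" and gt: "g \<in> Ar D" "dom D g = on_ob T X" "cod D g = Y"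
    using g X by auto
  then have e: "\<epsilon> Y \<in> Hom D (on_ob T (on_ob U Y)) Y"
    "\<epsilon> (on_ob T X) \<in> Hom D (on_ob T (on_ob U (on_ob T X))) (on_ob T X)"
    and n: "\<epsilon> Y \<cdot>\<^bsub>D\<^esub> on_ar T (on_ar U g) = g \<cdot>\<^bsub>D\<^esub> \<epsilon> (on_ob T X)"
    using adj g unfolding adjunction_def by blast+
  have "\<epsilon> Y \<cdot>\<^bsub>D\<^esub> (on_ar T (on_ar U g) \<cdot>\<^bsub>D\<^esub> on_ar T (\<eta> X)) = (g \<cdot>\<^bsub>D\<^esub> \<epsilon> (on_ob T X)) \<cdot>\<^bsub>D\<^esub> on_ar T (\<eta> X)"
    by (rule UC.D.cmp_reduce[OF n]) (use X gt a(1) e in simp_all)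
  then show ?thesis using a gt e X by simp
qed

text \<open>The transpose of \<open>on_ar T f\<close> is \<open>\<eta> Y \<cdot> f\<close>. With
  \<open>\<eta> Y\<close> invertible, \<open>f\<close> is recovered by transposing and cancelling
  the unit.\<close>

lemma adjunction_unit_iso_fully_faithful:
  assumes adj: "adjunction C D T U \<eta> \<epsilon>" and C: "preadditive_category C" and D: "preadditive_category D"
    and iso: "\<And>X. X \<in> Ob C \<Longrightarrow> iso_mor C (\<eta> X)"
  shows "fully_faithful C D T"
  unfolding fully_faithful_def
proof (intro ballI)
  interpret UC: functor_pair C D U
    using adj C D by unfold_locales (auto simp: adjunction_def)
  interpret TC: functor_pair D C T
    using adj C D by unfold_locales (auto simp: adjunction_def)
  fix X Y assume X: "X \<in> Ob C" "Y \<in> Ob C"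
  have \<eta>: "\<eta> X \<in> Ar C" "dom C (\<eta> X) = X" "cod C (\<eta> X) = on_ob U (on_ob T X)"
    "\<eta> Y \<in> Ar C" "dom C (\<eta> Y) = Y" "cod C (\<eta> Y) = on_ob U (on_ob T Y)"
    using adj X unfolding adjunction_def UC.C.Hom_iff by blast+
  have nat: "on_ar U (on_ar T f) \<cdot>\<^bsub>C\<^esub> \<eta> X = \<eta> Y \<cdot>\<^bsub>C\<^esub> f" if "f \<in> Hom C X Y" for f
    using adj that unfolding adjunction_def by blast
  obtain \<theta> where \<theta>: "\<theta> \<in> Ar C" "dom C \<theta> = on_ob U (on_ob T Y)" "cod C \<theta> = Y"
      "\<theta> \<cdot>\<^bsub>C\<^esub> \<eta> Y = ident C Y" "\<eta> Y \<cdot>\<^bsub>C\<^esub> \<theta> = ident C (on_ob U (on_ob T Y))"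
    using UC.C.iso_morE[OF iso[OF X(2)]] \<eta> by (metis UC.C.Hom_iff)
  show "bij_betw (on_ar T) (Hom C X Y) (Hom D (on_ob T X) (on_ob T Y))"
  proof (rule bij_betw_byWitness[where f'="\<lambda>h. \<theta> \<cdot>\<^bsub>C\<^esub> (on_ar U h \<cdot>\<^bsub>C\<^esub> \<eta> X)"])
    show "\<forall>f\<in>Hom C X Y. \<theta> \<cdot>\<^bsub>C\<^esub> (on_ar U (on_ar T f) \<cdot>\<^bsub>C\<^esub> \<eta> X) = f"
    proof
      fix f assume f: "f \<in> Hom C X Y"
      show "\<theta> \<cdot>\<^bsub>C\<^esub> (on_ar U (on_ar T f) \<cdot>\<^bsub>C\<^esub> \<eta> X) = f"
        using UC.C.cmp_reduce[OF \<theta>(4), of f] f \<eta> \<theta>(1-3) unfolding nat[OF f] by simp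
    qed
    show "\<forall>h\<in>Hom D (on_ob T X) (on_ob T Y). on_ar T (\<theta> \<cdot>\<^bsub>C\<^esub> (on_ar U h \<cdot>\<^bsub>C\<^esub> \<eta> X)) = h"
    proof
      fix h assume h: "h \<in> Hom D (on_ob T X) (on_ob T Y)"
      let ?f = "\<theta> \<cdot>\<^bsub>C\<^esub> (on_ar U h \<cdot>\<^bsub>C\<^esub> \<eta> X)"
      have f: "?f \<in> Hom C X Y" and Tf: "on_ar T ?f \<in> Hom D (on_ob T X) (on_ob T Y)" using h \<eta> \<theta>(1-3) X by simp_all
      have "on_ar U (on_ar T ?f) \<cdot>\<^bsub>C\<^esub> \<eta> X = on_ar U h \<cdot>\<^bsub>C\<^esub> \<eta> X"
        unfolding nat[OF f] using UC.C.cmp_reduce[OF \<theta>(5), of "on_ar U h \<cdot>\<^bsub>C\<^esub> \<eta> X"] h \<eta> \<theta>(1-3) by simp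
      then show "on_ar T ?f = h"
        using adjunction_unique[OF adj C D X(1) Tf] adjunction_unique[OF adj C D X(1) h] by simp
    qed
  qed (use \<eta> \<theta>(1-3) X in auto)
qed

section \<open>Right adjoints by duality\<close>

lemma is_functor_op: "is_functor (op_cat C) (op_cat D) T \<longleftrightarrow> is_functor C D T"
  by (auto simp: is_functor_def)

lemma additive_functor_op: "additive_functor (op_cat C) (op_cat D) T \<longleftrightarrow> additive_functor C D T"
  by (auto simp: additive_functor_def is_functor_op)

lemma adjunction_op: "adjunction (op_cat C) (op_cat D) T U \<eta> \<epsilon> \<longleftrightarrow> adjunction D C U T \<epsilon> \<eta>"
  unfolding adjunction_def is_functor_op by (simp, blast)

text \<open>The criterion for left adjoints in the opposite categories, where
  \<open>\<epsilon>\<close> becomes the unit.\<close>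

lemma right_adjoint_exists:
  fixes C :: "('o1, 'm1) excat" and D :: "('o2, 'm2) excat"
  assumes C: "exact_category C" and D: "exact_category D" and add: "additive_functor D C U"
    and ob: "\<And>X. X \<in> Ob C \<Longrightarrow> T0 X \<in> Ob D" and \<epsilon>: "\<And>X. X \<in> Ob C \<Longrightarrow> \<epsilon> X \<in> Hom C (on_ob U (T0 X)) X"
    and univ: "\<And>X Y f. X \<in> Ob C \<Longrightarrow> Y \<in> Ob D \<Longrightarrow> f \<in> Hom C (on_ob U Y) X \<Longrightarrow>
      \<exists>!g. g \<in> Hom D Y (T0 X) \<and> \<epsilon> X \<cdot>\<^bsub>C\<^esub> on_ar U g = f"
  obtains T \<eta> where "on_ob T = T0" "adjunction D C U T \<eta> \<epsilon>" "additive_functor C D T"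
proof -
  interpret functor_pair "op_cat C" "op_cat D" U
    using exact.op_preadditive[OF exactI[OF C]] exact.op_preadditive[OF exactI[OF D]] add
    by unfold_locales (simp_all add: is_functor_op additive_functor_def)
  obtain T \<eta> where "on_ob T = T0" "adjunction (op_cat C) (op_cat D) T U \<epsilon> \<eta>" "additive_functor (op_cat C) (op_cat D) T"
    by (rule left_adjoint_exists[of T0 \<epsilon>]) (use assms in \<open>simp_all add: additive_functor_op Hom_op del: C.Hom_iff D.Hom_iff\<close>)
  then show ?thesis using that by (simp add: adjunction_op additive_functor_op)
qed

section \<open>Admissibly presented and effaceable presheaves\<close>

locale exact_yoneda = exact C for C :: "('o, 'm) excat" (structure) +
  fixes \<iota> :: "'m \<Rightarrow> 'u"
  assumes inj_\<iota>: "inj_on \<iota> (Ar C)"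
begin

abbreviation \<Upsilon> :: "'o \<Rightarrow> ('o, 'm, 'u) presheaf" where "\<Upsilon> \<equiv> yoneda_ob C \<iota>"
abbreviation \<Upsilon>\<^sub>m :: "'m \<Rightarrow> ('o, 'm, 'u) presheaf_mor" where "\<Upsilon>\<^sub>m \<equiv> on_ar (yoneda C \<iota>)"
abbreviation L\<^sub>m :: "('o, 'm, 'u) presheaf_mor \<Rightarrow> 'm" where "L\<^sub>m \<equiv> on_ar (L_functor C \<iota>)"
abbreviation \<A> :: "(('o, 'm, 'u) presheaf, ('o, 'm, 'u) presheaf_mor) excat" where "\<A> \<equiv> mod_adm C \<iota>"

section \<open>Representable presheaves and the Yoneda lemma on elements\<close>

lemma \<iota>_eq_iff [simp]: "f \<in> Ar C \<Longrightarrow> g \<in> Ar C \<Longrightarrow> \<iota> f = \<iota> g \<longleftrightarrow> f = g"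
  using inj_\<iota> by (simp add: inj_on_eq_iff)

lemma inv_\<iota> [simp]: "f \<in> Ar C \<Longrightarrow> inv_into (Ar C) \<iota> (\<iota> f) = f"
  by (rule inv_into_f_f[OF inj_\<iota>])

lemma inv_\<iota>_Hom [simp]: "f \<in> Ar C \<Longrightarrow> dom C f = X \<Longrightarrow> cod C f = Y \<Longrightarrow> inv_into (Hom C X Y) \<iota> (\<iota> f) = f"
  by (rule inv_into_f_f[OF inj_on_subset[OF inj_\<iota>]]) auto

lemma el_\<Upsilon>: "el (\<Upsilon> X) Z = \<iota> ` Hom C Z X"
  by (simp add: yoneda_ob_def image_group_def del: Hom_iff)

lemma \<iota>_el [simp]: "f \<in> Ar C \<Longrightarrow> dom C f = Z \<Longrightarrow> cod C f = X \<Longrightarrow> \<iota> f \<in> el (\<Upsilon> X) Z"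
  by (auto simp: el_\<Upsilon>)

lemma el_\<Upsilon>E:
  assumes "u \<in> el (\<Upsilon> X) Z"
  obtains f where "f \<in> Ar C" "dom C f = Z" "cod C f = X" "u = \<iota> f"
  using assms by (auto simp: el_\<Upsilon>)

lemma one_\<Upsilon> [simp]: "\<one>\<^bsub>grp (\<Upsilon> X) Z\<^esub> = \<iota> (zero_mor C Z X)"
  by (simp add: yoneda_ob_def image_group_def)

lemma mult_\<Upsilon> [simp]:
  "f \<in> Ar C \<Longrightarrow> g \<in> Ar C \<Longrightarrow> dom C f = Z \<Longrightarrow> dom C g = Z \<Longrightarrow> cod C f = X \<Longrightarrow> cod C g = X \<Longrightarrow>
    \<iota> f \<otimes>\<^bsub>grp (\<Upsilon> X) Z\<^esub> \<iota> g = \<iota> (add_mor C f g)"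
  by (simp add: yoneda_ob_def image_group_def del: Hom_iff)

lemma res_\<Upsilon> [simp]: "u \<in> Ar C \<Longrightarrow> res (\<Upsilon> X) f (\<iota> u) = \<iota> (u \<cdot> f)"
  by (simp add: yoneda_ob_def)

lemma \<Upsilon>_presheaf:
  assumes X: "X \<in> Ob C"
  shows "is_presheaf C (\<Upsilon> X)"
proof (rule presheaf_image[where q="\<lambda>_. \<iota>"])
  show "is_presheaf C \<lparr>grp = \<lambda>Z. Hom_group C Z X, res = \<lambda>f u. u \<cdot> f\<rparr>"
    unfolding is_presheaf_def
    using X Hom_comm_group cmp_add add_cmp by (auto simp: hom_def)
qed (auto simp: el_\<Upsilon>)

text \<open>\<open>X\<close> is recovered as the codomain of its identity. \<open>L_choice\<close>
  singles out the presheaves equal to some \<open>\<Upsilon> X\<close>, and this makes that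
  \<open>X\<close> unique.\<close>

lemma \<Upsilon>_eqD:
  assumes "\<Upsilon> X = \<Upsilon> Y" "X \<in> Ob C"
  shows "X = Y"
proof -
  have "\<iota> (ident C X) \<in> el (\<Upsilon> Y) X" unfolding assms(1)[symmetric] using assms(2) by simp
  then show ?thesis using assms(2) by (elim el_\<Upsilon>E) (metis \<iota>_eq_iff ident_Ar cod_ident)
qed

text \<open>The morphism that the Yoneda lemma assigns to the element \<open>x\<close>;
  \<open>app_from_\<Upsilon>\<close> is the converse direction.\<close>

definition yon :: "('o, 'm, 'u) presheaf \<Rightarrow> 'o \<Rightarrow> 'u \<Rightarrow> ('o, 'm, 'u) presheaf_mor" where
  "yon F Y x = mor (\<Upsilon> Y) F (\<lambda>Z u. res F (inv_into (Ar C) \<iota> u) x)"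

lemma yon_Hom:
  assumes F: "is_presheaf C F" and Y: "Y \<in> Ob C" and x: "x \<in> el F Y"
  shows "yon F Y x \<in> Hom (ModC C) (\<Upsilon> Y) F"
  unfolding yon_def
proof (rule mor_Hom[OF \<Upsilon>_presheaf[OF Y] F])
  fix Z u assume Z: "Z \<in> Ob C" and "u \<in> el (\<Upsilon> Y) Z"
  then obtain f where f: "f \<in> Ar C" "dom C f = Z" "cod C f = Y" "u = \<iota> f" by (elim el_\<Upsilon>E)
  show "res F (inv_into (Ar C) \<iota> u) x \<in> el F Z" using f F x by simp
  fix v assume "v \<in> el (\<Upsilon> Y) Z"
  then obtain g where g: "g \<in> Ar C" "dom C g = Z" "cod C g = Y" "v = \<iota> g" by (elim el_\<Upsilon>E)
  show "res F (inv_into (Ar C) \<iota> (u \<otimes>\<^bsub>grp (\<Upsilon> Y) Z\<^esub> v)) x =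
      res F (inv_into (Ar C) \<iota> u) x \<otimes>\<^bsub>grp F Z\<^esub> res F (inv_into (Ar C) \<iota> v) x"
    using f g F x res_add[OF F, of f Z Y g x] by simp
next
  fix f u assume f: "f \<in> Ar C" and "u \<in> el (\<Upsilon> Y) (cod C f)"
  then obtain g where g: "g \<in> Ar C" "dom C g = cod C f" "cod C g = Y" "u = \<iota> g" by (elim el_\<Upsilon>E)
  show "res F (inv_into (Ar C) \<iota> (res (\<Upsilon> Y) f u)) x = res F f (res F (inv_into (Ar C) \<iota> u) x)"
    using f g F x by simp
qed

lemma app_yon [simp]: "y \<in> Ar C \<Longrightarrow> dom C y = Z \<Longrightarrow> cod C y = Y \<Longrightarrow> app (yon F Y x) Z (\<iota> y) = res F y x"
  by (auto simp: yon_def)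

lemma app_from_\<Upsilon>:
  assumes "\<alpha> \<in> Hom (ModC C) (\<Upsilon> Y) F" "y \<in> Ar C" "dom C y = Z" "cod C y = Y"
  shows "app \<alpha> Z (\<iota> y) = res F y (app \<alpha> Y (\<iota> (ident C Y)))"
proof -
  have Y: "Y \<in> Ob C" using assms by auto
  have "app \<alpha> Z (res (\<Upsilon> Y) y (\<iota> (ident C Y))) = res F y (app \<alpha> (cod C y) (\<iota> (ident C Y)))"
    using assms Y by (intro app_res) simp_all
  then show ?thesis using assms Y by simp
qed

lemma on_ob_yoneda [simp]: "on_ob (yoneda C \<iota>) = \<Upsilon>"
  by (simp add: yoneda_def)

lemma on_ar_yoneda: "\<Upsilon>\<^sub>m f = mor (\<Upsilon> (dom C f)) (\<Upsilon> (cod C f)) (\<lambda>Z u. \<iota> (f \<cdot> inv_into (Ar C) \<iota> u))"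
  by (simp add: yoneda_def mor_def el_\<Upsilon> del: Hom_iff)

lemma app_yoneda [simp]:
  "f \<in> Ar C \<Longrightarrow> u \<in> Ar C \<Longrightarrow> dom C u = Z \<Longrightarrow> cod C u = dom C f \<Longrightarrow> app (\<Upsilon>\<^sub>m f) Z (\<iota> u) = \<iota> (f \<cdot> u)"
  by (auto simp: on_ar_yoneda)

text \<open>\<open>\<Upsilon>\<^sub>m f\<close> is the Yoneda morphism of the element
  \<open>\<iota> f\<close>, so the claim is an instance of \<open>yon_Hom\<close>.\<close>

lemma yoneda_Hom:
  assumes f: "f \<in> Hom C X Y"
  shows "\<Upsilon>\<^sub>m f \<in> Hom (ModC C) (\<Upsilon> X) (\<Upsilon> Y)"
proof -
  have X: "X \<in> Ob C" "Y \<in> Ob C" "f \<in> Ar C" "dom C f = X" "cod C f = Y" using f by auto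
  have "\<Upsilon>\<^sub>m f = yon (\<Upsilon> Y) X (\<iota> f)"
    unfolding on_ar_yoneda yon_def mor_def
    using X by (auto simp: fun_eq_iff el_\<Upsilon> restrict_def)
  then show ?thesis using yon_Hom[OF \<Upsilon>_presheaf[OF X(2)] X(1)] X by simp
qed

text \<open>The elementwise form of a presentation: by the Yoneda lemma a morphism \<open>\<Upsilon> Y \<rightarrow> F\<close> is an element of \<open>F\<close> at \<open>Y\<close>.\<close>

definition pres :: "('o, 'm, 'u) presheaf \<Rightarrow> 'm \<Rightarrow> 'u \<Rightarrow> bool" where
  "pres F f x \<longleftrightarrow> is_presheaf C F \<and> f \<in> Ar C \<and> x \<in> el F (cod C f) \<and>
     (\<forall>Z\<in>Ob C. \<forall>z\<in>el F Z. \<exists>y\<in>Hom C Z (cod C f). z = res F y x) \<and>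
     (\<forall>y\<in>Ar C. cod C y = cod C f \<longrightarrow>
        (res F y x = \<one>\<^bsub>grp F (dom C y)\<^esub> \<longleftrightarrow> (\<exists>s\<in>Hom C (dom C y) (dom C f). y = f \<cdot> s)))"

lemma presD:
  assumes "pres F f x" "f \<in> Hom C X Y"
  shows "is_presheaf C F" "x \<in> el F Y"
    and "Z \<in> Ob C \<Longrightarrow> z \<in> el F Z \<Longrightarrow> \<exists>y. y \<in> Ar C \<and> dom C y = Z \<and> cod C y = Y \<and> z = res F y x"
    and "y \<in> Ar C \<Longrightarrow> dom C y = Z \<Longrightarrow> cod C y = Y \<Longrightarrow>
      res F y x = \<one>\<^bsub>grp F Z\<^esub> \<longleftrightarrow> (\<exists>s. s \<in> Ar C \<and> dom C s = Z \<and> cod C s = X \<and> y = f \<cdot> s)"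
proof -
  have f: "f \<in> Ar C" "dom C f = X" "cod C f = Y" using assms by auto
  note * = assms(1)[unfolded pres_def f]
  show "is_presheaf C F" "x \<in> el F Y" using * by auto
  show "\<exists>y. y \<in> Ar C \<and> dom C y = Z \<and> cod C y = Y \<and> z = res F y x" if "Z \<in> Ob C" "z \<in> el F Z"
  proof -
    have "\<exists>y\<in>Hom C Z Y. z = res F y x" using * that by blast
    then show ?thesis by auto
  qed
  show "res F y x = \<one>\<^bsub>grp F Z\<^esub> \<longleftrightarrow> (\<exists>s. s \<in> Ar C \<and> dom C s = Z \<and> cod C s = X \<and> y = f \<cdot> s)"
    if y: "y \<in> Ar C" "dom C y = Z" "cod C y = Y"
  proof -
    have "res F y x = \<one>\<^bsub>grp F (dom C y)\<^esub> \<longleftrightarrow> (\<exists>s\<in>Hom C (dom C y) X. y = f \<cdot> s)" using * y by blast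
    then show ?thesis unfolding y(2) by (simp add: Bex_def conj_assoc)
  qed
qed

lemma pres_zero:
  assumes "pres F f x" "f \<in> Hom C X Y"
  shows "res F f x = \<one>\<^bsub>grp F X\<^esub>"
  using presD(4)[OF assms, of f X] assms(2) dom_Ob[of f]
  by (metis Hom_iff cod_ident dom_ident ident_Ar ident_right)

text \<open>Among the multiples of \<open>f\<close> only \<open>f\<close> itself has to be checked,
  as restriction along \<open>f \<cdot> s\<close> passes through restriction along
  \<open>f\<close>.\<close>

lemma presI:
  assumes "is_presheaf C F" "f \<in> Hom C X Y" "x \<in> el F Y"
    and "\<And>Z z. Z \<in> Ob C \<Longrightarrow> z \<in> el F Z \<Longrightarrow> \<exists>y. y \<in> Ar C \<and> dom C y = Z \<and> cod C y = Y \<and> z = res F y x"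
    and "\<And>Z y. y \<in> Ar C \<Longrightarrow> dom C y = Z \<Longrightarrow> cod C y = Y \<Longrightarrow> res F y x = \<one>\<^bsub>grp F Z\<^esub> \<Longrightarrow>
      \<exists>s. s \<in> Ar C \<and> dom C s = Z \<and> cod C s = X \<and> y = f \<cdot> s"
    and "res F f x = \<one>\<^bsub>grp F X\<^esub>"
  shows "pres F f x"
proof -
  have f: "f \<in> Ar C" "dom C f = X" "cod C f = Y" using assms(2) by auto
  show ?thesis
    unfolding pres_def f
  proof (intro conjI ballI impI f assms(1,3))
    fix Z z assume "Z \<in> Ob C" "z \<in> el F Z"
    then show "\<exists>y\<in>Hom C Z Y. z = res F y x" using assms(4) by (simp add: Bex_def)
  next
    fix y assume y: "y \<in> Ar C" "cod C y = Y"
    show "res F y x = \<one>\<^bsub>grp F (dom C y)\<^esub> \<longleftrightarrow> (\<exists>s\<in>Hom C (dom C y) X. y = f \<cdot> s)"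
    proof
      assume "res F y x = \<one>\<^bsub>grp F (dom C y)\<^esub>"
      then show "\<exists>s\<in>Hom C (dom C y) X. y = f \<cdot> s" using assms(5)[OF y(1) refl y(2)] by (simp add: Bex_def)
    next
      assume "\<exists>s\<in>Hom C (dom C y) X. y = f \<cdot> s"
      then obtain s where s: "s \<in> Ar C" "dom C s = dom C y" "cod C s = X" "y = f \<cdot> s" by auto
      have "res F (f \<cdot> s) x = \<one>\<^bsub>grp F (dom C s)\<^esub>" using s(1,3) f assms(1,3,6) by simp
      then show "res F y x = \<one>\<^bsub>grp F (dom C y)\<^esub>" using s(2,4) by metis
    qed
  qed
qed

lemma pres_diff:
  assumes P: "pres F f x" "f \<in> Hom C X Y" and y: "y \<in> Hom C Z Y" "y' \<in> Hom C Z Y"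
  shows "res F y x = res F y' x \<longleftrightarrow> (\<exists>s. s \<in> Ar C \<and> dom C s = Z \<and> cod C s = X \<and> y \<^bold>- y' = f \<cdot> s)"
proof -
  note p = presD(1,2)[OF P]
  have Z: "Z \<in> Ob C" using y by auto
  have "res F (y \<^bold>- y') x = res F y x \<otimes>\<^bsub>grp F Z\<^esub> inv\<^bsub>grp F Z\<^esub> res F y' x"
    by (rule res_minus[OF p(1) y p(2)])
  then have "res F y x = res F y' x \<longleftrightarrow> res F (y \<^bold>- y') x = \<one>\<^bsub>grp F Z\<^esub>"
    using el_diff_one[OF p(1) Z, of "res F y x" "res F y' x"] y p by simp
  also have "\<dots> \<longleftrightarrow> (\<exists>s. s \<in> Ar C \<and> dom C s = Z \<and> cod C s = X \<and> y \<^bold>- y' = f \<cdot> s)"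
    by (rule presD(4)[OF P]) (use y in simp_all)
  finally show ?thesis .
qed

text \<open>The cokernel property in terms of elements: the Yoneda morphism of \<open>x\<close> is
  surjective with kernel consisting of the multiples of \<open>f\<close>, and the Yoneda morphism of
  \<open>y\<close> vanishes on them.\<close>

lemma pres_hom_exists:
  assumes P: "pres F f x" "f \<in> Hom C X Y" and G: "is_presheaf C G" "y \<in> el G Y" "res G f y = \<one>\<^bsub>grp G X\<^esub>"
  shows "\<exists>\<alpha>\<in>Hom (ModC C) F G. app \<alpha> Y x = y"
proof -
  note p = presD(1,2)[OF P]
  have Y: "Y \<in> Ob C" and f: "f \<in> Ar C" "dom C f = X" "cod C f = Y" using P by auto
  note q = yon_Hom[OF p(1) Y p(2)] and \<beta> = yon_Hom[OF G(1) Y G(2)]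
  have surj: "app (yon F Y x) Z ` el (\<Upsilon> Y) Z = el F Z" if Z: "Z \<in> Ob C" for Z
  proof (intro equalityI subsetI)
    fix z assume "z \<in> el F Z"
    then obtain y where "y \<in> Ar C" "dom C y = Z" "cod C y = Y" "z = res F y x" using presD(3)[OF P Z] by blast
    then show "z \<in> app (yon F Y x) Z ` el (\<Upsilon> Y) Z" by (intro image_eqI[of _ _ "\<iota> y"]) simp_all
  qed (use q Z in auto)
  have "app (yon G Y y) Z u = \<one>\<^bsub>grp G Z\<^esub>" if Z: "Z \<in> Ob C" "u \<in> el (\<Upsilon> Y) Z" "app (yon F Y x) Z u = \<one>\<^bsub>grp F Z\<^esub>" for Z u
  proof -
    obtain g where g: "g \<in> Ar C" "dom C g = Z" "cod C g = Y" "u = \<iota> g" using Z(2) by (rule el_\<Upsilon>E)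
    then obtain s where s: "s \<in> Ar C" "dom C s = Z" "cod C s = X" "g = f \<cdot> s"
      using presD(4)[OF P g(1-3)] Z(3) by auto
    have "res G (f \<cdot> s) y = \<one>\<^bsub>grp G Z\<^esub>" using s f G by simp
    then show ?thesis using g s(4) by simp
  qed
  from factor_surj[OF q surj \<beta> this]
  obtain \<gamma> where \<gamma>: "\<gamma> \<in> Hom (ModC C) F G" "\<forall>Z\<in>Ob C. \<forall>u\<in>el (\<Upsilon> Y) Z. app \<gamma> Z (app (yon F Y x) Z u) = app (yon G Y y) Z u"
    by blast
  have "app \<gamma> Y (app (yon F Y x) Y (\<iota> (ident C Y))) = app (yon G Y y) Y (\<iota> (ident C Y))"
    using bspec[OF bspec[OF \<gamma>(2) Y], of "\<iota> (ident C Y)"] Y by (simp del: app_yon)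
  then have "app \<gamma> Y x = y" using Y p G by simp
  with \<gamma> show ?thesis by blast
qed

lemma pres_hom_eqI:
  assumes P: "pres F f x" "f \<in> Hom C X Y" and \<alpha>: "\<alpha> \<in> Hom (ModC C) F G" "\<beta> \<in> Hom (ModC C) F G"
    and eq: "app \<alpha> Y x = app \<beta> Y x"
  shows "\<alpha> = \<beta>"
proof (rule mor_eqI[OF \<alpha>])
  fix Z z assume Z: "Z \<in> Ob C" "z \<in> el F Z"
  then obtain y where "y \<in> Ar C" "dom C y = Z" "cod C y = Y" "z = res F y x" using presD(3)[OF P] by blast
  then show "app \<alpha> Z z = app \<beta> Z z" using \<alpha> eq presD(2)[OF P] by simp
qed

text \<open>The cokernel of \<open>\<Upsilon>\<^sub>m f\<close> is formed by \<open>quot\<close>,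
  hence within the given universe. Its generator is the class of the identity of
  \<open>Y\<close>.\<close>

lemma pres_exists:
  assumes f: "f \<in> Hom C X Y"
  obtains F x where "pres F f x"
proof -
  have ft: "f \<in> Ar C" "dom C f = X" "cod C f = Y" and X: "X \<in> Ob C" "Y \<in> Ob C" using f by auto
  note Yf = yoneda_Hom[OF f]
  note pY = \<Upsilon>_presheaf[OF X(2)] and sub = im_subpresheaf[OF Yf]
  define F where "F = quot (\<Upsilon> Y) (im (\<Upsilon>\<^sub>m f))"
  define \<pi> where "\<pi> = proj (\<Upsilon> Y) (im (\<Upsilon>\<^sub>m f))"
  have \<pi>: "\<pi> \<in> Hom (ModC C) (\<Upsilon> Y) F" unfolding \<pi>_def F_def by (rule proj_Hom[OF pY sub])
  have surj: "app \<pi> Z ` el (\<Upsilon> Y) Z = el F Z" if "Z \<in> Ob C" for Z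
    unfolding \<pi>_def F_def by (rule proj_surj[OF pY sub that])
  have ker: "app \<pi> Z (\<iota> y) = \<one>\<^bsub>grp F Z\<^esub> \<longleftrightarrow> (\<exists>s. s \<in> Ar C \<and> dom C s = Z \<and> cod C s = X \<and> y = f \<cdot> s)"
    if y: "y \<in> Ar C" "dom C y = Z" "cod C y = Y" for y Z
  proof -
    have Z: "Z \<in> Ob C" using y by auto
    have "app \<pi> Z (\<iota> y) = \<one>\<^bsub>grp F Z\<^esub> \<longleftrightarrow> \<iota> y \<in> app (\<Upsilon>\<^sub>m f) Z ` el (\<Upsilon> X) Z"
      using proj_eq_one[OF pY sub Z, of "\<iota> y"] y by (simp add: \<pi>_def F_def im_iff[OF Yf])
    also have "\<dots> \<longleftrightarrow> (\<exists>s. s \<in> Ar C \<and> dom C s = Z \<and> cod C s = X \<and> y = f \<cdot> s)"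
    proof
      assume "\<iota> y \<in> app (\<Upsilon>\<^sub>m f) Z ` el (\<Upsilon> X) Z"
      then obtain u where u: "u \<in> el (\<Upsilon> X) Z" "\<iota> y = app (\<Upsilon>\<^sub>m f) Z u" by blast
      obtain s where s: "s \<in> Ar C" "dom C s = Z" "cod C s = X" "u = \<iota> s" using u(1) by (rule el_\<Upsilon>E)
      then have "y = f \<cdot> s" using u ft y by simp
      with s show "\<exists>s. s \<in> Ar C \<and> dom C s = Z \<and> cod C s = X \<and> y = f \<cdot> s" by blast
    next
      assume "\<exists>s. s \<in> Ar C \<and> dom C s = Z \<and> cod C s = X \<and> y = f \<cdot> s"
      then obtain s where "s \<in> Ar C" "dom C s = Z" "cod C s = X" "y = f \<cdot> s" by blast
      then show "\<iota> y \<in> app (\<Upsilon>\<^sub>m f) Z ` el (\<Upsilon> X) Z"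
        using ft by (intro image_eqI[of _ _ "\<iota> s"]) simp_all
    qed
    finally show ?thesis .
  qed
  define x where "x = app \<pi> Y (\<iota> (ident C Y))"
  have \<pi>x: "app \<pi> Z (\<iota> y) = res F y x" if "y \<in> Ar C" "dom C y = Z" "cod C y = Y" for y Z
    unfolding x_def by (rule app_from_\<Upsilon>[OF \<pi> that])
  have "pres F f x"
  proof (rule presI[OF Hom_presheaf(2)[OF \<pi>] f])
    show "x \<in> el F Y" using \<pi> X by (simp add: x_def)
    show "res F f x = \<one>\<^bsub>grp F X\<^esub>"
      unfolding \<pi>x[OF ft, symmetric] ker[OF ft]
      using ft X by (intro exI[of _ "ident C X"]) simp
    fix Z z assume Z: "Z \<in> Ob C" "z \<in> el F Z"
    then obtain u where u: "u \<in> el (\<Upsilon> Y) Z" "z = app \<pi> Z u" using surj by blast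
    obtain y where "y \<in> Ar C" "dom C y = Z" "cod C y = Y" "u = \<iota> y" using u(1) by (rule el_\<Upsilon>E)
    then show "\<exists>y. y \<in> Ar C \<and> dom C y = Z \<and> cod C y = Y \<and> z = res F y x" using u \<pi>x by blast
  next
    fix Z y assume y: "y \<in> Ar C" "dom C y = Z" "cod C y = Y" and "res F y x = \<one>\<^bsub>grp F Z\<^esub>"
    then show "\<exists>s. s \<in> Ar C \<and> dom C s = Z \<and> cod C s = X \<and> y = f \<cdot> s" using ker[OF y] \<pi>x[OF y] by simp
  qed
  then show ?thesis by (rule that)
qed

text \<open>The Yoneda lemma replaces \<open>q\<close> by its value at an identity. As
  \<open>\<iota>\<close> is injective on morphisms, exactness at each object turns into conditions
  on the morphisms themselves.\<close>

lemma presents_iff: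
  assumes f: "f \<in> Hom C X Y"
  shows "presents C \<iota> f q F \<longleftrightarrow> q \<in> Hom (ModC C) (\<Upsilon> Y) F \<and> pres F f (app q Y (\<iota> (ident C Y)))"
proof (cases "q \<in> Hom (ModC C) (\<Upsilon> Y) F")
  case True
  let ?x = "app q Y (\<iota> (ident C Y))"
  have ft: "f \<in> Ar C" "dom C f = X" "cod C f = Y" and X: "X \<in> Ob C" "Y \<in> Ob C" using f by auto
  note Yf = yoneda_Hom[OF f]
  obtain b where q: "q = (\<Upsilon> Y, b, F)" using True by (cases q) (auto simp: Hom_def)
  obtain a where a: "\<Upsilon>\<^sub>m f = (\<Upsilon> X, a, \<Upsilon> Y)"
    using Hom_fst[OF Yf] by (cases "\<Upsilon>\<^sub>m f") auto
  have ab: "app q = b" "app (\<Upsilon>\<^sub>m f) = a" by (simp_all add: q a app_def)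
  have ez: "presheaf_exact_at C (\<Upsilon>\<^sub>m f) q \<longleftrightarrow>
      (\<forall>Z\<in>Ob C. app (\<Upsilon>\<^sub>m f) Z ` el (\<Upsilon> X) Z = {u \<in> el (\<Upsilon> Y) Z. app q Z u = \<one>\<^bsub>grp F Z\<^esub>})"
    unfolding ab by (simp add: a q kernel_def)
  have ep: "presheaf_epi C q \<longleftrightarrow> (\<forall>Z\<in>Ob C. app q Z ` el (\<Upsilon> Y) Z = el F Z)"
    unfolding ab by (simp add: q)
  have app: "app q Z (\<iota> y) = res F y ?x" if "y \<in> Ar C" "dom C y = Z" "cod C y = Y" for y Z
    by (rule app_from_\<Upsilon>[OF True that])
  have app2: "app q Z (\<iota> y) = res F y ?x" if "y \<in> Hom C Z Y" for y Z using app that by simp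
  have surj: "app q Z ` el (\<Upsilon> Y) Z = el F Z \<longleftrightarrow> (\<forall>z\<in>el F Z. \<exists>y\<in>Hom C Z Y. z = res F y ?x)" if Z: "Z \<in> Ob C" for Z
  proof -
    have "app q Z ` el (\<Upsilon> Y) Z = (\<lambda>y. res F y ?x) ` Hom C Z Y"
      unfolding el_\<Upsilon> image_image by (rule image_cong) (use app in auto)
    moreover have "app q Z ` el (\<Upsilon> Y) Z \<subseteq> el F Z" using True Z by auto
    ultimately show ?thesis by blast
  qed
  have ker: "app (\<Upsilon>\<^sub>m f) Z ` el (\<Upsilon> X) Z = {u \<in> el (\<Upsilon> Y) Z. app q Z u = \<one>\<^bsub>grp F Z\<^esub>} \<longleftrightarrow>
    (\<forall>y\<in>Hom C Z Y. res F y ?x = \<one>\<^bsub>grp F Z\<^esub> \<longleftrightarrow> (\<exists>s\<in>Hom C Z X. y = f \<cdot> s))" if Z: "Z \<in> Ob C" for Z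
  proof -
    have 1: "app (\<Upsilon>\<^sub>m f) Z ` el (\<Upsilon> X) Z = \<iota> ` (\<lambda>s. f \<cdot> s) ` Hom C Z X"
      unfolding el_\<Upsilon> image_image by (rule image_cong) (use ft in auto)
    have 2: "{u \<in> el (\<Upsilon> Y) Z. app q Z u = \<one>\<^bsub>grp F Z\<^esub>} = \<iota> ` {y \<in> Hom C Z Y. res F y ?x = \<one>\<^bsub>grp F Z\<^esub>}"
      unfolding el_\<Upsilon> Compr_image_eq using app2 by (simp cong: conj_cong del: Hom_iff)
    have "(\<lambda>s. f \<cdot> s) ` Hom C Z X \<subseteq> Ar C" "{y \<in> Hom C Z Y. res F y ?x = \<one>\<^bsub>grp F Z\<^esub>} \<subseteq> Ar C"
      using ft by auto
    then have 3: "\<iota> ` (\<lambda>s. f \<cdot> s) ` Hom C Z X = \<iota> ` {y \<in> Hom C Z Y. res F y ?x = \<one>\<^bsub>grp F Z\<^esub>} \<longleftrightarrow>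
      (\<lambda>s. f \<cdot> s) ` Hom C Z X = {y \<in> Hom C Z Y. res F y ?x = \<one>\<^bsub>grp F Z\<^esub>}"
      by (rule inj_on_image_eq_iff[OF inj_\<iota>])
    have "(\<lambda>s. f \<cdot> s) ` Hom C Z X \<subseteq> Hom C Z Y" using ft by auto
    then show ?thesis unfolding 1 2 3 by blast
  qed
  \<comment> \<open>Exactness ranges over the objects first, \<open>pres\<close> over all morphisms
    into \<open>Y\<close>; both quantify over the same morphisms.\<close>
  have rel: "(\<forall>Z\<in>Ob C. \<forall>y\<in>Hom C Z Y. P y Z) \<longleftrightarrow> (\<forall>y\<in>Ar C. cod C y = Y \<longrightarrow> P y (dom C y))" for P
    by auto
  have "?x \<in> el F Y" using True X by simp
  then show ?thesis
    using True Hom_presheaf[OF True] ft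
    unfolding presents_def ez ep pres_def ft by (simp add: surj ker del: Hom_iff) (simp only: rel, blast)
next
  case False
  then show ?thesis using f by (auto simp: presents_def)
qed

lemma pres_presents:
  assumes P: "pres F f x" and f: "f \<in> Hom C X Y"
  shows "presents C \<iota> f (yon F Y x) F"
  unfolding presents_iff[OF f]
  using yon_Hom[of F Y x] presD(1,2)[OF P f] P f by auto

section \<open>Admissibly presented and effaceable presheaves\<close>

definition Adm :: "('o, 'm, 'u) presheaf set" where
  "Adm = {F. \<exists>f x. admissible C f \<and> pres F f x}"

lemma AdmE:
  assumes "F \<in> Adm"
  obtains f x X Y where "admissible C f" "pres F f x" "f \<in> Hom C X Y"
proof -
  obtain f x where "admissible C f" "pres F f x" using assms by (auto simp: Adm_def)
  then show ?thesis using that[of f x "dom C f" "cod C f"] admissible_Ar[of f] by simp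
qed

lemma AdmI: "admissible C f \<Longrightarrow> pres F f x \<Longrightarrow> F \<in> Adm"
  by (auto simp: Adm_def)

lemma Adm_presheaf: "F \<in> Adm \<Longrightarrow> is_presheaf C F"
  by (auto simp: Adm_def pres_def)

lemma mod_adm_eq: "\<A> = full_subcategory (ModC C) Adm"
proof -
  have "{F. \<exists>f q. admissible C f \<and> presents C \<iota> f q F} = Adm"
  proof (intro equalityI subsetI CollectI)
    fix F assume "F \<in> {F. \<exists>f q. admissible C f \<and> presents C \<iota> f q F}"
    then obtain f q where f: "admissible C f" "presents C \<iota> f q F" by blast
    then have "pres F f (app q (cod C f) (\<iota> (ident C (cod C f))))"
      using presents_iff[of f "dom C f" "cod C f" q F] admissible_Ar[OF f(1)] by simp
    then show "F \<in> Adm" by (rule AdmI[OF f(1)])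
  next
    fix F assume "F \<in> Adm"
    then show "\<exists>f q. admissible C f \<and> presents C \<iota> f q F" by (elim AdmE) (blast intro: pres_presents)
  qed
  then show ?thesis by (simp add: mod_adm_def)
qed

definition effaceable :: "('o, 'm, 'u) presheaf \<Rightarrow> bool" where
  "effaceable F \<longleftrightarrow> (\<forall>Z\<in>Ob C. \<forall>z\<in>el F Z. \<exists>p. deflation C p \<and> cod C p = Z \<and> res F p z = \<one>\<^bsub>grp F (dom C p)\<^esub>)"

lemma effaceableE:
  assumes "effaceable F" "Z \<in> Ob C" "z \<in> el F Z"
  obtains p where "deflation C p" "p \<in> Ar C" "cod C p = Z" "res F p z = \<one>\<^bsub>grp F (dom C p)\<^esub>"
  using assms unfolding effaceable_def by (metis deflation_Ar)

text \<open>A morphism can be lifted along a deflation after precomposing it with a deflation onto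
  its source.\<close>

lemma deflation_factor:
  assumes p: "deflation C p" and f: "f \<in> Ar C" "cod C f = cod C p"
  obtains q g where "deflation C q" "q \<in> Ar C" "g \<in> Ar C" "cod C q = dom C f" "dom C g = dom C q"
    "cod C g = dom C p" "p \<cdot> g = f \<cdot> q"
proof -
  obtain q g where pb: "is_pullback C q g p f" and q: "deflation C q" using obtain_pullback[OF p f] .
  show ?thesis using that[of q g] q is_pullbackD[OF pb] by simp
qed

text \<open>Each element is named by some \<open>y\<close> into the codomain of \<open>f\<close>.
  After a deflation, \<open>y\<close> factors through \<open>f\<close>, and then the element
  dies.\<close>

lemma pres_deflation_effaceable:
  assumes f: "deflation C f" and P: "pres F f x"
  shows "effaceable F"
  unfolding effaceable_def
proof (intro ballI)
  have ft: "f \<in> Ar C" "f \<in> Hom C (dom C f) (cod C f)" using f by simp_all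
  note p = presD(1,2)[OF P ft(2)]
  fix Z z assume Z: "Z \<in> Ob C" "z \<in> el F Z"
  then obtain y where y: "y \<in> Ar C" "dom C y = Z" "cod C y = cod C f" "z = res F y x"
    using presD(3)[OF P ft(2)] by blast
  obtain q g where q: "deflation C q" "q \<in> Ar C" "g \<in> Ar C" "cod C q = Z" "dom C g = dom C q"
    "cod C g = dom C f" "f \<cdot> g = y \<cdot> q"
    using deflation_factor[OF f y(1,3)] y(2) by metis
  have "res F q z = res F (f \<cdot> g) x" unfolding q(7) using y q(1-6) p by simp
  also have "\<dots> = \<one>\<^bsub>grp F (dom C q)\<^esub>" using q(1-6) p ft pres_zero[OF P ft(2)] by simp
  finally show "\<exists>p. deflation C p \<and> cod C p = Z \<and> res F p z = \<one>\<^bsub>grp F (dom C p)\<^esub>" using q by blast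
qed

text \<open>A deflation that kills the generator is a relation and factors through \<open>f\<close>,
  so \<open>admissible_deflationI\<close> applies.\<close>

lemma pres_effaceable_deflation:
  assumes f: "admissible C f" and P: "pres F f x" and e: "effaceable F"
  shows "deflation C f"
proof -
  have ft: "f \<in> Ar C" "f \<in> Hom C (dom C f) (cod C f)" using admissible_Ar[OF f] by simp_all
  obtain p where p: "deflation C p" "p \<in> Ar C" "cod C p = cod C f" "res F p x = \<one>\<^bsub>grp F (dom C p)\<^esub>"
    using effaceableE[OF e _ presD(2)[OF P ft(2)]] ft by auto
  then obtain s where s: "s \<in> Ar C" "dom C s = dom C p" "cod C s = dom C f" "p = f \<cdot> s"
    using presD(4)[OF P ft(2), of p "dom C p"] by auto
  show ?thesis
    by (rule admissible_deflationI[OF f s(1,3)]) (use p(1) s(4) in simp)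
qed

definition Eff :: "('o, 'm, 'u) presheaf set" where
  "Eff = {F \<in> Adm. effaceable F}"

lemma eff_eq: "eff C \<iota> = full_subcategory (ModC C) Eff"
proof -
  have "{F. \<exists>f q. deflation C f \<and> presents C \<iota> f q F} = Eff"
  proof (intro equalityI subsetI CollectI)
    fix F assume "F \<in> {F. \<exists>f q. deflation C f \<and> presents C \<iota> f q F}"
    then obtain f q where f: "deflation C f" "presents C \<iota> f q F" by blast
    then obtain x where "pres F f x" using presents_iff[of f "dom C f" "cod C f" q F] by auto
    then show "F \<in> Eff"
      using pres_deflation_effaceable[OF f(1)] AdmI[OF deflation_admissible[OF f(1)]] by (simp add: Eff_def)
  next
    fix F assume "F \<in> Eff"
    then have e: "effaceable F" and "F \<in> Adm" by (auto simp: Eff_def)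
    then obtain f x X Y where "admissible C f" "pres F f x" "f \<in> Hom C X Y" by (elim AdmE)
    then show "\<exists>f q. deflation C f \<and> presents C \<iota> f q F"
      using e pres_effaceable_deflation pres_presents by blast
  qed
  then show ?thesis by (simp add: eff_def)
qed

text \<open>A first deflation moves the element into \<open>K\<close>, and a second one kills it
  there.\<close>

lemma effaceable_ext:
  assumes se: "short_exact i p K G Q" and e: "effaceable K" "effaceable Q"
  shows "effaceable G"
  unfolding effaceable_def
proof (intro ballI)
  note i = short_exactD(1)[OF se] and p = short_exactD(2)[OF se]
  note ps = Hom_presheaf[OF i] Hom_presheaf[OF p]
  fix Z z assume Z: "Z \<in> Ob C" "z \<in> el G Z"
  obtain d where d: "deflation C d" "d \<in> Ar C" "cod C d = Z" "res Q d (app p Z z) = \<one>\<^bsub>grp Q (dom C d)\<^esub>"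
    using effaceableE[OF e(2) Z(1) app_el[OF p Z]] .
  have "app p (dom C d) (res G d z) = \<one>\<^bsub>grp Q (dom C d)\<^esub>" using d p Z by simp
  then obtain x where x: "x \<in> el K (dom C d)" "res G d z = app i (dom C d) x"
    using short_exact_kernelE[OF se, of "dom C d" "res G d z"] d Z ps by auto
  obtain d' where d': "deflation C d'" "d' \<in> Ar C" "cod C d' = dom C d" "res K d' x = \<one>\<^bsub>grp K (dom C d')\<^esub>"
    using effaceableE[OF e(1) _ x(1)] d by auto
  have "res G (d \<cdot> d') z = res G d' (app i (dom C d) x)" using x d d' Z ps by simp
  also have "\<dots> = app i (dom C d') (res K d' x)" using d'(1-3) x(1) i by simp
  also have "\<dots> = \<one>\<^bsub>grp G (dom C d')\<^esub>" unfolding d'(4) using d'(2) i by simp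
  finally show "\<exists>p. deflation C p \<and> cod C p = Z \<and> res G p z = \<one>\<^bsub>grp G (dom C p)\<^esub>"
    using d d' cmp_deflation[OF d'(1) d(1)] by (intro exI[of _ "d \<cdot> d'"]) simp
qed

section \<open>Closure under extensions and products\<close>

lemma matrix_apply:
  assumes B: "biproduct C X X' B i1 i2 p1 p2" and B': "biproduct C Y Y' B' j1 j2 q1 q2"
    and M: "M \<in> Hom C B B'" "q1 \<cdot> (M \<cdot> i1) = f" "q1 \<cdot> (M \<cdot> i2) = g" "q2 \<cdot> (M \<cdot> i1) = zero_mor C X Y'" "q2 \<cdot> (M \<cdot> i2) = f'"
    and s: "s \<in> Hom C T B"
  shows "q1 \<cdot> (M \<cdot> s) = add_mor C (f \<cdot> (p1 \<cdot> s)) (g \<cdot> (p2 \<cdot> s))" "q2 \<cdot> (M \<cdot> s) = f' \<cdot> (p2 \<cdot> s)"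
proof -
  interpret b: biprod C X X' B i1 i2 p1 p2 by unfold_locales (rule B)
  interpret b': biprod C Y Y' B' j1 j2 q1 q2 by unfold_locales (rule B')
  have Mt: "M \<in> Ar C" "dom C M = B" "cod C M = B'" and st: "s \<in> Ar C" "dom C s = T" "cod C s = B" using M s by auto
  have T: "T \<in> Ob C" using st by auto
  have e: "s = add_mor C (i1 \<cdot> (p1 \<cdot> s)) (i2 \<cdot> (p2 \<cdot> s))"
  proof -
    have "add_mor C (i1 \<cdot> p1) (i2 \<cdot> p2) \<cdot> s = s" using st by (simp add: b.biprod_sum)
    then show ?thesis using add_cmp[OF s, of "i1 \<cdot> p1" B "i2 \<cdot> p2"] st by simp
  qed
  have a: "q \<cdot> (M \<cdot> s) = add_mor C ((q \<cdot> (M \<cdot> i1)) \<cdot> (p1 \<cdot> s)) ((q \<cdot> (M \<cdot> i2)) \<cdot> (p2 \<cdot> s))"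
    if q: "q \<in> Ar C" "dom C q = B'" for q
  proof -
    have "(q \<cdot> M) \<cdot> add_mor C (i1 \<cdot> (p1 \<cdot> s)) (i2 \<cdot> (p2 \<cdot> s)) =
        add_mor C ((q \<cdot> M) \<cdot> (i1 \<cdot> (p1 \<cdot> s))) ((q \<cdot> M) \<cdot> (i2 \<cdot> (p2 \<cdot> s)))"
      by (rule cmp_add[where X=T and Y=B and Z="cod C q"]) (use q Mt st in simp_all)
    then show ?thesis unfolding e[symmetric] using q Mt st by simp
  qed
  show "q1 \<cdot> (M \<cdot> s) = add_mor C (f \<cdot> (p1 \<cdot> s)) (g \<cdot> (p2 \<cdot> s))"
    using a[of q1] M(2,3) by simp
  have f': "f' \<in> Ar C" "dom C f' = X'" "cod C f' = Y'" using M(5) Mt by auto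
  show "q2 \<cdot> (M \<cdot> s) = f' \<cdot> (p2 \<cdot> s)"
    using a[of q2] f' st T unfolding M(4,5) by simp
qed

text \<open>A horseshoe argument: the generator of \<open>H\<close> has a preimage \<open>g0\<close>
  in \<open>G\<close>, and restricting \<open>g0\<close> along \<open>f'\<close> leaves an element
  of \<open>F\<close>. Its name in the presentation of \<open>F\<close> is, up to sign, the
  off-diagonal entry of the matrix presenting \<open>G\<close>.\<close>

lemma Adm_ext:
  assumes se: "short_exact a b F G H" and F: "F \<in> Adm" and H: "H \<in> Adm"
  shows "G \<in> Adm"
proof -
  note a = short_exactD(1)[OF se] and b = short_exactD(2)[OF se]
  note ps = Hom_presheaf[OF a] Hom_presheaf[OF b]
  obtain f x X Y where f: "admissible C f" and P: "pres F f x" and fH: "f \<in> Hom C X Y" using F by (rule AdmE)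
  obtain f' x' X' Y' where f': "admissible C f'" and P': "pres H f' x'" and fH': "f' \<in> Hom C X' Y'" using H by (rule AdmE)
  have ft: "f \<in> Ar C" "dom C f = X" "cod C f = Y" "f' \<in> Ar C" "dom C f' = X'" "cod C f' = Y'"
    and Ob: "X \<in> Ob C" "Y \<in> Ob C" "X' \<in> Ob C" "Y' \<in> Ob C" using fH fH' by auto
  note x = presD(2)[OF P fH] and x' = presD(2)[OF P' fH']
  obtain g0 where g0: "g0 \<in> el G Y'" "app b Y' g0 = x'" using short_exact_surjE[OF se Ob(4) x'] by metis
  have "app b X' (res G f' g0) = \<one>\<^bsub>grp H X'\<^esub>" using g0 b ft pres_zero[OF P' fH'] by simp
  then obtain x1 where x1: "x1 \<in> el F X'" "res G f' g0 = app a X' x1"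
    using short_exact_kernelE[OF se Ob(3), of "res G f' g0"] g0 ft ps by auto
  \<comment> \<open>The inverse is taken so that the column \<open>(g, f')\<close> becomes a
    relation between the two generators, the image of \<open>x\<close> and
    \<open>g0\<close>.\<close>
  obtain g where g: "g \<in> Ar C" "dom C g = X'" "cod C g = Y" "inv\<^bsub>grp F X'\<^esub> x1 = res F g x"
    using presD(3)[OF P fH Ob(3), of "inv\<^bsub>grp F X'\<^esub> x1"] x1 Ob ps by auto
  have x1g: "x1 = inv\<^bsub>grp F X'\<^esub> res F g x"
    unfolding g(4)[symmetric] using group.inv_inv[OF presheaf_group[OF ps(1) Ob(3)] x1(1)] by simp
  \<comment> \<open>All restrictions of \<open>g0\<close> along multiples of \<open>f'\<close> are
    thereby expressed through \<open>F\<close>.\<close>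
  have rel: "res G s (res G f' g0) = inv\<^bsub>grp G T\<^esub> app a T (res F (g \<cdot> s) x)"
    if s: "s \<in> Ar C" "dom C s = T" "cod C s = X'" for s T
  proof -
    have T: "T \<in> Ob C" using s by auto
    have "res G s (res G f' g0) = app a T (res F s x1)" unfolding x1(2) using s x1 a by simp
    also have "\<dots> = inv\<^bsub>grp G T\<^esub> app a T (res F (g \<cdot> s) x)" unfolding x1g using s g x a ps T by simp
    finally show ?thesis .
  qed
  \<comment> \<open>If \<open>f'\<close> annihilates \<open>s\<close>, the restriction of
    \<open>g0\<close> along \<open>f' \<cdot> s\<close> vanishes. By injectivity of
    \<open>a\<close>, the composite \<open>g \<cdot> s\<close> is then a relation in
    \<open>F\<close>.\<close>
  have lift: "\<exists>t\<in>Hom C T X. f \<cdot> t = g \<cdot> s" if s: "s \<in> Hom C T X'" "f' \<cdot> s = zero_mor C T Y'" for s T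
  proof -
    have st: "s \<in> Ar C" "dom C s = T" "cod C s = X'" and T: "T \<in> Ob C" using s by auto
    have "res G (f' \<cdot> s) g0 = \<one>\<^bsub>grp G T\<^esub>" unfolding s(2) using g0 T Ob ps by simp
    then have "inv\<^bsub>grp G T\<^esub> app a T (res F (g \<cdot> s) x) = \<one>\<^bsub>grp G T\<^esub>"
      using rel[OF st] st ft g0 ps by simp
    then have "app a T (res F (g \<cdot> s) x) = \<one>\<^bsub>grp G T\<^esub>"
      by (subst (asm) group.inv_eq_1_iff[OF presheaf_group[OF ps(2) T]]) (use a st g(1-3) x T Ob ps in simp_all)
    then have "res F (g \<cdot> s) x = \<one>\<^bsub>grp F T\<^esub>"
      by (intro inj_one[OF a T short_exactD(3)[OF se T]]) (use st g x ps in simp_all)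
    then show ?thesis using presD(4)[OF P fH, of "g \<cdot> s" T] st g by auto
  qed
  obtain B i1 i2 p1 p2 where B: "biproduct C X X' B i1 i2 p1 p2" using obtain_biproduct[OF Ob(1,3)] .
  obtain B' j1 j2 q1 q2 where B': "biproduct C Y Y' B' j1 j2 q1 q2" using obtain_biproduct[OF Ob(2,4)] .
  interpret b: biprod C X X' B i1 i2 p1 p2 by unfold_locales (rule B)
  interpret b': biprod C Y Y' B' j1 j2 q1 q2 by unfold_locales (rule B')
  have gH: "g \<in> Hom C X' Y" using g by simp
  obtain M where M: "M \<in> Hom C B B'" "admissible C M" "q1 \<cdot> (M \<cdot> i1) = f" "q1 \<cdot> (M \<cdot> i2) = g"
    "q2 \<cdot> (M \<cdot> i1) = zero_mor C X Y'" "q2 \<cdot> (M \<cdot> i2) = f'"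
    using admissible_matrix[OF f fH f' fH' gH lift B B'] by blast
  note Ma = matrix_apply[OF B B' M(1,3-6)]
  have Mt: "M \<in> Ar C" "dom C M = B" "cod C M = B'" using M(1) by auto
  \<comment> \<open>The generator of \<open>G\<close> combines the image of \<open>x\<close>, on the
    summand \<open>Y\<close>, with the lift \<open>g0\<close>, on the summand
    \<open>Y'\<close>.\<close>
  define z where "z = res G q1 (app a Y x) \<otimes>\<^bsub>grp G B'\<^esub> res G q2 g0"
  have z: "z \<in> el G B'" using a x Ob ps g0 by (simp add: z_def)
  have rz: "res G w z = app a T (res F (q1 \<cdot> w) x) \<otimes>\<^bsub>grp G T\<^esub> res G (q2 \<cdot> w) g0"
    if w: "w \<in> Ar C" "dom C w = T" "cod C w = B'" for w T
    using w a x Ob ps g0 by (simp add: z_def)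
  have "pres G M z"
  proof (rule presI[OF ps(2) M(1) z])
    fix Z h assume Z: "Z \<in> Ob C" "h \<in> el G Z"
    obtain y' where y': "y' \<in> Ar C" "dom C y' = Z" "cod C y' = Y'" "app b Z h = res H y' x'"
      using presD(3)[OF P' fH' Z(1) app_el[OF b Z]] by blast
    have rg: "res G y' g0 \<in> el G Z" using y' g0 ps by simp
    have "app b Z (h \<otimes>\<^bsub>grp G Z\<^esub> inv\<^bsub>grp G Z\<^esub> res G y' g0) = \<one>\<^bsub>grp H Z\<^esub>"
      using Z y' g0 b ps rg by (simp add: x')
    then obtain u where u: "u \<in> el F Z" "h \<otimes>\<^bsub>grp G Z\<^esub> inv\<^bsub>grp G Z\<^esub> res G y' g0 = app a Z u"
      using short_exact_kernelE[OF se Z(1), of "h \<otimes>\<^bsub>grp G Z\<^esub> inv\<^bsub>grp G Z\<^esub> res G y' g0"] Z rg ps by auto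
    obtain y where y: "y \<in> Ar C" "dom C y = Z" "cod C y = Y" "u = res F y x"
      using presD(3)[OF P fH Z(1) u(1)] by blast
    have "h = app a Z u \<otimes>\<^bsub>grp G Z\<^esub> res G y' g0" using el_diff_mult[OF ps(2) Z rg] u by simp
    then have "h = res G (b'.pair y y') z" using y y' rz[of "b'.pair y y'" Z] by simp
    then show "\<exists>y. y \<in> Ar C \<and> dom C y = Z \<and> cod C y = B' \<and> h = res G y z"
      using y y' by (intro exI[of _ "b'.pair y y'"]) simp
  next
    fix Z w assume w: "w \<in> Ar C" "dom C w = Z" "cod C w = B'" "res G w z = \<one>\<^bsub>grp G Z\<^esub>"
    have Z: "Z \<in> Ob C" using w by auto
    have "app b Z (app a Z (res F (q1 \<cdot> w) x) \<otimes>\<^bsub>grp G Z\<^esub> res G (q2 \<cdot> w) g0) = \<one>\<^bsub>grp H Z\<^esub>"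
      unfolding rz[OF w(1-3), symmetric] w(4) using b Z by simp
    then have "res H (q2 \<cdot> w) x' = \<one>\<^bsub>grp H Z\<^esub>"
      using short_exact_zero[OF se Z, of "res F (q1 \<cdot> w) x"] a b w Z x g0 ps x' by simp
    then obtain s' where s': "s' \<in> Ar C" "dom C s' = Z" "cod C s' = X'" "q2 \<cdot> w = f' \<cdot> s'"
      using presD(4)[OF P' fH', of "q2 \<cdot> w" Z] w by auto
    have "res G (q2 \<cdot> w) g0 = inv\<^bsub>grp G Z\<^esub> app a Z (res F (g \<cdot> s') x)"
      unfolding s'(4) using rel[OF s'(1-3)] s'(1-3) ft g0 ps by simp
    then have "app a Z (res F (q1 \<cdot> w) x) \<otimes>\<^bsub>grp G Z\<^esub> inv\<^bsub>grp G Z\<^esub> app a Z (res F (g \<cdot> s') x) = \<one>\<^bsub>grp G Z\<^esub>"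
      using w(4) rz[OF w(1-3)] by simp
    then have e: "app a Z (res F (q1 \<cdot> w) x) = app a Z (res F (g \<cdot> s') x)"
      by (subst (asm) el_diff_one[OF ps(2) Z]) (use a w s'(1-3) g x Z ps in simp_all)
    have "res F (q1 \<cdot> w) x = res F (g \<cdot> s') x"
      by (rule inj_onD[OF short_exactD(3)[OF se Z] e]) (use w s'(1-3) g x Z ps in simp_all)
    then obtain s where s: "s \<in> Ar C" "dom C s = Z" "cod C s = X" "(q1 \<cdot> w) \<^bold>- (g \<cdot> s') = f \<cdot> s"
      using pres_diff[OF P fH, of "q1 \<cdot> w" Z "g \<cdot> s'"] w s'(1-3) g by auto
    have "w = M \<cdot> b.pair s s'"
    proof (rule b'.to_biprod_eqI)
      have "q1 \<cdot> w = add_mor C (f \<cdot> s) (g \<cdot> s')"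
        unfolding s(4)[symmetric] by (rule minus_add_cancel[where X=Z and Y=Y, symmetric]) (use w g s'(1-3) in simp_all)
      then show "q1 \<cdot> w = q1 \<cdot> (M \<cdot> b.pair s s')" using Ma(1)[of "b.pair s s'" Z] s s' by simp
      show "q2 \<cdot> w = q2 \<cdot> (M \<cdot> b.pair s s')" using Ma(2)[of "b.pair s s'" Z] s s' by simp
    qed (use w s s' Mt in simp_all)
    then show "\<exists>s. s \<in> Ar C \<and> dom C s = Z \<and> cod C s = B \<and> w = M \<cdot> s"
      using s s' by (intro exI[of _ "b.pair s s'"]) simp
  next
    have p: "p1 \<in> Hom C B X" "p2 \<in> Hom C B X'" by simp_all
    have q1M: "q1 \<cdot> M = add_mor C (f \<cdot> p1) (g \<cdot> p2)" and q2M: "q2 \<cdot> M = f' \<cdot> p2"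
      using Ma[of "ident C B" B] Mt by simp_all
    have "res F (add_mor C (f \<cdot> p1) (g \<cdot> p2)) x = res F p1 (res F f x) \<otimes>\<^bsub>grp F B\<^esub> res F (g \<cdot> p2) x"
      using res_add[OF ps(1), of "f \<cdot> p1" B Y "g \<cdot> p2" x] ft g x ps by simp
    also have "\<dots> = res F (g \<cdot> p2) x" using pres_zero[OF P fH] g x ps by simp
    finally show "res G M z = \<one>\<^bsub>grp G B\<^esub>"
      unfolding rz[OF Mt] q1M q2M using rel[of p2 B] ft g x a ps g0 by simp
  qed
  then show ?thesis using M(2) AdmI by blast
qed

text \<open>The diagonal case of \<open>admissible_matrix\<close> presents the product. The functor
  is first obtained as a cokernel, and its two maps to \<open>F\<close> and \<open>G\<close> are
  then shown to be jointly bijective.\<close>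

lemma Adm_prod:
  assumes F: "F \<in> Adm" and G: "G \<in> Adm"
  shows "\<exists>B\<in>Adm. \<exists>p1\<in>Hom (ModC C) B F. \<exists>p2\<in>Hom (ModC C) B G.
    \<forall>Z\<in>Ob C. bij_betw (\<lambda>x. (app p1 Z x, app p2 Z x)) (el B Z) (el F Z \<times> el G Z)"
proof -
  obtain f x X Y where f: "admissible C f" and P: "pres F f x" and fH: "f \<in> Hom C X Y" using F by (rule AdmE)
  obtain f' x' X' Y' where f': "admissible C f'" and P': "pres G f' x'" and fH': "f' \<in> Hom C X' Y'" using G by (rule AdmE)
  have ft: "f \<in> Ar C" "dom C f = X" "cod C f = Y" "f' \<in> Ar C" "dom C f' = X'" "cod C f' = Y'"
    and Ob: "X \<in> Ob C" "Y \<in> Ob C" "X' \<in> Ob C" "Y' \<in> Ob C" using fH fH' by auto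
  note x = presD(1,2)[OF P fH] and x' = presD(1,2)[OF P' fH']
  obtain B i1 i2 p1 p2 where B: "biproduct C X X' B i1 i2 p1 p2" using obtain_biproduct[OF Ob(1,3)] .
  obtain B' j1 j2 q1 q2 where B': "biproduct C Y Y' B' j1 j2 q1 q2" using obtain_biproduct[OF Ob(2,4)] .
  interpret b: biprod C X X' B i1 i2 p1 p2 by unfold_locales (rule B)
  interpret b': biprod C Y Y' B' j1 j2 q1 q2 by unfold_locales (rule B')
  have zH: "zero_mor C X' Y \<in> Hom C X' Y" using Ob by simp
  have lift: "\<exists>t\<in>Hom C T X. f \<cdot> t = zero_mor C X' Y \<cdot> s" if "s \<in> Hom C T X'" for s T
    using that ft Ob by (intro bexI[of _ "zero_mor C T X"]) auto
  obtain M where M: "M \<in> Hom C B B'" "admissible C M" "q1 \<cdot> (M \<cdot> i1) = f" "q1 \<cdot> (M \<cdot> i2) = zero_mor C X' Y"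
    "q2 \<cdot> (M \<cdot> i1) = zero_mor C X Y'" "q2 \<cdot> (M \<cdot> i2) = f'"
    using admissible_matrix[OF f fH f' fH' zH lift B B'] by blast
  have Mt: "M \<in> Ar C" "dom C M = B" "cod C M = B'" using M(1) by auto
  have Ma: "q1 \<cdot> (M \<cdot> s) = f \<cdot> (p1 \<cdot> s)" "q2 \<cdot> (M \<cdot> s) = f' \<cdot> (p2 \<cdot> s)" if "s \<in> Hom C T B" for s T
    using matrix_apply[OF B B' M(1,3-6) that] that ft Ob by auto
  have qM: "q1 \<cdot> M = f \<cdot> p1" "q2 \<cdot> M = f' \<cdot> p2" using Ma[of "ident C B" B] Mt by simp_all
  obtain E z where E: "pres E M z" using pres_exists[OF M(1)] .
  note z = presD(1,2)[OF E M(1)]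
  have "res F M (res F q1 x) = res F (q1 \<cdot> M) x" using Mt x by simp
  also have "\<dots> = \<one>\<^bsub>grp F B\<^esub>" unfolding qM using pres_zero[OF P fH] ft x by simp
  finally obtain \<alpha> where \<alpha>: "\<alpha> \<in> Hom (ModC C) E F" "app \<alpha> B' z = res F q1 x"
    using pres_hom_exists[OF E M(1) x(1), of "res F q1 x"] x by auto
  have "res G M (res G q2 x') = res G (q2 \<cdot> M) x'" using Mt x' by simp
  also have "\<dots> = \<one>\<^bsub>grp G B\<^esub>" unfolding qM using pres_zero[OF P' fH'] ft x' by simp
  finally obtain \<beta> where \<beta>: "\<beta> \<in> Hom (ModC C) E G" "app \<beta> B' z = res G q2 x'"
    using pres_hom_exists[OF E M(1) x'(1), of "res G q2 x'"] x' by auto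
  have ap: "app \<alpha> Z (res E w z) = res F (q1 \<cdot> w) x" "app \<beta> Z (res E w z) = res G (q2 \<cdot> w) x'"
    if "w \<in> Ar C" "dom C w = Z" "cod C w = B'" for w Z using that \<alpha> \<beta> z x x' by simp_all
  have "bij_betw (\<lambda>x. (app \<alpha> Z x, app \<beta> Z x)) (el E Z) (el F Z \<times> el G Z)" if Z: "Z \<in> Ob C" for Z
    unfolding bij_betw_def
  proof
    show "inj_on (\<lambda>x. (app \<alpha> Z x, app \<beta> Z x)) (el E Z)"
    proof (rule inj_onI)
      fix u v assume uv: "u \<in> el E Z" "v \<in> el E Z" "(app \<alpha> Z u, app \<beta> Z u) = (app \<alpha> Z v, app \<beta> Z v)"
      have d: "u \<otimes>\<^bsub>grp E Z\<^esub> inv\<^bsub>grp E Z\<^esub> v \<in> el E Z" using uv Z z by simp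
      then obtain w where w: "w \<in> Ar C" "dom C w = Z" "cod C w = B'" "u \<otimes>\<^bsub>grp E Z\<^esub> inv\<^bsub>grp E Z\<^esub> v = res E w z"
        using presD(3)[OF E M(1) Z] by blast
      have "app \<alpha> Z (u \<otimes>\<^bsub>grp E Z\<^esub> inv\<^bsub>grp E Z\<^esub> v) = \<one>\<^bsub>grp F Z\<^esub>" "app \<beta> Z (u \<otimes>\<^bsub>grp E Z\<^esub> inv\<^bsub>grp E Z\<^esub> v) = \<one>\<^bsub>grp G Z\<^esub>"
        using uv Z z x x' \<alpha>(1) \<beta>(1) by simp_all
      then have "res F (q1 \<cdot> w) x = \<one>\<^bsub>grp F Z\<^esub>" "res G (q2 \<cdot> w) x' = \<one>\<^bsub>grp G Z\<^esub>"
        unfolding w(4) using ap[OF w(1-3)] by simp_all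
      then obtain s s' where s: "s \<in> Ar C" "dom C s = Z" "cod C s = X" "q1 \<cdot> w = f \<cdot> s"
        and s': "s' \<in> Ar C" "dom C s' = Z" "cod C s' = X'" "q2 \<cdot> w = f' \<cdot> s'"
        using presD(4)[OF P fH, of "q1 \<cdot> w" Z] presD(4)[OF P' fH', of "q2 \<cdot> w" Z] w(1-3) by auto
      have "w = M \<cdot> b.pair s s'"
      proof (rule b'.to_biprod_eqI)
        show "q1 \<cdot> w = q1 \<cdot> (M \<cdot> b.pair s s')" using Ma(1)[of "b.pair s s'" Z] s s' by simp
        show "q2 \<cdot> w = q2 \<cdot> (M \<cdot> b.pair s s')" using Ma(2)[of "b.pair s s'" Z] s s' by simp
      qed (use w s s' Mt in simp_all)
      then have "res E w z = \<one>\<^bsub>grp E Z\<^esub>"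
        using presD(4)[OF E M(1) w(1-3)] s s' by (metis b.pair_Hom(1-3))
      then show "u = v" using w(4) uv Z z by (simp add: el_diff_one)
    qed
    show "(\<lambda>x. (app \<alpha> Z x, app \<beta> Z x)) ` el E Z = el F Z \<times> el G Z"
    proof (intro equalityI subsetI)
      fix uv assume "uv \<in> el F Z \<times> el G Z"
      then obtain u v where uv: "uv = (u, v)" "u \<in> el F Z" "v \<in> el G Z" by blast
      obtain y where y: "y \<in> Ar C" "dom C y = Z" "cod C y = Y" "u = res F y x"
        using presD(3)[OF P fH Z uv(2)] by blast
      obtain y' where y': "y' \<in> Ar C" "dom C y' = Z" "cod C y' = Y'" "v = res G y' x'"
        using presD(3)[OF P' fH' Z uv(3)] by blast
      have "uv = (app \<alpha> Z (res E (b'.pair y y') z), app \<beta> Z (res E (b'.pair y y') z))"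
        using uv y y' ap[of "b'.pair y y'" Z] by simp
      moreover have "res E (b'.pair y y') z \<in> el E Z" using y y' z by simp
      ultimately show "uv \<in> (\<lambda>x. (app \<alpha> Z x, app \<beta> Z x)) ` el E Z" by blast
    qed (use \<alpha> \<beta> Z in auto)
  qed
  then show ?thesis using AdmI[OF M(2) E] \<alpha>(1) \<beta>(1) by blast
qed

text \<open>Every morphism into \<open>X\<close> factors through the identity of \<open>X\<close>,
  so the functor presented by that identity has trivial values.\<close>

lemma Adm_zero: "\<exists>F\<in>Eff. \<forall>Z\<in>Ob C. el F Z = {\<one>\<^bsub>grp F Z\<^esub>}"
proof -
  obtain X where X: "X \<in> Ob C" using obtain_zero_object unfolding zero_object_def by metis
  have i: "ident C X \<in> Hom C X X" and d: "deflation C (ident C X)" using X ident_deflation by auto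
  obtain F x where P: "pres F (ident C X) x" using pres_exists[OF i] .
  have "el F Z = {\<one>\<^bsub>grp F Z\<^esub>}" if Z: "Z \<in> Ob C" for Z
  proof (intro equalityI subsetI)
    fix z assume "z \<in> el F Z"
    then obtain y where y: "y \<in> Ar C" "dom C y = Z" "cod C y = X" "z = res F y x" using presD(3)[OF P i Z] by blast
    then have "res F y x = \<one>\<^bsub>grp F Z\<^esub>" using presD(4)[OF P i y(1-3)] by (metis ident_left)
    then show "z \<in> {\<one>\<^bsub>grp F Z\<^esub>}" using y by simp
  qed (use Z presD(1)[OF P i] in simp)
  moreover have "F \<in> Eff"
    using AdmI[OF deflation_admissible[OF d] P] pres_deflation_effaceable[OF d P] by (simp add: Eff_def)
  ultimately show ?thesis by blast
qed

lemma Adm_ext_closed: "ext_closed C Adm"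
  using Adm_presheaf Adm_zero Adm_prod Adm_ext by unfold_locales (auto simp: Eff_def)

lemma Eff_ext_closed: "ext_closed C Eff"
proof unfold_locales
  fix F G assume F: "F \<in> Eff" and G: "G \<in> Eff"
  then obtain B p1 p2 where B: "B \<in> Adm" and p1: "p1 \<in> Hom (ModC C) B F" and p2: "p2 \<in> Hom (ModC C) B G"
    and bij: "\<And>Z. Z \<in> Ob C \<Longrightarrow> bij_betw (\<lambda>x. (app p1 Z x, app p2 Z x)) (el B Z) (el F Z \<times> el G Z)"
    using Adm_prod[of F G] by (auto simp: Eff_def)
  note ps = Hom_presheaf[OF p1] Hom_presheaf[OF p2]
  have "effaceable B"
    unfolding effaceable_def
  proof (intro ballI)
    fix Z z assume Z: "Z \<in> Ob C" "z \<in> el B Z"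
    obtain d where d: "deflation C d" "d \<in> Ar C" "cod C d = Z" "res F d (app p1 Z z) = \<one>\<^bsub>grp F (dom C d)\<^esub>"
      using effaceableE[OF _ Z(1) app_el[OF p1 Z]] F by (auto simp: Eff_def)
    have dz: "res B d z \<in> el B (dom C d)" "dom C d \<in> Ob C" using d Z ps by simp_all
    \<comment> \<open>The second deflation is chosen after restricting along the first one, so that
      the composite kills both components.\<close>
    obtain d' where d': "deflation C d'" "d' \<in> Ar C" "cod C d' = dom C d"
      "res G d' (app p2 (dom C d) (res B d z)) = \<one>\<^bsub>grp G (dom C d')\<^esub>"
      using effaceableE[OF _ dz(2) app_el[OF p2 dz(2,1)]] G by (auto simp: Eff_def)
    have D: "dom C d' \<in> Ob C" using d' by simp
    have "app p1 (dom C d') (res B (d \<cdot> d') z) = res F d' (res F d (app p1 Z z))"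
      using p1 Z d(1-3) d'(1-3) ps by simp
    also have "\<dots> = app p1 (dom C d') \<one>\<^bsub>grp B (dom C d')\<^esub>" unfolding d(4) using d(1-3) d'(1-3) ps p1 by simp
    finally have e1: "app p1 (dom C d') (res B (d \<cdot> d') z) = app p1 (dom C d') \<one>\<^bsub>grp B (dom C d')\<^esub>" .
    have "app p2 (dom C d') (res B (d \<cdot> d') z) = res G d' (app p2 (dom C d) (res B d z))"
      using p2 Z d(1-3) d'(1-3) ps by simp
    also have "\<dots> = app p2 (dom C d') \<one>\<^bsub>grp B (dom C d')\<^esub>" unfolding d'(4) using d'(1-3) p2 by simp
    finally have "(app p1 (dom C d') (res B (d \<cdot> d') z), app p2 (dom C d') (res B (d \<cdot> d') z)) =
        (app p1 (dom C d') \<one>\<^bsub>grp B (dom C d')\<^esub>, app p2 (dom C d') \<one>\<^bsub>grp B (dom C d')\<^esub>)" using e1 by simp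
    then have "res B (d \<cdot> d') z = \<one>\<^bsub>grp B (dom C d')\<^esub>"
      by (rule inj_onD[OF bij_betw_imp_inj_on[OF bij[OF D]]]) (use d d' Z ps D in simp_all)
    then show "\<exists>p. deflation C p \<and> cod C p = Z \<and> res B p z = \<one>\<^bsub>grp B (dom C p)\<^esub>"
      using d d' cmp_deflation[OF d'(1) d(1)] by (intro exI[of _ "d \<cdot> d'"]) simp
  qed
  then show "\<exists>B\<in>Eff. \<exists>p1\<in>Hom (ModC C) B F. \<exists>p2\<in>Hom (ModC C) B G.
      \<forall>Z\<in>Ob C. bij_betw (\<lambda>x. (app p1 Z x, app p2 Z x)) (el B Z) (el F Z \<times> el G Z)"
    using B p1 p2 bij by (auto simp: Eff_def)
qed (use Adm_zero Adm_presheaf Adm_ext effaceable_ext in \<open>auto simp: Eff_def\<close>)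

sublocale A: ext_closed C Adm by (rule Adm_ext_closed)
sublocale Ef: ext_closed C Eff by (rule Eff_ext_closed)

lemma mod_adm_exact: "exact_category \<A>"
  unfolding mod_adm_eq by (rule A.D_exact)

lemma eff_exact: "exact_category (eff C \<iota>)"
  unfolding eff_eq by (rule Ef.D_exact)

end

section \<open>The left adjoint of the Yoneda embedding\<close>

context exact_yoneda
begin

lemma yoneda_ident: "X \<in> Ob C \<Longrightarrow> \<Upsilon>\<^sub>m (ident C X) = ident (ModC C) (\<Upsilon> X)"
  by (rule mor_eqI[OF yoneda_Hom ModC_ident_Hom[OF \<Upsilon>_presheaf]]) (auto elim: el_\<Upsilon>E)

lemma yoneda_cmp:
  assumes f: "f \<in> Hom C X Y" and g: "g \<in> Hom C Y Z"
  shows "\<Upsilon>\<^sub>m (g \<cdot> f) = \<Upsilon>\<^sub>m g \<bullet> \<Upsilon>\<^sub>m f"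
proof (rule mor_eqI[OF yoneda_Hom ModC_cmp_Hom[OF yoneda_Hom[OF f] yoneda_Hom[OF g]]])
  fix W u assume W: "W \<in> Ob C" "u \<in> el (\<Upsilon> X) W"
  from W(2) obtain h where "h \<in> Ar C" "dom C h = W" "cod C h = X" "u = \<iota> h" by (rule el_\<Upsilon>E)
  then show "app (\<Upsilon>\<^sub>m (g \<cdot> f)) W u = app (\<Upsilon>\<^sub>m g \<bullet> \<Upsilon>\<^sub>m f) W u"
    using f g W app_cmp[OF yoneda_Hom[OF f] W] by simp
qed (use f g in simp)

lemma yoneda_add:
  assumes f: "f \<in> Hom C X Y" and g: "g \<in> Hom C X Y"
  shows "\<Upsilon>\<^sub>m (add_mor C f g) = add_mor (ModC C) (\<Upsilon>\<^sub>m f) (\<Upsilon>\<^sub>m g)"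
proof (rule mor_eqI[OF yoneda_Hom[OF add_Hom[OF f g]] ModC_add_Hom[OF yoneda_Hom[OF f] yoneda_Hom[OF g]]])
  fix W u assume W: "W \<in> Ob C" "u \<in> el (\<Upsilon> X) W"
  from W(2) obtain h where h: "h \<in> Ar C" "dom C h = W" "cod C h = X" "u = \<iota> h" by (rule el_\<Upsilon>E)
  have "h \<in> Hom C W X" using h by simp
  then show "app (\<Upsilon>\<^sub>m (add_mor C f g)) W u =
      app (add_mor (ModC C) (\<Upsilon>\<^sub>m f) (\<Upsilon>\<^sub>m g)) W u"
    unfolding app_add[OF yoneda_Hom[OF f] W] using f g h add_cmp[OF _ f g, of h W] by simp
qed

text \<open>The inverse evaluates a morphism at the identity of \<open>X\<close>.\<close>

lemma yoneda_fully_faithful: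
  assumes X: "X \<in> Ob C" and Y: "Y \<in> Ob C"
  shows "bij_betw (\<Upsilon>\<^sub>m) (Hom C X Y) (Hom (ModC C) (\<Upsilon> X) (\<Upsilon> Y))"
  unfolding bij_betw_def
proof
  have e: "app (\<Upsilon>\<^sub>m f) X (\<iota> (ident C X)) = \<iota> f" if "f \<in> Hom C X Y" for f using that X by simp
  show "inj_on (\<Upsilon>\<^sub>m) (Hom C X Y)"
  proof (rule inj_onI)
    fix f g assume fg: "f \<in> Hom C X Y" "g \<in> Hom C X Y" "\<Upsilon>\<^sub>m f = \<Upsilon>\<^sub>m g"
    then have "\<iota> f = \<iota> g" using e by metis
    then show "f = g" using fg by simp
  qed
  show "\<Upsilon>\<^sub>m ` Hom C X Y = Hom (ModC C) (\<Upsilon> X) (\<Upsilon> Y)"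
  proof (intro equalityI subsetI)
    fix \<alpha> assume \<alpha>: "\<alpha> \<in> Hom (ModC C) (\<Upsilon> X) (\<Upsilon> Y)"
    then have "app \<alpha> X (\<iota> (ident C X)) \<in> el (\<Upsilon> Y) X" using X by simp
    then obtain f where f: "f \<in> Ar C" "dom C f = X" "cod C f = Y" "app \<alpha> X (\<iota> (ident C X)) = \<iota> f" by (rule el_\<Upsilon>E)
    then have fH: "f \<in> Hom C X Y" by simp
    have "\<alpha> = \<Upsilon>\<^sub>m f"
    proof (rule mor_eqI[OF \<alpha> yoneda_Hom[OF fH]])
      fix Z u assume "Z \<in> Ob C" "u \<in> el (\<Upsilon> X) Z"
      then obtain h where "h \<in> Ar C" "dom C h = Z" "cod C h = X" "u = \<iota> h" by (elim el_\<Upsilon>E)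
      then show "app \<alpha> Z u = app (\<Upsilon>\<^sub>m f) Z u" using app_from_\<Upsilon>[OF \<alpha>, of h Z] f by simp
    qed
    then show "\<alpha> \<in> \<Upsilon>\<^sub>m ` Hom C X Y" using fH by blast
  qed (use yoneda_Hom in blast)
qed

text \<open>The presentation of a representable functor whose generator and cokernel are identities,
  as \<open>L_choice\<close> requires.\<close>

lemma pres_\<Upsilon>:
  assumes O: "zero_object C O'" and X: "X \<in> Ob C"
  shows "pres (\<Upsilon> X) (zero_mor C O' X) (\<iota> (ident C X))" "admissible C (zero_mor C O' X)"
    "is_cokernel C (ident C X) (zero_mor C O' X)"
proof -
  note c = zero_conflation[OF assms]
  have O': "O' \<in> Ob C" using O by (simp add: zero_object_def)
  show "admissible C (zero_mor C O' X)" using c by (intro inflation_admissible) (auto simp: inflation_def)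
  show "is_cokernel C (ident C X) (zero_mor C O' X)" by (rule conflation_cokernel[OF c])
  show "pres (\<Upsilon> X) (zero_mor C O' X) (\<iota> (ident C X))"
  proof (rule presI[OF \<Upsilon>_presheaf[OF X]])
    fix Z z assume "Z \<in> Ob C" "z \<in> el (\<Upsilon> X) Z"
    then obtain y where "y \<in> Ar C" "dom C y = Z" "cod C y = X" "z = \<iota> y" by (elim el_\<Upsilon>E)
    then show "\<exists>y. y \<in> Ar C \<and> dom C y = Z \<and> cod C y = X \<and> z = res (\<Upsilon> X) y (\<iota> (ident C X))"
      using X by (intro exI[of _ y]) simp
  next
    fix Z y assume y: "y \<in> Ar C" "dom C y = Z" "cod C y = X" "res (\<Upsilon> X) y (\<iota> (ident C X)) = \<one>\<^bsub>grp (\<Upsilon> X) Z\<^esub>"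
    have Z: "Z \<in> Ob C" using y by auto
    have "y = zero_mor C Z X" using y Z X by simp
    then show "\<exists>s. s \<in> Ar C \<and> dom C s = Z \<and> cod C s = O' \<and> y = zero_mor C O' X \<cdot> s"
      using Z O' X by (intro exI[of _ "zero_mor C Z O'"]) simp
  qed (use O' X in simp_all)
qed

lemma \<Upsilon>_Adm: "X \<in> Ob C \<Longrightarrow> \<Upsilon> X \<in> Adm"
  using obtain_zero_object pres_\<Upsilon> AdmI by metis

section \<open>The chosen presentation and the unit\<close>

abbreviation LL :: "('o, 'm, 'u) presheaf \<Rightarrow> 'o" where "LL \<equiv> on_ob (L_functor C \<iota>)"
abbreviation Lf :: "('o, 'm, 'u) presheaf \<Rightarrow> 'm" where "Lf F \<equiv> fst (L_choice C \<iota> F)"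
abbreviation Lq :: "('o, 'm, 'u) presheaf \<Rightarrow> ('o, 'm, 'u) presheaf_mor" where "Lq F \<equiv> fst (snd (L_choice C \<iota> F))"
abbreviation Lc :: "('o, 'm, 'u) presheaf \<Rightarrow> 'm" where "Lc F \<equiv> snd (snd (L_choice C \<iota> F))"
abbreviation LY :: "('o, 'm, 'u) presheaf \<Rightarrow> 'o" where "LY F \<equiv> cod C (Lf F)"
abbreviation Lx :: "('o, 'm, 'u) presheaf \<Rightarrow> 'u" where "Lx F \<equiv> app (Lq F) (LY F) (\<iota> (ident C (LY F)))"

lemma L_choice_props:
  assumes F: "F \<in> Adm"
  shows "admissible C (Lf F)" "Lq F \<in> Hom (ModC C) (\<Upsilon> (LY F)) F" "pres F (Lf F) (Lx F)" "is_cokernel C (Lc F) (Lf F)"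
proof -
  \<comment> \<open>\<open>Q\<close> is the condition under the choice operator in
    \<open>L_choice\<close>. It has to be shown satisfiable, including its clause on representable
    functors.\<close>
  define Q where "Q = (\<lambda>(f, q, c). admissible C f \<and> presents C \<iota> f q F \<and> is_cokernel C c f \<and>
     (\<forall>X\<in>Ob C. F = \<Upsilon> X \<longrightarrow> q = ident (ModC C) F \<and> c = ident C X))"
  have "\<exists>t. Q t"
  proof (cases "\<exists>X\<in>Ob C. F = \<Upsilon> X")
    case True
    then obtain X where X: "X \<in> Ob C" "F = \<Upsilon> X" by blast
    obtain O' where O: "zero_object C O'" using obtain_zero_object .
    have O': "O' \<in> Ob C" using O by (simp add: zero_object_def)
    note P = pres_\<Upsilon>[OF O X(1)]
    have "presents C \<iota> (zero_mor C O' X) (ident (ModC C) F) F"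
      using presents_iff[of "zero_mor C O' X" O' X "ident (ModC C) F" F] O' X P(1)
        ModC_ident_Hom[OF \<Upsilon>_presheaf[OF X(1)]] by simp
    then have "Q (zero_mor C O' X, ident (ModC C) F, ident C X)"
      unfolding Q_def using P X \<Upsilon>_eqD by simp blast
    then show ?thesis by blast
  next
    case False
    obtain f x X Y where f: "admissible C f" "pres F f x" "f \<in> Hom C X Y" using F by (rule AdmE)
    obtain c where "is_cokernel C c f" using admissible_cokernel[OF f(1)] by blast
    then have "Q (f, yon F Y x, c)" unfolding Q_def using f(1) False pres_presents[OF f(2,3)] by simp
    then show ?thesis by blast
  qed
  then have "Q (L_choice C \<iota> F)"
    unfolding L_choice_def Q_def[symmetric] by (rule someI_ex)
  then have *: "admissible C (Lf F)" "presents C \<iota> (Lf F) (Lq F) F" "is_cokernel C (Lc F) (Lf F)"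
    unfolding Q_def by (auto split: prod.splits)
  then show "admissible C (Lf F)" "is_cokernel C (Lc F) (Lf F)" by simp_all
  have "Lf F \<in> Hom C (dom C (Lf F)) (LY F)" using admissible_Ar[OF *(1)] by simp
  then show "Lq F \<in> Hom (ModC C) (\<Upsilon> (LY F)) F" "pres F (Lf F) (Lx F)"
    using *(2) presents_iff by blast+
qed

lemma LL_eq: "LL F = cod C (Lc F)"
  by (simp add: L_functor_def split: prod.splits)

lemma L_choice_types:
  assumes F: "F \<in> Adm"
  shows "Lf F \<in> Ar C" "Lc F \<in> Ar C" "dom C (Lc F) = LY F" "cod C (Lc F) = LL F" "LL F \<in> Ob C" "LY F \<in> Ob C"
    "Lx F \<in> el F (LY F)" "Lc F \<cdot> Lf F = zero_mor C (dom C (Lf F)) (LL F)"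
  using is_cokernelD[OF L_choice_props(4)[OF F]] cod_Ob[of "Lc F"] cod_Ob[of "Lf F"]
    presD(2)[OF L_choice_props(3)[OF F], of "dom C (Lf F)" "LY F"]
  by (simp_all add: LL_eq)

lemma Lf_Hom: "F \<in> Adm \<Longrightarrow> Lf F \<in> Hom C (dom C (Lf F)) (LY F)"
  using L_choice_types(1) by simp

text \<open>The unit at \<open>F\<close>. It exists because \<open>Lc F\<close> annihilates the
  relations \<open>Lf F\<close>, and its value at the generator determines it.\<close>

definition eta :: "('o, 'm, 'u) presheaf \<Rightarrow> ('o, 'm, 'u) presheaf_mor" where
  "eta F = (SOME \<alpha>. \<alpha> \<in> Hom (ModC C) F (\<Upsilon> (LL F)) \<and> app \<alpha> (LY F) (Lx F) = \<iota> (Lc F))"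

lemma eta:
  assumes F: "F \<in> Adm"
  shows "eta F \<in> Hom (ModC C) F (\<Upsilon> (LL F))" "app (eta F) (LY F) (Lx F) = \<iota> (Lc F)"
proof -
  note t = L_choice_types[OF F]
  have "\<exists>\<alpha>\<in>Hom (ModC C) F (\<Upsilon> (LL F)). app \<alpha> (LY F) (Lx F) = \<iota> (Lc F)"
    by (rule pres_hom_exists[OF L_choice_props(3)[OF F] Lf_Hom[OF F] \<Upsilon>_presheaf[OF t(5)]]) (use t in simp_all)
  then have "\<exists>\<alpha>. \<alpha> \<in> Hom (ModC C) F (\<Upsilon> (LL F)) \<and> app \<alpha> (LY F) (Lx F) = \<iota> (Lc F)" by blast
  from someI_ex[OF this] show "eta F \<in> Hom (ModC C) F (\<Upsilon> (LL F))" "app (eta F) (LY F) (Lx F) = \<iota> (Lc F)"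
    by (simp_all add: eta_def)
qed

text \<open>Both sides are determined at the generator, where the equation becomes
  \<open>g \<cdot> Lc F = b\<close>. The universal property is thus that of the cokernel
  \<open>Lc F\<close>.\<close>

lemma eta_universal:
  assumes F: "F \<in> Adm" and D: "D \<in> Ob C" and \<beta>: "\<beta> \<in> Hom (ModC C) F (\<Upsilon> D)"
  shows "\<exists>!g. g \<in> Hom C (LL F) D \<and> \<Upsilon>\<^sub>m g \<bullet> eta F = \<beta>"
proof -
  note t = L_choice_types[OF F] and P = L_choice_props(3)[OF F] and fH = Lf_Hom[OF F] and e = eta[OF F]
  have "app \<beta> (LY F) (Lx F) \<in> el (\<Upsilon> D) (LY F)" using \<beta> t by simp
  then obtain b where b: "b \<in> Ar C" "dom C b = LY F" "cod C b = D" "app \<beta> (LY F) (Lx F) = \<iota> b" by (rule el_\<Upsilon>E)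
  have "app \<beta> (dom C (Lf F)) (res F (Lf F) (Lx F)) = \<iota> (b \<cdot> Lf F)" using \<beta> t b by simp
  then have "b \<cdot> Lf F = zero_mor C (dom C (Lf F)) D"
    using pres_zero[OF P fH] \<beta> b t D by simp
  then have ex: "\<exists>!g. g \<in> Hom C (cod C (Lc F)) D \<and> g \<cdot> Lc F = b"
    using b by (intro cokernel_unique_factor[OF L_choice_props(4)[OF F]]) simp_all
  have iff: "\<Upsilon>\<^sub>m g \<bullet> eta F = \<beta> \<longleftrightarrow> g \<cdot> Lc F = b" if g: "g \<in> Hom C (LL F) D" for g
  proof -
    have a: "app (\<Upsilon>\<^sub>m g \<bullet> eta F) (LY F) (Lx F) = \<iota> (g \<cdot> Lc F)"
      using app_cmp[OF e(1) t(6,7)] e(2) g t(2,3,4) by simp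
    have c: "g \<cdot> Lc F \<in> Ar C" using g t by simp
    show ?thesis
    proof
      assume "\<Upsilon>\<^sub>m g \<bullet> eta F = \<beta>"
      then show "g \<cdot> Lc F = b" using a b(1,4) c by simp
    next
      assume "g \<cdot> Lc F = b"
      then show "\<Upsilon>\<^sub>m g \<bullet> eta F = \<beta>"
        using a b(4) by (intro pres_hom_eqI[OF P fH ModC_cmp_Hom[OF e(1) yoneda_Hom[OF g]] \<beta>]) simp
    qed
  qed
  show ?thesis using ex iff unfolding t(4) by blast
qed

text \<open>\<open>L_functor\<close> describes its value by lifts to the presentations, the
  adjunction by naturality of \<open>eta\<close>. Evaluation at the generator shows that both
  conditions single out the same \<open>g\<close>, which is unique by
  \<open>eta_universal\<close>.\<close>

lemma L_ar:
  assumes F: "F \<in> Adm" and G: "G \<in> Adm" and \<alpha>: "\<alpha> \<in> Hom (ModC C) F G"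
  shows "L\<^sub>m \<alpha> \<in> Hom C (LL F) (LL G)"
    "\<Upsilon>\<^sub>m (L\<^sub>m \<alpha>) \<bullet> eta F = eta G \<bullet> \<alpha>"
proof -
  note t = L_choice_types[OF F] and P = L_choice_props(3)[OF F] and fH = Lf_Hom[OF F] and e = eta[OF F]
  note t' = L_choice_types[OF G] and P' = L_choice_props(3)[OF G] and fH' = Lf_Hom[OF G] and e' = eta[OF G]
  note q = L_choice_props(2)[OF F] and q' = L_choice_props(2)[OF G]
  note ea = ModC_cmp_Hom[OF \<alpha> e'(1)]
  have ex: "\<exists>!g. g \<in> Hom C (LL F) (LL G) \<and> \<Upsilon>\<^sub>m g \<bullet> eta F = eta G \<bullet> \<alpha>"
    by (rule eta_universal[OF F t'(5) ea])
  then obtain g0 where g0: "g0 \<in> Hom C (LL F) (LL G)" "\<Upsilon>\<^sub>m g0 \<bullet> eta F = eta G \<bullet> \<alpha>" by blast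
  have lhs: "app (\<Upsilon>\<^sub>m g \<bullet> eta F) (LY F) (Lx F) = \<iota> (g \<cdot> Lc F)" if g: "g \<in> Hom C (LL F) (LL G)" for g
    using app_cmp[OF e(1) t(6,7)] e(2) g t(2,3,4) by simp
  have aq: "\<alpha> \<bullet> Lq F = Lq G \<bullet> \<Upsilon>\<^sub>m h \<longleftrightarrow> app \<alpha> (LY F) (Lx F) = res G h (Lx G)"
    if h: "h \<in> Hom C (LY F) (LY G)" for h
  proof -
    note H1 = ModC_cmp_Hom[OF q \<alpha>] and H2 = ModC_cmp_Hom[OF yoneda_Hom[OF h] q']
    have i: "\<iota> (ident C (LY F)) \<in> el (\<Upsilon> (LY F)) (LY F)" using t by simp
    have a1: "app (\<alpha> \<bullet> Lq F) (LY F) (\<iota> (ident C (LY F))) = app \<alpha> (LY F) (Lx F)"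
      by (rule app_cmp[OF q t(6) i])
    have a2: "app (Lq G \<bullet> \<Upsilon>\<^sub>m h) (LY F) (\<iota> (ident C (LY F))) = res G h (Lx G)"
      using app_cmp[OF yoneda_Hom[OF h] t(6) i] h t app_from_\<Upsilon>[OF q', of h "LY F"] by simp
    show ?thesis
    proof
      assume "app \<alpha> (LY F) (Lx F) = res G h (Lx G)"
      then have "app (\<alpha> \<bullet> Lq F) Z u = app (Lq G \<bullet> \<Upsilon>\<^sub>m h) Z u"
        if "Z \<in> Ob C" "u \<in> el (\<Upsilon> (LY F)) Z" for Z u
        using that(2) app_from_\<Upsilon>[OF H1] app_from_\<Upsilon>[OF H2] a1 a2 by (elim el_\<Upsilon>E) simp
      then show "\<alpha> \<bullet> Lq F = Lq G \<bullet> \<Upsilon>\<^sub>m h" by (rule mor_eqI[OF H1 H2])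
    qed (use a1 a2 in simp)
  qed
  have char: "(\<exists>h\<in>Hom C (LY F) (LY G). \<alpha> \<bullet> Lq F = Lq G \<bullet> \<Upsilon>\<^sub>m h \<and> g \<cdot> Lc F = Lc G \<cdot> h) \<longleftrightarrow>
      \<Upsilon>\<^sub>m g \<bullet> eta F = eta G \<bullet> \<alpha>" if g: "g \<in> Hom C (LL F) (LL G)" for g
  proof -
    have ax: "app \<alpha> (LY F) (Lx F) \<in> el G (LY F)" using \<alpha> t by simp
    have rhs: "app (eta G \<bullet> \<alpha>) (LY F) (Lx F) = \<iota> (Lc G \<cdot> h)"
      if h: "h \<in> Hom C (LY F) (LY G)" "app \<alpha> (LY F) (Lx F) = res G h (Lx G)" for h
      using app_cmp[OF \<alpha> t(6,7)] h e' t' by simp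
    show ?thesis
    proof
      assume "\<exists>h\<in>Hom C (LY F) (LY G). \<alpha> \<bullet> Lq F = Lq G \<bullet> \<Upsilon>\<^sub>m h \<and> g \<cdot> Lc F = Lc G \<cdot> h"
      then obtain h where h: "h \<in> Hom C (LY F) (LY G)" "app \<alpha> (LY F) (Lx F) = res G h (Lx G)" "g \<cdot> Lc F = Lc G \<cdot> h"
        using aq by blast
      show "\<Upsilon>\<^sub>m g \<bullet> eta F = eta G \<bullet> \<alpha>"
        by (rule pres_hom_eqI[OF P fH ModC_cmp_Hom[OF e(1) yoneda_Hom[OF g]] ea])
           (simp only: lhs[OF g] rhs[OF h(1,2)] h(3))
    next
      assume eq: "\<Upsilon>\<^sub>m g \<bullet> eta F = eta G \<bullet> \<alpha>"
      \<comment> \<open>A lift exists because the image of the generator of \<open>F\<close> is a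
        restriction of the generator of \<open>G\<close>.\<close>
      obtain h where h: "h \<in> Ar C" "dom C h = LY F" "cod C h = LY G" "app \<alpha> (LY F) (Lx F) = res G h (Lx G)"
        using presD(3)[OF P' fH' t(6) ax] by blast
      then have hH: "h \<in> Hom C (LY F) (LY G)" by simp
      have "\<iota> (g \<cdot> Lc F) = \<iota> (Lc G \<cdot> h)" using lhs[OF g] rhs[OF hH h(4)] eq by simp
      then have "g \<cdot> Lc F = Lc G \<cdot> h" using g t t' h by simp
      then show "\<exists>h\<in>Hom C (LY F) (LY G). \<alpha> \<bullet> Lq F = Lq G \<bullet> \<Upsilon>\<^sub>m h \<and> g \<cdot> Lc F = Lc G \<cdot> h"
        using hH aq[OF hH] h(4) by blast
    qed
  qed
  have "L\<^sub>m \<alpha> = (THE g. g \<in> Hom C (LL F) (LL G) \<and>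
      (\<exists>h\<in>Hom C (LY F) (LY G). \<alpha> \<bullet> Lq F = Lq G \<bullet> \<Upsilon>\<^sub>m h \<and> g \<cdot> Lc F = Lc G \<cdot> h))"
    using Hom_fst[OF \<alpha>] by (simp add: L_functor_def split_beta)
  also have "\<dots> = g0"
    by (rule the_equality) (use g0 char ex in blast)+
  finally show "L\<^sub>m \<alpha> \<in> Hom C (LL F) (LL G)"
    "\<Upsilon>\<^sub>m (L\<^sub>m \<alpha>) \<bullet> eta F = eta G \<bullet> \<alpha>" using g0 by simp_all
qed

section \<open>The adjunction of \<open>L_functor\<close> and \<open>yoneda\<close>\<close>

lemma Hom_A: "\<alpha> \<in> Hom \<A> F G \<longleftrightarrow> \<alpha> \<in> Hom (ModC C) F G \<and> F \<in> Adm \<and> G \<in> Adm"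
  by (simp add: mod_adm_eq A.Hom_D)

lemma Ob_A [simp]: "Ob \<A> = Adm"
  using Adm_presheaf by (auto simp: mod_adm_eq)

lemma A_simps: "cmp \<A> = cmp (ModC C)" "ident \<A> = ident (ModC C)"
  "add_mor \<A> = add_mor (ModC C)"
  by (simp_all add: mod_adm_eq)

lemma yoneda_additive: "additive_functor C \<A> (yoneda C \<iota>)"
  unfolding additive_functor_def is_functor_def A_simps Hom_A on_ob_yoneda
proof (intro conjI ballI allI impI)
  fix X Y assume X: "X \<in> Ob C" "Y \<in> Ob C"
  show "\<Upsilon>\<^sub>m \<in> hom (Hom_group C X Y) (Hom_group \<A> (\<Upsilon> X) (\<Upsilon> Y))"
  proof (rule homI)
    fix f g assume "f \<in> carrier (Hom_group C X Y)" "g \<in> carrier (Hom_group C X Y)"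
    then have f: "f \<in> Hom C X Y" and g: "g \<in> Hom C X Y" by (simp_all del: Hom_iff)
    show "\<Upsilon>\<^sub>m f \<in> carrier (Hom_group \<A> (\<Upsilon> X) (\<Upsilon> Y))"
      using yoneda_Hom[OF f] X \<Upsilon>_Adm by (simp add: Hom_group_def Hom_A)
    show "\<Upsilon>\<^sub>m (f \<otimes>\<^bsub>Hom_group C X Y\<^esub> g) =
        \<Upsilon>\<^sub>m f \<otimes>\<^bsub>Hom_group \<A> (\<Upsilon> X) (\<Upsilon> Y)\<^esub> \<Upsilon>\<^sub>m g"
      using yoneda_add[OF f g] by (simp add: Hom_group_def A_simps)
  qed
next
  fix X Y f assume f: "f \<in> Hom C X Y"
  show "\<Upsilon>\<^sub>m f \<in> Hom (ModC C) (\<Upsilon> X) (\<Upsilon> Y)" by (rule yoneda_Hom[OF f])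
  show "\<Upsilon> X \<in> Adm" "\<Upsilon> Y \<in> Adm" using f dom_Ob[of f] cod_Ob[of f] \<Upsilon>_Adm by auto
qed (use yoneda_ident yoneda_cmp \<Upsilon>_Adm in auto)

lemma L_adjunction: "\<exists>\<epsilon>. adjunction \<A> C (L_functor C \<iota>) (yoneda C \<iota>) eta \<epsilon>"
  and L_additive: "additive_functor \<A> C (L_functor C \<iota>)"
proof -
  interpret P: functor_pair "\<A>" C "yoneda C \<iota>"
    using yoneda_additive exact_category_preadditive[OF mod_adm_exact]
    by unfold_locales (simp_all add: additive_functor_def)
  have *: "\<And>F. F \<in> Ob \<A> \<Longrightarrow> LL F \<in> Ob C"
    "\<And>F G \<alpha>. \<alpha> \<in> Hom \<A> F G \<Longrightarrow> L\<^sub>m \<alpha> \<in> Hom C (LL F) (LL G)"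
    "\<And>F G \<alpha>. \<alpha> \<in> Hom \<A> F G \<Longrightarrow>
      \<Upsilon>\<^sub>m (L\<^sub>m \<alpha>) \<cdot>\<^bsub>\<A>\<^esub> eta F = eta G \<cdot>\<^bsub>\<A>\<^esub> \<alpha>"
    "\<And>F. F \<in> Ob \<A> \<Longrightarrow> eta F \<in> Hom \<A> F (on_ob (yoneda C \<iota>) (LL F))"
    "\<And>F D \<beta>. F \<in> Ob \<A> \<Longrightarrow> D \<in> Ob C \<Longrightarrow> \<beta> \<in> Hom \<A> F (on_ob (yoneda C \<iota>) D) \<Longrightarrow>
      \<exists>!g. g \<in> Hom C (LL F) D \<and> \<Upsilon>\<^sub>m g \<cdot>\<^bsub>\<A>\<^esub> eta F = \<beta>"
    unfolding Ob_A Hom_A A_simps on_ob_yoneda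
    by (rule L_choice_types(5), assumption)
       (elim conjE, rule L_ar, assumption+, elim conjE, rule L_ar, assumption+,
         intro conjI eta(1) \<Upsilon>_Adm L_choice_types(5), assumption+, elim conjE, rule eta_universal, assumption+)
  show "\<exists>\<epsilon>. adjunction \<A> C (L_functor C \<iota>) (yoneda C \<iota>) eta \<epsilon>"
    by (rule P.left_adjointI(1)[OF *])
  show "additive_functor \<A> C (L_functor C \<iota>)"
    by (rule P.left_adjointI(2)[OF * yoneda_additive])
qed

text \<open>The unit read in \<open>C\<close>: an element \<open>z\<close> of \<open>F\<close> at
  \<open>Z\<close> becomes a morphism from \<open>Z\<close> to \<open>LL F\<close>. This turns
  statements on the unit into equations between morphisms, free of \<open>\<iota>\<close>.\<close>

definition lm :: "('o, 'm, 'u) presheaf \<Rightarrow> 'o \<Rightarrow> 'u \<Rightarrow> 'm" where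
  "lm F Z z = inv_into (Ar C) \<iota> (app (eta F) Z z)"

lemma lm:
  assumes F: "F \<in> Adm" and Z: "Z \<in> Ob C" and z: "z \<in> el F Z"
  shows lm_Ar: "lm F Z z \<in> Ar C" and dom_lm: "dom C (lm F Z z) = Z" and cod_lm: "cod C (lm F Z z) = LL F"
    and app_eta: "app (eta F) Z z = \<iota> (lm F Z z)"
proof -
  have "app (eta F) Z z \<in> el (\<Upsilon> (LL F)) Z" using eta(1)[OF F] Z z by simp
  then obtain f where "f \<in> Ar C" "dom C f = Z" "cod C f = LL F" "app (eta F) Z z = \<iota> f" by (rule el_\<Upsilon>E)
  then show "lm F Z z \<in> Ar C" "dom C (lm F Z z) = Z" "cod C (lm F Z z) = LL F" "app (eta F) Z z = \<iota> (lm F Z z)"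
    by (simp_all add: lm_def)
qed

lemma lm_eqI:
  assumes "F \<in> Adm" "Z \<in> Ob C" "z \<in> el F Z" "app (eta F) Z z = \<iota> f" "f \<in> Ar C"
  shows "lm F Z z = f"
  using assms by (simp add: lm_def)

lemma lm_res:
  assumes F: "F \<in> Adm" and z: "z \<in> el F Z" and y: "y \<in> Ar C" "cod C y = Z" "dom C y = W"
  shows "lm F W (res F y z) = lm F Z z \<cdot> y"
proof -
  have Z: "Z \<in> Ob C" "W \<in> Ob C" using y by auto
  note l = lm[OF F Z(1) z]
  show ?thesis
    by (rule lm_eqI[OF F Z(2)]) (use z y l eta(1)[OF F] Adm_presheaf[OF F] in simp_all)
qed

lemma lm_one: "F \<in> Adm \<Longrightarrow> Z \<in> Ob C \<Longrightarrow> lm F Z \<one>\<^bsub>grp F Z\<^esub> = zero_mor C Z (LL F)"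
  using eta(1)[of F] Adm_presheaf[of F] L_choice_types(5)[of F] by (intro lm_eqI) simp_all

lemma lm_zero_iff:
  assumes "F \<in> Adm" "Z \<in> Ob C" "z \<in> el F Z"
  shows "app (eta F) Z z = \<one>\<^bsub>grp (\<Upsilon> (LL F)) Z\<^esub> \<longleftrightarrow> lm F Z z = zero_mor C Z (LL F)"
  using lm[OF assms] L_choice_types(5)[of F] assms by simp

lemma lm_app:
  assumes F: "F \<in> Adm" and G: "G \<in> Adm" and \<alpha>: "\<alpha> \<in> Hom (ModC C) F G" and Z: "Z \<in> Ob C" and z: "z \<in> el F Z"
  shows "lm G Z (app \<alpha> Z z) = L\<^sub>m \<alpha> \<cdot> lm F Z z"
proof (rule lm_eqI[OF G Z])
  note l = lm[OF F Z z] and La = L_ar[OF F G \<alpha>]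
  show "app \<alpha> Z z \<in> el G Z" using \<alpha> Z z by simp
  have "app (eta G \<bullet> \<alpha>) Z z = app (\<Upsilon>\<^sub>m (L\<^sub>m \<alpha>) \<bullet> eta F) Z z"
    using La(2) by simp
  then show "app (eta G) Z (app \<alpha> Z z) = \<iota> (L\<^sub>m \<alpha> \<cdot> lm F Z z)"
    using app_cmp[OF \<alpha> Z z] app_cmp[OF eta(1)[OF F] Z z] l La(1) by simp
  show "L\<^sub>m \<alpha> \<cdot> lm F Z z \<in> Ar C" using l La(1) by simp
qed

text \<open>Every admissible presentation computes \<^const>\<open>L_functor\<close>, not only the chosen one.\<close>

lemma lm_cokernel:
  assumes f: "admissible C f" and P: "pres F f x" and fH: "f \<in> Hom C X Y"
  shows "is_cokernel C (lm F Y x) f"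
  unfolding is_cokernel_def
proof (intro conjI ballI impI)
  have F: "F \<in> Adm" by (rule AdmI[OF f P])
  note x = presD(2)[OF P fH]
  have ft: "f \<in> Ar C" "dom C f = X" "cod C f = Y" and Ob: "X \<in> Ob C" "Y \<in> Ob C" using fH by auto
  note l = lm[OF F Ob(2) x] and L = L_choice_types(5)[OF F]
  show "lm F Y x \<in> Ar C" "f \<in> Ar C" "dom C (lm F Y x) = cod C f" using l ft by simp_all
  show "lm F Y x \<cdot> f = zero_mor C (dom C f) (cod C (lm F Y x))"
    using lm_res[OF F x ft(1,3,2)] pres_zero[OF P fH] lm_one[OF F Ob(1)] l ft by simp
  fix b assume b: "b \<in> Ar C" and b2: "dom C b = cod C f \<and> b \<cdot> f = zero_mor C (dom C f) (cod C b)"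
  define D where "D = cod C b"
  have bt: "b \<in> Ar C" "dom C b = Y" "cod C b = D" and D: "D \<in> Ob C" using b b2 ft D_def by auto
  have "\<exists>\<beta>\<in>Hom (ModC C) F (\<Upsilon> D). app \<beta> Y x = \<iota> b"
    by (rule pres_hom_exists[OF P fH \<Upsilon>_presheaf[OF D]]) (use bt b2 ft Ob D in simp_all)
  then obtain \<beta> where \<beta>: "\<beta> \<in> Hom (ModC C) F (\<Upsilon> D)" "app \<beta> Y x = \<iota> b" by blast
  have iff: "\<Upsilon>\<^sub>m g \<bullet> eta F = \<beta> \<longleftrightarrow> g \<cdot> lm F Y x = b" if g: "g \<in> Hom C (LL F) D" for g
  proof -
    have a: "app (\<Upsilon>\<^sub>m g \<bullet> eta F) Y x = \<iota> (g \<cdot> lm F Y x)"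
      using app_cmp[OF eta(1)[OF F] Ob(2) x] l g by simp
    have c: "g \<cdot> lm F Y x \<in> Ar C" using g l by simp
    show ?thesis
    proof
      assume "\<Upsilon>\<^sub>m g \<bullet> eta F = \<beta>"
      then show "g \<cdot> lm F Y x = b" using a \<beta>(2) c bt by simp
    next
      assume "g \<cdot> lm F Y x = b"
      then show "\<Upsilon>\<^sub>m g \<bullet> eta F = \<beta>"
        using a \<beta>(2) by (intro pres_hom_eqI[OF P fH ModC_cmp_Hom[OF eta(1)[OF F] yoneda_Hom[OF g]] \<beta>(1)]) simp
    qed
  qed
  have "\<exists>!g. g \<in> Hom C (LL F) D \<and> g \<cdot> lm F Y x = b"
    using eta_universal[OF F D \<beta>(1)] iff by blast
  then show "\<exists>!h. h \<in> Hom C (cod C (lm F Y x)) (cod C b) \<and> h \<cdot> lm F Y x = b"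
    unfolding l(3) D_def .
qed

text \<open>A presentation together with its factorization \<open>f = m \<cdot> p\<close>. Taking
  the image \<open>lm F Y x\<close> of the generator as the cokernel of \<open>f\<close> makes
  \<open>(m, lm F Y x)\<close> a conflation, from which the kernel, image and cokernel of the unit
  are read off.\<close>

lemma Adm_presE:
  assumes F: "F \<in> Adm"
  obtains f x X Y I m p where "admissible C f" "pres F f x" "f \<in> Hom C X Y" "f \<in> Ar C" "dom C f = X" "cod C f = Y"
    "X \<in> Ob C" "Y \<in> Ob C" "x \<in> el F Y" "m \<in> Ar C" "dom C m = I" "cod C m = Y" "p \<in> Ar C" "dom C p = X" "cod C p = I"
    "(m, lm F Y x) \<in> conflations C" "deflation C p" "f = m \<cdot> p" "I \<in> Ob C" "deflation C (lm F Y x)"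
proof -
  obtain f x X Y where f: "admissible C f" "pres F f x" "f \<in> Hom C X Y" using F by (rule AdmE)
  have ft: "f \<in> Ar C" "dom C f = X" "cod C f = Y" "X \<in> Ob C" "Y \<in> Ob C" using f(3) by auto
  obtain m p where c: "(m, lm F Y x) \<in> conflations C" "deflation C p" "m \<in> Ar C" "p \<in> Ar C"
    "cod C p = dom C m" "dom C p = dom C f" "cod C m = cod C f" "f = m \<cdot> p"
    using admissible_cokernelE[OF f(1) lm_cokernel[OF f]] by metis
  have d: "deflation C (lm F Y x)" using c(1) by (auto simp: deflation_def)
  show ?thesis
    by (rule that[OF f ft presD(2)[OF f(2,3)] c(3) refl _ c(4) _ c(5,1,2,8) _ d]) (use c ft in simp_all)
qed

text \<open>If \<open>z\<close> is named by \<open>y\<close>, vanishing of its image means that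
  \<open>y\<close> factors through \<open>m\<close>, and after a deflation also through
  \<open>f = m \<cdot> p\<close>. The converse holds because deflations are epi.\<close>

lemma lm_eq_zero_iff:
  assumes F: "F \<in> Adm" and Z: "Z \<in> Ob C" and z: "z \<in> el F Z"
  shows "lm F Z z = zero_mor C Z (LL F) \<longleftrightarrow> (\<exists>d. deflation C d \<and> cod C d = Z \<and> res F d z = \<one>\<^bsub>grp F (dom C d)\<^esub>)"
proof
  note pF = Adm_presheaf[OF F]
  obtain f x X Y I m p where f: "admissible C f" and P: "pres F f x" and fH: "f \<in> Hom C X Y"
    and x: "x \<in> el F Y" and Ob: "X \<in> Ob C" "Y \<in> Ob C" and ft: "f \<in> Ar C" "dom C f = X" "cod C f = Y"
    and m: "m \<in> Ar C" "dom C m = I" "cod C m = Y" and p: "p \<in> Ar C" "dom C p = X" "cod C p = I"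
    and c: "(m, lm F Y x) \<in> conflations C" and d: "deflation C p" and fe: "f = m \<cdot> p"
    using Adm_presE[OF F] by metis
  note l = lm[OF F Ob(2) x]
  obtain y where y: "y \<in> Ar C" "dom C y = Z" "cod C y = Y" "z = res F y x" using presD(3)[OF P fH Z z] by blast
  assume "lm F Z z = zero_mor C Z (LL F)"
  then have "lm F Y x \<cdot> y = zero_mor C Z (LL F)" using lm_res[OF F x y(1,3,2)] y(4) by simp
  then obtain y' where y': "y' \<in> Ar C" "dom C y' = Z" "cod C y' = I" "m \<cdot> y' = y"
    using kernel_factor[OF conflation_kernel[OF c], of y Z] y l m by auto
  obtain q g where q: "deflation C q" "q \<in> Ar C" "g \<in> Ar C" "cod C q = Z" "dom C g = dom C q" "cod C g = X" "p \<cdot> g = y' \<cdot> q"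
    using deflation_factor[OF d y'(1)] y'(2,3) p by metis
  have "f \<cdot> g = m \<cdot> (y' \<cdot> q)" unfolding fe q(7)[symmetric] using m p q(1-6) by simp
  also have "\<dots> = y \<cdot> q" using cmp_reduce[OF y'(4), of q] m y'(1-3) q(1-6) by simp
  finally have e: "f \<cdot> g = y \<cdot> q" .
  have "res F q z = res F (y \<cdot> q) x" using y q(1-6) x pF by simp
  also have "\<dots> = res F g (res F f x)" unfolding e[symmetric] using q(1-6) ft x pF by simp
  also have "\<dots> = \<one>\<^bsub>grp F (dom C q)\<^esub>" using pres_zero[OF P fH] q(1-6) pF by simp
  finally show "\<exists>d. deflation C d \<and> cod C d = Z \<and> res F d z = \<one>\<^bsub>grp F (dom C d)\<^esub>" using q by blast
next
  assume "\<exists>d. deflation C d \<and> cod C d = Z \<and> res F d z = \<one>\<^bsub>grp F (dom C d)\<^esub>"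
  then obtain d where d: "deflation C d" "cod C d = Z" "res F d z = \<one>\<^bsub>grp F (dom C d)\<^esub>" by blast
  have dt: "d \<in> Ar C" "dom C d \<in> Ob C" using d by simp_all
  note l = lm[OF F Z z] and L = L_choice_types(5)[OF F]
  have "lm F Z z \<cdot> d = zero_mor C (dom C d) (LL F)"
    using lm_res[OF F z dt(1) d(2) refl] d(3) lm_one[OF F dt(2)] by simp
  then have e: "lm F Z z \<cdot> d = zero_mor C Z (LL F) \<cdot> d" using dt d(2) L by simp
  show "lm F Z z = zero_mor C Z (LL F)"
    by (rule deflation_epi[OF d(1) _ _ e]) (use l d(2) L Z in simp_all)
qed

text \<open>The image of the generator is a cokernel with target \<open>LL F\<close>, hence epi. If
  \<open>F\<close> is effaceable this image is zero, which forces the identity of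
  \<open>LL F\<close> to be zero.\<close>

lemma lm_effaceable_iff:
  assumes F: "F \<in> Adm"
  shows "effaceable F \<longleftrightarrow> zero_object C (LL F)"
proof
  assume e: "effaceable F"
  obtain f x X Y where f: "admissible C f" "pres F f x" "f \<in> Hom C X Y" using F by (rule AdmE)
  have Y: "Y \<in> Ob C" using f(3) by auto
  note x = presD(2)[OF f(2,3)] and L = L_choice_types(5)[OF F]
  note l = lm[OF F Y x] and c = lm_cokernel[OF f]
  have "lm F Y x = zero_mor C Y (LL F)"
    unfolding lm_eq_zero_iff[OF F Y x] using e Y x unfolding effaceable_def by blast
  then have e: "ident C (LL F) \<cdot> lm F Y x = zero_mor C (LL F) (LL F) \<cdot> lm F Y x" using l Y L by simp
  have "ident C (LL F) = zero_mor C (LL F) (LL F)"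
    by (rule cokernel_epi[OF c _ _ e]) (use l L in simp_all)
  then show "zero_object C (LL F)" by (rule zero_objectI[OF L])
next
  assume O: "zero_object C (LL F)"
  show "effaceable F"
    unfolding effaceable_def
  proof (intro ballI)
    fix Z z assume Z: "Z \<in> Ob C" "z \<in> el F Z"
    have "lm F Z z = zero_mor C Z (LL F)" using zero_object_eq(1)[OF O Z(1)] lm[OF F Z] by simp
    then show "\<exists>p. deflation C p \<and> cod C p = Z \<and> res F p z = \<one>\<^bsub>grp F (dom C p)\<^esub>"
      using lm_eq_zero_iff[OF F Z] by blast
  qed
qed

subsection \<open>The kernel, image and cokernel of the unit\<close>

text \<open>An element named by \<open>y\<close> lies in the kernel exactly when \<open>y\<close>
  factors through \<open>m\<close>. So the kernel is generated by the restriction of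
  \<open>x\<close> along \<open>m\<close>, and its relations are the multiples of the deflation
  \<open>p\<close>.\<close>

lemma ker_eta_Eff:
  assumes F: "F \<in> Adm"
  shows "sub F (ker (eta F)) \<in> Eff"
proof -
  note pF = Adm_presheaf[OF F] and e = eta(1)[OF F]
  obtain f x X Y I m p where f: "admissible C f" and P: "pres F f x" and fH: "f \<in> Hom C X Y"
    and x: "x \<in> el F Y" and Ob: "X \<in> Ob C" "Y \<in> Ob C" and ft: "f \<in> Ar C" "dom C f = X" "cod C f = Y"
    and m: "m \<in> Ar C" "dom C m = I" "cod C m = Y" and p: "p \<in> Ar C" "dom C p = X" "cod C p = I"
    and c: "(m, lm F Y x) \<in> conflations C" and d: "deflation C p" and fe: "f = m \<cdot> p" and I: "I \<in> Ob C"
    using Adm_presE[OF F] by metis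
  note l = lm[OF F Ob(2) x] and k = conflation_kernel[OF c]
  have kern: "z \<in> ker (eta F) Z \<longleftrightarrow> z \<in> el F Z \<and> lm F Z z = zero_mor C Z (LL F)" if "Z \<in> Ob C" for Z z
    using lm_zero_iff[OF F that] by (auto simp: ker_iff[OF e] simp del: one_\<Upsilon>)
  have pH: "p \<in> Hom C X I" using p by simp
  have "pres (sub F (ker (eta F))) p (res F m x)"
  proof (rule presI[OF sub_presheaf[OF pF ker_subpresheaf[OF e]] pH], unfold sub_simps)
    have "lm F Y x \<cdot> m = zero_mor C I (LL F)" using is_kernelD(4)[OF k] l m by simp
    then show "res F m x \<in> ker (eta F) I" using lm_res[OF F x m(1,3,2)] m x pF by (simp add: kern[OF I])
    have "res F p (res F m x) = res F f x" unfolding fe using p m x pF by simp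
    then show "res F p (res F m x) = \<one>\<^bsub>grp F X\<^esub>" using pres_zero[OF P fH] by simp
    fix Z z assume Z: "Z \<in> Ob C" and "z \<in> ker (eta F) Z"
    then have z: "z \<in> el F Z" "lm F Z z = zero_mor C Z (LL F)" by (simp_all add: kern)
    obtain y where y: "y \<in> Ar C" "dom C y = Z" "cod C y = Y" "z = res F y x" using presD(3)[OF P fH Z z(1)] by blast
    have "lm F Y x \<cdot> y = zero_mor C Z (LL F)" using lm_res[OF F x y(1,3,2)] y(4) z(2) by simp
    then obtain y' where y': "y' \<in> Ar C" "dom C y' = Z" "cod C y' = I" "m \<cdot> y' = y"
      using kernel_factor[OF k, of y Z] y(1-3) l m by auto
    have "z = res F y' (res F m x)" unfolding y(4) y'(4)[symmetric] using y'(1-3) m x pF by simp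
    with y' show "\<exists>y. y \<in> Ar C \<and> dom C y = Z \<and> cod C y = I \<and> z = res F y (res F m x)" by blast
  next
    fix Z y assume y: "y \<in> Ar C" "dom C y = Z" "cod C y = I" "res F y (res F m x) = \<one>\<^bsub>grp F Z\<^esub>"
    then have "res F (m \<cdot> y) x = \<one>\<^bsub>grp F Z\<^esub>" using m x pF by simp
    then obtain s where s: "s \<in> Ar C" "dom C s = Z" "cod C s = X" "m \<cdot> y = f \<cdot> s"
      using presD(4)[OF P fH, of "m \<cdot> y" Z] y m by auto
    have e: "m \<cdot> y = m \<cdot> (p \<cdot> s)" using s unfolding fe using m p by simp
    have "y = p \<cdot> s" by (rule kernel_mono[OF k _ _ e]) (use y s p m in simp_all)
    with s show "\<exists>s. s \<in> Ar C \<and> dom C s = Z \<and> cod C s = X \<and> y = p \<cdot> s" by blast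
  qed
  then show ?thesis
    using d AdmI[OF deflation_admissible[OF d]] pres_deflation_effaceable[OF d] by (simp add: Eff_def)
qed

text \<open>The conflation \<open>(m, lm F Y x)\<close> of \<open>Adm_presE\<close> gives both
  claims: the inflation \<open>m\<close> presents the image of the unit, and the deflation
  \<open>lm F Y x\<close> presents its cokernel.\<close>

lemma im_eta_Adm:
  assumes F: "F \<in> Adm"
  shows "sub (\<Upsilon> (LL F)) (im (eta F)) \<in> Adm" "quot (\<Upsilon> (LL F)) (im (eta F)) \<in> Eff"
proof -
  note pF = Adm_presheaf[OF F] and e = eta(1)[OF F] and L = L_choice_types(5)[OF F]
  obtain f x X Y I m p where f: "admissible C f" and P: "pres F f x" and fH: "f \<in> Hom C X Y"
    and x: "x \<in> el F Y" and Ob: "X \<in> Ob C" "Y \<in> Ob C"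
    and m: "m \<in> Ar C" "dom C m = I" "cod C m = Y"
    and c: "(m, lm F Y x) \<in> conflations C" and d: "deflation C (lm F Y x)" and I: "I \<in> Ob C"
    using Adm_presE[OF F] by metis
  note l = lm[OF F Ob(2) x] and k = conflation_kernel[OF c] and s = im_subpresheaf[OF e] and pU = \<Upsilon>_presheaf[OF L]
  have imE: "\<exists>y. y \<in> Ar C \<and> dom C y = Z \<and> cod C y = Y \<and> u = \<iota> (lm F Y x \<cdot> y)" if Z: "Z \<in> Ob C" "u \<in> im (eta F) Z" for u Z
  proof -
    obtain z where z: "z \<in> el F Z" "u = app (eta F) Z z" using Z(2) by (auto simp: im_iff[OF e])
    obtain y where y: "y \<in> Ar C" "dom C y = Z" "cod C y = Y" "z = res F y x" using presD(3)[OF P fH Z(1) z(1)] by blast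
    then have "u = \<iota> (lm F Y x \<cdot> y)" using z lm(4)[OF F Z(1) z(1)] lm_res[OF F x y(1,3,2)] by simp
    with y show ?thesis by blast
  qed
  have imI: "\<iota> (lm F Y x \<cdot> y) \<in> im (eta F) Z" if y: "y \<in> Ar C" "dom C y = Z" "cod C y = Y" for y Z
  proof -
    have Z: "Z \<in> Ob C" using y by auto
    have "res F y x \<in> el F Z" using y x pF by simp
    then show ?thesis
      using lm(4)[OF F Z, of "res F y x"] lm_res[OF F x y(1,3,2)] by (auto simp: im_iff[OF e] intro!: image_eqI)
  qed
  have mH: "m \<in> Hom C I Y" using m by simp
  have lY: "\<iota> (lm F Y x) \<in> im (eta F) Y" using imI[of "ident C Y" Y] l Ob by simp
  have "pres (sub (\<Upsilon> (LL F)) (im (eta F))) m (\<iota> (lm F Y x))"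
  proof (rule presI[OF sub_presheaf[OF pU s] mH], unfold sub_simps)
    show "\<iota> (lm F Y x) \<in> im (eta F) Y" by (rule lY)
    show "res (\<Upsilon> (LL F)) m (\<iota> (lm F Y x)) = \<one>\<^bsub>grp (\<Upsilon> (LL F)) I\<^esub>" using l m is_kernelD(4)[OF k] by simp
    show "\<exists>y. y \<in> Ar C \<and> dom C y = Z \<and> cod C y = Y \<and> u = res (\<Upsilon> (LL F)) y (\<iota> (lm F Y x))"
      if "Z \<in> Ob C" "u \<in> im (eta F) Z" for Z u using imE[OF that] l by auto
    fix Z y assume y: "y \<in> Ar C" "dom C y = Z" "cod C y = Y" "res (\<Upsilon> (LL F)) y (\<iota> (lm F Y x)) = \<one>\<^bsub>grp (\<Upsilon> (LL F)) Z\<^esub>"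
    have Z: "Z \<in> Ob C" using y by auto
    have "lm F Y x \<cdot> y = zero_mor C Z (LL F)" using y l L Z by simp
    then obtain s where "s \<in> Ar C" "dom C s = Z" "cod C s = I" "m \<cdot> s = y"
      using kernel_factor[OF k, of y Z] y l m by auto
    then show "\<exists>s. s \<in> Ar C \<and> dom C s = Z \<and> cod C s = I \<and> y = m \<cdot> s" by blast
  qed
  moreover have "inflation C m" using c by (auto simp: inflation_def)
  ultimately show "sub (\<Upsilon> (LL F)) (im (eta F)) \<in> Adm" using AdmI inflation_admissible by blast
  let ?\<pi> = "proj (\<Upsilon> (LL F)) (im (eta F))" and ?Q = "quot (\<Upsilon> (LL F)) (im (eta F))"
  note \<pi> = proj_Hom[OF pU s] and pQ = quot_presheaf[OF pU s]
  have lH: "lm F Y x \<in> Hom C Y (LL F)" using l by simp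
  let ?u = "app ?\<pi> (LL F) (\<iota> (ident C (LL F)))"
  have ru: "res ?Q y ?u = app ?\<pi> Z (\<iota> y)" if "y \<in> Ar C" "dom C y = Z" "cod C y = LL F" for y Z
    using app_from_\<Upsilon>[OF \<pi> that] by simp
  have "pres ?Q (lm F Y x) ?u"
  proof (rule presI[OF pQ lH])
    show "?u \<in> el ?Q (LL F)" using \<pi> L by simp
    show "res ?Q (lm F Y x) ?u = \<one>\<^bsub>grp ?Q Y\<^esub>"
      unfolding ru[OF l(1-3)] using proj_eq_one[OF pU s Ob(2), of "\<iota> (lm F Y x)"] l lY by simp
    fix Z z assume Z: "Z \<in> Ob C" "z \<in> el ?Q Z"
    then obtain u where u: "u \<in> el (\<Upsilon> (LL F)) Z" "z = app ?\<pi> Z u" using proj_surj[OF pU s Z(1)] by blast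
    obtain y where "y \<in> Ar C" "dom C y = Z" "cod C y = LL F" "u = \<iota> y" using u(1) by (rule el_\<Upsilon>E)
    then show "\<exists>y. y \<in> Ar C \<and> dom C y = Z \<and> cod C y = LL F \<and> z = res ?Q y ?u" using ru u by metis
  next
    fix Z y assume y: "y \<in> Ar C" "dom C y = Z" "cod C y = LL F" "res ?Q y ?u = \<one>\<^bsub>grp ?Q Z\<^esub>"
    have Z: "Z \<in> Ob C" using y by auto
    have "\<iota> y \<in> im (eta F) Z" using proj_eq_one[OF pU s Z, of "\<iota> y"] y ru[OF y(1-3)] by simp
    then obtain w where w: "w \<in> Ar C" "dom C w = Z" "cod C w = Y" "\<iota> y = \<iota> (lm F Y x \<cdot> w)" using imE[OF Z] by blast
    then have "y = lm F Y x \<cdot> w" using y l by simp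
    with w show "\<exists>s. s \<in> Ar C \<and> dom C s = Z \<and> cod C s = Y \<and> y = lm F Y x \<cdot> s" by blast
  qed
  then show "?Q \<in> Eff"
    using d AdmI[OF deflation_admissible[OF d]] pres_deflation_effaceable[OF d] by (simp add: Eff_def)
qed

end

section \<open>The recollement\<close>

text \<open>Exactness in \<open>D\<close> asks for \<open>\<alpha>\<close> to be admissible, and
  here this comes from its image being in \<open>S\<close>. The sequence is spliced from two short
  exact ones along that image.\<close>

lemma (in ext_closed) four_term_exact:
  assumes \<alpha>: "\<alpha> \<in> Hom (ModC C) F G" and S: "K \<in> S" "F \<in> S" "G \<in> S" "Q \<in> S" "sub G (im \<alpha>) \<in> S"
    and i: "i \<in> Hom (ModC C) K F" "\<And>Z. Z \<in> Ob C \<Longrightarrow> inj_on (app i Z) (el K Z)"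
      "\<And>Z x. Z \<in> Ob C \<Longrightarrow> x \<in> el F Z \<Longrightarrow> app \<alpha> Z x = \<one>\<^bsub>grp G Z\<^esub> \<longleftrightarrow> x \<in> app i Z ` el K Z"
    and q: "q \<in> Hom (ModC C) G Q" "\<And>Z. Z \<in> Ob C \<Longrightarrow> app q Z ` el G Z = el Q Z"
      "\<And>Z y. Z \<in> Ob C \<Longrightarrow> y \<in> el G Z \<Longrightarrow> app q Z y = \<one>\<^bsub>grp Q Z\<^esub> \<longleftrightarrow> y \<in> app \<alpha> Z ` el F Z"
  shows "inflation D i \<and> exact_at D i \<alpha> \<and> exact_at D \<alpha> q \<and> deflation D q"
proof -
  interpret D: exact D by (rule exactI[OF D_exact])
  note ps = Hom_presheaf[OF \<alpha>] and s = im_subpresheaf[OF \<alpha>]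
  define I where "I = sub G (im \<alpha>)"
  define m where "m = incl G (im \<alpha>)"
  have m: "m \<in> Hom (ModC C) I G" unfolding m_def I_def by (rule incl_Hom[OF ps(2) s])
  obtain a where a: "a \<in> Hom (ModC C) F I" and aa: "\<And>Z x. Z \<in> Ob C \<Longrightarrow> x \<in> el F Z \<Longrightarrow> app a Z x = app \<alpha> Z x"
    using corestrict[OF \<alpha> s] unfolding I_def by (metis im_iff[OF \<alpha>] image_eqI)
  have elI: "el I Z = app \<alpha> Z ` el F Z" for Z by (simp add: I_def im_iff[OF \<alpha>])
  have am: "app m Z x = x" if "Z \<in> Ob C" "x \<in> el I Z" for Z x using that by (simp add: m_def I_def)
  have "\<alpha> = m \<bullet> a"
    by (rule mor_eqI[OF \<alpha> ModC_cmp_Hom[OF a m]]) (use a aa am in \<open>simp add: elI\<close>)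
  then have e: "\<alpha> = m \<cdot>\<^bsub>D\<^esub> a" by simp
  have se1: "short_exact i a K F I"
    using i a aa by (auto simp: short_exact_def elI) (simp_all add: I_def)
  have se2: "short_exact m q I G Q"
    using q m am by (auto simp: short_exact_def inj_on_def image_iff elI)
  have IS: "I \<in> S" using S(5) by (simp add: I_def)
  have inf: "inflation D i" "inflation D m" and de: "deflation D a" "deflation D q"
    using D_inflationI[OF se1] D_inflationI[OF se2] D_deflationI[OF se1] D_deflationI[OF se2] S IS by simp_all
  have am_t: "a \<in> Ar D" "m \<in> Ar D" "cod D a = dom D m"
    using Ar_D[OF a S(2) IS] Ar_D[OF m IS S(3)] Hom_fst[OF a] Hom_fst[OF m] by simp_all
  have ad\<alpha>: "admissible D \<alpha>" unfolding admissible_def using e inf de am_t by blast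
  have ki: "is_kernel D i \<alpha>" unfolding e
    using D.kernel_cmp_inflation[OF inf(2) am_t(1,3)] D_kernel[OF se1 S(1,2) IS] by blast
  have "K \<in> Ob D" "i \<in> Ar D" "dom D i = K"
    using S(1) S_presheaf Ar_D[OF i(1) S(1,2)] Hom_fst[OF i(1)] by simp_all
  \<comment> \<open>The inflation \<open>i\<close> is its own image, with the identity of
    \<open>K\<close> as deflation part.\<close>
  then have ii: "deflation D (ident D K)" "cod D (ident D K) = dom D i" "i = i \<cdot>\<^bsub>D\<^esub> ident D K"
    using D.ident_deflation[of K] by (simp_all del: full_subcategory_simps ModC_simps)
  have "exact_at D i \<alpha>" "exact_at D \<alpha> q"
    unfolding exact_at_def
    using D.inflation_admissible[OF inf(1)] D.deflation_admissible[OF de(2)] ad\<alpha> ki ii inf de e am_t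
      D_kernel[OF se2 IS S(3,4)] by blast+
  then show ?thesis using inf de by blast
qed

locale exact_enough_projectives = exact_yoneda C \<iota> for C :: "('o, 'm) excat" (structure) and \<iota> :: "'m \<Rightarrow> 'u" +
  assumes enough_projectives: "enough_projectives C"
begin

section \<open>Values at projectives\<close>

lemma projective_Ob: "projective C P \<Longrightarrow> P \<in> Ob C"
  by (simp add: projective_def)

lemma projective_lift:
  assumes "projective C P" "deflation C d" "f \<in> Hom C P (cod C d)"
  obtains g where "g \<in> Ar C" "dom C g = P" "cod C g = dom C d" "d \<cdot> g = f"
proof -
  have "\<exists>g\<in>Hom C P (dom C d). d \<cdot> g = f" using assms unfolding projective_def by blast
  then show ?thesis using that by auto
qed

text \<open>A deflation onto a projective has a section, and restricting along the section recovers
  \<open>z\<close>.\<close>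

lemma projective_effaced:
  assumes P: "projective C P" and F: "is_presheaf C F" and z: "z \<in> el F P"
    and d: "deflation C d" "cod C d = P" "res F d z = \<one>\<^bsub>grp F (dom C d)\<^esub>"
  shows "z = \<one>\<^bsub>grp F P\<^esub>"
proof -
  have PO: "P \<in> Ob C" by (rule projective_Ob[OF P])
  obtain s where s: "s \<in> Ar C" "dom C s = P" "cod C s = dom C d" "d \<cdot> s = ident C P"
    using projective_lift[OF P d(1), of "ident C P"] PO d(2) by auto
  have "res F (d \<cdot> s) z = res F s (res F d z)" using s(1-3) d(1,2) z F by simp
  then show ?thesis using s d F z PO by simp
qed

text \<open>The elements that the unit annihilates are those killed by deflations, and at a
  projective these are trivial.\<close>

lemma lm_projective_inj:
  assumes F: "F \<in> Adm" and P: "projective C P" and z: "z \<in> el F P" "z' \<in> el F P" and eq: "lm F P z = lm F P z'"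
  shows "z = z'"
proof -
  note pF = Adm_presheaf[OF F] and PO = projective_Ob[OF P] and e = eta(1)[OF F]
  have d: "z \<otimes>\<^bsub>grp F P\<^esub> inv\<^bsub>grp F P\<^esub> z' \<in> el F P" using z pF PO by simp
  have "app (eta F) P z = app (eta F) P z'" using app_eta[OF F PO] z eq by simp
  then have "app (eta F) P (z \<otimes>\<^bsub>grp F P\<^esub> inv\<^bsub>grp F P\<^esub> z') = \<one>\<^bsub>grp (\<Upsilon> (LL F)) P\<^esub>"
    using e z PO pF Hom_presheaf[OF e] by (simp del: one_\<Upsilon>)
  then obtain d where "deflation C d" "cod C d = P" "res F d (z \<otimes>\<^bsub>grp F P\<^esub> inv\<^bsub>grp F P\<^esub> z') = \<one>\<^bsub>grp F (dom C d)\<^esub>"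
    using lm_zero_iff[OF F PO d] lm_eq_zero_iff[OF F PO d] by blast
  then have "z \<otimes>\<^bsub>grp F P\<^esub> inv\<^bsub>grp F P\<^esub> z' = \<one>\<^bsub>grp F P\<^esub>" by (rule projective_effaced[OF P pF d])
  then show ?thesis using el_diff_one[OF pF PO z] by simp
qed

text \<open>The image of the generator of \<open>F\<close> is a deflation onto \<open>LL F\<close>,
  along which \<open>b\<close> lifts.\<close>

lemma lm_projective_surj:
  assumes F: "F \<in> Adm" and P: "projective C P" and b: "b \<in> Hom C P (LL F)"
  obtains z where "z \<in> el F P" "lm F P z = b"
proof -
  obtain f x X Y where pr: "pres F f x" "f \<in> Hom C X Y" and x: "x \<in> el F Y" "Y \<in> Ob C" and d: "deflation C (lm F Y x)"
    using Adm_presE[OF F] by metis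
  note l = lm[OF F x(2,1)]
  have bl: "b \<in> Hom C P (cod C (lm F Y x))" using b l by simp
  obtain y where y: "y \<in> Ar C" "dom C y = P" "cod C y = Y" "lm F Y x \<cdot> y = b"
    using projective_lift[OF P d bl] l by metis
  show ?thesis
    by (rule that[of "res F y x"]) (use lm_res[OF F x(1) y(1,3,2)] y x Adm_presheaf[OF F] in simp_all)
qed

text \<open>A projective presentation \<open>P\<^sub>1 \<Zsurj> \<Omega> \<Zinj> P\<^sub>0 \<Zsurj> D\<close>, given by \<open>d\<close>, \<open>w\<close>, \<open>\<pi>\<close>, and the cokernel \<open>J\<close> of
  \<open>\<Upsilon> P\<^sub>1 \<rightarrow> \<Upsilon> P\<^sub>0\<close> with its generator \<open>e\<close>.  The functor \<open>j\<^sub>!\<close> will send \<open>D\<close> to \<open>J\<close>.\<close>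

definition is_cover :: "'o \<Rightarrow> 'm \<times> 'm \<times> 'm \<times> ('o, 'm, 'u) presheaf \<times> 'u \<Rightarrow> bool" where
  "is_cover D = (\<lambda>(\<pi>, w, d, J, e). (w, \<pi>) \<in> conflations C \<and> projective C (dom C \<pi>) \<and> cod C \<pi> = D \<and>
     deflation C d \<and> projective C (dom C d) \<and> cod C d = dom C w \<and> pres J (w \<cdot> d) e)"

definition cover :: "'o \<Rightarrow> 'm \<times> 'm \<times> 'm \<times> ('o, 'm, 'u) presheaf \<times> 'u" where
  "cover D = (SOME t. is_cover D t)"

definition "c\<pi> D = fst (cover D)"
definition "cw D = fst (snd (cover D))"
definition "cd D = fst (snd (snd (cover D)))"
definition "J D = fst (snd (snd (snd (cover D))))"
definition "ce D = snd (snd (snd (snd (cover D))))"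
definition "P0 D = dom C (c\<pi> D)"
definition "P1 D = dom C (cd D)"
definition "Om D = dom C (cw D)"

lemma cover_exists:
  assumes D: "D \<in> Ob C"
  shows "is_cover D (cover D)"
proof -
  obtain \<pi> where \<pi>: "deflation C \<pi>" "projective C (dom C \<pi>)" "cod C \<pi> = D"
    using enough_projectives D unfolding enough_projectives_def by blast
  obtain w where w: "(w, \<pi>) \<in> conflations C" using \<pi>(1) by (auto simp: deflation_def)
  note wt = conflation_Ar[OF w]
  have "dom C w \<in> Ob C" using wt by simp
  then obtain d where d: "deflation C d" "projective C (dom C d)" "cod C d = dom C w"
    using enough_projectives unfolding enough_projectives_def by blast
  have "w \<cdot> d \<in> Hom C (dom C d) (cod C w)" using wt d by simp
  then obtain J e where "pres J (w \<cdot> d) e" using pres_exists by blast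
  then have "is_cover D (\<pi>, w, d, J, e)" using \<pi> w d by (simp add: is_cover_def)
  then show ?thesis unfolding cover_def by (rule someI)
qed

lemma cover:
  assumes D: "D \<in> Ob C"
  shows "(cw D, c\<pi> D) \<in> conflations C" "deflation C (cd D)" "projective C (P0 D)" "projective C (P1 D)"
    "pres (J D) (cw D \<cdot> cd D) (ce D)"
    "c\<pi> D \<in> Ar C" "dom C (c\<pi> D) = P0 D" "cod C (c\<pi> D) = D" "cw D \<in> Ar C" "dom C (cw D) = Om D" "cod C (cw D) = P0 D"
    "cd D \<in> Ar C" "dom C (cd D) = P1 D" "cod C (cd D) = Om D"
    "P0 D \<in> Ob C" "P1 D \<in> Ob C" "Om D \<in> Ob C" "cw D \<cdot> cd D \<in> Hom C (P1 D) (P0 D)" "ce D \<in> el (J D) (P0 D)"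
    "deflation C (c\<pi> D)" "admissible C (cw D \<cdot> cd D)" "J D \<in> Adm" "is_presheaf C (J D)"
proof -
  have *: "(cw D, c\<pi> D) \<in> conflations C \<and> projective C (dom C (c\<pi> D)) \<and> cod C (c\<pi> D) = D \<and>
     deflation C (cd D) \<and> projective C (dom C (cd D)) \<and> cod C (cd D) = dom C (cw D) \<and> pres (J D) (cw D \<cdot> cd D) (ce D)"
    using cover_exists[OF D] by (simp add: is_cover_def c\<pi>_def cw_def cd_def J_def ce_def split_beta)
  then show 1: "(cw D, c\<pi> D) \<in> conflations C" "deflation C (cd D)" "projective C (P0 D)" "projective C (P1 D)"
    "pres (J D) (cw D \<cdot> cd D) (ce D)" by (simp_all add: P0_def P1_def)
  show 2: "c\<pi> D \<in> Ar C" "dom C (c\<pi> D) = P0 D" "cod C (c\<pi> D) = D" "cw D \<in> Ar C" "dom C (cw D) = Om D" "cod C (cw D) = P0 D"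
    "cd D \<in> Ar C" "dom C (cd D) = P1 D" "cod C (cd D) = Om D"
    using conflation_Ar[OF 1(1)] * by (simp_all add: P0_def P1_def Om_def)
  show "P0 D \<in> Ob C" "P1 D \<in> Ob C" "Om D \<in> Ob C"
    using dom_Ob[OF 2(1)] dom_Ob[OF 2(7)] dom_Ob[OF 2(4)] 2 by simp_all
  show 3: "cw D \<cdot> cd D \<in> Hom C (P1 D) (P0 D)" using 2 by simp
  show "ce D \<in> el (J D) (P0 D)" by (rule presD(2)[OF 1(5) 3])
  show "deflation C (c\<pi> D)" using 1(1) by (auto simp: deflation_def)
  show 4: "admissible C (cw D \<cdot> cd D)" unfolding admissible_def
    using 1(1,2) 2 by (intro exI[of _ "cw D"] exI[of _ "cd D"]) (auto simp: inflation_def)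
  show "J D \<in> Adm" by (rule AdmI[OF 4 1(5)])
  then show "is_presheaf C (J D)" by (rule Adm_presheaf)
qed

text \<open>The unit of \<open>j_!\<close>. Both \<open>c\<pi> D\<close> and the image of the
  generator of \<open>J D\<close> are cokernels of \<open>cw D \<cdot> cd D\<close>, and
  \<open>\<theta> D\<close> is the comparison isomorphism between them.\<close>

definition \<theta> :: "'o \<Rightarrow> 'm" where
  "\<theta> D = (SOME t. t \<in> Hom C D (LL (J D)) \<and> iso_mor C t \<and> t \<cdot> c\<pi> D = lm (J D) (P0 D) (ce D))"

lemma \<theta>:
  assumes D: "D \<in> Ob C"
  shows "\<theta> D \<in> Hom C D (LL (J D))" "iso_mor C (\<theta> D)" "\<theta> D \<cdot> c\<pi> D = lm (J D) (P0 D) (ce D)"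
proof -
  note c = cover[OF D]
  have c1: "is_cokernel C (lm (J D) (P0 D) (ce D)) (cw D \<cdot> cd D)" by (rule lm_cokernel[OF c(21,5,18)])
  have c2: "is_cokernel C (c\<pi> D) (cw D \<cdot> cd D)"
    using cokernel_cmp_deflation[OF c(2), of "cw D"] c conflation_cokernel by simp
  note l = lm[OF c(22,15,19)]
  obtain a where "iso_mor C a" "a \<in> Hom C D (LL (J D))" "a \<cdot> c\<pi> D = lm (J D) (P0 D) (ce D)"
  proof -
    interpret op: exact "op_cat C" by (rule op_exact_locale)
    obtain b where b: "iso_mor C b" "b \<in> Hom C (LL (J D)) D" "b \<cdot> lm (J D) (P0 D) (ce D) = c\<pi> D"
      using op.kernel_iso[of "c\<pi> D" "cw D \<cdot> cd D" "lm (J D) (P0 D) (ce D)"] c1 c2 l c by (auto simp del: op.Hom_iff)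
    obtain a where a: "iso_mor C a" "a \<in> Hom C D (LL (J D))" "a \<cdot> b = ident C (LL (J D))"
      using iso_morE[OF b(1)] b(2) by auto
    have "a \<cdot> c\<pi> D = lm (J D) (P0 D) (ce D)"
      using cmp_reduce[OF a(3), of "lm (J D) (P0 D) (ce D)"] a(2) b(2) l unfolding b(3) by simp
    with a that show thesis by blast
  qed
  then have "\<exists>t. t \<in> Hom C D (LL (J D)) \<and> iso_mor C t \<and> t \<cdot> c\<pi> D = lm (J D) (P0 D) (ce D)" by blast
  from someI_ex[OF this] show "\<theta> D \<in> Hom C D (LL (J D))" "iso_mor C (\<theta> D)" "\<theta> D \<cdot> c\<pi> D = lm (J D) (P0 D) (ce D)"
    unfolding \<theta>_def by blast+
qed

text \<open>Naturality of \<open>lm\<close> combined with the choice of \<open>\<theta>\<close>: the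
  value of \<open>\<alpha>\<close> at the generator is expressed by the transpose of
  \<open>\<alpha>\<close>.\<close>

lemma lm_from_J:
  assumes D: "D \<in> Ob C" and F: "F \<in> Adm" and \<alpha>: "\<alpha> \<in> Hom (ModC C) (J D) F"
  shows "lm F (P0 D) (app \<alpha> (P0 D) (ce D)) = (L\<^sub>m \<alpha> \<cdot> \<theta> D) \<cdot> c\<pi> D"
proof -
  note c = cover[OF D] and t = \<theta>[OF D] and La = L_ar(1)[OF cover(22)[OF D] F \<alpha>]
  show ?thesis
    unfolding lm_app[OF c(22) F \<alpha> c(15,19)] t(3)[symmetric] using c t(1) La by simp
qed

text \<open>A morphism from \<open>J D\<close> to \<open>F\<close> is an element of \<open>F\<close>
  at \<open>P0 D\<close> killed by \<open>cw D \<cdot> cd D\<close>. As \<open>P0 D\<close> and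
  \<open>P1 D\<close> are projective, \<open>lm\<close> identifies such elements with the morphisms
  from \<open>P0 D\<close> to \<open>LL F\<close> that annihilate \<open>cw D \<cdot> cd D\<close>,
  that is, with morphisms out of its cokernel \<open>D\<close>.\<close>

lemma J_universal:
  assumes D: "D \<in> Ob C" and F: "F \<in> Adm" and a: "a \<in> Hom C D (LL F)"
  shows "\<exists>!\<alpha>. \<alpha> \<in> Hom \<A> (J D) F \<and> L\<^sub>m \<alpha> \<cdot> \<theta> D = a"
proof -
  note c = cover[OF D] and t = \<theta>[OF D] and pF = Adm_presheaf[OF F] and L = L_choice_types(5)[OF F]
  have at: "a \<in> Ar C" "dom C a = D" "cod C a = LL F" using a by auto
  obtain z where z: "z \<in> el F (P0 D)" "lm F (P0 D) z = a \<cdot> c\<pi> D"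
    using lm_projective_surj[OF F c(3), of "a \<cdot> c\<pi> D"] c at by auto
  have wd: "cw D \<cdot> cd D \<in> Ar C" "cod C (cw D \<cdot> cd D) = P0 D" "dom C (cw D \<cdot> cd D) = P1 D" using c(18) by auto
  have rz: "res F (cw D \<cdot> cd D) z = \<one>\<^bsub>grp F (P1 D)\<^esub>"
  proof (rule lm_projective_inj[OF F c(4)])
    have "c\<pi> D \<cdot> (cw D \<cdot> cd D) = zero_mor C (P1 D) D"
      using cmp_reduce[OF conflation_Ar(4)[OF c(1)], of "cd D"] c(6-14) D c(17) by simp
    then have "lm F (P1 D) (res F (cw D \<cdot> cd D) z) = zero_mor C (P1 D) (LL F)"
      unfolding lm_res[OF F z(1) wd] z(2) using c(6-16) at wd by simp
    then show "lm F (P1 D) (res F (cw D \<cdot> cd D) z) = lm F (P1 D) \<one>\<^bsub>grp F (P1 D)\<^esub>" using lm_one[OF F c(16)] by simp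
    show "res F (cw D \<cdot> cd D) z \<in> el F (P1 D)" by (rule res_el[OF pF wd(1,3)]) (use wd z in simp)
  qed (use pF c(16) in simp)
  obtain \<alpha> where \<alpha>: "\<alpha> \<in> Hom (ModC C) (J D) F" "app \<alpha> (P0 D) (ce D) = z"
    using pres_hom_exists[OF c(5,18) pF z(1) rz] by blast
  have iff: "L\<^sub>m \<beta> \<cdot> \<theta> D = a \<longleftrightarrow> app \<beta> (P0 D) (ce D) = z" if \<beta>: "\<beta> \<in> Hom (ModC C) (J D) F" for \<beta>
  proof -
    note La = L_ar(1)[OF c(22) F \<beta>]
    have "L\<^sub>m \<beta> \<cdot> \<theta> D = a \<longleftrightarrow> (L\<^sub>m \<beta> \<cdot> \<theta> D) \<cdot> c\<pi> D = a \<cdot> c\<pi> D"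
      using deflation_epi[OF c(20), of "L\<^sub>m \<beta> \<cdot> \<theta> D" "LL F" a] La t(1) at c(8) by auto
    also have "\<dots> \<longleftrightarrow> lm F (P0 D) (app \<beta> (P0 D) (ce D)) = lm F (P0 D) z"
      unfolding lm_from_J[OF D F \<beta>] z(2) ..
    also have "\<dots> \<longleftrightarrow> app \<beta> (P0 D) (ce D) = z"
      using lm_projective_inj[OF F c(3) _ z(1)] app_el[OF \<beta> c(15,19)] by blast
    finally show ?thesis .
  qed
  show ?thesis
  proof (rule ex1I[of _ \<alpha>])
    show "\<alpha> \<in> Hom \<A> (J D) F \<and> L\<^sub>m \<alpha> \<cdot> \<theta> D = a"
      using \<alpha> iff[OF \<alpha>(1)] F c(22) by (simp add: Hom_A)
    fix \<beta> assume "\<beta> \<in> Hom \<A> (J D) F \<and> L\<^sub>m \<beta> \<cdot> \<theta> D = a"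
    then have \<beta>: "\<beta> \<in> Hom (ModC C) (J D) F" "L\<^sub>m \<beta> \<cdot> \<theta> D = a" by (simp_all add: Hom_A)
    show "\<beta> = \<alpha>"
      by (rule pres_hom_eqI[OF c(5,18) \<beta>(1) \<alpha>(1)]) (use iff[OF \<beta>(1)] \<beta>(2) \<alpha>(2) in simp)
  qed
qed

text \<open>\<open>N F\<close> is generated by the values of \<open>F\<close> at projectives, equivalently by the element \<^term>\<open>x0 F\<close> at \<^term>\<open>P0 (LL F)\<close>.\<close>

definition x0 :: "('o, 'm, 'u) presheaf \<Rightarrow> 'u" where
  "x0 F = (SOME z. z \<in> el F (P0 (LL F)) \<and> lm F (P0 (LL F)) z = c\<pi> (LL F))"

definition N :: "('o, 'm, 'u) presheaf \<Rightarrow> 'o \<Rightarrow> 'u set" where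
  "N F = im (yon F (P0 (LL F)) (x0 F))"

lemma x0:
  assumes F: "F \<in> Adm"
  shows "x0 F \<in> el F (P0 (LL F))" "lm F (P0 (LL F)) (x0 F) = c\<pi> (LL F)"
proof -
  note c = cover[OF L_choice_types(5)[OF F]]
  have "c\<pi> (LL F) \<in> Hom C (P0 (LL F)) (LL F)" using c by simp
  then have "\<exists>z. z \<in> el F (P0 (LL F)) \<and> lm F (P0 (LL F)) z = c\<pi> (LL F)"
    using lm_projective_surj[OF F c(3)] by metis
  from someI_ex[OF this] show "x0 F \<in> el F (P0 (LL F))" "lm F (P0 (LL F)) (x0 F) = c\<pi> (LL F)"
    unfolding x0_def by blast+
qed

lemma N_subpresheaf: "F \<in> Adm \<Longrightarrow> subpresheaf F (N F)"
  unfolding N_def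
  by (rule im_subpresheaf[OF yon_Hom[OF Adm_presheaf cover(15)[OF L_choice_types(5)] x0(1)]])

lemma N_iff:
  assumes F: "F \<in> Adm"
  shows "z \<in> N F Z \<longleftrightarrow> (\<exists>y. y \<in> Ar C \<and> dom C y = Z \<and> cod C y = P0 (LL F) \<and> z = res F y (x0 F))"
proof -
  note yH = yon_Hom[OF Adm_presheaf[OF F] cover(15)[OF L_choice_types(5)[OF F]] x0(1)[OF F]]
  show ?thesis
  proof
    assume "z \<in> N F Z"
    then obtain u where u: "u \<in> el (\<Upsilon> (P0 (LL F))) Z" "z = app (yon F (P0 (LL F)) (x0 F)) Z u"
      unfolding N_def im_iff[OF yH] by blast
    obtain y where "y \<in> Ar C" "dom C y = Z" "cod C y = P0 (LL F)" "u = \<iota> y" using u(1) by (rule el_\<Upsilon>E)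
    then show "\<exists>y. y \<in> Ar C \<and> dom C y = Z \<and> cod C y = P0 (LL F) \<and> z = res F y (x0 F)" using u by auto
  next
    assume "\<exists>y. y \<in> Ar C \<and> dom C y = Z \<and> cod C y = P0 (LL F) \<and> z = res F y (x0 F)"
    then obtain y where "y \<in> Ar C" "dom C y = Z" "cod C y = P0 (LL F)" "z = res F y (x0 F)" by blast
    then show "z \<in> N F Z" unfolding N_def im_iff[OF yH] by (intro image_eqI[of _ _ "\<iota> y"]) simp_all
  qed
qed

text \<open>The morphism \<open>lm F P z\<close> lifts along the deflation
  \<open>c\<pi> (LL F)\<close>, and at a projective it determines \<open>z\<close>. So
  \<open>x0 F\<close> generates all values at projectives.\<close>

lemma N_projective:
  assumes F: "F \<in> Adm" and P: "projective C P" and z: "z \<in> el F P"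
  shows "z \<in> N F P"
proof -
  note L = L_choice_types(5)[OF F] and x = x0[OF F] and pF = Adm_presheaf[OF F]
  note c = cover[OF L] and PO = projective_Ob[OF P]
  have "lm F P z \<in> Hom C P (cod C (c\<pi> (LL F)))" using lm[OF F PO z] c by simp
  then obtain t where t: "t \<in> Ar C" "dom C t = P" "cod C t = P0 (LL F)" "c\<pi> (LL F) \<cdot> t = lm F P z"
    using projective_lift[OF P c(20)] c(7) by metis
  have "z = res F t (x0 F)"
    by (rule lm_projective_inj[OF F P z]) (use t x lm_res[OF F x(1) t(1,3,2)] pF in simp_all)
  with t show ?thesis unfolding N_iff[OF F] by blast
qed

text \<open>The relations of \<open>x0 F\<close> are the multiples of
  \<open>cw (LL F) \<cdot> r\<close>. They are kept apart from any presentation because they serve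
  twice: for \<open>N F\<close>, which \<open>x0 F\<close> generates, and for the kernel of the
  counit of \<open>j_!\<close>.\<close>

lemma x0_relations:
  assumes F: "F \<in> Adm"
  obtains r where "deflation C r" "r \<in> Ar C" "cod C r = Om (LL F)"
    "\<forall>y Z. y \<in> Ar C \<longrightarrow> dom C y = Z \<longrightarrow> cod C y = P0 (LL F) \<longrightarrow> (res F y (x0 F) = \<one>\<^bsub>grp F Z\<^esub> \<longleftrightarrow>
      (\<exists>s. s \<in> Ar C \<and> dom C s = Z \<and> cod C s = dom C r \<and> y = cw (LL F) \<cdot> (r \<cdot> s)))"
proof -
  note L = L_choice_types(5)[OF F] and x0 = x0[OF F] and pF = Adm_presheaf[OF F]
  note c = cover[OF L]
  let ?P = "P0 (LL F)" and ?w = "cw (LL F)" and ?\<pi> = "c\<pi> (LL F)" and ?O = "Om (LL F)"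
  obtain f x X Y I m p where P: "pres F f x" and fH: "f \<in> Hom C X Y"
    and x: "x \<in> el F Y" and Ob: "X \<in> Ob C" "Y \<in> Ob C" and ft: "f \<in> Ar C" "dom C f = X" "cod C f = Y"
    and m: "m \<in> Ar C" "dom C m = I" "cod C m = Y" and p: "p \<in> Ar C" "dom C p = X" "cod C p = I"
    and mc: "(m, lm F Y x) \<in> conflations C" and d: "deflation C p" and fe: "f = m \<cdot> p" and I: "I \<in> Ob C"
    using Adm_presE[OF F] by metis
  note l = lm[OF F Ob(2) x] and k = conflation_kernel[OF mc] and kw = conflation_kernel[OF c(1)]
  have lm0: "lm F Y x \<cdot> m = zero_mor C I (LL F)" using is_kernelD(4)[OF k] l m by simp
  have pw: "?\<pi> \<cdot> ?w = zero_mor C ?O (LL F)" using is_kernelD(4)[OF kw] c by simp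
  obtain w where w: "w \<in> Ar C" "dom C w = ?P" "cod C w = Y" "x0 F = res F w x"
    using presD(3)[OF P fH c(15) x0(1)] by blast
  have lw: "lm F Y x \<cdot> w = ?\<pi>" using lm_res[OF F x w(1,3,2)] w(4) x0(2) by simp
  have "lm F Y x \<cdot> (w \<cdot> ?w) = zero_mor C ?O (LL F)"
    using cmp_reduce[OF lw, of ?w] w(1-3) l c(9-11) pw by simp
  \<comment> \<open>\<open>w\<close> compares the cover of \<open>LL F\<close> with the presentation
    of \<open>F\<close>, and so it carries \<open>Om (LL F)\<close> into the kernel \<open>I\<close>
    of \<open>lm F Y x\<close>.\<close>
  then obtain v where v: "v \<in> Ar C" "dom C v = ?O" "cod C v = I" "m \<cdot> v = w \<cdot> ?w"
    using kernel_factor[OF k, of "w \<cdot> ?w" ?O] w(1-3) c(9-11) l m by auto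
  \<comment> \<open>A morphism into \<open>Om (LL F)\<close> gives a relation of \<open>x0 F\<close>
    exactly when its image in \<open>I\<close> lifts along \<open>p\<close>. The pullback of
    \<open>p\<close> along \<open>v\<close> collects these morphisms.\<close>
  obtain r t where pb: "is_pullback C r t p v" and r: "deflation C r"
    using obtain_pullback[OF d v(1)] v(3) p(3) by auto
  define R where "R = dom C r"
  have rt: "r \<in> Ar C" "dom C r = R" "cod C r = ?O" "t \<in> Ar C" "dom C t = R" "cod C t = X" "v \<cdot> r = p \<cdot> t"
    using is_pullbackD[OF pb] v p by (simp_all add: R_def)
  have "res F y (x0 F) = \<one>\<^bsub>grp F Z\<^esub> \<longleftrightarrow> (\<exists>s. s \<in> Ar C \<and> dom C s = Z \<and> cod C s = dom C r \<and> y = ?w \<cdot> (r \<cdot> s))"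
    if y: "y \<in> Ar C" "dom C y = Z" "cod C y = ?P" for y Z
  proof -
    have Z: "Z \<in> Ob C" using y by auto
    have ry: "res F y (x0 F) = res F (w \<cdot> y) x" unfolding w(4) using y w(1-3) x pF by simp
    show ?thesis
    proof
      assume "res F y (x0 F) = \<one>\<^bsub>grp F Z\<^esub>"
      then obtain u where u: "u \<in> Ar C" "dom C u = Z" "cod C u = X" "w \<cdot> y = f \<cdot> u"
        using presD(4)[OF P fH, of "w \<cdot> y" Z] ry y w(1-3) by auto
      have wy: "w \<cdot> y = m \<cdot> (p \<cdot> u)" using u m p unfolding fe by simp
      have "?\<pi> \<cdot> y = lm F Y x \<cdot> (m \<cdot> (p \<cdot> u))"
        unfolding wy[symmetric] using cmp_reduce[OF lw, of y] w(1-3) l y by simp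
      also have "\<dots> = zero_mor C Z (LL F)" using cmp_reduce[OF lm0, of "p \<cdot> u"] m p l(1-3) u(1-3) I L by simp
      finally obtain y' where y': "y' \<in> Ar C" "dom C y' = Z" "cod C y' = ?O" "?w \<cdot> y' = y"
        using kernel_factor[OF kw, of y Z] y c by auto
      have "m \<cdot> (v \<cdot> y') = w \<cdot> y" using cmp_reduce[OF v(4), of y'] v(1-3) m y' w(1-3) c(9-11) by simp
      then have e: "m \<cdot> (v \<cdot> y') = m \<cdot> (p \<cdot> u)" using wy by simp
      have vy: "v \<cdot> y' = p \<cdot> u" by (rule kernel_mono[OF k _ _ e]) (use v y' p u m in simp_all)
      have "y' \<in> Hom C Z (dom C v)" "u \<in> Hom C Z (dom C p)" using y'(1-3) u(1-3) v(2) p(2) by simp_all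
      then obtain s where s: "s \<in> Ar C" "dom C s = Z" "cod C s = R" "r \<cdot> s = y'"
        using pullback_factor[OF pb _ _ vy] rt(2) by metis
      show "\<exists>s. s \<in> Ar C \<and> dom C s = Z \<and> cod C s = dom C r \<and> y = ?w \<cdot> (r \<cdot> s)"
        unfolding rt(2) using s y'(4) by (intro exI[of _ s]) simp
    next
      assume "\<exists>s. s \<in> Ar C \<and> dom C s = Z \<and> cod C s = dom C r \<and> y = ?w \<cdot> (r \<cdot> s)"
      then obtain s where s: "s \<in> Ar C" "dom C s = Z" "cod C s = R" "y = ?w \<cdot> (r \<cdot> s)" using rt(2) by blast
      have "w \<cdot> y = m \<cdot> (v \<cdot> (r \<cdot> s))"
        unfolding s(4) using cmp_reduce[OF v(4), of "r \<cdot> s"] v(1-3) m s(1-3) w(1-3) c(9-11) rt(1-6) by simp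
      also have "\<dots> = f \<cdot> (t \<cdot> s)"
        unfolding fe using cmp_reduce[OF rt(7), of s] rt(1-6) v(1-3) p s(1-3) m by simp
      finally have wy: "w \<cdot> y = f \<cdot> (t \<cdot> s)" .
      have ts: "t \<cdot> s \<in> Ar C" "dom C (t \<cdot> s) = Z" "cod C (t \<cdot> s) = X" using rt(2,4-6) s(1-3) by simp_all
      have "res F (f \<cdot> (t \<cdot> s)) x = res F (t \<cdot> s) (res F f x)"
        by (rule res_cmp[OF pF ts(1)]) (use ts ft x in simp_all)
      then show "res F y (x0 F) = \<one>\<^bsub>grp F Z\<^esub>"
        unfolding ry wy pres_zero[OF P fH] using ts pF by simp
    qed
  qed
  then show ?thesis using that[OF r rt(1,3)] by simp
qed

text \<open>\<open>x0 F\<close> generates \<open>N F\<close> with the relations just found, and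
  their generator is admissible as the inflation \<open>cw (LL F)\<close> after the deflation
  \<open>r\<close>.\<close>

lemma N_Adm:
  assumes F: "F \<in> Adm"
  shows "sub F (N F) \<in> Adm"
proof -
  note L = L_choice_types(5)[OF F] and x0 = x0[OF F] and pF = Adm_presheaf[OF F]
  note c = cover[OF L]
  obtain r where r: "deflation C r" "r \<in> Ar C" "cod C r = Om (LL F)"
    and rel0: "\<forall>y Z. y \<in> Ar C \<longrightarrow> dom C y = Z \<longrightarrow> cod C y = P0 (LL F) \<longrightarrow> (res F y (x0 F) = \<one>\<^bsub>grp F Z\<^esub> \<longleftrightarrow>
      (\<exists>s. s \<in> Ar C \<and> dom C s = Z \<and> cod C s = dom C r \<and> y = cw (LL F) \<cdot> (r \<cdot> s)))"
    by (rule x0_relations[OF F])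
  note rel = rel0[rule_format]
  have wr: "cw (LL F) \<cdot> r \<in> Hom C (dom C r) (P0 (LL F))" using r c by simp
  have "pres (sub F (N F)) (cw (LL F) \<cdot> r) (x0 F)"
  proof (rule presI[OF sub_presheaf[OF pF N_subpresheaf[OF F]] wr], unfold sub_simps)
    show "x0 F \<in> N F (P0 (LL F))" by (rule N_projective[OF F c(3) x0(1)])
    show "\<exists>y. y \<in> Ar C \<and> dom C y = Z \<and> cod C y = P0 (LL F) \<and> z = res F y (x0 F)"
      if "Z \<in> Ob C" "z \<in> N F Z" for Z z using that N_iff[OF F] by blast
    show "\<exists>s. s \<in> Ar C \<and> dom C s = Z \<and> cod C s = dom C r \<and> y = (cw (LL F) \<cdot> r) \<cdot> s"
      if y: "y \<in> Ar C" "dom C y = Z" "cod C y = P0 (LL F)" "res F y (x0 F) = \<one>\<^bsub>grp F Z\<^esub>" for Z y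
    proof -
      obtain s where "s \<in> Ar C" "dom C s = Z" "cod C s = dom C r" "y = cw (LL F) \<cdot> (r \<cdot> s)" using rel[OF y(1-3)] y(4) by blast
      then show ?thesis using r c by (intro exI[of _ s]) simp
    qed
    show "res F (cw (LL F) \<cdot> r) (x0 F) = \<one>\<^bsub>grp F (dom C r)\<^esub>"
      using rel[of "cw (LL F) \<cdot> r" "dom C r"] r c(9-11)
      by (simp del: res_cmp) (rule exI[of _ "ident C (dom C r)"], simp)
  qed
  moreover have "admissible C (cw (LL F) \<cdot> r)"
    unfolding admissible_def using c r by (intro exI[of _ "cw (LL F)"] exI[of _ r]) (auto simp: inflation_def)
  ultimately show ?thesis using AdmI by blast
qed

text \<open>The image of the counit and \<open>N F\<close> are compared only at objects of
  \<open>C\<close>, so as functions on the whole type they may differ.\<close>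

lemma Adm_sub_cong:
  assumes M: "sub F M \<in> Adm" and F: "is_presheaf C F" and M': "subpresheaf F M'"
    and eq: "\<And>Z. Z \<in> Ob C \<Longrightarrow> M Z = M' Z"
  shows "sub F M' \<in> Adm"
proof -
  obtain f x where f: "admissible C f" "pres (sub F M) f x" using M by (auto simp: Adm_def)
  have "pres (sub F M') f x"
    using f(2) sub_presheaf[OF F M'] eq admissible_Ar[OF f(1)] unfolding pres_def by (simp del: Hom_iff)
  then show ?thesis by (rule AdmI[OF f(1)])
qed

text \<open>The quotient keeps the generator \<open>x\<close> and gains the relation
  \<open>x0 F\<close>, named by \<open>w\<close>; so it is presented by the row
  \<open>(f, w)\<close>. As \<open>lm F Y x \<cdot> w\<close> is the deflation
  \<open>c\<pi> (LL F)\<close>, this row is a deflation by \<open>copair_deflation\<close>.\<close>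

lemma quot_N_Eff:
  assumes F: "F \<in> Adm"
  shows "quot F (N F) \<in> Eff"
proof -
  note L = L_choice_types(5)[OF F] and x0 = x0[OF F] and pF = Adm_presheaf[OF F]
  note c = cover[OF L] and s = N_subpresheaf[OF F]
  let ?P = "P0 (LL F)" and ?\<pi> = "c\<pi> (LL F)" and ?Q = "quot F (N F)"
  obtain f x X Y I m p where P: "pres F f x" and fH: "f \<in> Hom C X Y"
    and x: "x \<in> el F Y" and Ob: "X \<in> Ob C" "Y \<in> Ob C" and ft: "f \<in> Ar C" "dom C f = X" "cod C f = Y"
    and m: "m \<in> Ar C" "dom C m = I" "cod C m = Y" and p: "p \<in> Ar C" "dom C p = X" "cod C p = I"
    and mc: "(m, lm F Y x) \<in> conflations C" and d: "deflation C p" and fe: "f = m \<cdot> p"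
    and dl: "deflation C (lm F Y x)"
    using Adm_presE[OF F] by metis
  note l = lm[OF F Ob(2) x] and k = conflation_kernel[OF mc]
  obtain w where w: "w \<in> Ar C" "dom C w = ?P" "cod C w = Y" "x0 F = res F w x"
    using presD(3)[OF P fH c(15) x0(1)] by blast
  have lw: "lm F Y x \<cdot> w = ?\<pi>" using lm_res[OF F x w(1,3,2)] w(4) x0(2) by simp
  obtain B i1 i2 p1 p2 where B: "biproduct C X ?P B i1 i2 p1 p2" using obtain_biproduct[OF Ob(1) c(15)] .
  interpret b: biprod C X ?P B i1 i2 p1 p2 by unfold_locales (rule B)
  define h where "h = b.copair f w"
  have h: "h \<in> Ar C" "dom C h = B" "cod C h = Y" "h \<cdot> i1 = f" "h \<cdot> i2 = w" using ft w by (simp_all add: h_def)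
  then have hH: "h \<in> Hom C B Y" by simp
  have B2: "biproduct C (dom C p) ?P B i1 i2 p1 p2" using B p by simp
  have dh: "deflation C h"
    by (rule copair_deflation[OF dl k d _ _ _ B2, of w]) (use h p m w l lw c(20) fe in simp_all)
  let ?x = "app (proj F (N F)) Y x"
  note \<pi> = proj_Hom[OF pF s] and pQ = quot_presheaf[OF pF s]
  have rx: "res ?Q y ?x = app (proj F (N F)) Z (res F y x)" if "y \<in> Ar C" "dom C y = Z" "cod C y = Y" for y Z
    using that \<pi> x by simp
  have "pres ?Q h ?x"
  proof (rule presI[OF pQ hH])
    show "?x \<in> el ?Q Y" using \<pi> x Ob by simp
    have pp: "f \<cdot> p1 \<in> Hom C B Y" "w \<cdot> p2 \<in> Hom C B Y" using ft w by simp_all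
    have "res F h x = res F (f \<cdot> p1) x \<otimes>\<^bsub>grp F B\<^esub> res F (w \<cdot> p2) x"
      unfolding h_def b.copair_def by (rule res_add[OF pF pp x])
    also have "\<dots> = res F p2 (x0 F)" unfolding w(4) using ft w(1-3) x pF pres_zero[OF P fH] by simp
    finally have "res F h x \<in> N F B" unfolding N_iff[OF F] by (intro exI[of _ p2]) simp
    then show "res ?Q h ?x = \<one>\<^bsub>grp ?Q B\<^esub>"
      unfolding rx[OF h(1-3)] using proj_eq_one[OF pF s, of B "res F h x"] h x pF by simp
    fix Z z assume Z: "Z \<in> Ob C" "z \<in> el ?Q Z"
    then obtain u where u: "u \<in> el F Z" "z = app (proj F (N F)) Z u" using proj_surj[OF pF s Z(1)] by blast
    obtain y where "y \<in> Ar C" "dom C y = Z" "cod C y = Y" "u = res F y x" using presD(3)[OF P fH Z(1) u(1)] by blast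
    then show "\<exists>y. y \<in> Ar C \<and> dom C y = Z \<and> cod C y = Y \<and> z = res ?Q y ?x" using rx u by metis
  next
    fix Z y assume y: "y \<in> Ar C" "dom C y = Z" "cod C y = Y" "res ?Q y ?x = \<one>\<^bsub>grp ?Q Z\<^esub>"
    have Z: "Z \<in> Ob C" using y by auto
    have "res F y x \<in> N F Z" using proj_eq_one[OF pF s Z, of "res F y x"] y rx[OF y(1-3)] x pF by simp
    then obtain y' where y': "y' \<in> Ar C" "dom C y' = Z" "cod C y' = ?P" "res F y x = res F y' (x0 F)"
      unfolding N_iff[OF F] by blast
    have wy': "w \<cdot> y' \<in> Hom C Z Y" and yH: "y \<in> Hom C Z Y" using w y' y by simp_all
    have "res F y x = res F (w \<cdot> y') x" unfolding y'(4) w(4) using w(1-3) y'(1-3) x pF by simp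
    then obtain t where t: "t \<in> Ar C" "dom C t = Z" "cod C t = X" "y \<^bold>- (w \<cdot> y') = f \<cdot> t"
      using pres_diff[OF P fH yH wy'] by blast
    have "h \<cdot> b.pair t y' = add_mor C (f \<cdot> t) (w \<cdot> y')"
      unfolding h_def using ft w t y' by (subst b.copair_cmp) simp_all
    also have "\<dots> = y" unfolding t(4)[symmetric] by (rule minus_add_cancel[OF yH wy'])
    finally show "\<exists>s. s \<in> Ar C \<and> dom C s = Z \<and> cod C s = B \<and> y = h \<cdot> s"
      using t y' by (intro exI[of _ "b.pair t y'"]) simp
  qed
  then show ?thesis
    using AdmI[OF deflation_admissible[OF dh]] pres_deflation_effaceable[OF dh] by (simp add: Eff_def)
qed

text \<open>The kernel is generated by the restriction \<open>e1\<close> of the generator along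
  \<open>cw (LL F) \<cdot> r\<close>. Restricting \<open>e1\<close> along \<open>u\<close> gives
  zero when \<open>r \<cdot> u\<close> factors through \<open>cd (LL F) = r \<cdot> d'\<close>, that
  is, when \<open>u\<close> is a multiple of \<open>d'\<close> up to a morphism into the kernel of
  \<open>r\<close>. So the relations form the row \<open>(\<kappa>, d')\<close>.\<close>

lemma ker_from_J_Eff:
  assumes F: "F \<in> Adm" and \<alpha>: "\<alpha> \<in> Hom (ModC C) (J (LL F)) F" and \<alpha>e: "app \<alpha> (P0 (LL F)) (ce (LL F)) = x0 F"
  shows "sub (J (LL F)) (ker \<alpha>) \<in> Eff"
proof -
  note L = L_choice_types(5)[OF F] and x0 = x0[OF F] and pF = Adm_presheaf[OF F]
  note c = cover[OF L] and s = ker_subpresheaf[OF \<alpha>]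
  let ?P = "P0 (LL F)" and ?w = "cw (LL F)" and ?d = "cd (LL F)" and ?J = "J (LL F)" and ?e = "ce (LL F)"
  obtain r where r: "deflation C r" "r \<in> Ar C" "cod C r = Om (LL F)"
    and rel0: "\<forall>y Z. y \<in> Ar C \<longrightarrow> dom C y = Z \<longrightarrow> cod C y = ?P \<longrightarrow> (res F y (x0 F) = \<one>\<^bsub>grp F Z\<^esub> \<longleftrightarrow>
      (\<exists>s. s \<in> Ar C \<and> dom C s = Z \<and> cod C s = dom C r \<and> y = ?w \<cdot> (r \<cdot> s)))"
    by (rule x0_relations[OF F])
  note rel = rel0[rule_format]
  define R where "R = dom C r"
  have rR: "dom C r = R" and RO: "R \<in> Ob C" using r by (simp_all add: R_def)
  obtain \<kappa> where \<kappa>: "(\<kappa>, r) \<in> conflations C" using r(1) by (auto simp: deflation_def)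
  define K where "K = dom C \<kappa>"
  have \<kappa>t: "\<kappa> \<in> Ar C" "dom C \<kappa> = K" "cod C \<kappa> = R" "r \<cdot> \<kappa> = zero_mor C K (Om (LL F))" and KO: "K \<in> Ob C"
    using conflation_Ar[OF \<kappa>] dom_Ob[of \<kappa>] r rR by (simp_all add: K_def)
  note kk = conflation_kernel[OF \<kappa>] and kw = conflation_kernel[OF c(1)]
  have "?d \<in> Hom C (P1 (LL F)) (cod C r)" using c r by simp
  then obtain d' where d': "d' \<in> Ar C" "dom C d' = P1 (LL F)" "cod C d' = R" "r \<cdot> d' = ?d"
    using projective_lift[OF c(4) r(1)] rR by metis
  obtain B i1 i2 p1 p2 where B: "biproduct C K (P1 (LL F)) B i1 i2 p1 p2" using obtain_biproduct[OF KO c(16)] .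
  interpret b: biprod C K "P1 (LL F)" B i1 i2 p1 p2 by unfold_locales (rule B)
  define h where "h = b.copair \<kappa> d'"
  have h: "h \<in> Ar C" "dom C h = B" "cod C h = R" "h \<cdot> i1 = \<kappa>" "h \<cdot> i2 = d'" using \<kappa>t d' by (simp_all add: h_def)
  then have hH: "h \<in> Hom C B R" by simp
  have B2: "biproduct C (dom C (ident C K)) (P1 (LL F)) B i1 i2 p1 p2" using B KO by simp
  have dh: "deflation C h"
    by (rule copair_deflation[OF r(1) kk ident_deflation[OF KO] _ _ _ B2, of d'])
       (use h \<kappa>t d' c(2) r rR KO in simp_all)
  have rh: "r \<cdot> h = ?d \<cdot> p2"
  proof (rule b.from_biprod_eqI)
    show "(r \<cdot> h) \<cdot> i1 = (?d \<cdot> p2) \<cdot> i1" using r rR h \<kappa>t c(12-17) by simp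
    show "(r \<cdot> h) \<cdot> i2 = (?d \<cdot> p2) \<cdot> i2" using r rR h d' c(12-17) by simp
  qed (use r rR h c(12-17) in simp_all)
  have wr: "?w \<cdot> r \<in> Ar C" "dom C (?w \<cdot> r) = R" "cod C (?w \<cdot> r) = ?P" using c r rR by simp_all
  define e1 where "e1 = res ?J (?w \<cdot> r) ?e"
  have e1: "e1 \<in> el ?J R" unfolding e1_def by (rule res_el[OF c(23) wr(1,2)]) (use wr c in simp)
  have re: "res ?J s e1 = res ?J (?w \<cdot> (r \<cdot> s)) ?e" if "s \<in> Ar C" "cod C s = R" for s
    unfolding e1_def using that wr c(9-11,19,23) r rR by simp
  have \<alpha>y: "app \<alpha> Z (res ?J y ?e) = res F y (x0 F)" if "y \<in> Ar C" "dom C y = Z" "cod C y = ?P" for y Z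
    using that \<alpha> \<alpha>e c(19) by simp
  have "pres (sub ?J (ker \<alpha>)) h e1"
  proof (rule presI[OF sub_presheaf[OF c(23) s] hH], unfold sub_simps)
    have "res F (?w \<cdot> r) (x0 F) = \<one>\<^bsub>grp F R\<^esub>"
      unfolding rel[OF wr] using r rR RO by (intro exI[of _ "ident C R"]) simp
    then show "e1 \<in> ker \<alpha> R" using e1 \<alpha>y[OF wr] by (simp add: ker_iff[OF \<alpha>] e1_def)
    have "res ?J h e1 = res ?J ((?w \<cdot> ?d) \<cdot> p2) ?e"
      unfolding re[OF h(1,3)] rh using c(9-14) by simp
    also have "\<dots> = res ?J p2 (res ?J (?w \<cdot> ?d) ?e)"
      by (rule res_cmp[OF c(23)]) (use c in simp_all)
    also have "\<dots> = \<one>\<^bsub>grp ?J B\<^esub>" unfolding pres_zero[OF c(5,18)] using c(23) by simp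
    finally show "res ?J h e1 = \<one>\<^bsub>grp ?J B\<^esub>" .
    fix Z z assume Z: "Z \<in> Ob C" and "z \<in> ker \<alpha> Z"
    then have z: "z \<in> el ?J Z" "app \<alpha> Z z = \<one>\<^bsub>grp F Z\<^esub>" by (simp_all add: ker_iff[OF \<alpha>])
    obtain y where y: "y \<in> Ar C" "dom C y = Z" "cod C y = ?P" "z = res ?J y ?e"
      using presD(3)[OF c(5,18) Z z(1)] by blast
    then obtain u where u: "u \<in> Ar C" "dom C u = Z" "cod C u = dom C r" "y = ?w \<cdot> (r \<cdot> u)"
      using rel[OF y(1-3)] \<alpha>y[OF y(1-3)] z(2) by auto
    then show "\<exists>y. y \<in> Ar C \<and> dom C y = Z \<and> cod C y = R \<and> z = res ?J y e1"
      using re[of u] y(4) rR by auto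
  next
    fix Z u assume u: "u \<in> Ar C" "dom C u = Z" "cod C u = R" "res ?J u e1 = \<one>\<^bsub>grp ?J Z\<^esub>"
    have Z: "Z \<in> Ob C" using u by auto
    have wru: "?w \<cdot> (r \<cdot> u) \<in> Ar C" "dom C (?w \<cdot> (r \<cdot> u)) = Z" "cod C (?w \<cdot> (r \<cdot> u)) = ?P"
      using u(1-3) c(9-11) r rR by simp_all
    obtain v where v: "v \<in> Ar C" "dom C v = Z" "cod C v = P1 (LL F)" "?w \<cdot> (r \<cdot> u) = (?w \<cdot> ?d) \<cdot> v"
      using presD(4)[OF c(5,18) wru] u(4) re[OF u(1,3)] by auto
    have q: "?w \<cdot> (r \<cdot> u) = ?w \<cdot> (?d \<cdot> v)" using v c(9-14) by simp
    have ru: "r \<cdot> u = ?d \<cdot> v"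
      by (rule kernel_mono[OF kw _ _ q]) (use u(1-3) v(1-3) r rR c(9-14) in simp_all)
    have uH: "u \<in> Hom C Z R" and dv: "d' \<cdot> v \<in> Hom C Z R" using u v d' by simp_all
    have "r \<cdot> (u \<^bold>- (d' \<cdot> v)) = zero_mor C Z (Om (LL F))"
    proof -
      have "r \<cdot> (d' \<cdot> v) = ?d \<cdot> v" using cmp_reduce[OF d'(4), of v] d'(1-3) v(1-3) r rR by simp
      then show ?thesis
        using cmp_minus[OF uH dv, of r "Om (LL F)"] r rR ru minus_self[of "?d \<cdot> v"] v(1-3) c(12-14) by simp
    qed
    then obtain t where t: "t \<in> Ar C" "dom C t = Z" "cod C t = K" "\<kappa> \<cdot> t = u \<^bold>- (d' \<cdot> v)"
      using kernel_factor[OF kk, of "u \<^bold>- (d' \<cdot> v)" Z] uH dv r rR \<kappa>t(2) by auto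
    have "h \<cdot> b.pair t v = add_mor C (\<kappa> \<cdot> t) (d' \<cdot> v)"
      unfolding h_def using \<kappa>t d'(1-3) t(1-3) v(1-3) by (subst b.copair_cmp) simp_all
    also have "\<dots> = u" unfolding t(4) by (rule minus_add_cancel[OF uH dv])
    finally show "\<exists>s. s \<in> Ar C \<and> dom C s = Z \<and> cod C s = B \<and> u = h \<cdot> s"
      using t v by (intro exI[of _ "b.pair t v"]) simp
  qed
  then show ?thesis
    using AdmI[OF deflation_admissible[OF dh]] pres_deflation_effaceable[OF dh] by (simp add: Eff_def)
qed

section \<open>The inclusion, its adjoints and its essential image\<close>

lemma Hom_E: "\<alpha> \<in> Hom (eff C \<iota>) F G \<longleftrightarrow> \<alpha> \<in> Hom (ModC C) F G \<and> F \<in> Eff \<and> G \<in> Eff"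
  by (simp add: eff_eq Ef.Hom_D)

lemma Eff_Adm: "F \<in> Eff \<Longrightarrow> F \<in> Adm"
  by (simp add: Eff_def)

lemma Ob_E [simp]: "Ob (eff C \<iota>) = Eff"
  using Adm_presheaf by (auto simp: eff_eq Eff_def)

lemma E_simps: "cmp (eff C \<iota>) = cmp (ModC C)" "ident (eff C \<iota>) = ident (ModC C)"
  "add_mor (eff C \<iota>) = add_mor (ModC C)"
  by (simp_all add: eff_eq)

lemma inclusion_simps [simp]: "on_ob inclusion F = F" "on_ar inclusion \<alpha> = \<alpha>"
  by (simp_all add: inclusion_def)

lemma inclusion_additive: "additive_functor (eff C \<iota>) \<A> inclusion"
  unfolding additive_functor_def is_functor_def A_simps E_simps Hom_A Hom_E
  using Eff_Adm by (auto simp: hom_def Hom_group_def Hom_A Hom_E A_simps E_simps)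

lemma quot_N_universal:
  assumes F: "F \<in> Adm" and G: "G \<in> Eff" and \<beta>: "\<beta> \<in> Hom (ModC C) F G"
  shows "\<exists>!\<gamma>. \<gamma> \<in> Hom (eff C \<iota>) (quot F (N F)) G \<and> \<gamma> \<bullet> proj F (N F) = \<beta>"
proof -
  note L = L_choice_types(5)[OF F] and x0 = x0[OF F] and pF = Adm_presheaf[OF F] and s = N_subpresheaf[OF F]
  note c = cover[OF L] and pG = Hom_presheaf(2)[OF \<beta>] and \<pi> = proj_Hom[OF pF s]
  have eG: "effaceable G" using G by (simp add: Eff_def)
  have bx: "app \<beta> (P0 (LL F)) (x0 F) \<in> el G (P0 (LL F))" using \<beta> x0(1) c(15) by simp
  \<comment> \<open>An effaceable functor vanishes at projectives, in particular at the object where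
    the generator of \<open>N F\<close> lives.\<close>
  have "app \<beta> (P0 (LL F)) (x0 F) = \<one>\<^bsub>grp G (P0 (LL F))\<^esub>"
    using effaceableE[OF eG c(15) bx] projective_effaced[OF c(3) pG bx] by metis
  then have "app \<beta> Z z = \<one>\<^bsub>grp G Z\<^esub>" if "Z \<in> Ob C" "z \<in> N F Z" for Z z
    using that \<beta> x0(1) pG unfolding N_iff[OF F] by auto
  then have "app \<beta> Z z = \<one>\<^bsub>grp G Z\<^esub>" if "Z \<in> Ob C" "z \<in> el F Z" "app (proj F (N F)) Z z = \<one>\<^bsub>grp (quot F (N F)) Z\<^esub>" for Z z
    using that proj_eq_one[OF pF s that(1,2)] by simp
  from factor_surj[OF \<pi> proj_surj[OF pF s] \<beta> this]
  obtain \<gamma> where \<gamma>: "\<gamma> \<in> Hom (ModC C) (quot F (N F)) G" "\<gamma> \<bullet> proj F (N F) = \<beta>" by blast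
  show ?thesis
  proof (rule ex1I[of _ \<gamma>])
    show "\<gamma> \<in> Hom (eff C \<iota>) (quot F (N F)) G \<and> \<gamma> \<bullet> proj F (N F) = \<beta>"
      using \<gamma> G quot_N_Eff[OF F] by (simp add: Hom_E)
    fix \<gamma>' assume "\<gamma>' \<in> Hom (eff C \<iota>) (quot F (N F)) G \<and> \<gamma>' \<bullet> proj F (N F) = \<beta>"
    then have \<gamma>': "\<gamma>' \<in> Hom (ModC C) (quot F (N F)) G" "\<gamma>' \<bullet> proj F (N F) = \<beta>" by (simp_all add: Hom_E)
    show "\<gamma>' = \<gamma>"
    proof (rule mor_eqI[OF \<gamma>'(1) \<gamma>(1)])
      fix Z y assume Z: "Z \<in> Ob C" and "y \<in> el (quot F (N F)) Z"
      then obtain z where z: "z \<in> el F Z" "y = app (proj F (N F)) Z z" using proj_surj[OF pF s Z] by blast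
      have "app (\<gamma>' \<bullet> proj F (N F)) Z z = app (\<gamma> \<bullet> proj F (N F)) Z z" using \<gamma> \<gamma>' by simp
      then show "app \<gamma>' Z y = app \<gamma> Z y" unfolding z(2) app_cmp[OF \<pi> Z z(1)] .
    qed
  qed
qed

text \<open>Morphisms preserve being killed by a deflation, and for elements of \<open>F\<close>
  this means lying in the kernel of the unit.\<close>

lemma ker_eta_universal:
  assumes F: "F \<in> Adm" and G: "G \<in> Eff" and \<beta>: "\<beta> \<in> Hom (ModC C) G F"
  shows "\<exists>!\<gamma>. \<gamma> \<in> Hom (eff C \<iota>) G (sub F (ker (eta F))) \<and> incl F (ker (eta F)) \<bullet> \<gamma> = \<beta>"
proof -
  note pF = Adm_presheaf[OF F] and e = eta(1)[OF F]
  note s = ker_subpresheaf[OF e]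
  note i = incl_Hom[OF pF s]
  have "app \<beta> Z z \<in> ker (eta F) Z" if Z: "Z \<in> Ob C" "z \<in> el G Z" for Z z
  proof -
    obtain d where d: "deflation C d" "d \<in> Ar C" "cod C d = Z" "res G d z = \<one>\<^bsub>grp G (dom C d)\<^esub>"
      using effaceableE[OF _ Z] G by (auto simp: Eff_def)
    have b: "app \<beta> Z z \<in> el F Z" using \<beta> Z by simp
    have "res F d (app \<beta> Z z) = app \<beta> (dom C d) (res G d z)" using \<beta> d(2,3) Z by simp
    also have "\<dots> = \<one>\<^bsub>grp F (dom C d)\<^esub>" unfolding d(4) using \<beta> d(2) by simp
    finally have "lm F Z (app \<beta> Z z) = zero_mor C Z (LL F)"
      unfolding lm_eq_zero_iff[OF F Z(1) b] using d by blast
    then show ?thesis using lm_zero_iff[OF F Z(1) b] b by (simp add: ker_iff[OF e] del: one_\<Upsilon>)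
  qed
  then obtain \<gamma> where \<gamma>: "\<gamma> \<in> Hom (ModC C) G (sub F (ker (eta F)))"
    and a\<gamma>: "\<And>Z x. Z \<in> Ob C \<Longrightarrow> x \<in> el G Z \<Longrightarrow> app \<gamma> Z x = app \<beta> Z x"
    using corestrict[OF \<beta> s] by metis
  have ai: "app (incl F (ker (eta F)) \<bullet> \<delta>) Z x = app \<delta> Z x"
    if "\<delta> \<in> Hom (ModC C) G (sub F (ker (eta F)))" "Z \<in> Ob C" "x \<in> el G Z" for \<delta> Z x
    using that app_el[OF that] by simp
  show ?thesis
  proof (rule ex1I[of _ \<gamma>])
    have "incl F (ker (eta F)) \<bullet> \<gamma> = \<beta>"
      by (rule mor_eqI[OF ModC_cmp_Hom[OF \<gamma> i] \<beta>]) (use ai[OF \<gamma>] a\<gamma> in metis)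
    then show "\<gamma> \<in> Hom (eff C \<iota>) G (sub F (ker (eta F))) \<and> incl F (ker (eta F)) \<bullet> \<gamma> = \<beta>"
      using \<gamma> G ker_eta_Eff[OF F] by (simp add: Hom_E)
    fix \<delta> assume "\<delta> \<in> Hom (eff C \<iota>) G (sub F (ker (eta F))) \<and> incl F (ker (eta F)) \<bullet> \<delta> = \<beta>"
    then have \<delta>: "\<delta> \<in> Hom (ModC C) G (sub F (ker (eta F)))" "incl F (ker (eta F)) \<bullet> \<delta> = \<beta>" by (simp_all add: Hom_E)
    show "\<delta> = \<gamma>"
      by (rule mor_eqI[OF \<delta>(1) \<gamma>]) (use ai[OF \<delta>(1)] a\<gamma> \<delta>(2) in metis)
  qed
qed

text \<open>Being killed by a deflation transports along isomorphisms, so \<open>Eff\<close> is its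
  own essential image. \<open>lm_effaceable_iff\<close> matches it with the kernel of
  \<open>L_functor\<close>.\<close>

lemma essential_image_inclusion:
  "essential_image (eff C \<iota>) \<A> inclusion = functor_kernel \<A> C (L_functor C \<iota>)"
proof -
  have "essential_image (eff C \<iota>) \<A> inclusion = Eff"
  proof (intro equalityI subsetI)
    fix F assume F: "F \<in> Eff"
    have "ident \<A> F \<in> Hom \<A> F F" "iso_mor \<A> (ident \<A> F)"
    proof -
      interpret B: preadditive "\<A>" using exact_category_preadditive[OF mod_adm_exact] by unfold_locales
      show "ident \<A> F \<in> Hom \<A> F F" "iso_mor \<A> (ident \<A> F)"
        using Eff_Adm[OF F] B.iso_mor_ident[of F] by simp_all
    qed
    then show "F \<in> essential_image (eff C \<iota>) \<A> inclusion"
      unfolding essential_image_def isomorphic_def using F Eff_Adm by auto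
  next
    fix G assume "G \<in> essential_image (eff C \<iota>) \<A> inclusion"
    then obtain F a where G: "G \<in> Adm" and F: "F \<in> Eff" and a: "a \<in> Hom \<A> F G" "iso_mor \<A> a"
      unfolding essential_image_def isomorphic_def by auto
    have aH: "a \<in> Hom (ModC C) F G" using a by (simp add: Hom_A)
    have bij: "bij_betw (app a Z) (el F Z) (el G Z)" if "Z \<in> Ob C" for Z
      using A.iso_bij[OF _ aH that] a(2) by (simp add: mod_adm_eq)
    have pF: "is_presheaf C F" "is_presheaf C G" using Hom_presheaf[OF aH] .
    have "effaceable G"
      unfolding effaceable_def
    proof (intro ballI)
      fix Z z assume Z: "Z \<in> Ob C" and "z \<in> el G Z"
      then obtain y where y: "y \<in> el F Z" "z = app a Z y" using bij_betw_imp_surj_on[OF bij[OF Z]] by blast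
      obtain d where d: "deflation C d" "d \<in> Ar C" "cod C d = Z" "res F d y = \<one>\<^bsub>grp F (dom C d)\<^esub>"
        using effaceableE[OF _ Z y(1)] F by (auto simp: Eff_def)
      have "res G d z = app a (dom C d) (res F d y)" using y d(1-3) aH by simp
      also have "\<dots> = \<one>\<^bsub>grp G (dom C d)\<^esub>" unfolding d(4) using d(2) aH by simp
      finally show "\<exists>p. deflation C p \<and> cod C p = Z \<and> res G p z = \<one>\<^bsub>grp G (dom C p)\<^esub>" using d by blast
    qed
    then show "G \<in> Eff" using G by (simp add: Eff_def)
  qed
  also have "Eff = functor_kernel \<A> C (L_functor C \<iota>)"
    unfolding functor_kernel_def Eff_def using lm_effaceable_iff by auto
  finally show ?thesis .
qed

lemma recollement_exists:
  "\<exists>i_up i_sh j_sh. recollement (eff C \<iota>) \<A> C i_up inclusion i_sh j_sh (L_functor C \<iota>) (yoneda C \<iota>)"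
proof -
  note Bpre = exact_category_preadditive[OF mod_adm_exact] and Epre = exact_category_preadditive[OF eff_exact]
  interpret incl: functor_pair "\<A>" "eff C \<iota>" inclusion
    using Bpre Epre inclusion_additive by unfold_locales (simp_all add: additive_functor_def)
  interpret L: functor_pair C "\<A>" "L_functor C \<iota>"
    using Bpre L_additive by unfold_locales (simp_all add: additive_functor_def)
  note nH = incl.C.Hom_iff incl.D.Hom_iff Hom_iff
  have up_Hom: "proj F (N F) \<in> Hom \<A> F (quot F (N F))" if F: "F \<in> Adm" for F
    using proj_Hom[OF Adm_presheaf[OF F] N_subpresheaf[OF F]] F Eff_Adm[OF quot_N_Eff[OF F]] by (simp add: Hom_A del: nH)
  have sh_Hom: "incl F (ker (eta F)) \<in> Hom \<A> (sub F (ker (eta F))) F" if F: "F \<in> Adm" for F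
    using incl_Hom[OF Adm_presheaf[OF F] ker_subpresheaf[OF eta(1)[OF F]]] F Eff_Adm[OF ker_eta_Eff[OF F]]
    by (simp add: Hom_A del: nH)
  obtain i_up \<epsilon>1 where up: "adjunction \<A> (eff C \<iota>) i_up inclusion (\<lambda>F. proj F (N F)) \<epsilon>1"
    "on_ob i_up = (\<lambda>F. quot F (N F))" "additive_functor \<A> (eff C \<iota>) i_up"
    by (rule incl.left_adjoint_exists[of "\<lambda>F. quot F (N F)" "\<lambda>F. proj F (N F)"])
       (use up_Hom quot_N_Eff quot_N_universal inclusion_additive in \<open>simp_all add: Hom_A A_simps del: nH\<close>)
  obtain i_sh \<eta>2 where sh: "adjunction (eff C \<iota>) \<A> inclusion i_sh \<eta>2 (\<lambda>F. incl F (ker (eta F)))"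
    "on_ob i_sh = (\<lambda>F. sub F (ker (eta F)))" "additive_functor \<A> (eff C \<iota>) i_sh"
    by (rule right_adjoint_exists[OF mod_adm_exact eff_exact inclusion_additive, of "\<lambda>F. sub F (ker (eta F))" "\<lambda>F. incl F (ker (eta F))"])
       (use sh_Hom ker_eta_Eff ker_eta_universal in \<open>simp_all add: Hom_A A_simps del: nH\<close>)
  obtain j_sh \<epsilon>3 where jsh: "adjunction C \<A> j_sh (L_functor C \<iota>) \<theta> \<epsilon>3"
    "on_ob j_sh = J" "additive_functor C \<A> j_sh"
    by (rule L.left_adjoint_exists[of J \<theta>])
       (use cover(22) \<theta>(1) J_universal L_additive in \<open>simp_all del: nH\<close>)
  obtain \<epsilon>4 where low: "adjunction \<A> C (L_functor C \<iota>) (yoneda C \<iota>) eta \<epsilon>4"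
    using L_adjunction by blast
  have ff1: "fully_faithful (eff C \<iota>) \<A> inclusion"
    unfolding fully_faithful_def using Eff_Adm by (auto simp: bij_betw_def inj_on_def image_iff Hom_A Hom_E simp del: nH)
  have ff2: "fully_faithful C \<A> j_sh"
    by (rule adjunction_unit_iso_fully_faithful[OF jsh(1) preadditive Bpre \<theta>(2)])
  have "Hom \<A> (\<Upsilon> X) (\<Upsilon> Y) = Hom (ModC C) (\<Upsilon> X) (\<Upsilon> Y)" if "X \<in> Ob C" "Y \<in> Ob C" for X Y
    using that \<Upsilon>_Adm by (auto simp: Hom_A simp del: nH)
  then have ff3: "fully_faithful C \<A> (yoneda C \<iota>)"
    unfolding fully_faithful_def using yoneda_fully_faithful by simp
  \<comment> \<open>The cokernel of the unit, effaceable by \<open>im_eta_Adm\<close>, closes the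
    sequence on the right.\<close>
  have seq4: "\<exists>Z\<in>Ob (eff C \<iota>). \<exists>q\<in>Hom \<A> (on_ob (yoneda C \<iota>) (LL F)) (on_ob inclusion Z).
      inflation \<A> (incl F (ker (eta F))) \<and> exact_at \<A> (incl F (ker (eta F))) (eta F) \<and>
      exact_at \<A> (eta F) q \<and> deflation \<A> q" if F: "F \<in> Adm" for F
  proof -
    note pF = Adm_presheaf[OF F] and e = eta(1)[OF F] and L = L_choice_types(5)[OF F]
    note pU = \<Upsilon>_presheaf[OF L] and sk = ker_subpresheaf[OF e] and si = im_subpresheaf[OF e]
    let ?Q = "quot (\<Upsilon> (LL F)) (im (eta F))" and ?q = "proj (\<Upsilon> (LL F)) (im (eta F))"
    have "inflation A.D (incl F (ker (eta F))) \<and> exact_at A.D (incl F (ker (eta F))) (eta F) \<and>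
        exact_at A.D (eta F) ?q \<and> deflation A.D ?q"
    proof (rule A.four_term_exact[OF e Eff_Adm[OF ker_eta_Eff[OF F]] F \<Upsilon>_Adm[OF L] Eff_Adm[OF im_eta_Adm(2)[OF F]]
          im_eta_Adm(1)[OF F] incl_Hom[OF pF sk] _ _ proj_Hom[OF pU si] proj_surj[OF pU si]])
      fix Z assume Z: "Z \<in> Ob C"
      show "inj_on (app (incl F (ker (eta F))) Z) (el (sub F (ker (eta F))) Z)" using Z by (simp add: inj_on_def)
      show "app (eta F) Z x = \<one>\<^bsub>grp (\<Upsilon> (LL F)) Z\<^esub> \<longleftrightarrow> x \<in> app (incl F (ker (eta F))) Z ` el (sub F (ker (eta F))) Z"
        if "x \<in> el F Z" for x using that Z by (auto simp: ker_iff[OF e] image_iff simp del: one_\<Upsilon>)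
      show "app ?q Z y = \<one>\<^bsub>grp ?Q Z\<^esub> \<longleftrightarrow> y \<in> app (eta F) Z ` el F Z" if "y \<in> el (\<Upsilon> (LL F)) Z" for y
        using proj_eq_one[OF pU si Z that] by (simp add: im_iff[OF e])
    qed
    moreover have "?q \<in> Hom \<A> (\<Upsilon> (LL F)) ?Q"
      using proj_Hom[OF pU si] \<Upsilon>_Adm[OF L] Eff_Adm[OF im_eta_Adm(2)[OF F]] by (simp add: Hom_A del: nH)
    ultimately show ?thesis
      using im_eta_Adm(2)[OF F] unfolding mod_adm_eq[symmetric] on_ob_yoneda inclusion_simps Ob_E by blast
  qed
  have seq5: "\<exists>Z\<in>Ob (eff C \<iota>). \<exists>k\<in>Hom \<A> (on_ob inclusion Z) (on_ob j_sh (LL F)).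
      inflation \<A> k \<and> exact_at \<A> k (\<epsilon>3 F) \<and>
      exact_at \<A> (\<epsilon>3 F) (proj F (N F)) \<and> deflation \<A> (proj F (N F))" if F: "F \<in> Adm" for F
  proof -
    note pF = Adm_presheaf[OF F] and L = L_choice_types(5)[OF F] and x0 = x0[OF F] and sN = N_subpresheaf[OF F]
    note c = cover[OF L]
    have \<epsilon>A: "\<epsilon>3 F \<in> Hom \<A> (J (LL F)) F" and tri: "L\<^sub>m (\<epsilon>3 F) \<cdot> \<theta> (LL F) = ident C (LL F)"
      using jsh(1,2) F unfolding adjunction_def Ob_A by auto
    have \<epsilon>: "\<epsilon>3 F \<in> Hom (ModC C) (J (LL F)) F" using \<epsilon>A by (simp add: Hom_A del: nH)
    \<comment> \<open>The triangle identity \<open>tri\<close> shows that \<open>lm\<close> takes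
      the value of the counit at the generator to \<open>c\<pi> (LL F)\<close>. Injectivity of
      \<open>lm\<close> at the projective \<open>P0 (LL F)\<close> identifies this value with
      \<open>x0 F\<close>.\<close>
    have \<epsilon>e: "app (\<epsilon>3 F) (P0 (LL F)) (ce (LL F)) = x0 F"
    proof (rule lm_projective_inj[OF F c(3) _ x0(1)])
      show "lm F (P0 (LL F)) (app (\<epsilon>3 F) (P0 (LL F)) (ce (LL F))) = lm F (P0 (LL F)) (x0 F)"
        unfolding lm_from_J[OF L F \<epsilon>] tri x0(2) using c by simp
      show "app (\<epsilon>3 F) (P0 (LL F)) (ce (LL F)) \<in> el F (P0 (LL F))" by (rule app_el[OF \<epsilon> c(15,19)])
    qed
    \<comment> \<open>The counit thus has image \<open>N F\<close>, so its cokernel is the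
      projection already used as the unit of \<open>i^*\<close>.\<close>
    have imN: "im (\<epsilon>3 F) Z = N F Z" if Z: "Z \<in> Ob C" for Z
    proof (intro equalityI subsetI)
      fix z assume "z \<in> im (\<epsilon>3 F) Z"
      then obtain u where u: "u \<in> el (J (LL F)) Z" "z = app (\<epsilon>3 F) Z u" by (auto simp: im_iff[OF \<epsilon>])
      obtain y where "y \<in> Ar C" "dom C y = Z" "cod C y = P0 (LL F)" "u = res (J (LL F)) y (ce (LL F))"
        using presD(3)[OF c(5,18) Z u(1)] by blast
      then show "z \<in> N F Z" unfolding N_iff[OF F] using u(2) \<epsilon> \<epsilon>e c(19) by (intro exI[of _ y]) simp
    next
      fix z assume "z \<in> N F Z"
      then obtain y where y: "y \<in> Ar C" "dom C y = Z" "cod C y = P0 (LL F)" "z = res F y (x0 F)" unfolding N_iff[OF F] by blast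
      then show "z \<in> im (\<epsilon>3 F) Z"
        unfolding im_iff[OF \<epsilon>] using \<epsilon> \<epsilon>e c(19,23) by (intro image_eqI[of _ _ "res (J (LL F)) y (ce (LL F))"]) simp_all
    qed
    let ?K = "sub (J (LL F)) (ker (\<epsilon>3 F))" and ?k = "incl (J (LL F)) (ker (\<epsilon>3 F))"
    note KE = ker_from_J_Eff[OF F \<epsilon> \<epsilon>e] and sk = ker_subpresheaf[OF \<epsilon>]
    have IA: "sub F (im (\<epsilon>3 F)) \<in> Adm"
      using Adm_sub_cong[OF N_Adm[OF F] pF im_subpresheaf[OF \<epsilon>]] imN by simp
    have "inflation A.D ?k \<and> exact_at A.D ?k (\<epsilon>3 F) \<and> exact_at A.D (\<epsilon>3 F) (proj F (N F)) \<and> deflation A.D (proj F (N F))"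
    proof (rule A.four_term_exact[OF \<epsilon> Eff_Adm[OF KE] c(22) F Eff_Adm[OF quot_N_Eff[OF F]] IA
          incl_Hom[OF c(23) sk] _ _ proj_Hom[OF pF sN] proj_surj[OF pF sN]])
      fix Z assume Z: "Z \<in> Ob C"
      show "inj_on (app ?k Z) (el ?K Z)" using Z by (simp add: inj_on_def)
      show "app (\<epsilon>3 F) Z x = \<one>\<^bsub>grp F Z\<^esub> \<longleftrightarrow> x \<in> app ?k Z ` el ?K Z"
        if "x \<in> el (J (LL F)) Z" for x using that Z by (auto simp: ker_iff[OF \<epsilon>] image_iff)
      show "app (proj F (N F)) Z y = \<one>\<^bsub>grp (quot F (N F)) Z\<^esub> \<longleftrightarrow> y \<in> app (\<epsilon>3 F) Z ` el (J (LL F)) Z" if "y \<in> el F Z" for y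
        using proj_eq_one[OF pF sN Z that] imN[OF Z] by (simp add: im_iff[OF \<epsilon>])
    qed
    moreover have "?k \<in> Hom \<A> ?K (J (LL F))"
      using incl_Hom[OF c(23) sk] c(22) Eff_Adm[OF KE] by (simp add: Hom_A del: nH)
    ultimately show ?thesis
      using KE unfolding mod_adm_eq[symmetric] inclusion_simps Ob_E jsh(2) by blast
  qed
  have "recollement (eff C \<iota>) \<A> C i_up inclusion i_sh j_sh (L_functor C \<iota>) (yoneda C \<iota>)"
    unfolding recollement_def
  proof (intro conjI exI)
    show "adjunction \<A> (eff C \<iota>) i_up inclusion (\<lambda>F. proj F (N F)) \<epsilon>1" by (rule up)
    show "adjunction (eff C \<iota>) \<A> inclusion i_sh \<eta>2 (\<lambda>F. incl F (ker (eta F)))" by (rule sh)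
    show "adjunction C \<A> j_sh (L_functor C \<iota>) \<theta> \<epsilon>3" by (rule jsh)
    show "adjunction \<A> C (L_functor C \<iota>) (yoneda C \<iota>) eta \<epsilon>4" by (rule low)
  qed (use mod_adm_exact eff_exact exact up sh jsh inclusion_additive L_additive yoneda_additive
      essential_image_inclusion ff1 ff2 ff3 seq4 seq5 in \<open>simp_all del: nH\<close>)
  then show ?thesis by blast
qed

end

theorem proposition4p30:
  fixes E :: "('o, 'm) excat"
    and \<iota> :: "'m \<Rightarrow> 'u"
  assumes "exact_category E"
    and "enough_projectives E"
    and "inj_on \<iota> (Ar E)"
  shows "\<exists>i_up i_sh j_sh.
    recollement (eff E \<iota>) (mod_adm E \<iota>) E i_up inclusion i_sh j_sh (L_functor E \<iota>) (yoneda E \<iota>)"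
proof -
  interpret exact E by (rule exactI[OF assms(1)])
  interpret exact_enough_projectives E \<iota> by unfold_locales (use assms in simp_all)
  show ?thesis by (rule recollement_exists)
qed

end
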